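(* Let $\mathbf{M}$ be a compact Riemannian manifold without boundary and let $L$ be a smooth self-adjoint non-negative second order elliptic differential operator in $L_2(\mathbf{M})$. Given $m\in\mathbb{N}$ and $1\le p\le\infty$ there exists a constant $C=C(\mathbf{M},m,p)>0$ such that for any $\omega>1$ and all $f\in\mathbf{E}_{\omega}(\sqrt{L})$ $$\|L^{m/2}f\|_{p}\le C\omega^{m}\|f\|_{p}.$$
   Context: $\mathbf{M}$ is connected; $\sqrt{L}$ has spectrum $0=\lambda_0<\lambda_1\le\lambda_2\le\dots$. The constant may depend on the fixed operator $L$. For $\omega>0$, $\mathbf{E}_{\omega}(\sqrt{L})$ is the span of all eigenfunctions of $\sqrt{L}$ whose eigenvalues are not greater than $\omega$. *)

theory Defs
  imports "HOL-Analysis.Analysis" "HOL-Probability.Essential_Supremum"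
begin

section \<open>Smooth functions between Euclidean spaces\<close>

text \<open>The domain is meant to be open.\<close>

fun Ck_on :: "nat \<Rightarrow> 'e::real_normed_vector set \<Rightarrow> ('e \<Rightarrow> 'f::real_normed_vector) \<Rightarrow> bool" where
  "Ck_on 0 S f \<longleftrightarrow> continuous_on S f"
| "Ck_on (Suc k) S f \<longleftrightarrow> (\<forall>x\<in>S. f differentiable (at x)) \<and>
     (\<forall>v. Ck_on k S (\<lambda>x. frechet_derivative f (at x) v))"

definition smooth_on :: "'e::real_normed_vector set \<Rightarrow> ('e \<Rightarrow> 'f::real_normed_vector) \<Rightarrow> bool" where
  "smooth_on S f \<longleftrightarrow> (\<forall>k. Ck_on k S f)"

definition partial_deriv :: "'n::finite \<Rightarrow> (real^'n \<Rightarrow> complex) \<Rightarrow> real^'n \<Rightarrow> complex" where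
  "partial_deriv i F x = frechet_derivative F (at x) (axis i 1)"

section \<open>Riemannian manifolds\<close>

text \<open>The manifold is the whole type \<open>'a\<close>. A chart is a pair of an open domain and a coordinate
  map; the coordinate map is only relevant on the domain. As all charts are onto open subsets
  of Euclidean space, there is no boundary.\<close>

type_synonym ('a, 'n) chart = "'a set \<times> ('a \<Rightarrow> real^'n)"

definition chart_inv :: "('a, 'n) chart \<Rightarrow> real^'n \<Rightarrow> 'a" where
  "chart_inv c = inv_into (fst c) (snd c)"

definition is_chart :: "('a::topological_space, 'n::finite) chart \<Rightarrow> bool" where
  "is_chart c \<longleftrightarrow> open (fst c) \<and> open (snd c ` fst c) \<and>
     homeomorphism (fst c) (snd c ` fst c) (snd c) (chart_inv c)"

definition transition :: "('a, 'n) chart \<Rightarrow> ('a, 'n) chart \<Rightarrow> real^'n \<Rightarrow> real^'n" where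
  "transition c d = snd d \<circ> chart_inv c"

definition smooth_atlas :: "('a::topological_space, 'n::finite) chart set \<Rightarrow> bool" where
  "smooth_atlas A \<longleftrightarrow> (\<forall>c\<in>A. is_chart c) \<and> (\<Union>c\<in>A. fst c) = UNIV \<and>
     (\<forall>c\<in>A. \<forall>d\<in>A. smooth_on (snd c ` (fst c \<inter> fst d)) (transition c d))"

definition smooth_fun :: "('a, 'n::finite) chart set \<Rightarrow> ('a \<Rightarrow> complex) \<Rightarrow> bool" where
  "smooth_fun A f \<longleftrightarrow> (\<forall>c\<in>A. smooth_on (snd c ` fst c) (f \<circ> chart_inv c))"

text \<open>A Riemannian metric is given by its coefficient matrices: \<open>g c x\<close> is the matrix, in the
  chart \<open>c\<close>, at the point with coordinates \<open>x\<close>. The last conjunct is the transformation law of a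
  covariant 2-tensor.\<close>

definition riemannian_metric ::
  "('a, 'n::finite) chart set \<Rightarrow> (('a, 'n) chart \<Rightarrow> real^'n \<Rightarrow> real^'n^'n) \<Rightarrow> bool" where
  "riemannian_metric A g \<longleftrightarrow>
     (\<forall>c\<in>A. smooth_on (snd c ` fst c) (g c) \<and>
        (\<forall>x\<in>snd c ` fst c. transpose (g c x) = g c x \<and>
           (\<forall>v. v \<noteq> 0 \<longrightarrow> v \<bullet> (g c x *v v) > 0))) \<and>
     (\<forall>c\<in>A. \<forall>d\<in>A. \<forall>x\<in>snd c ` (fst c \<inter> fst d).
        let J = matrix (frechet_derivative (transition c d) (at x))
        in g c x = transpose J ** g d (transition c d x) ** J)"

definition compact_riemannian_manifold ::
  "('a::{second_countable_topology, t2_space}, 'n::finite) chart set \<Rightarrow>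
   (('a, 'n) chart \<Rightarrow> real^'n \<Rightarrow> real^'n^'n) \<Rightarrow> bool" where
  "compact_riemannian_manifold A g \<longleftrightarrow>
     compact (UNIV :: 'a set) \<and> smooth_atlas A \<and> riemannian_metric A g"

text \<open>The Riemannian measure is the Borel measure with density \<open>sqrt (det g)\<close> in each chart.\<close>

definition riemannian_volume ::
  "('a::topological_space, 'n::finite) chart set \<Rightarrow> (('a, 'n) chart \<Rightarrow> real^'n \<Rightarrow> real^'n^'n) \<Rightarrow>
   'a measure" where
  "riemannian_volume A g = (THE M. sets M = sets borel \<and>
     (\<forall>c\<in>A. \<forall>B\<in>sets borel. B \<subseteq> fst c \<longrightarrow>
        emeasure M B = (\<integral>\<^sup>+x\<in>snd c ` B. ennreal (sqrt (det (g c x))) \<partial>lborel)))"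

section \<open>Second order elliptic differential operators\<close>

text \<open>Only the values of \<open>L\<close> on smooth functions matter. For scalar operators of order two,
  ellipticity (nonvanishing of the principal symbol at nonzero real covectors) forces the order
  to be exactly two. The coefficients \<open>a\<close>, \<open>b\<close>, \<open>q\<close> may be complex.\<close>

definition second_order_elliptic ::
  "('a, 'n::finite) chart set \<Rightarrow> (('a \<Rightarrow> complex) \<Rightarrow> ('a \<Rightarrow> complex)) \<Rightarrow> bool" where
  "second_order_elliptic A L \<longleftrightarrow> (\<forall>c\<in>A.
     \<exists>(a :: real^'n \<Rightarrow> complex^'n^'n) (b :: real^'n \<Rightarrow> complex^'n) (q :: real^'n \<Rightarrow> complex).
       smooth_on (snd c ` fst c) a \<and> smooth_on (snd c ` fst c) b \<and> smooth_on (snd c ` fst c) q \<and>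
       (\<forall>x\<in>snd c ` fst c. \<forall>\<xi> :: real^'n. \<xi> \<noteq> 0 \<longrightarrow>
          (\<Sum>i\<in>UNIV. \<Sum>j\<in>UNIV. a x $ i $ j * of_real (\<xi> $ i * \<xi> $ j)) \<noteq> 0) \<and>
       (\<forall>f. smooth_fun A f \<longrightarrow> (\<forall>x\<in>snd c ` fst c.
          let F = f \<circ> chart_inv c in
          L f (chart_inv c x) =
            (\<Sum>i\<in>UNIV. \<Sum>j\<in>UNIV. a x $ i $ j * partial_deriv i (partial_deriv j F) x) +
            (\<Sum>i\<in>UNIV. b x $ i * partial_deriv i F x) + q x * F x)))"

section \<open>Lebesgue spaces and unbounded operators\<close>

definition Lp_norm :: "'a measure \<Rightarrow> ennreal \<Rightarrow> ('a \<Rightarrow> complex) \<Rightarrow> ennreal" where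
  "Lp_norm M p f =
     (if p = \<infinity> then esssup M (\<lambda>x. ennreal (norm (f x)))
      else let I = (\<integral>\<^sup>+x. ennreal (norm (f x) powr enn2real p) \<partial>M)
           in if I = \<infinity> then \<infinity> else ennreal (enn2real I powr (1 / enn2real p)))"

definition L2_space :: "'a measure \<Rightarrow> ('a \<Rightarrow> complex) set" where
  "L2_space M = {f \<in> borel_measurable M. Lp_norm M 2 f < \<infinity>}"

definition L2_inner :: "'a measure \<Rightarrow> ('a \<Rightarrow> complex) \<Rightarrow> ('a \<Rightarrow> complex) \<Rightarrow> complex" where
  "L2_inner M f h = (LINT x|M. f x * cnj (h x))"

text \<open>Unbounded operators in L2 are represented by their graphs. Elements of L2 are functions rather
  than classes of functions, so graphs are closed under almost everywhere equality in
  both components; \<open>T O T\<close> is the square of \<open>T\<close> on its natural domain, and \<open>T ^^ m\<close> the power.\<close>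

type_synonym 'a L2_op = "(('a \<Rightarrow> complex) \<times> ('a \<Rightarrow> complex)) set"

text \<open>The operator in L2 determined by \<open>L\<close>: the closure of \<open>L\<close> on the smooth functions.\<close>

definition L2_realization ::
  "'a measure \<Rightarrow> ('a, 'n::finite) chart set \<Rightarrow> (('a \<Rightarrow> complex) \<Rightarrow> ('a \<Rightarrow> complex)) \<Rightarrow> 'a L2_op" where
  "L2_realization M A L = {(u, v). u \<in> L2_space M \<and> v \<in> L2_space M \<and>
     (\<forall>\<epsilon>>0. \<exists>f. smooth_fun A f \<and>
        Lp_norm M 2 (\<lambda>x. u x - f x) < \<epsilon> \<and> Lp_norm M 2 (\<lambda>x. v x - L f x) < \<epsilon>)}"

definition adjoint_op :: "'a measure \<Rightarrow> 'a L2_op \<Rightarrow> 'a L2_op" where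
  "adjoint_op M T = {(u, v). u \<in> L2_space M \<and> v \<in> L2_space M \<and>
     (\<forall>(x, y)\<in>T. L2_inner M y u = L2_inner M x v)}"

definition self_adjoint_op :: "'a measure \<Rightarrow> 'a L2_op \<Rightarrow> bool" where
  "self_adjoint_op M T \<longleftrightarrow>
     (\<forall>u\<in>L2_space M. \<forall>\<epsilon>>0. \<exists>w\<in>Domain T. Lp_norm M 2 (\<lambda>x. u x - w x) < \<epsilon>) \<and>
     adjoint_op M T = T"

definition nonneg_op :: "'a measure \<Rightarrow> 'a L2_op \<Rightarrow> bool" where
  "nonneg_op M T \<longleftrightarrow> (\<forall>(u, v)\<in>T. 0 \<le> Re (L2_inner M v u))"

text \<open>A nonnegative self-adjoint operator has a unique nonnegative self-adjoint square root.\<close>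

definition sqrt_op :: "'a measure \<Rightarrow> 'a L2_op \<Rightarrow> 'a L2_op" where
  "sqrt_op M T = (THE S. self_adjoint_op M S \<and> nonneg_op M S \<and> S O S = T)"

text \<open>\<open>half_power M T m\<close> is the power of \<open>T\<close> with exponent \<open>m / 2\<close>.\<close>

definition half_power :: "'a measure \<Rightarrow> 'a L2_op \<Rightarrow> nat \<Rightarrow> 'a L2_op" where
  "half_power M T m = sqrt_op M T ^^ m"

definition eigenfunctions :: "'a measure \<Rightarrow> 'a L2_op \<Rightarrow> real \<Rightarrow> ('a \<Rightarrow> complex) set" where
  "eigenfunctions M S l = {u. (u, \<lambda>x. of_real l * u x) \<in> S \<and> \<not> (AE x in M. u x = 0)}"

definition simple_eigenvalue :: "'a measure \<Rightarrow> 'a L2_op \<Rightarrow> real \<Rightarrow> bool" where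
  "simple_eigenvalue M S l \<longleftrightarrow>
     (\<exists>u\<in>eigenfunctions M S l. \<forall>w\<in>eigenfunctions M S l. \<exists>z. AE x in M. w x = z * u x)"

text \<open>The complex linear span of the eigenfunctions with eigenvalue at most \<open>\<omega>\<close>.\<close>

definition bandlimited :: "'a measure \<Rightarrow> 'a L2_op \<Rightarrow> real \<Rightarrow> ('a \<Rightarrow> complex) set" where
  "bandlimited M S \<omega> = {f. \<exists>U z. finite U \<and> U \<subseteq> (\<Union>l\<in>{..\<omega>}. eigenfunctions M S l) \<and>
     f = (\<lambda>x. \<Sum>u\<in>U. z u * u x)}"

end

theory Submission
  imports Defs "HOL-Library.Function_Algebras" "HOL-Probability.Distributions"
begin

text \<open>On a sum \<open>f = \<Sum> u\<^sub>j\<close> of eigenfunctions of \<open>L\<close> with eigenvalues \<open>l\<^sub>j\<close> at most \<open>1 / t\<close>, where \<open>t = 1 / \<omega>^2\<close>, the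
 half power acts as \<open>\<omega>^m \<psi>(t l)\<close> with \<open>\<psi>(x) = (sqrt x)^m\<close>. So the theorem says that \<open>\<psi>\<close> is a multiplier on the unit interval:
 \<open>\<Sum> \<psi>(t l\<^sub>j) u\<^sub>j\<close> is bounded by \<open>f\<close> in all \<open>L\<^sub>p\<close>, uniformly in \<open>t\<close>. Multipliers form an algebra and can be integrated
 with respect to a parameter, so it suffices to obtain the square root from a supply of multipliers.

 The supply is the heat flow at complex times, \<open>exp (- (1 + i s) x)\<close>, with a bound that is polynomial in \<open>s\<close>
 (\<open>heat_bound\<close>). The inverse Fourier transform of a high power of \<open>1 / (1 + i s)\<close> is a Gamma density, which makes \<open>(b - x)^n\<close>
 with \<open>b \<ge> 1\<close> a multiplier for some \<open>n > 0\<close>; differences in \<open>b\<close> reduce the degree, and \<open>x\<close> is a multiplier (\<open>is_mult_id\<close>).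
 Finally \<open>sqrt x\<close> is a multiple of the integral of \<open>\<tau>^(-3/2) (1 - exp (- \<tau> x))\<close> over \<open>\<tau> > 0\<close> (\<open>is_mult_sqrt\<close>).

 For the heat bound the coefficients of \<open>L\<close> are fixed at a point of a chart. The symbol is negative, because \<open>L\<close> is
 nonnegative (\<open>symbol_negative\<close>), so a Gaussian solves the equation up to an error of size \<open>1 / sqrt r\<close> times a
 Gaussian (\<open>heat_parametrix\<close>). Duhamel's formula turns this into a linear integral inequality for the modulus of the flow
 (\<open>duhamel_AE\<close>), and Levi's series dominates the flow by a kernel with bounded rows and columns for times up to a negative
 power of \<open>1 + |s|\<close> (\<open>levi_dominates\<close>). For larger times the flow is factored into a short real time, a contraction of \<open>L\<^sub>2\<close>,
 and a short real time. All constants are uniform in \<open>p\<close>, so \<open>p = \<infinity>\<close> is a limit.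

 The square root of the operator is a description; that it denotes a square root is the theorem that a nonnegative
 self-adjoint operator has exactly one nonnegative self-adjoint root (\<open>sqrt_ex1\<close>).\<close>

abbreviation cdom :: "('a, 'n::finite) chart => (real^'n) set" where "cdom c == snd c ` fst c"

abbreviation pd :: "'n::finite => (real^'n => complex) => real^'n => complex" where "pd == partial_deriv"

abbreviation dsum :: "('n::finite => 'n => 'b::comm_monoid_add) => 'b" where
 "dsum f == SUM i:UNIV. SUM j:UNIV. f i j"

abbreviation (input) tends :: "('i => 'b::topological_space) => 'b => 'i filter => bool" (infix "--->" 55) where "f ---> l == f \<longlongrightarrow> l"

abbreviation (input) nint :: "'m measure => ('m => ennreal) => ennreal" where "nint N f == nn_integral N f"

abbreviation (input) meas :: "'m measure => ('m => 'b::topological_space) set" where "meas N == borel_measurable N"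

abbreviation (input) "fd == frechet_derivative"

abbreviation (input) has_vd :: "(real => 'b::real_normed_vector) => 'b => real filter => bool" (infix "has'_vd" 50) where
 "f has_vd d == (f has_vector_derivative d)"

abbreviation (input) "restr c == restrict_space lborel (cdom c)"

abbreviation (input) "borel2 == borel \<Otimes>\<^sub>M borel"
abbreviation (input) "borel3 == borel \<Otimes>\<^sub>M borel \<Otimes>\<^sub>M borel"

lemmas enn_mult = ennreal_mult'[symmetric]
lemmas lint_cong = Bochner_Integration.integral_cong
lemmas nth_le = Finite_Cartesian_Product.norm_nth_le

abbreviation (input) seq_limit :: "(nat => 'b::topological_space) => 'b => bool" (infix "---->" 60) where
 "f ----> l == f \<longlonglongrightarrow> l"



section \<open>Spaces with a semi-definite inner product\<close>

text \<open>Elements of \<open>L2\<close> are functions and not classes, so vectors of norm zero need not vanish, and an identity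
 between vectors is expressed by pairing both sides with all vectors.\<close>

locale semi_inner =
 fixes X :: "'v::ab_group_add set"
  and sc :: "complex => 'v => 'v"
  and ip :: "'v => 'v => complex"
 assumes zero_mem [simp, intro]: "0 : X"
  and add_mem [simp, intro]: "u : X ==> v : X ==> u + v : X"
  and uminus_mem [simp, intro]: "u : X ==> - u : X"
  and sc_mem [simp, intro]: "u : X ==> sc c u : X"
  and ip_add: "u : X ==> v : X ==> z : X ==> ip (u + v) z = ip u z + ip v z"
  and ip_sc: "u : X ==> z : X ==> ip (sc c u) z = c * ip u z"
  and ip_cnj: "u : X ==> z : X ==> ip z u = cnj (ip u z)"
  and ip_ge: "u : X ==> 0 <= Re (ip u u)"
begin

definition nrm :: "'v => real" where "nrm u = sqrt (Re (ip u u))"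

lemma diff_mem [simp, intro]: "u : X ==> v : X ==> u - v : X"
 using add_mem[of u "-v"] by simp

lemma ip_zero [simp]: "z : X ==> ip 0 z = 0"
 using ip_add[of 0 0 z] by simp

lemma ip_uminus: "u : X ==> z : X ==> ip (- u) z = - ip u z"
 using ip_add[of u "-u" z] by (simp add: add_eq_0_iff)

lemma ip_diff: "u : X ==> v : X ==> z : X ==> ip (u - v) z = ip u z - ip v z"
 using ip_add[of u "-v" z] by (simp add: ip_uminus)

lemma ip_zero2 [simp]: "z : X ==> ip z 0 = 0"
 using ip_cnj[of 0 z] by simp

lemma ip_add2: "u : X ==> v : X ==> z : X ==> ip z (u + v) = ip z u + ip z v"
 using ip_cnj[of "u+v" z] ip_cnj[of u z] ip_cnj[of v z] by (simp add: ip_add)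

lemma ip_uminus2: "u : X ==> z : X ==> ip z (- u) = - ip z u"
 using ip_cnj[of "-u" z] ip_cnj[of u z] by (simp add: ip_uminus)

lemma ip_diff2: "u : X ==> v : X ==> z : X ==> ip z (u - v) = ip z u - ip z v"
 using ip_cnj[of "u-v" z] ip_cnj[of u z] ip_cnj[of v z] by (simp add: ip_diff)

lemma ip_sc2: "u : X ==> z : X ==> ip z (sc c u) = cnj c * ip z u"
 using ip_cnj[of "sc c u" z] ip_cnj[of u z] by (simp add: ip_sc)

lemmas ip_simps = ip_add ip_add2 ip_diff ip_diff2 ip_uminus ip_uminus2 ip_sc ip_sc2

lemma ip_self: "u : X ==> ip u u = of_real ((nrm u)^2)"
proof -
 assume u: "u : X"
 have "Im (ip u u) = 0" using ip_cnj[OF u u] by (metis complex_cnj_cancel_iff complex_cnj_cnj Reals_cnj_iff complex_is_Real_iff)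
 thus ?thesis using ip_ge[OF u] by (simp add: nrm_def complex_eq_iff)
qed

lemma nrm_sq: "u : X ==> (nrm u)^2 = Re (ip u u)"
 by (simp add: ip_self)

lemma nrm_ge [simp]: "0 <= nrm u"
 if "u : X" using ip_ge[OF that] by (simp add: nrm_def)

lemma nrm_sc: "u : X ==> nrm (sc c u) = cmod c * nrm u"
proof -
 assume u: "u : X"
 have "(nrm (sc c u))^2 = (cmod c * nrm u)^2"
 proof -
  have "ip (sc c u) (sc c u) = (c * cnj c) * ip u u" using u by (simp add: ip_simps)
  also have "... = of_real ((cmod c * nrm u)^2)" using u by (simp add: ip_self complex_norm_square[symmetric] power_mult_distrib)
  finally show ?thesis using u by (simp add: nrm_sq)
 qed
 thus ?thesis using u by (metis abs_norm_cancel abs_of_nonneg mult_nonneg_nonneg norm_ge_zero nrm_ge sc_mem power2_eq_iff_nonneg)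
qed

lemma nrm_uminus: "u : X ==> nrm (- u) = nrm u"
 by (simp add: nrm_def ip_simps)

lemma nrm_minus_commute: "u : X ==> v : X ==> nrm (u - v) = nrm (v - u)"
 using nrm_uminus[of "u - v"] by simp

text \<open>The discriminant argument, where the quadratic coefficient may vanish.\<close>

lemma form_cauchy_schwarz:
 fixes a b :: real and c :: complex
 assumes "!!t::complex. 0 <= a + 2 * Re (t * c) + (cmod t)^2 * b" "0 <= b" "0 <= a"
 shows "(cmod c)^2 <= a * b"
proof (cases "b = 0")
 case True
 have "c = 0"
 proof (rule ccontr)
  assume "c ~= 0"
  define t where "t = - of_real (a + 1) * cnj c / of_real ((cmod c)^2)"
  have "t * c = - of_real (a + 1)"
   using `c ~= 0` complex_norm_square[of c] unfolding t_def by (simp add: field_simps)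
  hence "Re (t * c) = - (a + 1)" by simp
  thus False using assms(1)[of t] True assms(3) by simp
 qed
 thus ?thesis using True by simp
next
 case False
 hence b: "b > 0" using assms(2) by simp
 define t where "t = - cnj c / of_real b"
 have "t * c = - of_real ((cmod c)^2 / b)"
  using complex_norm_square[of c] unfolding t_def by (simp add: field_simps)
 hence 1: "Re (t * c) = - ((cmod c)^2 / b)" by simp
 have 2: "(cmod t)^2 * b = (cmod c)^2 / b" using b unfolding t_def by (simp add: norm_divide power2_eq_square)
 have "0 <= a - (cmod c)^2 / b" using assms(1)[of t] 1 2 by simp
 thus ?thesis using b by (simp add: field_simps)
qed

lemma cauchy_schwarz:
 assumes u: "u : X" and v: "v : X" shows "cmod (ip u v) <= nrm u * nrm v"
proof -
 have "(cmod (ip v u))^2 <= (nrm u)^2 * (nrm v)^2"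
 proof (rule form_cauchy_schwarz)
  fix t :: complex
  have "0 <= Re (ip (u + sc t v) (u + sc t v))" using u v by (intro ip_ge) auto
  also have "ip (u + sc t v) (u + sc t v) = ip u u + (t * ip v u + cnj (t * ip v u)) + t * cnj t * ip v v"
   using u v ip_cnj[OF v u] by (simp add: ip_simps algebra_simps)
  also have "Re ... = (nrm u)^2 + 2 * Re (t * ip v u) + (cmod t)^2 * (nrm v)^2"
   using u v by (simp add: ip_self complex_norm_square[symmetric])
  finally show "0 <= (nrm u)^2 + 2 * Re (t * ip v u) + (cmod t)^2 * (nrm v)^2" .
 qed auto
 hence "(cmod (ip v u))^2 <= (nrm u * nrm v)^2" by (simp add: power_mult_distrib)
 hence "cmod (ip v u) <= nrm u * nrm v" using u v by (simp add: power2_le_iff_abs_le)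
 thus ?thesis using ip_cnj[OF u v] by simp
qed

lemma nrm_triangle:
 assumes u: "u : X" and v: "v : X" shows "nrm (u + v) <= nrm u + nrm v"
proof -
 have "(nrm (u + v))^2 = (nrm u)^2 + 2 * Re (ip u v) + (nrm v)^2"
  using u v ip_cnj[OF u v] by (simp add: nrm_sq ip_simps)
 also have "... <= (nrm u)^2 + 2 * (nrm u * nrm v) + (nrm v)^2"
  using cauchy_schwarz[OF u v] complex_Re_le_cmod[of "ip u v"] by linarith
 also have "... = (nrm u + nrm v)^2" by (simp add: power2_eq_square algebra_simps)
 finally show ?thesis using u v by (simp add: power2_le_iff_abs_le)
qed

lemma nrm_triangle_diff:
 assumes u: "u : X" and v: "v : X" and w: "w : X" shows "nrm (u - w) <= nrm (u - v) + nrm (v - w)"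
 using nrm_triangle[of "u - v" "v - w"] assms by simp

lemma nrm_triangle_abs:
 assumes u: "u : X" and v: "v : X" shows "abs (nrm u - nrm v) <= nrm (u - v)"
 using nrm_triangle[of "u - v" v] nrm_triangle[of "v - u" u] assms nrm_minus_commute[OF u v] by auto

end

locale semi_hilbert = semi_inner X sc ip for X :: "'v::ab_group_add set" and sc ip +
 assumes complete: "!!u :: nat => 'v. (!!n. u n : X) ==>
   (!!e. e > 0 ==> EX N. ALL m>=N. ALL n>=N. Re (ip (u m - u n) (u m - u n)) < e) ==>
   EX l:X. (%n. Re (ip (u n - l) (u n - l))) ----> 0"
begin

lemma complete_nrm:
 assumes "!!n. u n : X" "!!e. e > 0 ==> EX N. ALL m>=N. ALL n>=N. nrm (u m - u n) < e"
 obtains l where "l : X" "(%n. nrm (u n - l)) ----> 0"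
proof -
 have "EX N. ALL m>=N. ALL n>=N. Re (ip (u m - u n) (u m - u n)) < e" if "e > 0" for e
 proof -
  obtain N where N: "ALL m>=N. ALL n>=N. nrm (u m - u n) < sqrt e" using assms(2)[of "sqrt e"] `e > 0` by auto
  have "Re (ip (u m - u n) (u m - u n)) < e" if "m >= N" "n >= N" for m n
   using N that unfolding nrm_def by (simp add: real_sqrt_less_iff)
  thus ?thesis by blast
 qed
 from complete[OF assms(1) this] obtain l where l: "l : X" "(%n. Re (ip (u n - l) (u n - l))) ----> 0" by blast
 have "(%n. nrm (u n - l)) ----> 0" using tendsto_real_sqrt[OF l(2)] unfolding nrm_def by simp
 with l(1) show ?thesis by (rule that)
qed

lemma ip_tendsto:
 assumes "!!n. u n : X" "l : X" "(%n. nrm (u n - l)) ----> 0"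
  and "!!n. v n : X" "m : X" "(%n. nrm (v n - m)) ----> 0"
 shows "(%n. ip (u n) (v n)) ----> ip l m"
proof (rule LIM_zero_cancel, rule Lim_null_comparison)
 let ?b = "%n. nrm (u n - l) * (nrm (v n - m) + nrm m) + nrm l * nrm (v n - m)"
 show "\<forall>\<^sub>F n in sequentially. norm (ip (u n) (v n) - ip l m) <= ?b n"
 proof (intro always_eventually allI)
  fix n
  have "ip (u n) (v n) - ip l m = ip (u n - l) (v n) + ip l (v n - m)" using assms by (simp add: ip_simps)
  also have "cmod ... <= nrm (u n - l) * nrm (v n) + nrm l * nrm (v n - m)"
   using assms by (intro norm_triangle_le add_mono cauchy_schwarz) auto
  also have "nrm (v n) <= nrm (v n - m) + nrm m" using nrm_triangle[of "v n - m" m] assms by simp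
  finally show "norm (ip (u n) (v n) - ip l m) <= ?b n" using assms by (auto simp: mult_left_mono)
 qed
 have "?b ----> 0 * (0 + nrm m) + nrm l * 0" by (intro tendsto_intros assms)
 thus "?b ----> 0" by simp
qed

lemma ip_tendsto1:
 assumes "!!n. u n : X" "l : X" "(%n. nrm (u n - l)) ----> 0" "z : X"
 shows "(%n. ip (u n) z) ----> ip l z"
 using ip_tendsto[OF assms(1-3), of "%_. z" z] assms(4) by (simp add: nrm_def)

lemma nrm_tendsto:
 assumes "!!n. u n : X" "l : X" "(%n. nrm (u n - l)) ----> 0"
 shows "(%n. nrm (u n)) ----> nrm l"
proof (rule LIM_zero_cancel, rule Lim_null_comparison[OF _ assms(3)])
 show "\<forall>\<^sub>F n in sequentially. norm (nrm (u n) - nrm l) <= nrm (u n - l)"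
  using nrm_triangle_abs[OF assms(1,2)] by simp
qed

lemma nrm_eq_0I: "u : X ==> (!!z. z : X ==> ip u z = 0) ==> nrm u = 0"
 by (simp add: nrm_def)

subsection \<open>Symmetric bounded operators\<close>

definition sop :: "('v => 'v) => real => bool" where
 "sop P K = (0 <= K & (ALL u:X. P u : X & nrm (P u) <= K * nrm u) & (ALL u:X. ALL z:X. ip (P u) z = ip u (P z)))"

definition commute :: "('v => 'v) => ('v => 'v) => bool" where
 "commute P Q = ((ALL u:X. ALL z:X. ip (P (Q u)) z = ip (Q (P u)) z))"

definition posop :: "('v => 'v) => bool" where
 "posop P = ((ALL u:X. 0 <= Re (ip (P u) u)))"

lemma sop_mem [simp]: "sop P K ==> u : X ==> P u : X" by (auto simp: sop_def)
lemma sop_nrm: "sop P K ==> u : X ==> nrm (P u) <= K * nrm u" by (auto simp: sop_def)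
lemma sop_sym: "sop P K ==> u : X ==> z : X ==> ip (P u) z = ip u (P z)" by (auto simp: sop_def)
lemma sop_ge: "sop P K ==> 0 <= K" by (auto simp: sop_def)
lemma commuteD: "commute P Q ==> u : X ==> z : X ==> ip (P (Q u)) z = ip (Q (P u)) z" by (auto simp: commute_def)
lemma commute_sym: "commute P Q ==> commute Q P" by (auto simp: commute_def)

text \<open>The form of a positive operator is again a semi-inner product.\<close>

lemma posop_cauchy_schwarz:
 assumes Q: "sop Q K" "posop Q" and m: "y : X" "z : X" and y: "Re (ip (Q y) y) = 0"
 shows "ip (Q y) z = 0"
proof -
 interpret q: semi_inner X sc "%u z. ip (Q u) z"
 proof
  show "ip (Q z) u = cnj (ip (Q u) z)" if "u : X" "z : X" for u z
   using that ip_cnj[of "Q u" z] sop_sym[OF Q(1), of z u] sop_mem[OF Q(1)] by simp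
 qed (use Q(2) sop_mem[OF Q(1)] in "auto simp: sop_sym[OF Q(1)] ip_add ip_sc posop_def")
 show ?thesis using q.cauchy_schwarz[OF m] y by (simp add: q.nrm_def)
qed

lemma sop_nrm_diff:
 assumes P: "sop P K" and u: "u : X" and v: "v : X" shows "nrm (P u - P v) <= K * nrm (u - v)"
proof -
 have "nrm (P u - P v) = nrm (P (u - v))"
 proof -
  have "!!z. z : X ==> ip (P u - P v) z = ip (P (u - v)) z" using P u v by (simp add: ip_simps sop_sym)
  moreover have "!!z. z : X ==> ip z (P u - P v) = ip z (P (u - v))" using P u v by (simp add: ip_simps flip: sop_sym[OF P])
  ultimately show ?thesis using P u v by (simp add: nrm_def)
 qed
 thus ?thesis using sop_nrm[OF P, of "u - v"] u v by simp
qed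

lemma nrm_cong:
 assumes "u : X" "v : X" "!!z. z : X ==> ip u z = ip v z"
 shows "nrm u = nrm v"
proof -
 have "nrm (u - v) = 0" using assms by (intro nrm_eq_0I) (auto simp: ip_simps)
 thus ?thesis using nrm_triangle_abs[OF assms(1,2)] by simp
qed

lemma sop_tendsto:
 assumes P: "sop P K" and u: "!!n. u n : X" "l : X" "(%n. nrm (u n - l)) ----> 0"
 shows "(%n. nrm (P (u n) - P l)) ----> 0"
proof (rule Lim_null_comparison)
 show "\<forall>\<^sub>F n in sequentially. norm (nrm (P (u n) - P l)) <= K * nrm (u n - l)"
  using sop_nrm_diff[OF P u(1,2)] P u by (simp add: abs_of_nonneg)
 show "(%n. K * nrm (u n - l)) ----> 0" using tendsto_mult_left[OF u(3), of K] by simp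
qed

lemma sop_comp:
 assumes "sop P K" "sop Q J" "commute P Q" shows "sop (%u. P (Q u)) (K * J)"
proof -
 have "nrm (P (Q u)) <= K * J * nrm u" if "u : X" for u
  using sop_nrm[OF assms(1), of "Q u"] mult_left_mono[OF sop_nrm[OF assms(2) that] sop_ge[OF assms(1)]] assms that
  by (simp add: mult.assoc)
 moreover have "ip (P (Q u)) z = ip u (P (Q z))" if "u : X" "z : X" for u z
 proof -
  have "ip (P (Q u)) z = ip (Q (P u)) z" using assms(3) that by (rule commuteD)
  also have "... = ip u (P (Q z))" using assms that by (simp add: sop_sym)
  finally show ?thesis .
 qed
 ultimately show ?thesis using assms by (simp add: sop_def)
qed

lemma sop_one_minus:
 assumes "sop P K" shows "sop (%u. u - P u) (1 + K)"
proof -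
 have "nrm (u - P u) <= (1 + K) * nrm u" if "u : X" for u
  using nrm_triangle[of u "- P u"] sop_nrm[OF assms that] assms that by (simp add: nrm_uminus algebra_simps)
 thus ?thesis using assms by (auto simp: sop_def ip_simps)
qed

text \<open>Iterating \<open>Z = (Y + Z Z) / 2\<close> from \<open>0\<close> yields \<open>1 - sqrt (1 - Y)\<close>. The steps are dominated by those of the same iteration
 for \<open>Y = 1\<close>, a bounded increasing sequence of numbers.\<close>

fun sqrt_scalar :: "nat => real" where
 "sqrt_scalar 0 = 0" | "sqrt_scalar (Suc n) = (1 + (sqrt_scalar n)^2) / 2"

fun sqrt_iter :: "('v => 'v) => nat => 'v => 'v" where
 "sqrt_iter Y 0 u = 0"
| "sqrt_iter Y (Suc n) u = sc (1/2) (Y u + sqrt_iter Y n (sqrt_iter Y n u))"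

lemma sqrt_scalar_bounds: "0 <= sqrt_scalar n" "sqrt_scalar n <= 1" "sqrt_scalar n <= sqrt_scalar (Suc n)"
proof -
 have 1: "0 <= sqrt_scalar n & sqrt_scalar n <= 1"
 proof (induction n)
  case (Suc n) thus ?case using power_le_one[of "sqrt_scalar n" 2] by simp
 qed simp
 thus "0 <= sqrt_scalar n" "sqrt_scalar n <= 1" by auto
 have "0 <= (1 - sqrt_scalar n)^2" by simp
 thus "sqrt_scalar n <= sqrt_scalar (Suc n)" by (simp add: power2_eq_square algebra_simps)
qed

lemma sop_sqrt_iter:
 assumes Y: "sop Y 1"
 shows "sop (sqrt_iter Y n) (sqrt_scalar n)"
proof (induction n)
 case 0 thus ?case by (simp add: sop_def nrm_def)
next
 case (Suc n)
 let ?Z = "sqrt_iter Y n"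
 have "nrm (sqrt_iter Y (Suc n) u) <= sqrt_scalar (Suc n) * nrm u" if u: "u : X" for u
 proof -
  have "nrm (?Z (?Z u)) <= sqrt_scalar n * (sqrt_scalar n * nrm u)"
   by (rule order.trans[OF sop_nrm[OF Suc] mult_left_mono[OF sop_nrm[OF Suc]]]) (use u Suc sqrt_scalar_bounds in auto)
  moreover have "nrm (Y u) <= nrm u" using sop_nrm[OF Y u] by simp
  ultimately have "nrm (Y u + ?Z (?Z u)) <= nrm u + sqrt_scalar n * (sqrt_scalar n * nrm u)"
   using nrm_triangle[of "Y u" "?Z (?Z u)"] Y Suc u by simp
  thus ?thesis using Y Suc u by (simp add: nrm_sc power2_eq_square algebra_simps)
 qed
 moreover have "0 <= sqrt_scalar (Suc n)" by (rule sqrt_scalar_bounds)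
 moreover have "sqrt_iter Y (Suc n) u : X" if "u : X" for u using Y Suc that by simp
 moreover have "ip (sqrt_iter Y (Suc n) u) z = ip u (sqrt_iter Y (Suc n) z)" if "u : X" "z : X" for u z
 proof -
  have "ip (?Z (?Z u)) z = ip u (?Z (?Z z))"
   using that sop_sym[OF Suc sop_mem[OF Suc that(1)] that(2)] sop_sym[OF Suc that(1) sop_mem[OF Suc that(2)]] by simp
  thus ?thesis using that Y Suc sop_sym[OF Y that] by (simp add: ip_simps)
 qed
 ultimately show ?case unfolding sop_def by blast
qed

lemma commute_sqrt_iter:
 assumes Y: "sop Y 1" and Q: "sop Q K" and c: "commute Q Y"
 shows "commute Q (sqrt_iter Y n)"
proof (induction n)
 case 0 thus ?case using Q by (simp add: commute_def sop_sym)
next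
 case (Suc n)
 let ?Z = "sqrt_iter Y n"
 note Z = sop_sqrt_iter[OF Y, of n]
 show ?case unfolding commute_def
 proof (intro ballI)
  fix u w assume u: "u : X" and w: "w : X"
  have "ip (Q (?Z (?Z u))) w = ip (?Z (Q (?Z u))) w" using Suc Z u w by (intro commuteD) auto
  also have "... = ip (Q (?Z u)) (?Z w)" using Q Z u w by (simp add: sop_sym)
  also have "... = ip (?Z (Q u)) (?Z w)" using Suc Z u w by (intro commuteD) auto
  also have "... = ip (?Z (?Z (Q u))) w" using Q Z u w by (simp add: sop_sym)
  finally have 1: "ip (Q (?Z (?Z u))) w = ip (?Z (?Z (Q u))) w" .
  have "ip (Q (sqrt_iter Y (Suc n) u)) w = (ip (Q (Y u)) w + ip (Q (?Z (?Z u))) w) / 2"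
   using Q Y Z u w by (simp add: sop_sym[OF Q] ip_simps)
  also have "... = ip (sqrt_iter Y (Suc n) (Q u)) w"
   using Q Y Z u w 1 commuteD[OF c u w] by (simp add: ip_simps)
  finally show "ip (Q (sqrt_iter Y (Suc n) u)) w = ip (sqrt_iter Y (Suc n) (Q u)) w" .
 qed
qed

declare sqrt_iter.simps [simp del]

lemma sqrt_iter_step:
 assumes Y: "sop Y 1" and u: "u : X"
 shows "nrm (sqrt_iter Y (Suc n) u - sqrt_iter Y n u) <= (sqrt_scalar (Suc n) - sqrt_scalar n) * nrm u"
 using u
proof (induction n arbitrary: u)
 case 0 thus ?case using sop_nrm[OF Y 0] Y by (simp add: nrm_sc sqrt_iter.simps)
next
 case (Suc n)
 let ?a = "sqrt_iter Y (Suc n)" and ?b = "sqrt_iter Y n"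
 let ?x = "sqrt_scalar (Suc n)" and ?y = "sqrt_scalar n"
 note a = sop_sqrt_iter[OF Y, of "Suc n"] and b = sop_sqrt_iter[OF Y, of n]
 have YY: "commute Y Y" by (simp add: commute_def)
 have ab: "commute ?a ?b" by (intro commute_sqrt_iter[OF Y a] commute_sym[OF commute_sqrt_iter[OF Y Y YY]])
 note u = Suc.prems
 have mem: "?a u : X" "?b u : X" "?a (?a u) : X" "?b (?b u) : X"
  by (intro sop_mem[OF a] sop_mem[OF b] u)+
 define p where "p = ?a u + ?b u"
 have p: "p : X" using mem by (simp add: p_def)
 have np: "nrm p <= (?x + ?y) * nrm u" unfolding p_def using nrm_triangle[OF mem(1,2)] sop_nrm[OF a u] sop_nrm[OF b u]
  by (simp add: algebra_simps del: sqrt_scalar.simps)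
 have weak: "nrm (?a p - ?b p) = nrm (?a (?a u) - ?b (?b u))"
 proof (rule nrm_cong)
  have mp: "?a p : X" "?b p : X" using sop_mem[OF a p] sop_mem[OF b p] .
  show "?a p - ?b p : X" "?a (?a u) - ?b (?b u) : X" using mp mem by auto
  fix z assume z: "z : X"
  have mz: "?a z : X" "?b z : X" using sop_mem[OF a z] sop_mem[OF b z] .
  have "ip (?a (?b u)) z = ip (?b (?a u)) z" by (rule commuteD[OF ab u z])
  hence c: "ip (?b u) (?a z) = ip (?a u) (?b z)" using sop_sym[OF a mem(2) z] sop_sym[OF b mem(1) z] by simp
  have "ip (?a p - ?b p) z = ip p (?a z) - ip p (?b z)"
   using mp z sop_sym[OF a p z] sop_sym[OF b p z] by (simp only: ip_simps)
  also have "... = ip (?a u) (?a z) - ip (?b u) (?b z)"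
   unfolding p_def using mem mz c by (simp only: ip_simps) simp
  also have "... = ip (?a (?a u) - ?b (?b u)) z"
   using mem z sop_sym[OF a mem(1) z] sop_sym[OF b mem(2) z] by (simp only: ip_simps)
  finally show "ip (?a p - ?b p) z = ip (?a (?a u) - ?b (?b u)) z" .
 qed
 have "nrm (sqrt_iter Y (Suc (Suc n)) u - sqrt_iter Y (Suc n) u)
  = nrm (sc (1/2) (Y u + ?a (?a u)) - sc (1/2) (Y u + ?b (?b u)))"
  by (rule arg_cong[where f = nrm], rule arg_cong2[where f = "(-)"]; rule sqrt_iter.simps)
 also have "... = nrm (sc (1/2) (?a (?a u) - ?b (?b u)))"
 proof -
  have "nrm (sc (1/2) (c + p) - sc (1/2) (c + q)) = nrm (sc (1/2) (p - q))" if "c : X" "p : X" "q : X" for c p q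
   using that by (intro nrm_cong) (simp_all add: ip_simps field_simps)
  thus ?thesis using sop_mem[OF Y u] mem(3,4) by blast
 qed
 also have "... = nrm (?a p - ?b p) / 2" using mem by (simp add: nrm_sc weak)
 also have "... <= ((?x - ?y) * nrm p) / 2" by (intro divide_right_mono Suc.IH[OF p]) simp
 also have "... <= ((?x - ?y) * ((?x + ?y) * nrm u)) / 2"
 proof (intro divide_right_mono mult_left_mono np)
  show "0 <= ?x - ?y" using sqrt_scalar_bounds(3)[of n] by linarith
 qed simp
 also have "... = (sqrt_scalar (Suc (Suc n)) - ?x) * nrm u"
  unfolding sqrt_scalar.simps(2)[of "Suc n"] by (subst (3) sqrt_scalar.simps(2)) (simp add: power2_eq_square field_simps del: sqrt_scalar.simps)
 finally show ?case .
qed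

lemma sop_sqrt:
 assumes Y: "sop Y 1"
 obtains R where "sop R 2" "posop R" "!!u z. u : X ==> z : X ==> ip (R (R u)) z = ip (u - Y u) z"
  "!!Q K. sop Q K ==> commute Q Y ==> commute Q R" "sop (%u. u - R u) 1"
proof -
 let ?Z = "sqrt_iter Y"
 note Zn = sop_sqrt_iter[OF Y]
 have incs: "incseq sqrt_scalar" by (rule incseq_SucI) (rule sqrt_scalar_bounds)
 have step: "nrm (?Z m u - ?Z n u) <= (sqrt_scalar m - sqrt_scalar n) * nrm u" if "n <= m" "u : X" for m n u
  using that(1)
 proof (induction m rule: dec_induct)
  case base show ?case by (simp add: nrm_def)
 next
  case (step k)
  show ?case using nrm_triangle_diff[of "?Z (Suc k) u" "?Z k u" "?Z n u"] sqrt_iter_step[OF Y that(2), of k] step.IH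
   sop_mem[OF Zn that(2)] by (simp add: algebra_simps del: sqrt_scalar.simps)
 qed
 have "EX l:X. (%n. nrm (?Z n u - l)) ----> 0" if u: "u : X" for u
 proof -
  have "EX N. ALL m>=N. ALL n>=N. nrm (?Z m u - ?Z n u) < e" if "e > 0" for e
  proof -
   have "Bseq sqrt_scalar" using sqrt_scalar_bounds by (intro BseqI[of 1]) (auto simp: abs_of_nonneg)
   hence "Cauchy sqrt_scalar" using incs by (intro convergent_Cauchy Bseq_monoseq_convergent incseq_imp_monoseq)
   moreover have e': "0 < e / (nrm u + 1)" using `e > 0` nrm_ge[OF u] by (simp add: add_nonneg_pos)
   ultimately obtain N where N: "ALL m>=N. ALL n>=N. dist (sqrt_scalar m) (sqrt_scalar n) < e / (nrm u + 1)"
    unfolding Cauchy_def by blast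
   have "nrm (?Z m u - ?Z n u) < e" if "N <= n" "n <= m" for m n
   proof -
    have "nrm (?Z m u - ?Z n u) <= (sqrt_scalar m - sqrt_scalar n) * nrm u" by (rule step[OF that(2) u])
    also have "... <= e / (nrm u + 1) * nrm u"
    proof (rule mult_right_mono[OF _ nrm_ge[OF u]])
     have "dist (sqrt_scalar m) (sqrt_scalar n) < e / (nrm u + 1)" using N that by simp
     thus "sqrt_scalar m - sqrt_scalar n <= e / (nrm u + 1)" by (simp add: dist_real_def)
    qed
    also have "... < e" using `e > 0` nrm_ge[OF u] by (simp add: field_simps add_nonneg_pos)
    finally show ?thesis .
   qed
   hence "ALL m>=N. ALL n>=N. nrm (?Z m u - ?Z n u) < e"
    using nrm_minus_commute[OF sop_mem[OF Zn u] sop_mem[OF Zn u]] by (metis linear)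
   thus ?thesis by blast
  qed
  from complete_nrm[of "%n. ?Z n u", OF sop_mem[OF Zn u] this] show ?thesis by blast
 qed
 then obtain Z where Z: "!!u. u : X ==> Z u : X" "!!u. u : X ==> (%n. nrm (?Z n u - Z u)) ----> 0"
  by metis
 note ZnX = sop_mem[OF Zn]
 note lim = ip_tendsto1[OF ZnX Z(1) Z(2)]
 have sopZ: "sop Z 1" unfolding sop_def
 proof (intro conjI ballI)
  fix u assume u: "u : X"
  show "nrm (Z u) <= 1 * nrm u"
  proof (rule LIMSEQ_le_const2[OF nrm_tendsto[OF ZnX[OF u] Z(1)[OF u] Z(2)[OF u]]], intro exI allI impI)
   fix n
   have "sqrt_scalar n * nrm u <= 1 * nrm u" using sqrt_scalar_bounds u by (intro mult_right_mono) auto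
   thus "nrm (?Z n u) <= 1 * nrm u" using sop_nrm[OF Zn u, of n] by linarith
  qed
  fix z assume z: "z : X"
  have "(%n. ip (?Z n u) z) ----> ip (Z u) z" by (rule lim[OF u u u z])
  moreover have "(%n. cnj (ip (?Z n z) u)) ----> cnj (ip (Z z) u)" by (intro tendsto_cnj lim[OF z z z u])
  moreover have "cnj (ip (?Z n z) u) = ip (?Z n u) z" for n
   using ip_cnj[OF ZnX[OF z] u] sop_sym[OF Zn u z] by simp
  moreover have "cnj (ip (Z z) u) = ip u (Z z)" using ip_cnj[OF Z(1)[OF z] u] by simp
  ultimately show "ip (Z u) z = ip u (Z z)" using LIMSEQ_unique by force
 qed (use Z in auto)
 have fixeq: "ip (Z u) z = (ip (Y u) z + ip (Z u) (Z z)) / 2" if u: "u : X" and z: "z : X" for u z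
 proof -
  have "(%n. (ip (Y u) z + ip (?Z n u) (?Z n z)) / 2) ----> (ip (Y u) z + ip (Z u) (Z z)) / 2"
   by (intro tendsto_intros ip_tendsto ZnX Z u z) auto
  moreover have "(ip (Y u) z + ip (?Z n u) (?Z n z)) / 2 = ip (?Z (Suc n) u) z" for n
   using Y u z ZnX[OF u] ZnX[OF z] ZnX[OF ZnX[OF u]] by (simp add: ip_simps sop_sym[OF Zn] sqrt_iter.simps)
  moreover have "(%n. ip (?Z (Suc n) u) z) ----> ip (Z u) z" using lim[OF u u u z] by (rule LIMSEQ_Suc)
  ultimately show ?thesis using LIMSEQ_unique by force
 qed
 define R where "R u = u - Z u" for u
 have R2: "sop R 2" using sop_one_minus[OF sopZ] unfolding R_def[abs_def] by simp
 show ?thesis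
 proof (rule that[of R])
  show "sop R 2" by (rule R2)
  show "posop R" unfolding posop_def
  proof
   fix u assume u: "u : X"
   have "Re (ip (Z u) u) <= nrm (Z u) * nrm u"
    using cauchy_schwarz[OF Z(1)[OF u] u] complex_Re_le_cmod[of "ip (Z u) u"] by linarith
   also have "... <= nrm u * nrm u" using sop_nrm[OF sopZ u] u by (intro mult_right_mono) auto
   finally show "0 <= Re (ip (R u) u)" using u Z(1)[OF u] unfolding R_def
    by (simp add: ip_simps power2_eq_square flip: nrm_sq)
  qed
  show "ip (R (R u)) z = ip (u - Y u) z" if u: "u : X" and z: "z : X" for u z
  proof -
   have "ip (R (R u)) z = ip (u - Z u) (z - Z z)"
    using sop_sym[OF R2 sop_mem[OF R2 u] z] by (simp add: R_def)
   also have "... = ip u z - ip (Z u) z - ip u (Z z) + ip (Z u) (Z z)" using u z Z(1) by (simp add: ip_simps)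
   also have "... = ip u z - ip (Y u) z" using fixeq[OF u z] sop_sym[OF sopZ u z] by (simp add: field_simps)
   finally show ?thesis using u z Y by (simp add: ip_simps)
  qed
  show "commute Q R" if Q: "sop Q K" "commute Q Y" for Q K
   unfolding commute_def
  proof (intro ballI)
   fix u z assume u: "u : X" and z: "z : X"
   have "(%n. ip (?Z n (Q u)) z) ----> ip (Z (Q u)) z" using Q u z by (intro lim) auto
   moreover have "(%n. ip (?Z n u) (Q z)) ----> ip (Z u) (Q z)" using Q u z by (intro lim) auto
   moreover have "ip (?Z n (Q u)) z = ip (?Z n u) (Q z)" for n
    using commuteD[OF commute_sqrt_iter[OF Y Q, of n] u z] sop_sym[OF Q(1) ZnX[OF u] z] by simp
   ultimately have "ip (Z (Q u)) z = ip (Z u) (Q z)" using LIMSEQ_unique by force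
   thus "ip (Q (R u)) z = ip (R (Q u)) z" using u z Q Z(1) sop_mem[OF R2] unfolding R_def
    by (simp add: ip_simps sop_sym[OF Q(1)])
  qed
  show "sop (%u. u - R u) 1" using sopZ unfolding R_def by simp
 qed
qed

subsection \<open>Self-adjoint graphs and their square roots\<close>

definition adj :: "('v \<times> 'v) set => ('v \<times> 'v) set" where
 "adj T = {(u, v). u : X & v : X & (\<forall>(x, y)\<in>T. ip y u = ip x v)}"

definition sa :: "('v \<times> 'v) set => bool" where
 "sa T = ((ALL u:X. ALL e>0. EX w:Domain T. nrm (u - w) < e) & adj T = T)"

definition nonneg :: "('v \<times> 'v) set => bool" where
 "nonneg T = ((\<forall>(u, v)\<in>T. 0 <= Re (ip v u)))"

lemma nonnegD: "nonneg T ==> (u, v) : T ==> 0 <= Re (ip v u)" by (auto simp: nonneg_def)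

lemma weak_flip: "(!!z. z : X ==> ip u z = ip v z) ==> u : X ==> v : X ==> z : X ==> ip z u = ip z v"
 using ip_cnj by metis

lemma parallelogram:
 assumes "a : X" "b : X" shows "(nrm (a - b))^2 + (nrm (a + b))^2 = 2 * (nrm a)^2 + 2 * (nrm b)^2"
 using assms by (simp add: nrm_sq ip_simps)

context
 fixes T assumes T: "sa T"
begin

lemma sa_memD: assumes "(u, v) : T" shows "u : X" "v : X"
proof -
 have "(u, v) : adj T" using T assms by (simp add: sa_def)
 thus "u : X" "v : X" by (auto simp: adj_def)
qed

lemma sa_sym: assumes "(u, v) : T" "(x, y) : T" shows "ip y u = ip x v"
proof -
 have "(u, v) : adj T" using T assms by (simp add: sa_def)
 thus ?thesis using assms(2) by (auto simp: adj_def)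
qed

lemma sa_I:
 assumes "u : X" "v : X" "!!x y. (x, y) : T ==> x : X ==> y : X ==> ip y u = ip x v" shows "(u, v) : T"
proof -
 have "(u, v) : adj T" using assms sa_memD unfolding adj_def by blast
 thus ?thesis using T by (simp add: sa_def)
qed

lemma sa_add: assumes "(u, v) : T" "(x, y) : T" shows "(u + x, v + y) : T"
 using sa_memD[OF assms(1)] sa_memD[OF assms(2)]
 by (intro sa_I) (auto simp: ip_simps sa_sym[OF assms(1)] sa_sym[OF assms(2)])

lemma sa_diff: assumes "(u, v) : T" "(x, y) : T" shows "(u - x, v - y) : T"
 using sa_memD[OF assms(1)] sa_memD[OF assms(2)]
 by (intro sa_I) (auto simp: ip_simps sa_sym[OF assms(1)] sa_sym[OF assms(2)])

lemma sa_sc: assumes "(u, v) : T" shows "(sc c u, sc c v) : T"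
 using sa_memD[OF assms(1)]
 by (intro sa_I) (auto simp: ip_simps sa_sym[OF assms(1)])

lemma sa_weak:
 assumes "(u, v) : T" "u' : X" "v' : X" "!!z. z : X ==> ip u z = ip u' z" "!!z. z : X ==> ip v z = ip v' z"
 shows "(u', v') : T"
proof (rule sa_I[OF assms(2,3)])
 fix x y assume xy: "(x, y) : T"
 note m = sa_memD[OF assms(1)] sa_memD[OF xy]
 have "ip y u' = ip y u" "ip x v' = ip x v"
  using weak_flip[OF assms(4), of y] weak_flip[OF assms(5), of x] m assms(2,3) by auto
 thus "ip y u' = ip x v'" using sa_sym[OF assms(1) xy] by simp
qed

lemma sa_closed:
 assumes "!!n. (u n, v n) : T" "l : X" "(%n. nrm (u n - l)) ----> 0" "m : X" "(%n. nrm (v n - m)) ----> 0"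
 shows "(l, m) : T"
proof (rule sa_I[OF assms(2,4)])
 fix x y assume xy: "(x, y) : T"
 note mm = sa_memD[OF assms(1)] sa_memD[OF xy]
 have "(%n. ip y (u n)) ----> ip y l" "(%n. ip x (v n)) ----> ip x m"
  using ip_tendsto[of "%_. y" y u l] ip_tendsto[of "%_. x" x v m] assms mm by (auto simp: nrm_def)
 moreover have "ip y (u n) = ip x (v n)" for n by (rule sa_sym[OF assms(1) xy])
 ultimately show "ip y l = ip x m" using LIMSEQ_unique by simp
qed

end
end

context semi_hilbert begin
text \<open>Choose \<open>(u, v)\<close> in the graph such that \<open>u + v\<close> is as close to \<open>w\<close> as possible; minimising sequences converge because
 nonnegativity gives \<open>|u + v|^2 >= |u|^2 + |v|^2\<close>. The remainder \<open>e\<close> is orthogonal to the range of \<open>1 + T\<close>, hence \<open>(e, - e)\<close>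
 is in the adjoint, and nonnegativity forces \<open>e = 0\<close>.\<close>

lemma resolvent_ex:
 assumes T: "sa T" and N: "nonneg T" and w: "w : X"
 shows "EX u. (u, w - u) : T"
proof -
 note sa_memD = sa_memD[OF T] and sa_I = sa_I[OF T] and sa_add = sa_add[OF T] and sa_diff = sa_diff[OF T]
  and sa_sc = sa_sc[OF T] and sa_closed = sa_closed[OF T] and sa_weak = sa_weak[OF T]
 define V where "V = {nrm (w - (u + v)) |u v. (u, v) : T}"
 have z: "(0, 0) : T"
  by (rule sa_I; simp)
 have V0: "0 <= x" if xV: "x : V" for x
 proof -
  obtain u v where uv: "(u, v) : T" "x = nrm (w - (u + v))" using xV by (auto simp: V_def)
  show ?thesis unfolding uv(2) by (rule nrm_ge[OF diff_mem[OF w add_mem[OF sa_memD[OF uv(1)]]]])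
 qed
 have Vne: "V ~= {}" unfolding V_def by (rule ccontr) (use z in simp)
 have Vbd: "bdd_below V" using V0 by (rule bdd_belowI)
 define d where "d = Inf V"
 have d0: "0 <= d" unfolding d_def using Vne V0 by (rule cInf_greatest)
 have dle: "d <= nrm (w - (u + v))" if "(u, v) : T" for u v
  unfolding d_def by (rule cInf_lower[OF _ Vbd]) (use that in "auto simp: V_def")
 have "EX u v. (u, v) : T & nrm (w - (u + v)) < d + 1 / Suc n" for n
 proof -
  have "Inf V < d + 1 / Suc n" by (simp add: d_def)
  from cInf_lessD[OF Vne this] show ?thesis by (auto simp: V_def)
 qed
 then obtain u v where uv: "!!n. (u n, v n) : T" "!!n. nrm (w - (u n + v n)) < d + 1 / Suc n" by metis
 note mem = sa_memD[OF uv(1)]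
 have key: "(nrm (u m - u n))^2 + (nrm (v m - v n))^2 <= 4 * (d + 1 / Suc k)^2 - 4 * d^2" if "k <= m" "k <= n" for m n k
 proof -
  let ?a = "w - (u m + v m)" and ?b = "w - (u n + v n)"
  have mab: "?a : X" "?b : X" using mem w by auto
  have less: "nrm (w - (u j + v j)) <= d + 1 / Suc k" if "k <= j" for j
  proof -
   have "1 / real (Suc j) <= 1 / Suc k" using that by (intro divide_left_mono) auto
   thus ?thesis using uv(2)[of j] by linarith
  qed
  let ?p = "sc (1/2) (u m + u n)" and ?q = "sc (1/2) (v m + v n)"
  have "(?p, ?q) : T" by (intro sa_sc sa_add uv)
  hence "2 * d <= 2 * nrm (w - (?p + ?q))" using dle by simp
  also have "... = nrm (sc 2 (w - (?p + ?q)))" using mem w by (simp add: nrm_sc)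
  also have "... = nrm (?a + ?b)" using mem w by (intro nrm_cong) (auto simp: ip_simps algebra_simps)
  finally have 1: "(2 * d)^2 <= (nrm (?a + ?b))^2" using d0 by (intro power_mono) auto
  have 2: "(nrm ?a)^2 <= (d + 1 / Suc k)^2" "(nrm ?b)^2 <= (d + 1 / Suc k)^2"
   using less that mab by (auto intro!: power_mono)
  have 3: "nrm (?a - ?b) = nrm (u m - u n + (v m - v n))"
  proof -
   have "nrm (?a - ?b) = nrm (- (u m - u n + (v m - v n)))" by (simp add: algebra_simps)
   also have "... = nrm (u m - u n + (v m - v n))" by (intro nrm_uminus add_mem diff_mem mem)
   finally show ?thesis .
  qed
  have T': "(u m - u n, v m - v n) : T" by (rule sa_diff[OF uv(1) uv(1)])
  have "(nrm (u m - u n + (v m - v n)))^2 = (nrm (u m - u n))^2 + 2 * Re (ip (v m - v n) (u m - u n)) + (nrm (v m - v n))^2"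
  proof -
   have "nrm (p + q) ^ 2 = (nrm p)^2 + 2 * Re (ip q p) + (nrm q)^2" if "p : X" "q : X" for p q
    using that ip_cnj[OF that(2,1)] by (simp add: nrm_sq ip_simps)
   from this[OF diff_mem[OF mem(1) mem(1)] diff_mem[OF mem(2) mem(2)]] show ?thesis .
  qed
  hence "(nrm (u m - u n))^2 + (nrm (v m - v n))^2 <= (nrm (?a - ?b))^2"
   using nonnegD[OF N T'] 3 by simp
  thus ?thesis using parallelogram[OF mab] 1 2 by (simp add: power_mult_distrib)
 qed
 have lim0: "(%k. 4 * (d + 1 / real (Suc k))^2 - 4 * d^2) ----> 4 * (d + 0)^2 - 4 * d^2"
  by (intro tendsto_intros LIMSEQ_inverse_real_of_nat[unfolded inverse_eq_divide])
 have cau: "EX K. ALL m>=K. ALL n>=K. nrm (u m - u n) < e & nrm (v m - v n) < e" if "e > 0" for e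
 proof -
  have "eventually (%k. 4 * (d + 1 / real (Suc k))^2 - 4 * d^2 < e^2) sequentially"
   using order_tendstoD(2)[OF lim0, of "e^2"] that by simp
  then obtain K where K: "4 * (d + 1 / real (Suc K))^2 - 4 * d^2 < e^2" by (auto simp: eventually_sequentially)
  have "nrm (u m - u n) < e & nrm (v m - v n) < e" if "m >= K" "n >= K" for m n
  proof -
   have "(nrm (u m - u n))^2 < e^2" "(nrm (v m - v n))^2 < e^2"
    using key[OF that] K zero_le_power2[of "nrm (u m - u n)"] zero_le_power2[of "nrm (v m - v n)"] by linarith+
   thus ?thesis using `e > 0` by (auto dest: power_less_imp_less_base)
  qed
  thus ?thesis by blast
 qed
 obtain p where p: "p : X" "(%n. nrm (u n - p)) ----> 0"
  using complete_nrm[of u] mem(1) cau by metis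
 obtain q where q: "q : X" "(%n. nrm (v n - q)) ----> 0"
  using complete_nrm[of v] mem(2) cau by metis
 have pq: "(p, q) : T" by (rule sa_closed[OF uv(1) p q])
 define e where "e = w - (p + q)"
 have e: "e : X" using p q w by (auto simp: e_def)
 have ele: "nrm e <= d"
 proof (rule LIMSEQ_le_const)
  show "(%n. d + 1 / Suc n + nrm (u n - p) + nrm (v n - q)) ----> d"
   using tendsto_add[OF tendsto_add[OF tendsto_add[OF tendsto_const[of d] LIMSEQ_inverse_real_of_nat[unfolded inverse_eq_divide]] p(2)] q(2)] by simp
  show "EX N. ALL n>=N. nrm e <= d + 1 / Suc n + nrm (u n - p) + nrm (v n - q)"
  proof (intro exI allI impI)
   fix n
   have m1: "w - (u n + v n) : X" "u n - p : X" "v n - q : X"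
    by (intro diff_mem add_mem mem w p(1) q(1))+
   have "e = (w - (u n + v n)) + ((u n - p) + (v n - q))" by (simp add: e_def algebra_simps)
   hence "nrm e <= nrm (w - (u n + v n)) + nrm ((u n - p) + (v n - q))"
    using nrm_triangle[OF m1(1) add_mem[OF m1(2,3)]] by simp
   also have "... <= d + 1 / Suc n + (nrm (u n - p) + nrm (v n - q))"
    by (rule add_mono[OF less_imp_le[OF uv(2)] nrm_triangle[OF m1(2,3)]])
   finally show "nrm e <= d + 1 / Suc n + nrm (u n - p) + nrm (v n - q)" by simp
  qed
 qed
 have orth: "ip (x + y) e = 0" if xy: "(x, y) : T" for x y
 proof -
  note mxy = sa_memD[OF xy]
  have "(cmod (- ip (x + y) e))^2 <= 0 * (nrm (x + y))^2"
  proof (rule form_cauchy_schwarz)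
   fix t :: complex
   have "d <= nrm (w - ((p + sc t x) + (q + sc t y)))" by (intro dle sa_add pq sa_sc xy)
   also have "... = nrm (e - sc t (x + y))"
   proof (rule nrm_cong)
    show "w - ((p + sc t x) + (q + sc t y)) : X" "e - sc t (x + y) : X"
     by (intro diff_mem add_mem sc_mem w p(1) q(1) mxy e)+
    fix z assume "z : X"
    thus "ip (w - ((p + sc t x) + (q + sc t y))) z = ip (e - sc t (x + y)) z"
     using mxy p(1) q(1) w e unfolding e_def by (simp add: ip_simps algebra_simps)
   qed
   finally have "(nrm e)^2 <= (nrm (e - sc t (x + y)))^2" using ele e by (intro power_mono) auto
   also have "(nrm (e - sc t (x + y)))^2 = (nrm e)^2 + 2 * Re (t * - ip (x + y) e) + (cmod t)^2 * (nrm (x + y))^2"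
   proof -
    define s where "s = x + y"
    have s: "s : X" using mxy by (simp add: s_def)
    have "ip (e - sc t s) (e - sc t s) = ip e e - (t * ip s e + cnj (t * ip s e)) + t * cnj t * ip s s"
     using e s ip_cnj[OF s e] by (simp add: ip_simps algebra_simps)
    hence "Re (ip (e - sc t s) (e - sc t s)) = (nrm e)^2 + 2 * Re (t * - ip s e) + (cmod t)^2 * (nrm s)^2"
     using e s by (simp add: ip_self complex_norm_square[symmetric])
    thus ?thesis using e s by (simp add: nrm_sq s_def)
   qed
   finally show "0 <= 0 + 2 * Re (t * - ip (x + y) e) + (cmod t)^2 * (nrm (x + y))^2" by simp
  qed auto
  thus ?thesis by simp
 qed
 have "(e, - e) : T"
 proof (rule sa_I[OF e uminus_mem[OF e]])
  fix x y assume "(x, y) : T" "x : X" "y : X"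
  thus "ip y e = ip x (- e)" using orth[of x y] e by (simp add: ip_simps add_eq_0_iff)
 qed
 from nonnegD[OF N this] have "(nrm e)^2 <= 0" using e by (simp add: ip_simps nrm_sq)
 hence e0: "nrm e = 0" by simp
 have "(p, w - p) : T"
 proof (rule sa_weak[OF pq p(1)])
  show "ip q z = ip (w - p) z" if "z : X" for z
  proof -
   have "cmod (ip e z) <= 0" using cauchy_schwarz[OF e that] e0 by simp
   thus ?thesis using p q w that by (simp add: e_def ip_simps)
  qed
 qed (use p w in auto)
 thus ?thesis by blast
qed

lemma sa_functional:
 assumes T: "sa T" and v: "(0, v) : T" shows "nrm v = 0"
proof -
 have m: "v : X" by (rule sa_memD[OF T v])
 have "nrm v <= e" if e: "0 < e" for e
 proof -
  obtain x y where x: "(x, y) : T" "nrm (v - x) < e" using T m e unfolding sa_def by blast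
  note xm = sa_memD[OF T x(1)]
  have "ip x v = 0" using sa_sym[OF T v x(1)] xm by simp
  hence "ip (v - x) v = of_real ((nrm v)^2)" using m xm by (simp add: ip_diff ip_self)
  hence "(nrm v)^2 <= nrm (v - x) * nrm v" using cauchy_schwarz[of "v - x" v] m xm by (simp add: norm_power)
  hence "nrm v <= nrm (v - x) | nrm v = 0" using nrm_ge[OF m] unfolding power2_eq_square by (metis mult_right_le_imp_le order.order_iff_strict)
  thus ?thesis using x(2) e by linarith
 qed
 hence "nrm v <= 0" by (rule dense_ge)
 thus ?thesis using nrm_ge[OF m] by simp
qed

lemma nrm_0_ip: "nrm e = 0 ==> e : X ==> z : X ==> ip e z = 0"
 using cauchy_schwarz[of e z] by simp

text \<open>Let \<open>B\<close> be the inverse of \<open>1 + T\<close>, and let \<open>F\<close> be the positive root of \<open>B - B B\<close>; this is what \<open>S B\<close> has to be. The root of \<open>T\<close>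
 is the relation \<open>B v = F u\<close>. Since \<open>B B + F F = B\<close> and \<open>B\<close> is injective, its members also satisfy \<open>u = B u + F v\<close>, and these
 two equations give symmetry, positivity and \<open>S S = T\<close>. For any other root \<open>S'\<close>, the operator \<open>S' B\<close> is positive with square
 \<open>B - B B\<close> and commutes with \<open>F\<close>, hence equals \<open>F\<close>; so \<open>S'\<close> is contained in \<open>S\<close>.\<close>

lemma sqrt_ex1:
 assumes T: "sa T" and N: "nonneg T"
 shows "EX! S. sa S & nonneg S & S O S = T"
proof -
 have "EX B. ALL w:X. (B w, w - B w) : T" using resolvent_ex[OF T N] by metis
 then obtain B where B: "!!w. w : X ==> (B w, w - B w) : T" by blast
 have BX [simp]: "B w : X" if "w : X" for w by (rule sa_memD(1)[OF T B[OF that]])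
 have Bs: "ip (B w) z = ip w (B z)" if w: "w : X" and z: "z : X" for w z
  using sa_sym[OF T B[OF z] B[OF w]] w z by (simp add: ip_simps)
 have Bge: "0 <= Re (ip (w - B w) (B w))" if "w : X" for w by (rule nonnegD[OF N B[OF that]])
 have Bn: "nrm (B w) <= nrm w" if w: "w : X" for w
 proof -
  have "(nrm w)^2 = (nrm (B w))^2 + 2 * Re (ip (w - B w) (B w)) + (nrm (w - B w))^2"
   using w ip_cnj[OF w BX[OF w]] by (simp add: ip_simps nrm_sq)
  hence "(nrm (B w))^2 <= (nrm w)^2" using Bge[OF w] zero_le_power2[of "nrm (w - B w)"] by linarith
  thus ?thesis using nrm_ge[OF w] by (auto dest: power2_le_imp_le)
 qed
 have sB: "sop B 1" using Bs Bn by (simp add: sop_def)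
 have BT: "ip (B (x + y)) z = ip x z" if xy: "(x, y) : T" and z: "z : X" for x y z
 proof -
  note m = sa_memD[OF T xy]
  have d: "(x - B (x + y), y - (x + y - B (x + y))) : T" using m by (intro sa_diff[OF T xy B]) simp
  have "y - (x + y - B (x + y)) = - (x - B (x + y))" by simp
  with nonnegD[OF N d] have "0 <= Re (ip (- (x - B (x + y))) (x - B (x + y)))" by simp
  hence "(nrm (x - B (x + y)))^2 <= 0" using m by (simp add: ip_uminus nrm_sq del: minus_diff_eq)
  hence "ip (x - B (x + y)) z = 0" using m z by (intro nrm_0_ip) auto
  thus ?thesis using m z by (simp add: ip_simps)
 qed
 have Binj: "ip e z = 0" if e: "e : X" and 0: "!!z. z : X ==> ip (B e) z = 0" and z: "z : X" for e z
 proof -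
  have "(0, e) : T" by (rule sa_weak[OF T B[OF e]]) (use e 0 in "auto simp: ip_simps")
  thus ?thesis using sa_functional[OF T] e z by (intro nrm_0_ip) auto
 qed
 \<comment> \<open>a contraction, since \<open>B\<close> and \<open>1 - B\<close> are positive\<close>
 define Y where "Y w = w - (B w - B (B w))" for w
 have sY: "sop Y 1" unfolding sop_def
 proof (intro conjI ballI)
  fix u assume u: "u : X"
  define q where "q = Re (ip (B u) u) - Re (ip (B u) (B u))"
  let ?v = "B (u - B u)"
  have v: "ip (u - Y u) z = ip ?v z" if "z : X" for z using u that by (simp add: Y_def ip_simps Bs)
  have q: "0 <= q" using Bge[OF u] u ip_cnj[OF u BX[OF u]] by (simp add: q_def ip_simps)
  have "Re (ip ?v ?v) <= Re (ip ?v (u - B u))"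
   using Bge[of "u - B u"] u ip_cnj[of "u - B u" ?v] by (simp add: ip_diff)
  also have "... = q - Re (ip (B u - B (B u)) (B u))" using u by (simp add: q_def ip_simps Bs)
  also have "... <= q" using Bge[of "B u"] ip_ge[of "B u - B (B u)"] u by (simp add: ip_simps Bs)
  finally have "(nrm ?v)^2 <= q" using u by (simp add: nrm_sq)
  moreover have "nrm (u - Y u) = nrm ?v" by (rule nrm_cong[OF _ _ v]) (use u in "auto simp: Y_def")
  ultimately have "Re (ip (u - Y u) (u - Y u)) <= q" using nrm_sq[of "u - Y u"] u by (simp add: Y_def)
  moreover have "Re (ip (u - Y u) u) = q" using u by (simp add: Y_def q_def ip_simps Bs)
  moreover have "ip (Y u) (Y u) = ip u u - ip (u - Y u) u - ip u (u - Y u) + ip (u - Y u) (u - Y u)" using u by (simp add: Y_def ip_simps)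
  moreover have "Re (ip u (u - Y u)) = Re (ip (u - Y u) u)" using u ip_cnj[of "u - Y u" u] by (simp add: Y_def)
  ultimately have "(nrm (Y u))^2 <= (nrm u)^2" using q u by (simp add: nrm_sq Y_def)
  thus "nrm (Y u) <= 1 * nrm u" using nrm_ge[OF u] by (auto dest: power2_le_imp_le)
 qed (auto simp: Y_def ip_simps Bs)
 obtain F where F: "sop F 2" "posop F" "!!u z. u : X ==> z : X ==> ip (F (F u)) z = ip (u - Y u) z"
  "!!Q K. sop Q K ==> commute Q Y ==> commute Q F" using sop_sqrt[OF sY] by metis
 have FX [simp]: "F u : X" if "u : X" for u by (rule sop_mem[OF F(1) that])
 have Fs: "ip (F u) z = ip u (F z)" if "u : X" "z : X" for u z by (rule sop_sym[OF F(1) that])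
 have FF: "ip (F u) (F z) = ip (B u) z - ip (B u) (B z)" if "u : X" "z : X" for u z
  using F(3)[OF that] that by (simp add: Y_def ip_simps Fs Bs)
 have cY: "commute Q Y" if Q: "sop Q K" "commute Q B" for Q K unfolding commute_def
 proof (intro ballI)
  fix u z assume u: "u : X" and z: "z : X"
  note [simp] = sop_mem[OF Q(1)]
  have "ip (Q (B (B u))) z = ip (B (B (Q u))) z" using commuteD[OF Q(2), of "B u" z] commuteD[OF Q(2), of u "B z"] u z by (simp add: Bs)
  thus "ip (Q (Y u)) z = ip (Y (Q u)) z" using commuteD[OF Q(2) u z] u z by (simp add: Y_def ip_simps sop_sym[OF Q(1)])
 qed
 have "commute B F" by (rule F(4)[OF sB cY[OF sB]]) (simp add: commute_def)
 hence BF: "ip (B u) (F z) = ip (F u) (B z)" if "u : X" "z : X" for u z using that by (auto simp: commute_def Fs Bs)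
 define S where "S = {(u, v). u : X & v : X & (ALL z:X. ip (B v) z = ip (F u) z)}"
 have S: "u : X" "v : X" "!!z. z : X ==> ip v (B z) = ip u (F z)" if "(u, v) : S" for u v
  using that by (auto simp: S_def Fs Bs)
 have SF: "ip v (F z) = ip u z - ip u (B z)" if uv: "(u, v) : S" and z: "z : X" for u v z
 proof -
  have "ip (F v - (u - B u)) z = 0"
  proof (rule Binj[OF _ _ z])
   fix z assume "z : X"
   thus "ip (B (F v - (u - B u))) z = 0"
    using S(1,2)[OF uv] BF[of v z] FF[of u z] S(3)[OF uv, of "F z"] by (simp add: ip_simps Bs Fs)
  qed (use S[OF uv] in simp)
  thus ?thesis using S(1,2)[OF uv] z by (simp add: ip_simps Bs Fs)
 qed
 have BS: "(B w, F w) : S" if "w : X" for w using that BF by (simp add: S_def Fs Bs)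
 have Ssym: "ip v x = ip u y" if uv: "(u, v) : S" and xy: "(x, y) : S" for u v x y
 proof -
  note m = S(1,2)[OF uv] S(1,2)[OF xy]
  have "ip v (F y) = ip v (x - B x)" by (rule weak_flip) (use m SF[OF xy] in "auto simp: ip_simps Fs Bs")
  moreover have "ip u (B y) = ip u (F x)" by (rule weak_flip) (use m S(3)[OF xy] in "auto simp: Fs Bs")
  ultimately show ?thesis using S(3)[OF uv, of x] SF[OF uv, of y] m by (simp add: ip_simps)
 qed
 have saS: "sa S" unfolding sa_def
 proof (intro conjI ballI allI impI)
  fix u and e :: real assume "u : X" "0 < e"
  then obtain x y where x: "(x, y) : T" "nrm (u - x) < e" using T unfolding sa_def by blast
  note m = sa_memD[OF T x(1)]
  have "nrm (u - B (x + y)) = nrm (u - x)" using m `u : X` BT[OF x(1)] by (intro nrm_cong) (auto simp: ip_diff)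
  thus "EX w:Domain S. nrm (u - w) < e" using x(2) BS[of "x + y"] m by (intro bexI[of _ "B (x + y)"]) auto
 next
  show "adj S = S"
  proof (intro equalityI subrelI)
   fix u v assume "(u, v) : adj S"
   hence m: "u : X" "v : X" and "!!w. w : X ==> ip (F w) u = ip (B w) v" using BS by (auto simp: adj_def)
   moreover have "ip v (B z) = cnj (ip (B z) v)" "ip u (F z) = cnj (ip (F z) u)" if "z : X" for z using that m by (auto intro: ip_cnj)
   ultimately show "(u, v) : S" by (simp add: S_def Bs Fs)
  next
   fix u v assume uv: "(u, v) : S"
   thus "(u, v) : adj S" using S(1,2)[OF uv] Ssym[OF _ uv] by (auto simp: adj_def)
  qed
 qed
 have nnS: "nonneg S" unfolding nonneg_def
 proof clarify
  fix u v assume uv: "(u, v) : S"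
  note m = S(1,2)[OF uv]
  have "ip v (F v) = ip v (u - B u)" by (rule weak_flip) (use m SF[OF uv] in "auto simp: ip_simps Fs Bs")
  hence "ip v u = ip v (B u) + ip v (F v)" using m by (simp add: ip_simps)
  also have "... = ip (F u) u + ip (F v) v" using S(3)[OF uv m(1)] m by (simp add: Fs)
  finally show "0 <= Re (ip v u)" using F(2) m by (simp add: posop_def)
 qed
 have SST: "S O S = T"
 proof safe
  fix u v z assume uv: "(u, v) : S" and vz: "(v, z) : S"
  note m = S(1,2)[OF uv] S(2)[OF vz]
  have e: "ip (B (u + z)) q = ip u q" if q: "q : X" for q using S(3)[OF vz q] SF[OF uv q] m q by (simp add: Bs ip_simps)
  show "(u, z) : T" by (rule sa_weak[OF T B[of "u + z"]]) (use m e in "auto simp: ip_simps")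
 next
  fix x y assume xy: "(x, y) : T"
  note m = sa_memD[OF T xy]
  have x: "ip (B (x + y)) q = ip x q" if "q : X" for q by (rule BT[OF xy that])
  have "ip (x + y) (F (B q)) = ip x (F q)" "ip (x + y) (F (F q)) = ip y (B q)" if "q : X" for q
   using x[of "F q"] BF[of "x + y" q] FF[of "x + y" q] x[of q] x[of "B q"] m that by (simp_all add: Bs Fs ip_simps diff_eq_eq add.commute)
  hence "(x, F (x + y)) : S" "(F (x + y), y) : S" using m by (simp_all add: S_def Bs Fs)
  thus "(x, y) : S O S" by blast
 qed
 have uniq: "S' = S" if S': "sa S'" "nonneg S'" "S' O S' = T" for S'
 proof -
  have "EX v. (B w, v) : S' & (v, w - B w) : S'" if "w : X" for w using B[OF that] S'(3) by blast
  then obtain P where P: "!!w. w : X ==> (B w, P w) : S'" "!!w. w : X ==> (P w, w - B w) : S'" by metis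
  have PX [simp]: "P w : X" if "w : X" for w by (rule sa_memD(2)[OF S'(1) P(1)[OF that]])
  note ss = sa_sym[OF S'(1)]
  have Ps: "ip (P w) z = ip w (P z)" if w: "w : X" and z: "z : X" for w z
   using ss[OF P(1)[OF z] P(1)[OF w]] ss[OF P(2)[OF z] P(2)[OF w]] w z by (simp add: ip_simps)
  have PB: "ip (P u) (B z) = ip (B u) (P z)" if "u : X" "z : X" for u z by (rule ss[OF P(1)[OF that(2)] P(1)[OF that(1)]])
  have PP: "ip (P w) (P z) = ip (B w) z - ip (B w) (B z)" if w: "w : X" and z: "z : X" for w z
   using ss[OF P(2)[OF z] P(1)[OF w]] z w by (simp add: ip_simps)
  have Ppos: "posop P" unfolding posop_def
  proof
   fix w assume w: "w : X"
   have "Re (ip (P w) (w - B w)) = Re (ip (w - B w) (P w))" using w ip_cnj[of "w - B w" "P w"] by simp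
   thus "0 <= Re (ip (P w) w)" using nonnegD[OF S'(2) P(1)[OF w]] nonnegD[OF S'(2) P(2)[OF w]] w by (simp add: ip_simps)
  qed
  have Pn: "nrm (P w) = nrm (F w)" if "w : X" for w using PP[OF that that] FF[OF that that] by (simp add: nrm_def)
  have sP: "sop P 2" using sop_nrm[OF F(1)] Ps by (simp add: sop_def Pn)
  have "commute P F" by (rule F(4)[OF sP cY[OF sP]]) (use PB in "simp add: commute_def Ps Bs")
  hence PF: "ip (P u) (F z) = ip (F u) (P z)" if "u : X" "z : X" for u z using that by (auto simp: commute_def Ps Fs)
  have PeqF: "ip (P w) z = ip (F w) z" if w: "w : X" and z: "z : X" for w z
  proof -
   define y where "y = P w - F w"
   have y: "y : X" using w by (simp add: y_def)
   have i: "ip q y = ip q (P w) - ip q (F w)" if "q : X" for q using that w by (simp add: y_def ip_simps)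
   have "ip (P y) y + ip (F y) y = 0" using i[of "P y"] i[of "F y"] y PF[OF y w] PP[OF y w] FF[OF y w] by simp
   hence "Re (ip (P y) y) + Re (ip (F y) y) = 0" by (metis plus_complex.sel(1) zero_complex.sel(1))
   hence "Re (ip (P y) y) = 0" "Re (ip (F y) y) = 0" using Ppos F(2) y unfolding posop_def by (smt (verit))+
   hence "ip (P y) w = 0" "ip (F y) w = 0" using posop_cauchy_schwarz[OF sP Ppos y w] posop_cauchy_schwarz[OF F(1,2) y w] by auto
   hence "ip y y = 0" using i[OF y] y w by (simp add: Ps Fs)
   hence "ip y z = 0" using y z by (intro nrm_0_ip) (auto simp: nrm_def)
   thus ?thesis using w z by (simp add: y_def ip_simps)
  qed
  have "S' <= S"
  proof (rule subrelI)
   fix u v assume uv: "(u, v) : S'"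
   note m = sa_memD[OF S'(1) uv]
   have "ip v (B z) = ip u (F z)" if z: "z : X" for z
    using ss[OF P(1)[OF z] uv] PeqF[OF z] weak_flip[of "P z" "F z" u] m z by simp
   thus "(u, v) : S" using m by (simp add: S_def Bs Fs)
  qed
  moreover have "S <= S'"
  proof (rule subrelI)
   fix u v assume uv: "(u, v) : S"
   show "(u, v) : S'" using `S' <= S` S(1,2)[OF uv] Ssym[OF _ uv] by (intro sa_I[OF S'(1)]) auto
  qed
  ultimately show ?thesis by blast
 qed
 show ?thesis using saS nnS SST uniq by blast
qed

end

section \<open>Square integrable functions\<close>

lemma enn2real_2 [simp]: "enn2real 2 = 2"
 by (metis enn2real_ennreal ennreal_numeral zero_le_numeral)

lemma Lp_norm_2:
 "Lp_norm M 2 f = (let I = (nint M (%x. ennreal ((cmod (f x))^2))) in if I = \<infinity> then \<infinity> else ennreal (sqrt (enn2real I)))"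
proof -
 have "(2::ennreal) ~= \<infinity>" by simp
 moreover have "cmod (f x) powr 2 = (cmod (f x))^2" for x
  by (cases "f x = 0") (auto simp: powr_numeral)
 ultimately show ?thesis by (simp add: Lp_norm_def Let_def powr_half_sqrt)
qed

lemma L2_space_iff:
 "f : L2_space M \<longleftrightarrow> f : meas M & integrable M (%x. (cmod (f x))^2)"
proof -
 have "Lp_norm M 2 f < \<infinity> \<longleftrightarrow> (nint M (%x. ennreal ((cmod (f x))^2))) < \<infinity>"
  by (auto simp: Lp_norm_2 Let_def top.not_eq_extremum)
 moreover have "integrable M (%x. (cmod (f x))^2) \<longleftrightarrow> (nint M (%x. ennreal ((cmod (f x))^2))) < \<infinity>"
  if "f : meas M"
  using that by (simp add: integrable_iff_bounded)
 ultimately show ?thesis by (auto simp: L2_space_def)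
qed

lemma L2_space_measurable: "f : L2_space M ==> f : meas M"
 by (simp add: L2_space_def)

lemma borel_measurable_cnj [measurable (raw)]:
 "f : meas M ==> (%x. cnj (f x)) : meas M"
 by (rule borel_measurable_continuous_on[of cnj]) (auto intro: continuous_intros)

lemma L2_mult_integrable:
 assumes "f : L2_space M" "g : L2_space M"
 shows "integrable M (%x. f x * cnj (g x))"
proof (rule Bochner_Integration.integrable_bound)
 show "integrable M (%x. (cmod (f x))^2 + (cmod (g x))^2)"
  using assms by (auto simp: L2_space_iff)
 show "(%x. f x * cnj (g x)) : meas M"
  using assms by (auto simp: L2_space_iff intro: borel_measurable_cnj)
 have "cmod (a * cnj b) <= (cmod a)^2 + (cmod b)^2" for a b
 proof -
  have "0 <= (cmod a - cmod b)^2 + (cmod a)^2 + (cmod b)^2" by simp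
  thus ?thesis by (simp add: norm_mult power2_diff)
 qed
 thus "AE x in M. norm (f x * cnj (g x)) <= norm ((cmod (f x))^2 + (cmod (g x))^2)"
  by auto
qed

lemma L2_space_add:
 assumes "f : L2_space M" "g : L2_space M" shows "(%x. f x + g x) : L2_space M"
 unfolding L2_space_iff
proof
 show m: "(%x. f x + g x) : meas M" using assms by (auto simp: L2_space_iff)
 show "integrable M (%x. (cmod (f x + g x))^2)"
 proof (rule Bochner_Integration.integrable_bound)
  show "integrable M (%x. 2 * (cmod (f x))^2 + 2 * (cmod (g x))^2)"
   using assms by (auto simp: L2_space_iff)
  show "(%x. (cmod (f x + g x))^2) : meas M" using m by measurable
  have "(cmod (a + b))^2 <= 2 * (cmod a)^2 + 2 * (cmod b)^2" for a b
  proof -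
   have "(cmod (a + b))^2 <= (cmod a + cmod b)^2" by (intro power_mono norm_triangle_ineq) simp
   also have "... <= (cmod a + cmod b)^2 + (cmod a - cmod b)^2" by simp
   also have "... = 2 * (cmod a)^2 + 2 * (cmod b)^2" by (simp add: power2_eq_square algebra_simps)
   finally show ?thesis .
  qed
  thus "AE x in M. norm ((cmod (f x + g x))^2) <= norm (2 * (cmod (f x))^2 + 2 * (cmod (g x))^2)"
   by auto
 qed
qed

lemma L2_space_scale:
 assumes "f : L2_space M" shows "(%x. c * f x) : L2_space M"
 using assms unfolding L2_space_iff by (auto simp: norm_mult power_mult_distrib)

lemma L2_space_uminus: assumes "f : L2_space M" shows "(%x. - f x) : L2_space M"
 using L2_space_scale[OF assms, of "-1"] by simp

lemma L2_space_diff: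
 assumes "f : L2_space M" "g : L2_space M" shows "(%x. f x - g x) : L2_space M"
 using L2_space_add[OF assms(1) L2_space_uminus[OF assms(2)]] by simp

lemma L2_inner_self: "L2_inner M f f = of_real (LINT x|M. (cmod (f x))^2)"
 by (simp add: L2_inner_def complex_norm_square[symmetric] del: of_real_power)

text \<open>The Riesz--Fischer theorem.\<close>

lemma L2_complete:
 fixes u :: "nat => 'a => complex"
 assumes u: "!!n. u n : L2_space M"
  and C: "!!e. e > 0 ==> EX N. ALL m>=N. ALL n>=N. (LINT x|M. (cmod (u m x - u n x))^2) < e"
 shows "EX l:L2_space M. (%n. \<integral>x. (cmod (u n x - l x))^2 \<partial>M) ----> 0"
proof -
 note um = L2_space_measurable[OF u]
 have [measurable]: "!!n. u n : meas M" by (rule um)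
 have int: "integrable M (%x. (cmod (u m x - u n x))^2)" for m n
  using L2_space_diff[OF u u] by (simp add: L2_space_iff)
 have nn: "nint M (%x. ennreal ((cmod (u m x - u n x))^2)) = ennreal (LINT x|M. (cmod (u m x - u n x))^2)" for m n
  by (rule nn_integral_eq_integral[OF int]) simp
 define D where "D m n = nint M (%x. ennreal ((cmod (u m x - u n x))^2))" for m n
 have "EX N. ALL m>=N. ALL n>=N. D m n < ennreal ((1/4)^k)" for k :: nat
  using C[of "(1/4)^k"] by (auto simp: D_def nn ennreal_less_iff)
 then obtain N where N: "!!k m n. m >= N k ==> n >= N k ==> D m n < ennreal ((1/4)^k)" by metis
 \<comment> \<open>along this subsequence the distances are summable, so it converges almost everywhere\<close>
 define k where "k j = (\<Sum>i\<le>j. N i) + j" for j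
 have kN: "N j <= k j" for j unfolding k_def by (rule trans_le_add1) (rule member_le_sum; simp)
 have kS: "k j <= k (Suc j)" "j <= k j" for j by (simp_all add: k_def)
 define d where "d j x = u (k (Suc j)) x - u (k j) x" for j x
 have "nint M (%x. (\<Sum>j. ennreal (2^j * (cmod (d j x))^2))) = (\<Sum>j. \<integral>\<^sup>+x. ennreal (2^j * (cmod (d j x))^2) \<partial>M)"
  unfolding d_def by (rule nn_integral_suminf) measurable
 also have "... = (\<Sum>j. ennreal (2^j) * D (k (Suc j)) (k j))"
  unfolding D_def d_def by (simp add: nn_integral_cmult ennreal_mult)
 also have "... <= (\<Sum>j. ennreal ((1/2)^j))"
 proof (rule suminf_le)
  fix j
  have "ennreal (2^j) * D (k (Suc j)) (k j) <= ennreal (2^j) * ennreal ((1/4)^j)"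
   using N[of j "k (Suc j)" "k j"] kN[of j] kS(1)[of j] by (intro mult_left_mono) auto
  also have "... = ennreal ((1/2)^j)" by (simp add: ennreal_mult[symmetric] power_mult_distrib[symmetric])
  finally show "ennreal (2^j) * D (k (Suc j)) (k j) <= ennreal ((1/2)^j)" .
 qed auto
 also have "... = ennreal (\<Sum>j. (1/2)^j)" by (rule suminf_ennreal2) (auto intro: summable_geometric)
 also have "... < \<infinity>" by simp
 finally have "AE x in M. (\<Sum>j. ennreal (2^j * (cmod (d j x))^2)) ~= \<infinity>"
  by (intro nn_integral_PInf_AE) (auto simp: d_def)
 hence conv: "AE x in M. convergent (%j. u (k j) x)"
 proof eventually_elim
  fix x assume "(\<Sum>j. ennreal (2^j * (cmod (d j x))^2)) ~= \<infinity>"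
  hence "summable (%j. 2^j * (cmod (d j x))^2)" by (intro summable_suminf_not_top) auto
  hence "Bseq (%j. 2^j * (cmod (d j x))^2)" by (intro convergent_imp_Bseq) (auto intro: convergentI dest: summable_LIMSEQ_zero)
  then obtain K where K: "K > 0" "!!j. 2^j * (cmod (d j x))^2 <= K" by (auto simp: Bseq_def)
  have "cmod (d j x) <= sqrt K * (sqrt (1/2))^j" for j
  proof -
   have "(cmod (d j x))^2 <= K * (1/2)^j" using K(2)[of j] by (simp add: field_simps)
   hence "cmod (d j x) <= sqrt (K * (1/2)^j)" by (rule real_le_rsqrt)
   thus ?thesis by (simp add: real_sqrt_mult real_sqrt_power)
  qed
  moreover have "summable (%j. sqrt K * (sqrt (1/2))^j)"
   by (intro summable_mult summable_geometric) (simp add: real_sqrt_divide)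
  ultimately have "summable (%j. d j x)" using summable_comparison_test'[of "%j. sqrt K * (sqrt (1/2))^j" 0 "%j. d j x"] by blast
  hence "convergent (%n. \<Sum>j<n. d j x)" by (simp add: summable_iff_convergent)
  hence "convergent (%n. (\<Sum>j<n. d j x) + u (k 0) x)" by (intro convergent_add convergent_const)
  moreover have "(\<Sum>j<n. d j x) + u (k 0) x = u (k n) x" for n
   unfolding d_def by (subst sum_lessThan_telescope) simp
  ultimately show "convergent (%j. u (k j) x)" by simp
 qed
 define l where "l x = lim (%j. u (k j) x)" for x
 have [measurable]: "l : meas M" unfolding l_def by measurable
 have bound: "nint M (%x. ennreal ((cmod (u m x - l x))^2)) <= ennreal ((1/4)^i)" if "m >= N i" for m i
 proof -
  have "nint M (%x. ennreal ((cmod (u m x - l x))^2)) = nint M (%x. liminf (%j. ennreal ((cmod (u m x - u (k j) x))^2)))"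
  proof (rule nn_integral_cong_AE, use conv in eventually_elim)
   fix x assume "convergent (%j. u (k j) x)"
   hence "(%j. u (k j) x) ----> l x" unfolding l_def by (simp add: convergent_LIMSEQ_iff)
   hence "(%j. ennreal ((cmod (u m x - u (k j) x))^2)) ----> ennreal ((cmod (u m x - l x))^2)"
    by (intro tendsto_intros)
   thus "ennreal ((cmod (u m x - l x))^2) = liminf (%j. ennreal ((cmod (u m x - u (k j) x))^2))"
    by (intro lim_imp_Liminf[symmetric]) simp_all
  qed
  also have "... <= liminf (%j. \<integral>\<^sup>+x. ennreal ((cmod (u m x - u (k j) x))^2) \<partial>M)"
   by (rule nn_integral_liminf) measurable
  also have "... <= ennreal ((1/4)^i)"
  proof (rule Liminf_le)
   have "eventually (%j. j >= N i) sequentially" by (rule eventually_ge_at_top)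
   thus "\<forall>\<^sub>F j in sequentially. (nint M (%x. ennreal ((cmod (u m x - u (k j) x))^2))) <= ennreal ((1/4)^i)"
   proof eventually_elim
    case (elim j)
    hence "k j >= N i" using kS(2)[of j] by linarith
    thus ?case using N[OF that, of "k j"] by (simp add: D_def less_imp_le)
   qed
  qed simp
  finally show ?thesis .
 qed
 have L: "(%x. u m x - l x) : L2_space M" if "m >= N 0" for m
  using bound[OF that] by (auto simp: L2_space_iff integrable_iff_bounded intro: le_less_trans)
 have "l : L2_space M"
  using L2_space_diff[OF u[of "N 0"] L[of "N 0"]] by simp
 moreover have "(%n. \<integral>x. (cmod (u n x - l x))^2 \<partial>M) ----> 0"
 proof (rule LIMSEQ_I)
  fix r :: real assume "r > 0"
  then obtain i where i: "(1/4::real)^i < r" using real_arch_pow_inv[of r "1/4"] by auto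
  have "norm ((LINT x|M. (cmod (u n x - l x))^2) - 0) < r" if "n >= N i" for n
  proof -
   have I: "integrable M (%x. (cmod (u n x - l x))^2)"
    using bound[OF that] by (auto simp: integrable_iff_bounded intro: le_less_trans)
   have "ennreal (LINT x|M. (cmod (u n x - l x))^2) <= ennreal ((1/4)^i)"
    using bound[OF that] nn_integral_eq_integral[OF I] by simp
   thus ?thesis using i by (simp add: ennreal_le_iff)
  qed
  thus "EX no. ALL n>=no. norm ((LINT x|M. (cmod (u n x - l x))^2) - 0) < r" by blast
 qed
 ultimately show ?thesis by blast
qed

lemma semi_hilbert_L2:
 "semi_hilbert (L2_space M) (%c f x. c * f x) (L2_inner M)"
proof
 show "0 : L2_space M" by (simp add: L2_space_iff zero_fun_def)
 show "u + v : L2_space M" if "u : L2_space M" "v : L2_space M" for u v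
  using L2_space_add[OF that] by (simp add: plus_fun_def)
 show "- u : L2_space M" if "u : L2_space M" for u
  using L2_space_uminus[OF that] by (simp add: fun_Compl_def)
 show "(%x. c * u x) : L2_space M" if "u : L2_space M" for u c
  by (rule L2_space_scale[OF that])
 show "L2_inner M (u + v) z = L2_inner M u z + L2_inner M v z"
  if "u : L2_space M" "v : L2_space M" "z : L2_space M" for u v z
  using L2_mult_integrable[OF that(1,3)] L2_mult_integrable[OF that(2,3)]
  by (simp add: L2_inner_def distrib_right)
 show "L2_inner M (%x. c * u x) z = c * L2_inner M u z" for u z c
  by (simp add: L2_inner_def mult.assoc)
 show "L2_inner M z u = cnj (L2_inner M u z)" for u z
 proof -
  have "(%x. z x * cnj (u x)) = (%x. cnj (u x * cnj (z x)))" by (simp add: fun_eq_iff mult.commute)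
  hence "(LINT x|M. z x * cnj (u x)) = (LINT x|M. cnj (u x * cnj (z x)))" by (simp only:)
  moreover have "(LINT x|M. cnj (f x)) = cnj (LINT x|M. f x)" for f
   by (rule integral_bounded_linear'[OF bounded_linear_cnj bounded_linear_cnj]) simp
  ultimately show ?thesis unfolding L2_inner_def by (simp only:)
 qed
 show "0 <= Re (L2_inner M u u)" for u
  by (simp add: L2_inner_self)
 show "EX l:L2_space M. (%n. Re (L2_inner M (u n - l) (u n - l))) ----> 0"
  if "!!n. u n : L2_space M"
   "!!e. e > 0 ==> EX N. ALL m>=N. ALL n>=N. Re (L2_inner M (u m - u n) (u m - u n)) < e" for u :: "nat => 'a => complex"
  using L2_complete[of u M] that by (simp add: L2_inner_self)
qed

context
 fixes M :: "'a measure"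
begin

interpretation L2: semi_hilbert "L2_space M" "%c f x. c * f x" "L2_inner M"
 by (rule semi_hilbert_L2)

lemma Lp_norm_2_nrm:
 assumes "f : L2_space M" shows "Lp_norm M 2 f = ennreal (L2.nrm f)"
proof -
 have I: "integrable M (%x. (cmod (f x))^2)" using assms by (simp add: L2_space_iff)
 show ?thesis using nn_integral_eq_integral[OF I]
  by (simp add: Lp_norm_2 L2.nrm_def L2_inner_self)
qed

lemma self_adjoint_op_sa:
 assumes "T <= L2_space M \<times> L2_space M"
 shows "self_adjoint_op M T = (L2.sa T)"
proof -
 have adj: "adjoint_op M T = L2.adj T" by (simp add: adjoint_op_def L2.adj_def)
 have "Lp_norm M 2 (%x. u x - w x) = ennreal (L2.nrm (u - w))" if "u : L2_space M" "w : Domain T" for u w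
 proof -
  have "w : L2_space M" using that assms by auto
  thus ?thesis using Lp_norm_2_nrm[OF L2_space_diff[OF that(1)]] by (simp add: fun_diff_def)
 qed
 moreover have "(ALL eps>0. EX w:Domain T. ennreal (L2.nrm (u - w)) < eps) \<longleftrightarrow> (ALL e>0. EX w:Domain T. L2.nrm (u - w) < e)"
  if "u : L2_space M" for u
 proof safe
  fix e :: real assume "ALL eps>0. EX w:Domain T. ennreal (L2.nrm (u - w)) < eps" "e > 0"
  hence "EX w:Domain T. ennreal (L2.nrm (u - w)) < ennreal e" by simp
  then obtain w where w: "w : Domain T" "ennreal (L2.nrm (u - w)) < ennreal e" by blast
  have "L2.nrm (u - w) < e" using w(2) `e > 0` by (metis ennreal_leI linorder_not_less)
  thus "EX w:Domain T. L2.nrm (u - w) < e" using w(1) by blast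
 next
  fix eps :: ennreal assume A: "ALL e>0. EX w:Domain T. L2.nrm (u - w) < e" "eps > 0"
  obtain e' where "0 < e'" "e' < eps" using dense[OF A(2)] by blast
  then obtain e where e: "ennreal e < eps" "0 < e" by (cases e') auto
  then obtain w where "w : Domain T" "L2.nrm (u - w) < e" using A(1) by blast
  hence "ennreal (L2.nrm (u - w)) < ennreal e" using e(2) by (simp add: ennreal_lessI)
  thus "EX w:Domain T. ennreal (L2.nrm (u - w)) < eps" using e(1) `w : Domain T` by (meson less_trans)
 qed
 ultimately show ?thesis unfolding self_adjoint_op_def L2.sa_def adj by (simp cong: bex_cong)
qed

lemma self_adjoint_op_carrier:
 assumes "self_adjoint_op M T" shows "T <= L2_space M \<times> L2_space M"
proof -
 have "T = adjoint_op M T" using assms by (simp add: self_adjoint_op_def)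
 also have "... <= L2_space M \<times> L2_space M" by (auto simp: adjoint_op_def)
 finally show ?thesis .
qed

lemma self_adjoint_op_iff: "self_adjoint_op M T = (L2.sa T)"
proof -
 have "T <= L2_space M \<times> L2_space M" if "L2.sa T"
 proof
  fix p assume "p : T" thus "p : L2_space M \<times> L2_space M"
   using L2.sa_memD[OF that] by (cases p) auto
 qed
 thus ?thesis using self_adjoint_op_sa self_adjoint_op_carrier by blast
qed

lemma sqrt_op:
 assumes "self_adjoint_op M T" "nonneg_op M T"
 shows "self_adjoint_op M (sqrt_op M T)" "nonneg_op M (sqrt_op M T)" "sqrt_op M T O sqrt_op M T = T"
proof -
 have nn: "nonneg_op M T = L2.nonneg T" for T by (simp add: nonneg_op_def L2.nonneg_def)
 have "EX! S. self_adjoint_op M S & nonneg_op M S & S O S = T"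
  unfolding self_adjoint_op_iff nn using assms by (intro L2.sqrt_ex1) (simp_all add: self_adjoint_op_iff nn)
 from theI'[OF this] show "self_adjoint_op M (sqrt_op M T)" "nonneg_op M (sqrt_op M T)" "sqrt_op M T O sqrt_op M T = T"
  unfolding sqrt_op_def by auto
qed

lemma self_adjoint_functional:
 assumes S: "self_adjoint_op M S" and h: "(f, h) : S" "(f, h') : S"
 shows "AE x in M. h x = h' x"
proof -
 have sa: "L2.sa S" using S by (simp add: self_adjoint_op_iff)
 define v where "v = h - h'"
 have v: "(0, v) : S" unfolding v_def using L2.sa_diff[OF sa h] by simp
 have m: "v : L2_space M" by (rule L2.sa_memD[OF sa v])
 have "L2.nrm v = 0" by (rule L2.sa_functional[OF sa v])
 hence "(LINT x|M. (cmod (v x))^2) = 0" using L2.ip_self[OF m] unfolding L2_inner_self by simp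
 hence "AE x in M. (cmod (v x))^2 = 0" using m by (subst (asm) integral_nonneg_eq_0_iff_AE) (auto simp: L2_space_iff)
 thus ?thesis by eventually_elim (simp add: v_def)
qed

lemma self_adjoint_AE_cong:
 assumes S: "self_adjoint_op M S" and h: "(f, h) : S" and e: "AE x in M. f x = f' x" "f' : L2_space M"
 shows "(f', h) : S"
proof -
 have sa: "L2.sa S" using S by (simp add: self_adjoint_op_iff)
 note m = L2.sa_memD[OF sa h]
 show ?thesis
 proof (rule L2.sa_weak[OF sa h e(2) m(2)])
  fix z assume z: "z : L2_space M"
  show "L2_inner M f z = L2_inner M f' z" unfolding L2_inner_def
   using e m z by (intro integral_cong_AE borel_measurable_times borel_measurable_cnj L2_space_measurable) auto
 qed simp
qed

lemma self_adjoint_sum: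
 assumes S: "self_adjoint_op M S" and "finite U" "!!u. u : U ==> (F u, G u) : S"
 shows "((%x. SUM u:U. z u * F u x), (%x. SUM u:U. z u * G u x)) : S"
 using assms(2,3)
proof (induction U rule: finite_induct)
 have sa: "L2.sa S" using S by (simp add: self_adjoint_op_iff)
 {
  case empty
  have "(0, 0) : S" by (rule L2.sa_I[OF sa]) auto
  thus ?case by (simp add: zero_fun_def)
 next
  case (insert u U)
  have "(F u, G u) : S" using insert.prems by simp
  note c = L2.sa_add[OF sa L2.sa_sc[OF sa this, of "z u"] insert.IH[OF insert.prems]]
  show ?case using c insert.hyps by (simp add: plus_fun_def)
 }
qed

lemma eigenvalue_nonneg:
 assumes S: "self_adjoint_op M S" and nn: "nonneg_op M S" and u: "u : eigenfunctions M S l"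
 shows "0 <= l"
proof (rule ccontr)
 assume l: "\<not> 0 <= l"
 have uS: "(u, %x. of_real l * u x) : S" and nz: "\<not> (AE x in M. u x = 0)" using u by (auto simp: eigenfunctions_def)
 have m: "u : L2_space M" using self_adjoint_op_carrier[OF S] uS by blast
 have "0 <= Re (L2_inner M (%x. of_real l * u x) u)" using nn uS by (auto simp: nonneg_op_def)
 also have "L2_inner M (%x. of_real l * u x) u = of_real l * L2_inner M u u" by (simp add: L2_inner_def mult.assoc)
 finally have "0 <= l * (LINT x|M. (cmod (u x))^2)" by (simp add: L2_inner_self)
 hence "(LINT x|M. (cmod (u x))^2) = 0" using l by (simp add: zero_le_mult_iff antisym)
 hence "AE x in M. (cmod (u x))^2 = 0" using m by (subst (asm) integral_nonneg_eq_0_iff_AE) (auto simp: L2_space_iff)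
 hence "AE x in M. u x = 0" by eventually_elim simp
 thus False using nz by simp
qed

lemma relpow_eigen_sum:
 fixes z :: "('a => complex) => complex" and e :: "('a => complex) => real"
 assumes S: "self_adjoint_op M S" and U: "finite U" "!!u. u : U ==> (u, %x. of_real (e u) * u x) : S"
 defines "F \<equiv> %k x. SUM u:U. z u * (of_real (e u ^ k) * u x)"
 shows "(F 0, F k) : S ^^ k & (ALL h. (F 0, h) : S ^^ k --> h : L2_space M & (AE x in M. h x = F k x))"
proof (induction k)
 have sa: "L2.sa S" using S by (simp add: self_adjoint_op_iff)
 have st: "(F k, F (Suc k)) : S" for k unfolding F_def
 proof (rule self_adjoint_sum[OF S U(1)])
  fix u assume "u : U"
  from L2.sa_sc[OF sa U(2)[OF this], of "of_real (e u ^ k)"]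
  show "((%x. of_real (e u ^ k) * u x), (%x. of_real (e u ^ Suc k) * u x)) : S" by (simp add: mult_ac)
 qed
 note Fm = L2.sa_memD(1)[OF sa st]
 {
  case 0 show ?case using Fm by simp
 next
  case (Suc k)
  have "h : L2_space M & (AE x in M. h x = F (Suc k) x)" if "(F 0, h) : S ^^ Suc k" for h
  proof -
   obtain h' where h': "(F 0, h') : S ^^ k" "(h', h) : S" using `(F 0, h) : S ^^ Suc k` by auto
   have "(F k, h) : S" using Suc h'(1) by (intro self_adjoint_AE_cong[OF S h'(2) _ Fm]) auto
   thus ?thesis using self_adjoint_functional[OF S _ st] L2.sa_memD(2)[OF sa] by blast
  qed
  thus ?case using Suc st by (blast intro: relpow_Suc_I)
 }
qed

end

section \<open>Smooth functions\<close>

lemma frechet_derivative_cong_open: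
 assumes "open S" "x : S" "!!y. y : S ==> f y = g y"
 shows "f differentiable (at x) \<longleftrightarrow> g differentiable (at x)"
  and "fd f (at x) = fd g (at x)"
proof -
 have "(f has_derivative D) (at x) \<longleftrightarrow> (g has_derivative D) (at x)" for D
  using has_derivative_transform_within_open[OF _ assms(1,2), of f D UNIV g]
   has_derivative_transform_within_open[OF _ assms(1,2), of g D UNIV f] assms(3) by auto
 thus "f differentiable (at x) \<longleftrightarrow> g differentiable (at x)"
  and "fd f (at x) = fd g (at x)"
  by (simp_all add: differentiable_def frechet_derivative_def)
qed

lemma Ck_on_cong:
 assumes "open S" "!!x. x : S ==> f x = g x"
 shows "Ck_on k S f = (Ck_on k S g)"
 using assms(2)
proof (induction k arbitrary: f g)
 case 0 thus ?case by (simp cong: continuous_on_cong)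
next
 case (Suc k)
 have "Ck_on k S (%x. fd f (at x) v) \<longleftrightarrow> Ck_on k S (%x. fd g (at x) v)" for v
  by (rule Suc.IH) (use frechet_derivative_cong_open(2)[OF assms(1), of _ f g] Suc.prems in auto)
 thus ?case using frechet_derivative_cong_open(1)[OF assms(1), of _ f g] Suc.prems by simp
qed

lemma Ck_on_local:
 assumes "!!x. x : S ==> EX U. open U & x : U & Ck_on k U f"
 shows "Ck_on k S f"
 using assms
proof (induction k arbitrary: f)
 case 0
 show ?case unfolding Ck_on.simps
 proof (rule continuous_at_imp_continuous_on, rule ballI)
  fix x assume "x : S"
  with 0 obtain U where "open U" "x : U" "continuous_on U f" by auto
  thus "continuous (at x) f" by (simp add: continuous_on_eq_continuous_at)
 qed
next
 case (Suc k)
 have "f differentiable (at x)" if "x : S" for x using Suc.prems[OF that] by auto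
 moreover have "Ck_on k S (%x. fd f (at x) v)" for v
  by (rule Suc.IH) (use Suc.prems in force)
 ultimately show ?case by simp
qed

lemma Ck_on_SucD: "Ck_on (Suc k) S f ==> Ck_on k S f"
proof (induction k arbitrary: f)
 case 0
 thus ?case by (auto intro!: continuous_at_imp_continuous_on dest: differentiable_imp_continuous_within)
next
 case (Suc k) thus ?case by simp
qed

lemma Ck_on_const [simp]: "Ck_on k S (%x. c)"
 by (induction k arbitrary: c) auto

lemma frechet_derivative_eqI: "(f has_derivative D) (at x) ==> fd f (at x) = D"
 by (metis frechet_derivative_at)

lemma differentiableD: "f differentiable (at x) ==> (f has_derivative fd f (at x)) (at x)"
 by (simp add: frechet_derivative_works)

text \<open>To show that a function is \<open>C^{k+1}\<close>, it suffices to exhibit its derivative.\<close>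

lemma Ck_on_SucI:
 assumes "open S" "!!x. x : S ==> (f has_derivative D x) (at x)" "!!v. Ck_on k S (%x. D x v)"
 shows "Ck_on (Suc k) S f"
proof -
 have "Ck_on k S (%x. fd f (at x) v)" for v
  using assms(3)[of v] by (subst Ck_on_cong[OF assms(1), of _ "%x. D x v"]) (auto dest!: assms(2) frechet_derivative_eqI)
 thus ?thesis using assms(2) by (auto simp: differentiable_def)
qed

lemma Ck_on_SucE:
 assumes "Ck_on (Suc k) S f"
 shows "x : S ==> (f has_derivative fd f (at x)) (at x)"
  and "Ck_on k S (%x. fd f (at x) v)"
 using assms by (auto intro: differentiableD)

lemma Ck_on_linear:
 assumes "open S" "bounded_linear l" "Ck_on k S f"
 shows "Ck_on k S (%x. l (f x))"
 using assms(3)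
proof (induction k arbitrary: f)
 case 0 thus ?case using linear_continuous_on[OF assms(2), of UNIV] by (auto intro: continuous_on_compose2)
next
 case (Suc k)
 show ?case
  by (rule Ck_on_SucI[OF assms(1), of _ "%x v. l (fd f (at x) v)"])
   (use Ck_on_SucE[OF Suc.prems] Suc.IH in "auto intro: bounded_linear.has_derivative[OF assms(2)]")
qed

lemma Ck_on_bounded_linear:
 assumes "open S" "bounded_linear l" shows "Ck_on k S l"
proof (cases k)
 case 0 thus ?thesis by (simp add: linear_continuous_on[OF assms(2)])
next
 case (Suc k)
 show ?thesis unfolding Suc
  by (rule Ck_on_SucI[OF assms(1), of _ "%x. l"]) (auto intro: bounded_linear_imp_has_derivative assms)
qed

lemma Ck_on_add:
 assumes "open S" "Ck_on k S f" "Ck_on k S g"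
 shows "Ck_on k S (%x. f x + g x)"
 using assms(2,3)
proof (induction k arbitrary: f g)
 case 0 thus ?case by (auto intro: continuous_intros)
next
 case (Suc k)
 show ?case
  by (rule Ck_on_SucI[OF assms(1), of _ "%x v. fd f (at x) v + fd g (at x) v"])
   (use Ck_on_SucE[OF Suc.prems(1)] Ck_on_SucE[OF Suc.prems(2)] Suc.IH in "auto intro!: has_derivative_add")
qed

lemma Ck_on_sum:
 assumes "open S" "!!i. i : I ==> Ck_on k S (f i)"
 shows "Ck_on k S (%x. SUM i:I. f i x)"
proof (cases "finite I")
 case True
 thus ?thesis using assms(2) by (induction I rule: finite_induct) (auto intro!: Ck_on_add assms(1))
qed simp

lemma Ck_on_bilinear:
 assumes "open S" "bounded_bilinear pr" "Ck_on k S f" "Ck_on k S g"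
 shows "Ck_on k S (%x. pr (f x) (g x))"
 using assms(3,4)
proof (induction k arbitrary: f g)
 case 0 thus ?case by (auto intro: bounded_bilinear.continuous_on[OF assms(2)])
next
 case (Suc k)
 let ?D = "%x v. pr (f x) (fd g (at x) v) + pr (fd f (at x) v) (g x)"
 show ?case
 proof (rule Ck_on_SucI[OF assms(1), of _ ?D])
  fix x assume x: "x : S"
  show "((%x. pr (f x) (g x)) has_derivative ?D x) (at x)"
   using bounded_bilinear.FDERIV[OF assms(2) Ck_on_SucE(1)[OF Suc.prems(1) x] Ck_on_SucE(1)[OF Suc.prems(2) x]] .
 next
  fix v
  show "Ck_on k S (%x. ?D x v)"
   by (intro Ck_on_add[OF assms(1)] Suc.IH Ck_on_SucE(2)[OF Suc.prems(1)] Ck_on_SucE(2)[OF Suc.prems(2)]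
     Ck_on_SucD[OF Suc.prems(1)] Ck_on_SucD[OF Suc.prems(2)])
 qed
qed

lemma Ck_on_exp:
 fixes q :: "'e::real_normed_vector => complex"
 assumes "open S" "Ck_on k S q"
 shows "Ck_on k S (%x. exp (q x))"
 using assms(2)
proof (induction k)
 case 0 thus ?case by (auto intro: continuous_intros)
next
 case (Suc k)
 show ?case
 proof (rule Ck_on_SucI[OF assms(1), of _ "%x v. exp (q x) * fd q (at x) v"])
  fix x assume x: "x : S"
  show "((%x. exp (q x)) has_derivative (%v. exp (q x) * fd q (at x) v)) (at x)"
   using has_derivative_compose[OF Ck_on_SucE(1)[OF Suc.prems x] DERIV_exp[unfolded has_field_derivative_def]] .
 next
  fix v
  show "Ck_on k S (%x. exp (q x) * fd q (at x) v)"
   by (intro Ck_on_bilinear[OF assms(1) bounded_bilinear_mult] Ck_on_SucE(2)[OF Suc.prems] Suc.IH Ck_on_SucD[OF Suc.prems])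
 qed
qed

lemma Ck_on_scalar_compose:
 fixes q :: "'e::real_normed_vector => real" and h :: "nat => real => real"
 assumes "open S" "Ck_on k S q" "!!n x. (h n has_real_derivative h (Suc n) x) (at x)"
 shows "Ck_on k S (%x. h n (q x))"
 using assms(2)
proof (induction k arbitrary: n)
 case 0
 have "continuous_on UNIV (h n)" using assms(3) by (intro continuous_at_imp_continuous_on) (auto intro: DERIV_isCont)
 with 0 show ?case by (auto intro: continuous_on_compose2)
next
 case (Suc k)
 show ?case
 proof (rule Ck_on_SucI[OF assms(1), of _ "%x v. h (Suc n) (q x) * fd q (at x) v"])
  fix x assume x: "x : S"
  show "((%x. h n (q x)) has_derivative (%v. h (Suc n) (q x) * fd q (at x) v)) (at x)"
   using has_derivative_compose[OF Ck_on_SucE(1)[OF Suc.prems x] assms(3)[unfolded has_field_derivative_def]] .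
 next
  fix v
  show "Ck_on k S (%x. h (Suc n) (q x) * fd q (at x) v)"
   by (intro Ck_on_bilinear[OF assms(1) bounded_bilinear_mult] Ck_on_SucE(2)[OF Suc.prems] Suc.IH Ck_on_SucD[OF Suc.prems])
 qed
qed

lemma linear_euclidean_expand:
 fixes l :: "'e::euclidean_space => 'f::real_vector"
 assumes "linear l" shows "l v = (SUM b:Basis. (v \<bullet> b) *\<^sub>R l b)"
proof -
 have "l v = l (SUM b:Basis. (v \<bullet> b) *\<^sub>R b)" by (simp add: euclidean_representation)
 also have "... = (SUM b:Basis. (v \<bullet> b) *\<^sub>R l b)"
  by (simp add: linear_sum[OF assms] linear_cmul[OF assms])
 finally show ?thesis .
qed

lemma Ck_on_compose:
 fixes F :: "'e::euclidean_space => 'f::real_normed_vector" and theta :: "'d::real_normed_vector => 'e"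
 assumes "open S" "theta ` S <= U" "Ck_on k S theta" "Ck_on k U F"
 shows "Ck_on k S (%x. F (theta x))"
 using assms(3,4)
proof (induction k arbitrary: F)
 case 0 thus ?case using assms(2) by (auto intro: continuous_on_compose2)
next
 case (Suc k)
 let ?D = "%x v. fd F (at (theta x)) (fd theta (at x) v)"
 let ?D' = "%x v. SUM b:Basis. (fd theta (at x) v \<bullet> b) *\<^sub>R fd F (at (theta x)) b"
 have der: "((%x. F (theta x)) has_derivative ?D x) (at x)" if "x : S" for x
  using has_derivative_compose[OF Ck_on_SucE(1)[OF Suc.prems(1) that] Ck_on_SucE(1)[OF Suc.prems(2)]] assms(2) that by blast
 show ?case
 proof (rule Ck_on_SucI[OF assms(1) der])
  fix v
  have "?D x v = ?D' x v" if "x : S" for x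
  proof -
   have "linear (fd F (at (theta x)))"
    by (rule has_derivative_linear[OF Ck_on_SucE(1)[OF Suc.prems(2)]]) (use assms(2) that in auto)
   thus ?thesis by (rule linear_euclidean_expand)
  qed
  moreover have "Ck_on k S (%x. ?D' x v)"
   by (intro Ck_on_sum[OF assms(1)] Ck_on_bilinear[OF assms(1) bounded_bilinear_scaleR]
     Ck_on_linear[OF assms(1) bounded_linear_inner_left] Ck_on_SucE(2)[OF Suc.prems(1)]
     Suc.IH[OF Ck_on_SucD[OF Suc.prems(1)] Ck_on_SucE(2)[OF Suc.prems(2)]])
  ultimately show "Ck_on k S (%x. ?D x v)" by (subst Ck_on_cong[OF assms(1)]) auto
 qed
qed

lemma smooth_on_D: "smooth_on S f ==> Ck_on k S f" by (simp add: smooth_on_def)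

lemma smooth_on_continuous: "smooth_on S f ==> continuous_on S f"
 using smooth_on_D[of S f 0] by simp

lemma smooth_on_derivative:
 assumes "smooth_on S f"
 shows "x : S ==> (f has_derivative fd f (at x)) (at x)"
  and "smooth_on S (%x. fd f (at x) v)"
 using Ck_on_SucE[OF smooth_on_D[OF assms]] by (auto simp: smooth_on_def)

lemma smooth_on_mult:
 fixes f g :: "_ => 'b::real_normed_algebra"
 assumes "open S" "smooth_on S f" "smooth_on S g" shows "smooth_on S (%x. f x * g x)"
 using assms by (auto simp: smooth_on_def intro: Ck_on_bilinear bounded_bilinear_mult)

subsection \<open>Bump functions\<close>

text \<open>Differentiation only changes the polynomial, so all derivatives of \<open>exp (- 1 / x)\<close> are of this form.\<close>

definition flat_exp :: "real poly => real => real" where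
 "flat_exp p x = (if x > 0 then poly p (1 / x) * exp (- 1 / x) else 0)"

lemma poly_exp_decay: "((%t. poly p t * exp (- t)) ---> 0) (at_top :: real filter)"
proof (induction p rule: pCons_induct)
 case 0 show ?case by simp
next
 case (pCons a p)
 have e: "((%t. t ^ k * exp (- t)) ---> 0) (at_top :: real filter)" for k
  using tendsto_power_div_exp_0[of k] by (simp add: exp_minus divide_inverse)
 have "((%t. (\<Sum>i\<le>degree (pCons a p). coeff (pCons a p) i * (t ^ i * exp (- t)))) ---> (\<Sum>i\<le>degree (pCons a p). coeff (pCons a p) i * 0)) (at_top :: real filter)"
  by (intro tendsto_intros e)
 thus ?case by (simp add: poly_altdef sum_distrib_right mult.assoc)
qed

lemma flat_exp_deriv:
 "(flat_exp p has_real_derivative flat_exp ([:0, 0, 1:] * (p - pderiv p)) x) (at x)"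
proof -
 consider "x > 0" | "x < 0" | "x = 0" by linarith
 thus ?thesis
 proof cases
  case 1
  have "((%x. poly p (1 / x) * exp (- 1 / x)) has_real_derivative
    flat_exp ([:0, 0, 1:] * (p - pderiv p)) x) (at x)"
   using 1 by (auto intro!: derivative_eq_intros poly_DERIV[THEN DERIV_chain2] simp: flat_exp_def field_simps power2_eq_square)
  thus ?thesis
   by (rule has_field_derivative_transform_within_open[where S = "{0<..}"]) (use 1 in "auto simp: flat_exp_def")
 next
  case 2
  have "((%x. 0) has_real_derivative flat_exp ([:0, 0, 1:] * (p - pderiv p)) x) (at x)"
   using 2 by (simp add: flat_exp_def)
  thus ?thesis
   by (rule has_field_derivative_transform_within_open[where S = "{..<0}"]) (use 2 in "auto simp: flat_exp_def")
 next
  case 3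
  have "((%h. flat_exp p h / h) ---> 0) (at_right 0)"
  proof -
   have "((%t. poly ([:0, 1:] * p) t * exp (- t)) ---> 0) (at_top :: real filter)" by (rule poly_exp_decay)
   hence "((%h. poly ([:0, 1:] * p) (inverse h) * exp (- inverse h)) ---> 0) (at_right (0::real))"
    by (rule filterlim_compose) (rule filterlim_inverse_at_top_right)
   moreover have "\<forall>\<^sub>F h in at_right (0::real). poly ([:0, 1:] * p) (inverse h) * exp (- inverse h) = flat_exp p h / h"
    unfolding eventually_at_right_field by (auto simp: flat_exp_def field_simps intro!: exI[of _ 1])
   ultimately show ?thesis by (rule Lim_transform_eventually)
  qed
  moreover have "((%h. flat_exp p h / h) ---> 0) (at_left 0)"
  proof (rule Lim_transform_eventually[OF tendsto_const])
   show "\<forall>\<^sub>F h in at_left (0::real). 0 = flat_exp p h / h"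
    unfolding eventually_at_left_field by (auto simp: flat_exp_def intro!: exI[of _ "-1"])
  qed
  ultimately have "((%h. flat_exp p h / h) ---> 0) (at 0)" by (simp add: filterlim_at_split)
  thus ?thesis using 3 by (simp add: has_field_derivative_iff flat_exp_def)
 qed
qed

definition bump :: "'n::euclidean_space => real => 'n => real" where
 "bump x0 R x = flat_exp 1 (R^2 - (x - x0) \<bullet> (x - x0))"

lemma bump_pos: "x : ball x0 R ==> bump x0 R x > 0"
proof -
 assume "x : ball x0 R"
 hence "norm (x - x0) < R" by (simp add: dist_norm norm_minus_commute)
 hence "(norm (x - x0))^2 < R^2" by (intro power_strict_mono) auto
 thus ?thesis by (simp add: bump_def flat_exp_def power2_norm_eq_inner)
qed

lemma bump_zero: "x ~: ball x0 R ==> R > 0 ==> bump x0 R x = 0"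
proof -
 assume "x ~: ball x0 R" "R > 0"
 hence "R <= norm (x - x0)" by (simp add: dist_norm norm_minus_commute)
 hence "R^2 <= (norm (x - x0))^2" using `R > 0` by (intro power_mono) auto
 thus ?thesis by (simp add: bump_def flat_exp_def power2_norm_eq_inner)
qed

lemma bump_nonneg: "0 <= bump x0 R x"
 by (simp add: bump_def flat_exp_def)

lemma Ck_on_diff_const: "open S ==> Ck_on k S (%x. x - c)"
 using Ck_on_add[OF _ Ck_on_bounded_linear[OF _ bounded_linear_ident] Ck_on_const[of k S "- c"]] by simp

lemma Ck_on_bump: "Ck_on k UNIV (bump x0 R)"
proof -
 define P where "P = rec_nat (1 :: real poly) (%_ p. [:0, 0, 1:] * (p - pderiv p))"
 have q: "Ck_on k UNIV (%x::'a. R^2 + (- 1) * ((x - x0) \<bullet> (x - x0)))"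
  by (intro Ck_on_add Ck_on_const Ck_on_linear[OF open_UNIV bounded_linear_mult_right]
    Ck_on_bilinear[OF open_UNIV bounded_bilinear_inner] Ck_on_diff_const open_UNIV)
 have "Ck_on k UNIV (%x::'a. flat_exp (P 0) (R^2 + (- 1) * ((x - x0) \<bullet> (x - x0))))"
  by (rule Ck_on_scalar_compose[OF open_UNIV q, of "%n. flat_exp (P n)"]) (simp add: P_def flat_exp_deriv del: mult_pCons_left)
 thus ?thesis by (simp add: P_def bump_def[abs_def])
qed

lemma smooth_bump: "smooth_on UNIV (%x. complex_of_real (bump x0 R x))"
 by (auto simp: smooth_on_def intro: Ck_on_linear bounded_linear_of_real Ck_on_bump)

subsection \<open>Partial derivatives\<close>

lemma partial_deriv_eqI: "(f has_derivative D) (at x) ==> pd i f x = D (axis i 1)"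
 by (simp add: partial_deriv_def frechet_derivative_eqI)

lemma partial_deriv_cong_open:
 assumes "open S" "x : S" "!!y. y : S ==> f y = g y"
 shows "pd i f x = pd i g x"
 unfolding partial_deriv_def using frechet_derivative_cong_open(2)[OF assms] by simp

lemma partial_deriv2_cong_open:
 assumes "open S" "x : S" "!!y. y : S ==> f y = g y"
 shows "pd i (pd j f) x = pd i (pd j g) x"
 by (rule partial_deriv_cong_open[OF assms(1,2) partial_deriv_cong_open[OF assms(1)]]) (use assms(3) in auto)

lemma partial_deriv_const [simp]: "pd i (%x. c) = (%x. 0)"
 by (rule ext) (simp add: partial_deriv_def)

lemma partial_deriv_mult:
 assumes "f differentiable (at x)" "g differentiable (at x)"
 shows "pd i (%x. f x * g x) x = f x * pd i g x + pd i f x * g x"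
 by (subst partial_deriv_eqI[OF has_derivative_mult[OF differentiableD[OF assms(1)] differentiableD[OF assms(2)]]])
  (simp add: partial_deriv_def)

lemma partial_deriv_add:
 assumes "f differentiable (at x)" "g differentiable (at x)"
 shows "pd i (%x. f x + g x) x = pd i f x + pd i g x"
 by (subst partial_deriv_eqI[OF has_derivative_add[OF differentiableD[OF assms(1)] differentiableD[OF assms(2)]]])
  (simp add: partial_deriv_def)

lemma partial_deriv_exp:
 assumes "q differentiable (at x)"
 shows "pd i (%x. exp (q x)) x = exp (q x) * pd i q x"
 by (subst partial_deriv_eqI[OF has_derivative_compose[OF differentiableD[OF assms(1)] DERIV_exp[unfolded has_field_derivative_def]]])
  (simp add: partial_deriv_def)

lemma smooth_partial_deriv: "smooth_on S f ==> smooth_on S (pd i f)"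
 unfolding partial_deriv_def[abs_def] by (rule smooth_on_derivative)

lemma smooth_on_differentiable: "smooth_on S f ==> x : S ==> f differentiable (at x)"
 using smooth_on_derivative(1) differentiable_def by blast

lemma partial_derivs_mult_exp:
 assumes c: "smooth_on UNIV beta" and q: "smooth_on UNIV q"
 shows "pd i (%x. beta x * exp (q x)) x = (pd i beta x + beta x * pd i q x) * exp (q x)"
  and "pd i (pd j (%x. beta x * exp (q x))) x =
   (pd i (pd j beta) x + pd j beta x * pd i q x + pd i beta x * pd j q x
   + beta x * (pd i (pd j q) x + pd i q x * pd j q x)) * exp (q x)"
proof -
 have e: "smooth_on UNIV (%x. exp (q x))" using q by (auto simp: smooth_on_def intro: Ck_on_exp)
 note sd = smooth_on_differentiable[OF _ UNIV_I]
 have 1: "pd i (%x. beta x * exp (q x)) = (%x. (pd i beta x + beta x * pd i q x) * exp (q x))"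
  if c: "smooth_on UNIV beta" for beta i
  by (rule ext) (simp add: partial_deriv_mult sd[OF c] sd[OF e] partial_deriv_exp sd[OF q] algebra_simps)
 show "pd i (%x. beta x * exp (q x)) x = (pd i beta x + beta x * pd i q x) * exp (q x)"
  by (simp add: 1[OF c])
 have m: "smooth_on UNIV (%x. beta x * pd j q x)"
  by (intro smooth_on_mult c smooth_partial_deriv q) auto
 have c2: "smooth_on UNIV (%x. pd j beta x + beta x * pd j q x)"
  using smooth_partial_deriv[OF c] m by (auto simp: smooth_on_def intro: Ck_on_add)
 have "pd i (pd j (%x. beta x * exp (q x))) x =
  (pd i (%x. pd j beta x + beta x * pd j q x) x + (pd j beta x + beta x * pd j q x) * pd i q x) * exp (q x)"
  by (simp add: 1[OF c] 1[OF c2])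
 also have "pd i (%x. pd j beta x + beta x * pd j q x) x = pd i (pd j beta) x + (beta x * pd i (pd j q) x + pd i beta x * pd j q x)"
  by (simp add: partial_deriv_add partial_deriv_mult sd[OF m] sd[OF smooth_partial_deriv[OF c]] sd[OF c] sd[OF smooth_partial_deriv[OF q]])
 finally show "pd i (pd j (%x. beta x * exp (q x))) x =
   (pd i (pd j beta) x + pd j beta x * pd i q x + pd i beta x * pd j q x
   + beta x * (pd i (pd j q) x + pd i q x * pd j q x)) * exp (q x)"
  by (simp add: algebra_simps)
qed

section \<open>Charts and differential operators in coordinates\<close>

definition op_coeffs ::
 "('a, 'n::finite) chart set => (('a => complex) => ('a => complex)) => ('a, 'n) chart =>
 (real^'n => complex^'n^'n) => (real^'n => complex^'n) => (real^'n => complex) => bool" where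
 "op_coeffs A L c a b q \<longleftrightarrow>
  smooth_on (cdom c) a & smooth_on (cdom c) b & smooth_on (cdom c) q \<and>
  (ALL x:cdom c. ALL xi :: real^'n. xi ~= 0 -->
    dsum (%i j. a x $ i $ j * of_real (xi $ i * xi $ j)) ~= 0) \<and>
  (ALL f. smooth_fun A f --> (ALL x:cdom c.
    L f (chart_inv c x) =
     dsum (%i j. a x $ i $ j * pd i (pd j (f o chart_inv c)) x) +
     (SUM i:UNIV. b x $ i * pd i (f o chart_inv c) x) + q x * (f o chart_inv c) x))"

lemma second_order_elliptic_coeffs:
 assumes "second_order_elliptic A L" "c : A" obtains a b q where "op_coeffs A L c a b q"
proof -
 have "EX a b q. op_coeffs A L c a b q"
  using assms(1) unfolding second_order_elliptic_def op_coeffs_def Let_def by (rule bspec[OF _ assms(2)])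
 thus ?thesis using that by blast
qed

definition zero_ext :: "('a, 'n) chart => (real^'n => complex) => 'a => complex" where
 "zero_ext c psi y = (if y : fst c then psi (snd c y) else 0)"

locale charted_manifold =
 fixes A :: "('a::{second_countable_topology, t2_space}, 'n::finite) chart set"
 assumes atlas: "smooth_atlas A"
begin

lemma chartD:
 assumes "c : A"
 shows "open (fst c)" "open (cdom c)" "homeomorphism (fst c) (cdom c) (snd c) (chart_inv c)"
 using atlas assms unfolding smooth_atlas_def is_chart_def by blast+

lemma chart_inv_left: "c : A ==> y : fst c ==> chart_inv c (snd c y) = y"
 using chartD(3)[of c] unfolding homeomorphism_def by blast

lemma chart_inv_right: "c : A ==> x : cdom c ==> snd c (chart_inv c x) = x"
 using chartD(3)[of c] unfolding homeomorphism_def by blast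

lemma chart_inv_mem: "c : A ==> x : cdom c ==> chart_inv c x : fst c"
 using chartD(3)[of c] unfolding homeomorphism_def by blast

lemma chart_continuous: "c : A ==> continuous_on (fst c) (snd c)"
 "c : A ==> continuous_on (cdom c) (chart_inv c)"
 using chartD(3)[of c] unfolding homeomorphism_def by blast+

lemma chart_cover: "EX c:A. y : fst c"
 using atlas unfolding smooth_atlas_def by blast

lemma chart_open_image:
 assumes "c : A" "open U" shows "open (snd c ` (fst c Int U))"
proof -
 have "snd c ` (fst c Int U) = cdom c Int chart_inv c -` U"
  using chart_inv_left[OF assms(1)] by force
 thus ?thesis using continuous_open_preimage[OF chart_continuous(2)[OF assms(1)] chartD(2)[OF assms(1)] assms(2)] by simp
qed

lemma chart_compact_inv:
 assumes "c : A" "compact K" "K <= cdom c" shows "compact (chart_inv c ` K)" "closed (chart_inv c ` K)"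
proof -
 show "compact (chart_inv c ` K)"
  using compact_continuous_image[OF continuous_on_subset[OF chart_continuous(2)[OF assms(1)] assms(3)] assms(2)] .
 thus "closed (chart_inv c ` K)" by (rule compact_imp_closed)
qed

lemma zero_ext_chart_inv: "c : A ==> x : cdom c ==> zero_ext c psi (chart_inv c x) = psi x"
 by (simp add: zero_ext_def chart_inv_right chart_inv_mem)

lemma smooth_fun_zero_ext:
 assumes c: "c : A" and psi: "smooth_on UNIV psi" and K: "compact K" "K <= cdom c"
  and supp: "!!x. x ~: K ==> psi x = 0"
 shows "smooth_fun A (zero_ext c psi)"
 unfolding smooth_fun_def
proof
 fix d assume d: "d : A"
 let ?K = "chart_inv c ` K"
 show "smooth_on (cdom d) (zero_ext c psi o chart_inv d)"
  unfolding smooth_on_def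
 proof (rule allI, rule Ck_on_local)
  fix k x assume x: "x : cdom d"
  define y where "y = chart_inv d x"
  have y: "y : fst d" "x = snd d y" using x chart_inv_mem[OF d] chart_inv_right[OF d] by (auto simp: y_def)
  show "EX U. open U & x : U & Ck_on k U (zero_ext c psi o chart_inv d)"
  proof (cases "y : fst c")
   case True
   let ?U = "snd d ` (fst d Int fst c)"
   have o: "open ?U" by (rule chart_open_image[OF d chartD(1)[OF c]])
   have "smooth_on ?U (transition d c)" using atlas c d unfolding smooth_atlas_def by blast
   hence "Ck_on k ?U (%x. psi (transition d c x))"
    using Ck_on_compose[OF o subset_UNIV smooth_on_D smooth_on_D[OF psi]] by blast
   moreover have "Ck_on k ?U (zero_ext c psi o chart_inv d) \<longleftrightarrow> Ck_on k ?U (%x. psi (transition d c x))"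
   proof (rule Ck_on_cong[OF o])
    fix z assume "z : ?U"
    then obtain w where "z = snd d w" "w : fst d" "w : fst c" by blast
    thus "(zero_ext c psi o chart_inv d) z = psi (transition d c z)"
     using chart_inv_left[OF d, of w] by (simp add: zero_ext_def transition_def)
   qed
   ultimately have "Ck_on k ?U (zero_ext c psi o chart_inv d)" by simp
   moreover have "x : ?U" using y True by blast
   ultimately show ?thesis using o by blast
  next
   case False
   let ?U = "snd d ` (fst d Int (- ?K))"
   have o: "open ?U" using chart_compact_inv(2)[OF c K] by (intro chart_open_image[OF d]) auto
   have "y ~: ?K" using False K(2) chart_inv_mem[OF c] by auto
   hence xU: "x : ?U" using y by auto
   have "(zero_ext c psi o chart_inv d) z = 0" if zU: "z : ?U" for z
   proof -
    obtain w where w: "z = snd d w" "w : fst d" "w ~: ?K" using zU by blast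
    hence "w : fst c ==> snd c w ~: K" using chart_inv_left[OF c, of w] by (metis imageI)
    thus ?thesis using w chart_inv_left[OF d, of w] supp[of "snd c w"] by (simp add: zero_ext_def)
   qed
   hence "Ck_on k ?U (zero_ext c psi o chart_inv d) \<longleftrightarrow> Ck_on k ?U (%x. 0 :: complex)"
    by (rule Ck_on_cong[OF o])
   hence "Ck_on k ?U (zero_ext c psi o chart_inv d)" by simp
   thus ?thesis using o xU by blast
  qed
 qed
qed

lemma smooth_fun_continuous:
 assumes "smooth_fun A f" shows "continuous_on UNIV f"
proof (rule continuous_at_imp_continuous_on, rule ballI)
 fix y
 obtain c where c: "c : A" "y : fst c" using chart_cover by blast
 have "continuous_on (cdom c) (f o chart_inv c)"
  using assms c(1) smooth_on_continuous unfolding smooth_fun_def by blast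
 hence "continuous_on (fst c) ((f o chart_inv c) o snd c)"
  unfolding o_def by (rule continuous_on_compose2[OF _ chart_continuous(1)[OF c(1)]]) auto
 hence "continuous_on (fst c) f"
  by (rule continuous_on_cong[THEN iffD1, rotated -1]) (auto simp: chart_inv_left[OF c(1)])
 thus "continuous (at y) f" using c(2) chartD(1)[OF c(1)] by (simp add: continuous_on_eq_continuous_at)
qed

lemma measurable_zero_ext:
 assumes "c : A" "continuous_on (cdom c) psi" shows "zero_ext c psi : meas borel"
proof -
 have "(%y. indicator (fst c) y *\<^sub>R psi (snd c y)) : meas borel"
  using chartD(1)[OF assms(1)] continuous_on_compose2[OF assms(2) chart_continuous(1)[OF assms(1)]]
  by (intro borel_measurable_continuous_on_indicator) auto
 also have "(%y. indicator (fst c) y *\<^sub>R psi (snd c y)) = zero_ext c psi"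
  by (auto simp: zero_ext_def indicator_def)
 finally show ?thesis .
qed

end

definition chart_op :: "(real^'n => complex^'n^'n) => (real^'n => complex^'n) => (real^'n => complex) =>
  (real^'n => complex) => real^'n::finite => complex" where
 "chart_op a b q F x = dsum (%i j. a x $ i $ j * pd i (pd j F) x) +
     (SUM i:UNIV. b x $ i * pd i F x) + q x * F x"

lemma chart_op_cong_open:
 assumes "open S" "x : S" "!!y. y : S ==> F y = G y"
 shows "chart_op a b q F x = chart_op a b q G x"
 unfolding chart_op_def using assms partial_deriv_cong_open[OF assms] partial_deriv2_cong_open[OF assms] by simp

lemma chart_op_zero: "chart_op a b q (%x. 0) x = 0"
 by (simp add: chart_op_def)

context charted_manifold
begin

lemma op_zero_ext:
 assumes c: "c : A" and psi: "smooth_on UNIV psi" and K: "compact K" "K <= cdom c"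
  and supp: "!!x. x ~: K ==> psi x = 0" and L: "second_order_elliptic A L" and co: "op_coeffs A L c a b q"
 shows "L (zero_ext c psi) = zero_ext c (chart_op a b q psi)"
proof
 fix y
 have sm: "smooth_fun A (zero_ext c psi)" by (rule smooth_fun_zero_ext[OF assms(1-5)])
 show "L (zero_ext c psi) y = zero_ext c (chart_op a b q psi) y"
 proof (cases "y : fst c")
  case True
  have x: "snd c y : cdom c" using True by simp
  have "L (zero_ext c psi) (chart_inv c (snd c y)) = chart_op a b q (zero_ext c psi o chart_inv c) (snd c y)"
   using co sm x unfolding op_coeffs_def chart_op_def by blast
  also have "... = chart_op a b q psi (snd c y)"
   by (rule chart_op_cong_open[OF chartD(2)[OF c] x]) (simp add: zero_ext_chart_inv[OF c])
  finally show ?thesis using True chart_inv_left[OF c True] by (simp add: zero_ext_def)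
 next
  case False
  obtain d where d: "d : A" "y : fst d" using chart_cover by blast
  obtain a' b' q' where co': "op_coeffs A L d a' b' q'" by (rule second_order_elliptic_coeffs[OF L d(1)])
  let ?U = "snd d ` (fst d Int (- chart_inv c ` K))"
  have o: "open ?U" using chart_compact_inv(2)[OF c K] by (intro chart_open_image[OF d(1)]) auto
  have "y ~: chart_inv c ` K" using False K(2) chart_inv_mem[OF c] by auto
  hence xU: "snd d y : ?U" using d by auto
  have z: "(zero_ext c psi o chart_inv d) z = 0" if zU: "z : ?U" for z
  proof -
   obtain w where w: "z = snd d w" "w : fst d" "w ~: chart_inv c ` K" using zU by blast
   hence "w : fst c ==> snd c w ~: K" using chart_inv_left[OF c, of w] by (metis imageI)
   thus ?thesis using w chart_inv_left[OF d(1), of w] supp[of "snd c w"] by (simp add: zero_ext_def)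
  qed
  have "L (zero_ext c psi) (chart_inv d (snd d y)) = chart_op a' b' q' (zero_ext c psi o chart_inv d) (snd d y)"
   using co' sm d unfolding op_coeffs_def chart_op_def by blast
  also have "... = chart_op a' b' q' (%x. 0) (snd d y)"
   by (rule chart_op_cong_open[OF o xU z])
  finally show ?thesis using False chart_inv_left[OF d] by (simp add: chart_op_zero zero_ext_def)
 qed
qed

end

section \<open>Change of variables over an arbitrary finite index type\<close>

text \<open>A copy of the index type with the order of the natural numbers. Volumes and determinants do not change under
 renumbering of the coordinates.\<close>

typedef (overloaded) ('n::finite) index = "{i::nat. i < CARD('n)}"
 morphisms index_nat Index by (rule exI[of _ 0]) simp

instantiation index :: (finite) "{finite, wellorder}"
begin
definition "i <= j \<longleftrightarrow> index_nat i <= index_nat j" for i j :: "'a index"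
definition "i < j \<longleftrightarrow> index_nat i < index_nat j" for i j :: "'a index"
instance
proof
 interpret type_definition "index_nat :: 'a index => nat" Index "{i. i < CARD('a)}"
  by (rule type_definition_index)
 show "finite (UNIV :: 'a index set)" unfolding univ by (intro finite_imageI) simp
 fix x y z :: "'a index"
 show "x < y \<longleftrightarrow> x <= y & ~ y <= x" unfolding less_eq_index_def less_index_def by linarith
 show "x <= x" unfolding less_eq_index_def by simp
 show "x <= y ==> y <= z ==> x <= z" unfolding less_eq_index_def by simp
 show "x <= y ==> y <= x ==> x = y" unfolding less_eq_index_def by (rule iffD1[OF index_nat_inject]) simp
 show "x <= y | y <= x" unfolding less_eq_index_def by linarith
next
 fix P :: "'a index => bool" and a
 assume P: "!!x. (!!y. y < x ==> P y) ==> P x"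
 have "ALL a. index_nat a = k --> P a" for k
 proof (induction k rule: less_induct)
  case (less k)
  show ?case
  proof (intro allI impI)
   fix a :: "'a index" assume a: "index_nat a = k"
   show "P a" by (rule P) (use less a in "simp add: less_index_def")
  qed
 qed
 thus "P a" by blast
qed
end

lemma ex_bij_index: "\<exists>pm :: 'n::finite index => 'n. bij pm"
proof -
 interpret type_definition "index_nat :: 'n index => nat" Index "{i. i < CARD('n)}"
  by (rule type_definition_index)
 have "card (UNIV :: 'n index set) = card {i::nat. i < CARD('n)}" by (rule card)
 hence "card (UNIV :: 'n index set) = card (UNIV :: 'n set)" by simp
 thus ?thesis using finite_same_card_bij[of "UNIV :: 'n index set" "UNIV :: 'n set"] by simp
qed

lemma det_reindex:
 fixes A :: "real^'n^'n" and pm :: "'m::finite => 'n::finite"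
 assumes "bij pm"
 shows "det (\<chi> i j. A $ pm i $ pm j) = det A"
proof -
 have inv: "pm (inv pm x) = x" "inv pm (pm y) = y" for x y
  using assms by (simp_all add: bij_is_surj surj_f_inv_f bij_is_inj)
 have bi: "bij (inv pm)" using assms by (rule bij_imp_bij_inv)
 have p: "(pm o q o inv pm) permutes UNIV" if "q permutes UNIV" for q :: "'m => 'm"
  using that assms bi by (auto simp: permutes_bij intro!: bij_imp_permutes bij_comp)
 have q: "(inv pm o p o pm) permutes UNIV" if "p permutes UNIV" for p :: "'n => 'n"
  using that assms bi by (auto simp: permutes_bij intro!: bij_imp_permutes bij_comp)
 have sign: "sign (pm o q o inv pm) = sign q" if "q permutes UNIV" for q :: "'m => 'm"
 proof -
  interpret permutes_bij_finite q UNIV UNIV pm "inv pm" "pm o q o inv pm"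
   by unfold_locales (use that assms inv in "auto simp: bij_is_inj bij_is_surj o_def intro!: eq_reflection")
  show ?thesis by (rule sign_p')
 qed
 show ?thesis unfolding det_def
 proof (rule sum.reindex_bij_witness[where i = "%p. inv pm o p o pm" and j = "%q. pm o q o inv pm"])
  fix q :: "'m => 'm" assume "q : {p. p permutes UNIV}"
  hence qp: "q permutes UNIV" by simp
  have "(\<Prod>i\<in>UNIV. A $ i $ (pm o q o inv pm) i) = (\<Prod>i\<in>UNIV. A $ pm i $ pm (q i))"
   by (rule prod.reindex_bij_witness[where i = pm and j = "inv pm"]) (auto simp: inv)
  thus "of_int (sign (pm o q o inv pm)) * (\<Prod>i\<in>UNIV. A $ i $ (pm o q o inv pm) i) =
    of_int (sign q) * (\<Prod>i\<in>UNIV. (\<chi> i j. A $ pm i $ pm j) $ i $ q i)" using sign[OF qp] by simp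
 next
  fix q :: "'m => 'm" assume q: "q : {p. p permutes UNIV}"
  show "inv pm o (pm o q o inv pm) o pm = q" by (simp add: fun_eq_iff inv)
  show "pm o q o inv pm : {p. p permutes UNIV}" using p[of q] q by simp
 next
  fix p :: "'n => 'n" assume p: "p : {p. p permutes UNIV}"
  show "pm o (inv pm o p o pm) o inv pm = p" by (simp add: fun_eq_iff inv)
  show "inv pm o p o pm : {p. p permutes UNIV}" using q[of p] p by simp
 qed
qed

lemma lborel_reindex:
 fixes pm :: "'m::finite => 'n::finite"
 assumes "bij pm"
 shows "(lborel :: (real^'n) measure) = distr lborel borel (%x. \<chi> i. x $ inv pm i)"
proof (rule lborel_eqI)
 let ?Q = "%x :: real^'m. \<chi> i. x $ inv pm i"
 have inv: "pm (inv pm x) = x" "inv pm (pm y) = y" for x y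
  using assms by (simp_all add: bij_is_surj surj_f_inv_f bij_is_inj)
 have Q: "?Q : meas borel"
  by (intro borel_measurable_continuous_onI continuous_intros)
 show "sets (distr lborel borel ?Q) = sets borel" by simp
 fix l u :: "real^'n" assume lu: "!!b. b : Basis ==> l \<bullet> b <= u \<bullet> b"
 have "?Q -` box l u = box (\<chi> i. l $ pm i) (\<chi> i. u $ pm i)"
 proof -
  have "(ALL i. F i (inv pm i)) \<longleftrightarrow> (ALL j. F (pm j) j)" for F by (metis inv)
  note this[of "%i j. l $ i < x $ j & x $ j < u $ i" for x :: "real^'m"]
  thus ?thesis by (simp add: set_eq_iff mem_box_cart)
 qed
 hence "emeasure (distr lborel borel ?Q) (box l u) = emeasure lborel (box (\<chi> i. l $ pm i) (\<chi> i. u $ pm i))"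
  using Q by (simp add: emeasure_distr)
 also have "... = (\<Prod>b\<in>Basis. ((\<chi> i. u $ pm i) - (\<chi> i. l $ pm i) :: real^'m) \<bullet> b)"
 proof (rule emeasure_lborel_box)
  fix b :: "real^'m" assume "b : Basis"
  then obtain i where "b = axis i 1" by (auto simp: Basis_vec_def)
  thus "(\<chi> i. l $ pm i) \<bullet> b <= (\<chi> i. u $ pm i) \<bullet> b"
   using lu[of "axis (pm i) 1"] by (simp add: inner_axis axis_in_Basis_iff)
 qed
 also have "(\<Prod>b\<in>Basis. ((\<chi> i. u $ pm i) - (\<chi> i. l $ pm i) :: real^'m) \<bullet> b) = (\<Prod>i\<in>UNIV. u $ pm i - l $ pm i)"
  by (rule prod.reindex_bij_witness[where i = "%i. axis i 1" and j = "%b. SOME i. b = axis i 1"])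
   (auto simp: Basis_vec_def axis_eq_axis inner_axis)
 also have "... = (\<Prod>i\<in>UNIV. u $ i - l $ i)"
  by (rule prod.reindex_bij_witness[where i = "inv pm" and j = pm]) (auto simp: inv)
 also have "... = (\<Prod>b\<in>Basis. (u - l) \<bullet> b)"
  by (rule prod.reindex_bij_witness[where j = "%i. axis i 1" and i = "%b. SOME i. b = axis i 1"])
   (auto simp: Basis_vec_def axis_eq_axis inner_axis)
 finally show "emeasure (distr lborel borel ?Q) (box l u) = ennreal (\<Prod>b\<in>Basis. (u - l) \<bullet> b)" .
qed

lemma nn_integral_eq_has_integral:
 fixes F :: "'a::euclidean_space => real" and G :: "'b::euclidean_space => real"
 assumes nn: "!!x. 0 <= F x" "!!x. 0 <= G x" and m: "F : meas borel" "G : meas borel"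
  and eq: "!!b. (F has_integral b) UNIV = (G has_integral b) UNIV"
 shows "nint lborel (%x. ennreal (F x)) = nint lborel (%x. ennreal (G x))" (is "?I = ?J")
proof -
 have "?J = ennreal b" if "?I = ennreal b" "0 <= b" for b
  using nn_integral_has_integral[OF m(1) nn(1) that] nn_integral_has_integral_lborel[OF m(2) nn(2)] eq by blast
 moreover have "?I = ennreal b" if "?J = ennreal b" "0 <= b" for b
  using nn_integral_has_integral[OF m(2) nn(2) that] nn_integral_has_integral_lborel[OF m(1) nn(1)] eq by blast
 ultimately show ?thesis by (cases ?I; cases ?J) auto
qed

lemma nn_change_of_variables:
 fixes f :: "real^'n::finite => real" and g :: "real^'n => real^'n"
 assumes g': "!!x. x : S ==> (g has_derivative g' x) (at x within S)"
   and h': "!!y. y : T ==> (h has_derivative h' y) (at y within T)"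
   and f0: "!!y. y : T ==> 0 <= f y"
   and gh: "!!x. x : S ==> g x : T & h(g x) = x"
   and hg: "!!y. y : T ==> h y : S & g(h y) = y"
   and id: "!!y. y : T ==> h' y o g'(h y) = id"
   and mf: "(%y. indicator T y * f y) : meas borel"
   and mg: "(%x. indicator S x * (abs (det (matrix (g' x))) * f (g x))) : meas borel"
  shows "nint lborel (%y. ennreal (indicator T y * f y)) =
     (nint lborel (%x. ennreal (indicator S x * (abs (det (matrix (g' x))) * f (g x)))))"
proof -
 obtain pm :: "'n index => 'n" where pm: "bij pm" using ex_bij_index by blast
 have inv: "pm (inv pm x) = x" "inv pm (pm y) = y" for x y
  using pm by (simp_all add: bij_is_surj surj_f_inv_f bij_is_inj)
 define P :: "real^'n => real^('n index)" where "P x = (\<chi> i. x $ pm i)" for x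
 define Q :: "real^('n index) => real^'n" where "Q x = (\<chi> i. x $ inv pm i)" for x
 have PQ: "P (Q x) = x" and QP: "Q (P y) = y" for x y by (simp_all add: P_def Q_def inv vec_eq_iff)
 have lP: "bounded_linear P" unfolding linear_conv_bounded_linear[symmetric]
  by (rule linearI) (auto simp: P_def vec_eq_iff)
 have lQ: "bounded_linear Q" unfolding linear_conv_bounded_linear[symmetric]
  by (rule linearI) (auto simp: Q_def vec_eq_iff)
 have mQ: "Q : meas borel" using lQ by (intro borel_measurable_continuous_onI linear_continuous_on)
 have leb: "(lborel :: (real^'n) measure) = distr lborel borel Q"
  using lborel_reindex[OF pm] by (simp add: Q_def[abs_def])
 have tr: "nint lborel (%y. ennreal (F y)) = nint lborel (%x. ennreal (F (Q x)))" if "F : meas borel" for F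
  using that mQ by (subst leb) (simp add: nn_integral_distr)
 have dPQ: "det (matrix (P o l o Q)) = det (matrix l)" if "linear l" for l
 proof -
  have "matrix (P o l o Q) = (\<chi> i j. matrix l $ pm i $ pm j)"
  proof -
   have "Q (axis j 1) = axis (pm j) 1" for j by (auto simp: Q_def axis_def vec_eq_iff inv)
   hence "(P o l o Q) (axis j 1) $ i = l (axis (pm j) 1) $ pm i" for i j by (simp add: P_def)
   thus ?thesis by (simp add: matrix_def vec_eq_iff)
  qed
  thus ?thesis using det_reindex[OF pm] by simp
 qed
 define S' T' where "S' = Q -` S" and "T' = Q -` T"
 have comp: "((%x. P (k (Q x))) has_derivative (P o k' (Q x) o Q)) (at x within Q -` U)"
  if "(k has_derivative k' (Q x)) (at (Q x) within U)" for k k' x U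
 proof -
  have 1: "(Q has_derivative Q) (at x within Q -` U)" by (rule bounded_linear_imp_has_derivative[OF lQ])
  have 2: "(k has_derivative k' (Q x)) (at (Q x) within Q ` (Q -` U))"
   by (rule has_derivative_subset[OF that]) auto
  have "((%x. k (Q x)) has_derivative (%v. k' (Q x) (Q v))) (at x within Q -` U)"
   by (rule has_derivative_in_compose[OF 1 2])
  from bounded_linear.has_derivative[OF lP this] show ?thesis by (simp add: o_def)
 qed
 have ind: "indicator (Q -` U) x = (indicator U (Q x) :: real)" for U x by (simp add: indicator_def)
 have d: "abs (det (matrix (P o g' (Q x) o Q))) = abs (det (matrix (g' (Q x))))" if "x : S'" for x
  using that g'[of "Q x"] by (subst dPQ) (auto simp: S'_def intro: has_derivative_linear)
 have eqG: "indicator S' x * (abs (det (matrix (P o g' (Q x) o Q))) * f (Q (P (g (Q x))))) =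
  indicator S (Q x) * (abs (det (matrix (g' (Q x)))) * f (g (Q x)))" for x
 proof (cases "x : S'")
  case True thus ?thesis using d[OF True] by (simp add: QP S'_def ind)
 qed (simp add: S'_def ind indicator_def)
 have "nint lborel (%y. ennreal (indicator T' y * f (Q y))) =
   (nint lborel (%x. ennreal (indicator S' x * (abs (det (matrix (P o g' (Q x) o Q))) * f (Q (P (g (Q x))))))))"
 proof (rule nn_integral_eq_has_integral)
  have "((%x. abs (det (matrix (P o g' (Q x) o Q))) * f (Q (P (g (Q x))))) has_integral b) S' = ((%y. f (Q y)) has_integral b) T'" for b
  proof (rule cov_invertible_nonneg_eq[where h = "%y. P (h (Q y))" and h' = "%y. P o h' (Q y) o Q"])
   show "((%x. P (g (Q x))) has_derivative P o g' (Q x) o Q) (at x within S')" if "x : S'" for x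
    using that unfolding S'_def by (intro comp g') auto
   show "((%x. P (h (Q x))) has_derivative P o h' (Q x) o Q) (at x within T')" if "x : T'" for x
    using that unfolding T'_def by (intro comp h') auto
   show "0 <= f (Q y)" if "y : T'" for y using that f0 by (simp add: T'_def)
   show "P (g (Q x)) : T' & P (h (Q (P (g (Q x))))) = x" if "x : S'" for x
    using that gh by (simp add: S'_def T'_def QP PQ)
   show "P (h (Q y)) : S' & P (g (Q (P (h (Q y))))) = y" if "y : T'" for y
    using that hg by (simp add: S'_def T'_def QP PQ)
   show "(P o h' (Q y) o Q) o (P o g' (Q (P (h (Q y)))) o Q) = id" if "y : T'" for y
    using that id[of "Q y"] by (simp add: T'_def QP PQ fun_eq_iff)
  qed
  moreover have "((%x. indicator U x * F x) has_integral b) UNIV = (F has_integral b) U" for U and F :: "real^('n index) => real" and b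
   unfolding has_integral_restrict_UNIV[of U F b, symmetric] by (rule arg_cong[where f = "%F. (F has_integral b) UNIV"]) (auto simp: indicator_def)
  ultimately show "((%y. indicator T' y * f (Q y)) has_integral b) UNIV = ((%x. indicator S' x * (abs (det (matrix (P o g' (Q x) o Q))) * f (Q (P (g (Q x)))))) has_integral b) UNIV" for b
   by (simp only:)
  show "0 <= indicator T' y * f (Q y)" "0 <= indicator S' y * (abs (det (matrix (P o g' (Q y) o Q))) * f (Q (P (g (Q y)))))" for y
   using f0[of "Q y"] f0[of "g (Q y)"] gh[of "Q y"] by (auto simp: indicator_def S'_def T'_def QP)
  show "(%y. indicator T' y * f (Q y)) : meas borel"
   using measurable_compose[OF mQ mf] by (simp add: T'_def ind)
  show "(%x. indicator S' x * (abs (det (matrix (P o g' (Q x) o Q))) * f (Q (P (g (Q x)))))) : meas borel"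
   unfolding eqG using measurable_compose[OF mQ mg] by simp
 qed
 thus ?thesis unfolding eqG T'_def ind tr[OF mf] tr[OF mg] .
qed

text \<open>The determinant does not vanish on the segment to the identity matrix.\<close>

lemma det_pos_of_positive_definite:
 fixes G :: "real^'n::finite^'n"
 assumes "!!v. v ~= 0 ==> v \<bullet> (G *v v) > 0"
 shows "det G > 0"
proof (rule ccontr)
 assume neg: "\<not> det G > 0"
 define H where "H t = t *\<^sub>R mat 1 + (1 - t) *\<^sub>R G" for t :: real
 have cont: "continuous_on {0..1} (%t. det (H t))"
  unfolding det_def H_def by (intro continuous_intros)
 have "EX t. 0 <= t & t <= 1 & det (H t) = 0"
 proof (rule IVT'[OF _ _ _ cont])
  show "det (H 0) <= 0" using neg by (simp add: H_def)
  show "0 <= det (H 1)" by (simp add: H_def)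
 qed simp
 then obtain t where t: "0 <= t" "t <= 1" "det (H t) = 0" by blast
 hence "\<not> invertible (H t)" by (simp add: invertible_det_nz)
 then obtain v where v: "v ~= 0" "H t *v v = 0"
  using invertible_left_inverse[of "H t"] matrix_left_invertible_ker[of "H t"] by blast
 have "v \<bullet> (H t *v v) = t * (v \<bullet> v) + (1 - t) * (v \<bullet> (G *v v))"
  by (simp add: H_def matrix_vector_mult_add_rdistrib scaleR_matrix_vector_assoc[symmetric] inner_add_right)
 also have "... > 0"
 proof (cases "t = 1")
  case True thus ?thesis using v(1) by simp
 next
  case False
  hence "(1 - t) * (v \<bullet> (G *v v)) > 0" using t assms[OF v(1)] by simp
  moreover have "t * (v \<bullet> v) >= 0" using t by simp
  ultimately show ?thesis by linarith
 qed
 finally show False using v(2) by simp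
qed

lemma compact_norm_bound:
 fixes f :: "'b::topological_space => 'c::real_normed_vector"
 assumes "compact K" "continuous_on K f" shows "EX B>=0. ALL x:K. norm (f x) <= B"
proof -
 have "bounded (f ` K)" using assms by (intro compact_imp_bounded compact_continuous_image)
 then obtain B where "ALL y:f ` K. norm y <= B" unfolding bounded_iff by blast
 thus ?thesis by (intro exI[of _ "max B 0"]) (auto simp: le_max_iff_disj)
qed

section \<open>The Riemannian volume\<close>

locale riemannian_manifold = charted_manifold A for A :: "('a::{second_countable_topology, t2_space}, 'n::finite) chart set" +
 fixes g :: "('a, 'n) chart => real^'n => real^'n^'n"
 assumes compact_space: "compact (UNIV :: 'a set)"
  and metric: "riemannian_metric A g"
begin


definition dens :: "('a, 'n) chart => real^'n => real" where
 "dens c x = sqrt (det (g c x))"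

lemma dens_pos: "c : A ==> x : cdom c ==> dens c x > 0"
 using metric unfolding riemannian_metric_def dens_def
 by (intro real_sqrt_gt_zero det_pos_of_positive_definite) blast

lemma dens_continuous: assumes "c : A" shows "continuous_on (cdom c) (dens c)"
proof -
 have "smooth_on (cdom c) (g c)" using metric assms unfolding riemannian_metric_def by blast
 hence "continuous_on (cdom c) (g c)" by (rule smooth_on_continuous)
 thus ?thesis unfolding dens_def[abs_def] det_def by (intro continuous_intros)
qed

lemma borel_chart_image:
 assumes c: "c : A" and B: "B : sets borel"
 shows "snd c ` (B Int fst c) : sets borel"
proof -
 have "chart_inv c -` B Int space (restrict_space borel (cdom c)) : sets (restrict_space borel (cdom c))"
  by (rule measurable_sets[OF borel_measurable_continuous_on_restrict[OF chart_continuous(2)[OF c]] B])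
 moreover have "chart_inv c -` B Int space (restrict_space borel (cdom c)) = snd c ` (B Int fst c)"
  using chart_inv_left[OF c] by (auto simp: space_restrict_space)
 ultimately show ?thesis using chartD(2)[OF c] by (simp add: sets_restrict_space_iff)
qed

lemma borel_dens:
 assumes c: "c : A" and S: "S : sets borel" "S <= cdom c"
 shows "(%x. indicator S x * dens c x) : meas borel"
proof -
 have "(%x. indicator S x *\<^sub>R dens c x) : meas borel"
  by (rule borel_measurable_continuous_on_indicator[OF S(1) continuous_on_subset[OF dens_continuous[OF c] S(2)]])
 thus ?thesis by simp
qed

lemma transition_has_derivative:
 assumes "c : A" "d : A" "x : snd c ` (fst c Int fst d)"
 shows "(transition c d has_derivative fd (transition c d) (at x)) (at x)"
proof -
 have "smooth_on (snd c ` (fst c Int fst d)) (transition c d)"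
  using atlas assms(1,2) unfolding smooth_atlas_def by blast
 thus ?thesis by (rule smooth_on_derivative(1)[OF _ assms(3)])
qed

lemma transition_apply: "c : A ==> y : fst c ==> transition c d (snd c y) = snd d y"
 by (simp add: transition_def chart_inv_left)

lemma dens_transition:
 assumes c: "c : A" and d: "d : A" and x: "x : snd c ` (fst c Int fst d)"
 shows "dens c x = abs (det (matrix (fd (transition c d) (at x)))) * dens d (transition c d x)"
proof -
 define J where "J = matrix (fd (transition c d) (at x))"
 have "g c x = transpose J ** g d (transition c d x) ** J"
  using metric c d x unfolding riemannian_metric_def Let_def J_def by blast
 hence "det (g c x) = (det J)^2 * det (g d (transition c d x))" by (simp add: det_mul det_transpose power2_eq_square)
 thus ?thesis by (simp add: dens_def real_sqrt_mult J_def)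
qed

lemma transition_inverse_derivative:
 assumes c: "c : A" and d: "d : A" and y: "y : fst c Int fst d"
 shows "fd (transition d c) (at (snd d y)) o fd (transition c d) (at (snd c y)) = id"
proof -
 let ?U = "snd c ` (fst c Int fst d)"
 have o: "open ?U" by (rule chart_open_image[OF c chartD(1)[OF d]])
 have x: "snd c y : ?U" "snd d y : snd d ` (fst d Int fst c)" using y by auto
 have "((%x. transition d c (transition c d x)) has_derivative
  (%v. fd (transition d c) (at (snd d y)) (fd (transition c d) (at (snd c y)) v))) (at (snd c y))"
  using has_derivative_compose[OF transition_has_derivative[OF c d x(1)], of "transition d c"]
   transition_has_derivative[OF d c x(2)] transition_apply[OF c] y by auto
 moreover have "((%x. transition d c (transition c d x)) has_derivative (%v. v)) (at (snd c y))"
 proof (rule has_derivative_transform_within_open[OF has_derivative_ident o x(1)])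
  fix z assume "z : ?U"
  then obtain w where "w : fst c" "w : fst d" "z = snd c w" by blast
  thus "z = transition d c (transition c d z)"
   using transition_apply[OF c, of w d] transition_apply[OF d, of w c] by simp
 qed
 ultimately have "(%v. fd (transition d c) (at (snd d y)) (fd (transition c d) (at (snd c y)) v)) = (%v. v)"
  by (rule has_derivative_unique)
 thus ?thesis by (simp add: o_def id_def)
qed

lemma volume_consistent:
 assumes c: "c : A" and d: "d : A" and B: "B : sets borel" "B <= fst c Int fst d"
 shows "nint lborel (%x. ennreal (indicator (snd d ` B) x * dens d x)) = nint lborel (%x. ennreal (indicator (snd c ` B) x * dens c x))"
proof -
 have Bc: "snd c ` B : sets borel" "snd c ` B <= cdom c"
  and Bd: "snd d ` B : sets borel" "snd d ` B <= cdom d"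
  using borel_chart_image[OF c B(1)] borel_chart_image[OF d B(1)] B(2) by (auto simp: Int_absorb2)
 let ?D = "%x. fd (transition c d) (at x)"
 have eq: "indicator (snd c ` B) x * (abs (det (matrix (?D x))) * dens d (transition c d x)) = indicator (snd c ` B) x * dens c x" for x
 proof (cases "x : snd c ` B")
  case True
  hence "x : snd c ` (fst c Int fst d)" using B(2) by blast
  thus ?thesis using dens_transition[OF c d] by simp
 qed simp
 have "nint lborel (%x. ennreal (indicator (snd d ` B) x * dens d x)) =
  (nint lborel (%x. ennreal (indicator (snd c ` B) x * (abs (det (matrix (?D x))) * dens d (transition c d x)))))"
 proof (rule nn_change_of_variables[where h = "transition d c" and h' = "%y. fd (transition d c) (at y)"])
  show "(transition c d has_derivative ?D x) (at x within snd c ` B)" if "x : snd c ` B" for x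
   by (rule has_derivative_at_withinI[OF transition_has_derivative[OF c d]]) (use that B(2) in blast)
  show "(transition d c has_derivative fd (transition d c) (at x)) (at x within snd d ` B)" if "x : snd d ` B" for x
   by (rule has_derivative_at_withinI[OF transition_has_derivative[OF d c]]) (use that B(2) in blast)
  show "0 <= dens d y" if "y : snd d ` B" for y
   using dens_pos[OF d, of y] that Bd(2) by (meson less_imp_le subsetD)
  show "transition c d x : snd d ` B & transition d c (transition c d x) = x" if xB: "x : snd c ` B" for x
  proof -
   obtain y where y: "y : B" "x = snd c y" using xB by blast
   hence "y : fst c" "y : fst d" using B(2) by auto
   thus ?thesis using y transition_apply[OF c, of y d] transition_apply[OF d, of y c] by simp
  qed
  show "transition d c x : snd c ` B & transition c d (transition d c x) = x" if xB: "x : snd d ` B" for x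
  proof -
   obtain y where y: "y : B" "x = snd d y" using xB by blast
   hence "y : fst c" "y : fst d" using B(2) by auto
   thus ?thesis using y transition_apply[OF c, of y d] transition_apply[OF d, of y c] by simp
  qed
  show "fd (transition d c) (at x) o ?D (transition d c x) = id" if xB: "x : snd d ` B" for x
  proof -
   obtain y where y: "y : B" "x = snd d y" using xB by blast
   hence yy: "y : fst c Int fst d" using B(2) by auto
   thus ?thesis using transition_inverse_derivative[OF c d yy] transition_apply[OF d, of y c] y by simp
  qed
  show "(%y. indicator (snd d ` B) y * dens d y) : meas borel" by (rule borel_dens[OF d Bd])
  show "(%x. indicator (snd c ` B) x * (abs (det (matrix (?D x))) * dens d (transition c d x))) : meas borel"
   unfolding eq by (rule borel_dens[OF c Bc])
 qed
 thus ?thesis unfolding eq .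
qed

definition chart_measure :: "('a, 'n) chart => 'a measure" where
 "chart_measure c = distr (density (restr c) (%x. ennreal (dens c x))) borel (chart_inv c)"

lemma chart_measurable:
 assumes "c : A"
 shows "chart_inv c : measurable (density (restr c) (%x. ennreal (dens c x))) borel"
  and "(%x. ennreal (dens c x)) : meas (restr c)"
proof -
 have s: "sets (restr c) = sets (restrict_space borel (cdom c))"
  by (rule sets_restrict_space_cong) simp
 show "chart_inv c : measurable (density (restr c) (%x. ennreal (dens c x))) borel"
  using borel_measurable_continuous_on_restrict[OF chart_continuous(2)[OF assms]]
  by (simp cong: measurable_cong_sets add: s)
 show "(%x. ennreal (dens c x)) : meas (restr c)"
  using borel_measurable_continuous_on_restrict[OF dens_continuous[OF assms]]
  by (simp cong: measurable_cong_sets add: s)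
qed

lemma nn_integral_chart_measure:
 assumes c: "c : A" and f: "f : meas borel"
 shows "(\<integral>\<^sup>+y. f y \<partial>chart_measure c) = nint lborel (%x. f (chart_inv c x) * ennreal (dens c x) * indicator (cdom c) x)"
proof -
 have o: "cdom c : sets lborel" using chartD(2)[OF c] by simp
 have m: "(%x. f (chart_inv c x)) : meas (restr c)"
  using measurable_compose[OF chart_measurable(1)[OF c] f] by simp
 have "(\<integral>\<^sup>+y. f y \<partial>chart_measure c) = (\<integral>\<^sup>+x. ennreal (dens c x) * f (chart_inv c x) \<partial>restr c)"
  unfolding chart_measure_def
  using f chart_measurable[OF c] m by (simp add: nn_integral_distr nn_integral_density)
 also have "... = nint lborel (%x. ennreal (dens c x) * f (chart_inv c x) * indicator (cdom c) x)"
  using o by (subst nn_integral_restrict_space) (auto simp: )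
 finally show ?thesis by (simp add: mult.commute)
qed

lemma emeasure_chart_measure:
 assumes c: "c : A" and B: "B : sets borel"
 shows "emeasure (chart_measure c) B = nint lborel (%x. ennreal (indicator (snd c ` (B Int fst c)) x * dens c x))"
proof -
 have "emeasure (chart_measure c) B = (\<integral>\<^sup>+y. indicator B y \<partial>chart_measure c)"
  using B by (simp add: chart_measure_def)
 also have "... = nint lborel (%x. indicator B (chart_inv c x) * ennreal (dens c x) * indicator (cdom c) x)"
  using B by (intro nn_integral_chart_measure[OF c]) simp
 also have "... = nint lborel (%x. ennreal (indicator (snd c ` (B Int fst c)) x * dens c x))"
 proof (rule nn_integral_cong)
  fix x
  have "x : snd c ` (B Int fst c) \<longleftrightarrow> x : cdom c & chart_inv c x : B"
  proof
   assume "x : snd c ` (B Int fst c)"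
   then obtain y where "y : B" "y : fst c" "x = snd c y" by blast
   thus "x : cdom c & chart_inv c x : B" using chart_inv_left[OF c, of y] by simp
  next
   assume "x : cdom c & chart_inv c x : B"
   thus "x : snd c ` (B Int fst c)" using chart_inv_right[OF c, of x] chart_inv_mem[OF c, of x] by (metis IntI imageI)
  qed
  thus "indicator B (chart_inv c x) * ennreal (dens c x) * indicator (cdom c) x
   = ennreal (indicator (snd c ` (B Int fst c)) x * dens c x)" by (auto simp: indicator_def)
 qed
 finally show ?thesis .
qed

lemma ball_cover:
 "EX I :: (('a, 'n) chart \<times> (real^'n) \<times> real) set. finite I \<and>
  (\<forall>(c, x, R)\<in>I. c : A & R > 0 & cball x R <= cdom c) \<and>
  (ALL y. \<exists>(c, x, R)\<in>I. y : fst c & snd c y : ball x (R/2))"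
proof -
 define J where "J = {(c, x, R). c : A & R > 0 & cball x R <= cdom c}"
 define U where "U = (%(c :: ('a, 'n) chart, x, R). fst c Int snd c -` ball x (R/2))"
 have oU: "open (U j)" if "j : J" for j
 proof -
  obtain c x R where j: "j = (c, x, R)" by (cases j) auto
  have "c : A" using that by (simp add: j J_def)
  thus ?thesis unfolding j U_def prod.case
   by (intro continuous_open_preimage chart_continuous chartD open_ball)
 qed
 have "UNIV <= \<Union>(U ` J)"
 proof
  fix y
  obtain c where c: "c : A" "y : fst c" using chart_cover by blast
  obtain R where R: "R > 0" "cball (snd c y) R <= cdom c"
   using chartD(2)[OF c(1)] c(2) by (meson imageI open_contains_cball)
  have "(c, snd c y, R) : J" using c R by (simp add: J_def)
  moreover have "y : U (c, snd c y, R)" using c R by (simp add: U_def)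
  ultimately show "y : \<Union>(U ` J)" by blast
 qed
 then obtain I where I: "I <= J" "finite I" "UNIV <= \<Union>(U ` I)"
  using compactE_image[OF compact_space, of J U] oU by metis
 have "\<exists>(c, x, R)\<in>I. y : fst c & snd c y : ball x (R/2)" for y
 proof -
  obtain j where j: "j : I" "y : U j" using I(3) by blast
  obtain c x R where jj: "j = (c, x, R)" by (cases j) auto
  show ?thesis using j unfolding jj U_def by (intro bexI[of _ "(c, x, R)"]) auto
 qed
 moreover have "\<forall>(c, x, R)\<in>I. c : A & R > 0 & cball x R <= cdom c"
  using I(1) unfolding J_def by blast
 ultimately show ?thesis using I(2) by blast
qed

definition is_volume :: "'a measure => bool" where
 "is_volume M = (sets M = sets borel \<and>
  (ALL c:A. ALL B:sets borel. B <= fst c -->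
    emeasure M B = (\<integral>\<^sup>+x\<in>snd c ` B. ennreal (sqrt (det (g c x))) \<partial>lborel)))"

lemma is_volume_iff:
 "is_volume M = (sets M = sets borel \<and>
  (ALL c:A. ALL B:sets borel. B <= fst c --> emeasure M B = emeasure (chart_measure c) B))"
proof -
 have "(\<integral>\<^sup>+x\<in>snd c ` B. ennreal (sqrt (det (g c x))) \<partial>lborel) = emeasure (chart_measure c) B"
  if "c : A" "B : sets borel" "B <= fst c" for c B
 proof -
  have "(\<integral>\<^sup>+x\<in>snd c ` B. ennreal (sqrt (det (g c x))) \<partial>lborel) = nint lborel (%x. ennreal (indicator (snd c ` B) x * dens c x))"
   by (intro nn_integral_cong) (auto simp: dens_def indicator_def)
  thus ?thesis using that by (simp add: emeasure_chart_measure Int_absorb2)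
 qed
 thus ?thesis by (auto simp: is_volume_def)
qed

lemma chart_measure_consistent:
 assumes "c : A" "d : A" "B : sets borel" "B <= fst c Int fst d"
 shows "emeasure (chart_measure c) B = emeasure (chart_measure d) B"
 using volume_consistent[OF assms] assms by (simp add: emeasure_chart_measure Int_absorb2)

lemma borel_partition:
 obtains cs :: "nat => ('a, 'n) chart" and P :: "nat => 'a set" and N :: nat
 where "!!i. i < N ==> cs i : A" "!!i. P i : sets borel" "!!i. i < N ==> P i <= fst (cs i)"
  "disjoint_family P" "(\<Union>i<N. P i) = UNIV"
proof -
 from ball_cover obtain I where I: "finite I" "\<forall>(c, x, R)\<in>I. c : A & R > 0 & cball x R <= cdom c"
  "ALL y. \<exists>(c, x, R)\<in>I. y : fst c & snd c y : ball x (R/2)" by blast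
 obtain xs where xs: "set xs = I" using finite_list[OF I(1)] by blast
 define cs where "cs i = fst (xs ! i)" for i
 define N where "N = length xs"
 have csA: "cs i : A" if "i < N" for i
 proof -
  have "xs ! i : I" using that xs nth_mem[of i xs] by (simp add: N_def)
  thus ?thesis using I(2) by (auto simp: cs_def)
 qed
 define F where "F i = (if i < N then fst (cs i) else {})" for i
 have F: "F i : sets borel" for i using chartD(1)[OF csA] by (auto simp: F_def)
 define P where "P = disjointed F"
 show ?thesis
 proof (rule that[of N cs P])
  show "P i : sets borel" for i unfolding P_def disjointed_def using F by auto
  show "P i <= fst (cs i)" if "i < N" for i using disjointed_subset[of F i] that by (auto simp: P_def F_def)
  show "disjoint_family P" unfolding P_def by (rule disjoint_family_disjointed)
  show "(\<Union>i<N. P i) = UNIV"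
  proof safe
   fix y :: 'a
   obtain c x R where c: "(c, x, R) : I" "y : fst c" using I(3) by blast
   then obtain i where i: "i < N" "xs ! i = (c, x, R)" using xs by (metis in_set_conv_nth N_def)
   hence "y : (\<Union>i. F i)" using c(2) by (auto simp: F_def cs_def)
   hence "y : (\<Union>i. P i)" unfolding P_def UN_disjointed_eq .
   then obtain j where j: "y : P j" by blast
   moreover have "j < N" using disjointed_subset[of F j] j by (auto simp: P_def F_def split: if_splits)
   ultimately show "y : (\<Union>i<N. P i)" by blast
  qed simp
 qed (rule csA)
qed

text \<open>The measures of two charts agree on the overlap, so they can be glued along a finite partition into Borel sets
 that lie in charts.\<close>

lemma riemannian_volume_is_volume: "is_volume (riemannian_volume A g)"
proof (rule borel_partition)
 fix cs P and N :: nat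
 assume *: "!!i. i < N ==> cs i : A" "!!i. P i : sets borel" "!!i. i < N ==> P i <= fst (cs i)"
  "disjoint_family P" "(\<Union>i<N. P i) = UNIV"
 have part: "emeasure K B = (\<Sum>i<N. emeasure K (B Int P i))" if "sets K = sets borel" "B : sets borel" for K B
 proof -
  have "(\<Sum>i<N. emeasure K (B Int P i)) = emeasure K (\<Union>i<N. B Int P i)"
  proof (rule sum_emeasure)
   show "disjoint_family_on (%i. B Int P i) {..<N}" using *(4) unfolding disjoint_family_on_def by blast
  qed (use that *(2) in auto)
  also have "(\<Union>i<N. B Int P i) = B" using *(5) by blast
  finally show ?thesis by simp
 qed
 define mu where "mu B = (\<Sum>i<N. emeasure (chart_measure (cs i)) (B Int P i))" for B
 define M where "M = measure_of UNIV (sets borel) mu"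
 have sM: "sets M = sets borel" unfolding M_def by (metis sets.sets_measure_of_eq space_borel)
 have ca: "countably_additive (sets borel) mu"
 proof (rule countably_additiveI)
  fix F :: "nat => 'a set" assume F: "range F <= sets borel" "disjoint_family F"
  have "(\<Sum>n. mu (F n)) = (\<Sum>i<N. \<Sum>n. emeasure (chart_measure (cs i)) (F n Int P i))"
   unfolding mu_def by (rule suminf_sum) simp
  also have "... = (\<Sum>i<N. emeasure (chart_measure (cs i)) (\<Union>n. F n Int P i))"
   using F *(2) by (intro sum.cong suminf_emeasure) (auto simp: chart_measure_def disjoint_family_on_def)
  finally show "(\<Sum>n. mu (F n)) = mu (\<Union>n. F n)" by (simp add: mu_def)
 qed
 have eM: "emeasure M B = mu B" if "B : sets borel" for B
  unfolding M_def
 proof (rule emeasure_measure_of_sigma[OF _ _ ca that])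
  show "sigma_algebra UNIV (sets borel)" using sets.sigma_algebra_axioms[of borel] by simp
  show "positive (sets borel) mu" by (simp add: positive_def mu_def)
 qed
 have M: "is_volume M" unfolding is_volume_iff
 proof (intro conjI ballI impI sM)
  fix c B assume c: "c : A" and B: "B : sets borel" "B <= fst c"
  have "emeasure M B = (\<Sum>i<N. emeasure (chart_measure c) (B Int P i))"
   unfolding eM[OF B(1)] mu_def
  proof (rule sum.cong[OF refl], rule chart_measure_consistent)
   fix i assume i: "i : {..<N}"
   thus "cs i : A" "c : A" "B Int P i : sets borel" "B Int P i <= fst (cs i) Int fst c"
    using c B *(1,2) *(3)[of i] by auto
  qed
  also have "... = emeasure (chart_measure c) B" using B by (intro part[symmetric]) (auto simp: chart_measure_def)
  finally show "emeasure M B = emeasure (chart_measure c) B" .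
 qed
 have "K = M" if K: "is_volume K" for K
 proof (rule measure_eqI)
  show "sets K = sets M" using K sM by (simp add: is_volume_iff)
  fix B assume "B : sets K"
  hence B: "B : sets borel" and sK: "sets K = sets borel" using K by (auto simp: is_volume_iff)
  have "emeasure K (B Int P i) = emeasure M (B Int P i)" if i: "i < N" for i
  proof -
   have "B Int P i <= fst (cs i)" "B Int P i : sets borel" using *(3)[OF i] *(2) B by auto
   thus ?thesis using K M *(1)[OF i] by (simp add: is_volume_iff)
  qed
  thus "emeasure K B = emeasure M B" using part[OF sK B] part[OF sM B] by simp
 qed
 with M have "is_volume (THE M. is_volume M)" by (rule theI)
 thus ?thesis unfolding riemannian_volume_def is_volume_def .
qed

lemma sets_volume: "sets (riemannian_volume A g) = sets borel"
 using riemannian_volume_is_volume by (simp add: is_volume_iff)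

lemma nn_integral_chart:
 assumes c: "c : A" and f: "f : meas borel"
 shows "(\<integral>\<^sup>+y. f y * indicator (fst c) y \<partial>riemannian_volume A g) =
  (nint lborel (%x. f (chart_inv c x) * ennreal (dens c x) * indicator (cdom c) x))"
proof -
 let ?M = "riemannian_volume A g"
 have o: "fst c : sets borel" using chartD(1)[OF c] by simp
 have "density ?M (indicator (fst c)) = chart_measure c"
 proof (rule measure_eqI)
  show "sets (density ?M (indicator (fst c))) = sets (chart_measure c)"
   by (simp add: sets_volume chart_measure_def)
  fix B assume "B : sets (density ?M (indicator (fst c)))"
  hence B: "B : sets borel" by (simp add: sets_volume)
  have "emeasure (density ?M (indicator (fst c))) B = (\<integral>\<^sup>+y. indicator (fst c) y * indicator B y \<partial>?M)"
   using B o by (subst emeasure_density) (auto simp: sets_volume intro!: borel_measurable_indicator)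
  also have "... = (\<integral>\<^sup>+y. indicator (B Int fst c) y \<partial>?M)"
   by (intro nn_integral_cong) (auto simp: indicator_def)
  also have "... = emeasure ?M (B Int fst c)" using B o by (simp add: sets_volume)
  also have "... = emeasure (chart_measure c) (B Int fst c)"
   using riemannian_volume_is_volume c B o by (simp add: is_volume_iff)
  also have "... = emeasure (chart_measure c) B" using B o by (simp add: emeasure_chart_measure[OF c])
  finally show "emeasure (density ?M (indicator (fst c))) B = emeasure (chart_measure c) B" .
 qed
 hence "(\<integral>\<^sup>+y. f y \<partial>density ?M (indicator (fst c))) = (\<integral>\<^sup>+y. f y \<partial>chart_measure c)" by simp
 thus ?thesis using f o nn_integral_chart_measure[OF c f]
  by (subst (asm) nn_integral_density) (auto simp: sets_volume mult.commute cong: measurable_cong_sets)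
qed

lemma volume_finite: "finite_measure (riemannian_volume A g)"
proof
 let ?M = "riemannian_volume A g"
 from ball_cover obtain I where I: "finite I" "\<forall>(c, x, R)\<in>I. c : A & R > 0 & cball x R <= cdom c"
  "ALL y. \<exists>(c, x, R)\<in>I. y : fst c & snd c y : ball x (R/2)" by blast
 define U where "U = (%(c :: ('a, 'n) chart, x, R). fst c Int snd c -` ball x (R/2))"
 have oU: "U j : sets borel" and fin: "emeasure ?M (U j) < \<infinity>" if j: "j : I" for j
 proof -
  obtain c x R where jj: "j = (c, x, R)" by (cases j) auto
  have cR: "c : A" "R > 0" "cball x R <= cdom c" using j I(2) by (auto simp: jj)
  have "open (U j)" unfolding jj U_def prod.case
   by (intro continuous_open_preimage chart_continuous chartD open_ball cR)
  thus m: "U j : sets borel" by simp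
  have sub: "U j <= fst c" by (auto simp: U_def jj)
  obtain K where K: "!!z. z : cball x R ==> norm (dens c z) <= K"
   using compact_norm_bound[OF compact_cball continuous_on_subset[OF dens_continuous[OF cR(1)] cR(3)]] by blast
  have "emeasure ?M (U j) = nint lborel (%z. ennreal (indicator (snd c ` U j) z * dens c z))"
   using riemannian_volume_is_volume cR m sub by (simp add: is_volume_iff emeasure_chart_measure Int_absorb2)
  also have "... <= nint lborel (%z. ennreal K * indicator (cball x R) z)"
  proof (rule nn_integral_mono)
   fix z
   have "z : cball x R" if "z : snd c ` U j" using that cR(2) by (auto simp: U_def jj)
   thus "ennreal (indicator (snd c ` U j) z * dens c z) <= ennreal K * indicator (cball x R) z"
    using K[of z] by (force simp: indicator_def intro!: ennreal_leI)
  qed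
  also have "... < \<infinity>" using emeasure_compact_finite[OF compact_cball, of x R]
   by (simp add: nn_integral_cmult_indicator ennreal_mult_less_top)
  finally show "emeasure ?M (U j) < \<infinity>" .
 qed
 have "space ?M = UNIV" using sets_volume sets_eq_imp_space_eq[of ?M borel] by simp
 also have "UNIV = (\<Union>j\<in>I. U j)"
 proof -
  have "y : (\<Union>j\<in>I. U j)" for y
  proof -
   obtain c x R where "(c, x, R) : I" "y : fst c" "snd c y : ball x (R/2)" using I(3) by blast
   thus ?thesis by (intro UN_I[of "(c, x, R)"]) (auto simp: U_def)
  qed
  thus ?thesis by blast
 qed
 also have "emeasure ?M ... <= (SUM j:I. emeasure ?M (U j))"
  using oU I(1) by (intro emeasure_subadditive_finite) (auto simp: sets_volume)
 also have "... < \<infinity>" using fin I(1) by simp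
 finally show "emeasure ?M (space ?M) ~= \<infinity>" by simp
qed

end

section \<open>The sign of the principal symbol\<close>

lemma bounded_measurable_L2:
 assumes "finite_measure M" "f : meas M" "!!x. cmod (f x) <= K"
 shows "f : L2_space M"
 unfolding L2_space_iff
proof
 interpret finite_measure M by fact
 show "integrable M (%x. (cmod (f x))^2)"
 proof (rule integrable_const_bound[of _ "K^2"])
  show "AE x in M. norm ((cmod (f x))^2) <= K^2" using assms(3) by (intro always_eventually allI) (simp add: power_mono)
 qed (use assms(2) in measurable)
qed fact

lemma Lp_norm_zero [simp]: "Lp_norm M 2 (%x. 0) = 0"
 by (simp add: Lp_norm_2)

lemma quadratic_nonneg_coeff:
 fixes a b c :: real
 assumes "!!t. 0 <= c + t * b - t^2 * a" shows "a <= 0"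
proof (rule ccontr)
 assume "\<not> a <= 0"
 hence a: "a > 0" by simp
 define t where "t = (abs b + abs c + 1) / a + 1"
 have t1: "t >= 1" using a by (simp add: t_def)
 have "t * a = abs b + abs c + 1 + a" using a by (simp add: t_def field_simps)
 hence "t^2 * a = t * (abs b + abs c + 1 + a)" by (simp add: power2_eq_square)
 also have "... = t * abs b + t * (abs c + 1 + a)" by (simp add: algebra_simps)
 also have "... >= t * b + 1 * (abs c + 1 + a)" using t1 a by (intro add_mono mult_left_mono mult_right_mono) auto
 finally have "t^2 * a >= t * b + (abs c + 1 + a)" by simp
 thus False using assms[of t] a by linarith
qed

context riemannian_manifold
begin

lemma integral_zero_ext:
 fixes psi :: "real^'n => complex"
 assumes c: "c : A" and m: "zero_ext c psi : meas borel"
 shows "(\<integral>y. zero_ext c psi y \<partial>riemannian_volume A g) = (LBINT x. indicator (cdom c) x *\<^sub>R (dens c x *\<^sub>R psi x))"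
proof -
 let ?M = "riemannian_volume A g"
 have o: "fst c : sets borel" "cdom c : sets lborel" using chartD(1,2)[OF c] by auto
 have eq: "density ?M (%y. ennreal (indicator (fst c) y)) = chart_measure c"
 proof (rule measure_eqI)
  show "sets (density ?M (%y. ennreal (indicator (fst c) y))) = sets (chart_measure c)"
   by (simp add: sets_volume chart_measure_def)
  fix B assume "B : sets (density ?M (%y. ennreal (indicator (fst c) y)))"
  hence B: "B : sets borel" by (simp add: sets_volume)
  have "emeasure (density ?M (%y. ennreal (indicator (fst c) y))) B = (\<integral>\<^sup>+y. ennreal (indicator (fst c) y) * indicator B y \<partial>?M)"
   using B o by (subst emeasure_density) (auto simp: sets_volume cong: measurable_cong_sets)
  also have "... = (\<integral>\<^sup>+y. indicator B y * indicator (fst c) y \<partial>?M)"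
   by (intro nn_integral_cong) (auto simp: indicator_def)
  also have "... = (\<integral>\<^sup>+y. indicator B y \<partial>chart_measure c)"
   using B by (simp add: nn_integral_chart[OF c] nn_integral_chart_measure[OF c])
  also have "... = emeasure (chart_measure c) B" using B by (simp add: chart_measure_def)
  finally show "emeasure (density ?M (%y. ennreal (indicator (fst c) y))) B = emeasure (chart_measure c) B" .
 qed
 have m': "zero_ext c psi : borel_measurable ?M" using m by (simp add: sets_volume cong: measurable_cong_sets)
 have "(\<integral>y. zero_ext c psi y \<partial>?M) = (\<integral>y. indicator (fst c) y *\<^sub>R zero_ext c psi y \<partial>?M)"
  by (rule lint_cong) (auto simp: zero_ext_def indicator_def)
 also have "... = (\<integral>y. zero_ext c psi y \<partial>density ?M (%y. ennreal (indicator (fst c) y)))"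
  using m' o by (subst integral_density) (auto simp: sets_volume cong: measurable_cong_sets)
 also have "... = (\<integral>y. zero_ext c psi y \<partial>chart_measure c)" unfolding eq ..
 also have "... = (\<integral>x. zero_ext c psi (chart_inv c x) \<partial>density (restr c) (%x. ennreal (dens c x)))"
  unfolding chart_measure_def by (rule integral_distr[OF chart_measurable(1)[OF c] m])
 also have "... = (\<integral>x. dens c x *\<^sub>R zero_ext c psi (chart_inv c x) \<partial>restr c)"
 proof (rule integral_density)
  show "(%x. zero_ext c psi (chart_inv c x)) : meas (restr c)"
   using measurable_compose[OF chart_measurable(1)[OF c] m] by simp
  have s: "sets (restr c) = sets (restrict_space borel (cdom c))"
   by (rule sets_restrict_space_cong) simp
  show "dens c : meas (restr c)"
   using borel_measurable_continuous_on_restrict[OF dens_continuous[OF c]] by (simp cong: measurable_cong_sets add: s)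
  show "AE x in restr c. 0 <= dens c x"
   using o dens_pos[OF c] by (intro AE_I2) (auto simp: space_restrict_space less_imp_le)
 qed
 also have "... = (LBINT x. indicator (cdom c) x *\<^sub>R (dens c x *\<^sub>R zero_ext c psi (chart_inv c x)))"
  using o by (subst integral_restrict_space) auto
 also have "... = (LBINT x. indicator (cdom c) x *\<^sub>R (dens c x *\<^sub>R psi x))"
  by (rule lint_cong) (auto simp: indicator_def zero_ext_chart_inv[OF c])
 finally show ?thesis .
qed

end

locale elliptic_operator = riemannian_manifold A g
 for A :: "('a::{second_countable_topology, t2_space}, 'n::finite) chart set" and g +
 fixes L :: "('a => complex) => ('a => complex)" and M :: "'a measure" and T :: "'a L2_op"
 assumes M_eq: "M = riemannian_volume A g"
  and elliptic: "second_order_elliptic A L"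
  and T_eq: "T = L2_realization M A L"
  and T_sa: "self_adjoint_op M T"
  and T_nonneg: "nonneg_op M T"
begin

abbreviation "ip == L2_inner M"

lemma sets_M [measurable_cong]: "sets M = sets borel" by (simp add: M_eq sets_volume)

lemma space_M [simp]: "space M = UNIV" using sets_M sets_eq_imp_space_eq[of M borel] by simp

sublocale finite_measure M unfolding M_eq by (rule volume_finite)

lemma T_sym: "(u, v) : T ==> (x, y) : T ==> ip y u = ip x v"
 using T_sa unfolding self_adjoint_op_def adjoint_op_def by blast

lemma T_memD: "(u, v) : T ==> u : L2_space M" "(u, v) : T ==> v : L2_space M"
 using T_sa unfolding self_adjoint_op_def adjoint_op_def by blast+

lemma chart_op_continuous:
 assumes c: "c : A" and co: "op_coeffs A L c a b q" and psi: "smooth_on UNIV psi"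
 shows "continuous_on (cdom c) (chart_op a b q psi)"
proof -
 have "continuous_on (cdom c) a" "continuous_on (cdom c) b" "continuous_on (cdom c) q"
  using co smooth_on_continuous unfolding op_coeffs_def by blast+
 moreover have "continuous_on (cdom c) (pd i psi)" "continuous_on (cdom c) (pd i (pd j psi))" for i j
  by (rule continuous_on_subset[OF _ subset_UNIV], intro smooth_on_continuous smooth_partial_deriv psi)+
 moreover have "continuous_on (cdom c) psi" by (rule continuous_on_subset[OF smooth_on_continuous[OF psi]]) simp
 ultimately show ?thesis unfolding chart_op_def[abs_def] by (intro continuous_intros)
qed

lemma chart_op_supp:
 assumes K: "compact K" and supp: "!!x. x ~: K ==> psi x = 0" and x: "x ~: K"
 shows "chart_op a b q psi x = 0"
proof -
 have "chart_op a b q psi x = chart_op a b q (%x. 0) x"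
  by (rule chart_op_cong_open[of "- K"]) (use assms compact_imp_closed in auto)
 thus ?thesis by (simp add: chart_op_zero)
qed

lemma zero_ext_L2:
 assumes c: "c : A" and psi: "continuous_on (cdom c) psi" and K: "compact K" "K <= cdom c"
  and supp: "!!x. x ~: K ==> psi x = 0"
 shows "zero_ext c psi : L2_space M"
proof -
 have "bounded (psi ` K)" by (intro compact_imp_bounded compact_continuous_image continuous_on_subset[OF psi] K)
 then obtain B where B: "ALL y:psi ` K. norm y <= B" unfolding bounded_iff by blast
 have "cmod (zero_ext c psi y) <= max B 0" for y
  using B supp[of "snd c y"] by (cases "snd c y : K") (auto simp: zero_ext_def le_max_iff_disj)
 thus ?thesis using measurable_zero_ext[OF c psi]
  by (intro bounded_measurable_L2[OF finite_measure_axioms]) (auto cong: measurable_cong_sets simp: sets_M)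
qed

lemma test_function_in_T:
 assumes c: "c : A" and psi: "smooth_on UNIV psi" and K: "compact K" "K <= cdom c"
  and supp: "!!x. x ~: K ==> psi x = 0" and co: "op_coeffs A L c a b q"
 shows "(zero_ext c psi, zero_ext c (chart_op a b q psi)) : T"
proof -
 have L: "L (zero_ext c psi) = zero_ext c (chart_op a b q psi)"
  by (rule op_zero_ext[OF c psi K supp elliptic co])
 have 1: "zero_ext c psi : L2_space M"
  by (rule zero_ext_L2[OF c _ K supp]) (auto intro: continuous_on_subset[OF smooth_on_continuous[OF psi]])
 have 2: "zero_ext c (chart_op a b q psi) : L2_space M"
  by (rule zero_ext_L2[OF c chart_op_continuous[OF c co psi] K chart_op_supp[OF K(1) supp]])
 show ?thesis unfolding T_eq L2_realization_def mem_Collect_eq prod.case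
  using 1 2 smooth_fun_zero_ext[OF c psi K supp] L by (auto intro!: exI[of _ "zero_ext c psi"])
qed

lemma smooth_bump_exp: "smooth_on UNIV q ==> smooth_on UNIV (%x. complex_of_real (bump x0 R x) * exp (q x))"
 by (intro smooth_on_mult smooth_bump open_UNIV) (auto simp: smooth_on_def intro: Ck_on_exp)

lemma sign_from_bumps:
 fixes s :: "real^'n => real"
 assumes c: "c : A" and s: "continuous_on (cdom c) s"
  and le: "!!x0 R. R > 0 ==> cball x0 R <= cdom c ==>
   (LBINT x. indicator (cball x0 R) x * ((bump x0 R x)^2 * dens c x * s x)) <= 0"
  and x1: "x1 : cdom c"
 shows "s x1 <= 0"
proof (rule ccontr)
 assume "\<not> s x1 <= 0"
 hence "s x1 > 0" by simp
 moreover have "isCont s x1" using s x1 chartD(2)[OF c] continuous_on_eq_continuous_at by blast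
 ultimately have "\<forall>\<^sub>F x in at x1. s x > 0" by (simp add: isCont_def order_tendstoD(1))
 hence "\<forall>\<^sub>F x in nhds x1. s x > 0" using `s x1 > 0` by (simp add: eventually_nhds_conv_at)
 then obtain r where r: "r > 0" "!!x. dist x x1 < r ==> s x > 0" by (auto simp: eventually_nhds_metric)
 obtain R0 where R0: "R0 > 0" "cball x1 R0 <= cdom c" using chartD(2)[OF c] x1 by (meson open_contains_cball)
 define R where "R = min R0 (r/2)"
 have R: "R > 0" "cball x1 R <= cdom c" "!!x. x : cball x1 R ==> s x > 0"
  using r R0 by (auto simp: R_def dist_commute subset_iff)
 let ?h = "%x. indicator (cball x1 R) x * ((bump x1 R x)^2 * dens c x * s x)"
 have bc: "continuous_on UNIV (bump x1 R)" using Ck_on_bump[of 0 x1 R] by simp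
 have ih: "integrable lborel ?h"
 proof -
  have "continuous_on (cball x1 R) (%x. (bump x1 R x)^2 * dens c x * s x)"
   by (intro continuous_intros continuous_on_subset[OF bc] continuous_on_subset[OF s] continuous_on_subset[OF dens_continuous[OF c]] R subset_UNIV)
  from borel_integrable_compact[OF compact_cball this] show ?thesis by simp
 qed
 have nn: "0 <= ?h x" for x
 proof (cases "x : cball x1 R")
  case True
  hence "dens c x > 0" "s x > 0" using dens_pos[OF c] R by auto
  thus ?thesis using True by (auto intro!: mult_nonneg_nonneg)
 qed simp
 have "(LBINT x. ?h x) = 0"
  by (rule antisym[OF le[OF R(1,2)] Bochner_Integration.integral_nonneg[OF nn]])
 hence "AE x in lborel. ?h x = 0" using integral_nonneg_eq_0_iff_AE[OF ih] nn by simp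
 moreover have "?h x ~= 0" if "x : ball x1 R" for x
 proof -
  have "x : cball x1 R" using that by auto
  hence "dens c x > 0" "s x > 0" using dens_pos[OF c] R by auto
  thus ?thesis using bump_pos[OF that] `x : cball x1 R` by simp
 qed
 ultimately have "AE x in lborel. x ~: ball x1 R" by (auto elim!: eventually_mono)
 hence "emeasure lborel (ball x1 R) = 0" by (subst (asm) AE_iff_measurable[of "ball x1 R"]) auto
 moreover have "emeasure lborel (ball x1 R) > 0"
  using content_ball_pos[OF R(1), of x1] by (simp add: measure_def enn2real_positive_iff)
 ultimately show False by simp
qed

definition symbol :: "(real^'n => complex^'n^'n) => real^'n => real^'n => complex" where
 "symbol a xi x = dsum (%i j. a x $ i $ j * of_real (xi $ i * xi $ j))"

text \<open>Test the operator on \<open>exp (i t \<langle>xi, x\<rangle>)\<close> times a bump function. The pairing is quadratic in \<open>t\<close>, with minus the integral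
 of the symbol as leading coefficient; it is real and nonnegative for all \<open>t\<close>.\<close>

lemma symbol_integral:
 fixes xi :: "real^'n"
 assumes c: "c : A" and co: "op_coeffs A L c a b q" and R: "R > 0" "cball x0 R <= cdom c"
 defines "I == LBINT x. indicator (cball x0 R) x *\<^sub>R (of_real ((bump x0 R x)^2 * dens c x) * symbol a xi x)"
 shows "Im I = 0" "Re I <= 0"
proof -
 define beta where "beta x = complex_of_real (bump x0 R x)" for x
 have sb: "smooth_on UNIV beta" unfolding beta_def[abs_def] by (rule smooth_bump)
 define F2 where "F2 x = of_real ((bump x0 R x)^2 * dens c x) * symbol a xi x" for x
 define F1 where "F1 x = of_real (dens c x) * beta x * (dsum (%i j. a x $ i $ j * (\<i> * (pd j beta x * of_real (xi $ i) + pd i beta x * of_real (xi $ j)))) +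
  (SUM i:UNIV. b x $ i * (\<i> * of_real (xi $ i) * beta x)))" for x
 define F0 where "F0 x = of_real (dens c x) * beta x * (dsum (%i j. a x $ i $ j * pd i (pd j beta) x) +
  (SUM i:UNIV. b x $ i * pd i beta x) + q x * beta x)" for x
 have cont: "continuous_on (cdom c) a" "continuous_on (cdom c) b" "continuous_on (cdom c) q"
  using co smooth_on_continuous unfolding op_coeffs_def by blast+
 note cont' = cont[THEN continuous_on_subset, OF R(2)]
 have cb: "continuous_on (cball x0 R) beta" "continuous_on (cball x0 R) (pd i beta)" "continuous_on (cball x0 R) (pd i (pd j beta))" for i j
  by (rule continuous_on_subset[OF _ subset_UNIV], intro smooth_on_continuous smooth_partial_deriv sb)+
 have cbr: "continuous_on (cball x0 R) (bump x0 R)" using Ck_on_bump[of 0 x0 R] by (auto intro: continuous_on_subset)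
 have cd: "continuous_on (cball x0 R) (dens c)" by (rule continuous_on_subset[OF dens_continuous[OF c] R(2)])
 have int: "integrable lborel (%x. indicator (cball x0 R) x *\<^sub>R F2 x)" "integrable lborel (%x. indicator (cball x0 R) x *\<^sub>R F1 x)"
  "integrable lborel (%x. indicator (cball x0 R) x *\<^sub>R F0 x)"
  unfolding F2_def F1_def F0_def symbol_def
  by (intro borel_integrable_compact compact_cball continuous_intros cont' cb cbr cd)+
 define J where "J F = (LBINT x. indicator (cball x0 R) x *\<^sub>R F x)" for F :: "real^'n => complex"
 have key: "0 <= Re (J F0 + of_real t * J F1 - of_real (t^2) * J F2) & Im (J F0 + of_real t * J F1 - of_real (t^2) * J F2) = 0" for t :: real
 proof -
  define qq where "qq x = (of_real t * \<i>) * of_real (xi \<bullet> x)" for x :: "real^'n"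
  have lq: "bounded_linear qq" unfolding qq_def[abs_def]
   by (intro bounded_linear_compose[OF bounded_linear_mult_right] bounded_linear_compose[OF bounded_linear_of_real] bounded_linear_inner_right)
  have sq: "smooth_on UNIV qq" using lq by (auto simp: smooth_on_def intro: Ck_on_bounded_linear)
  have pq: "pd i qq = (%x. of_real t * \<i> * of_real (xi $ i))" for i
   by (rule ext) (simp add: partial_deriv_eqI[OF bounded_linear_imp_has_derivative[OF lq]] qq_def inner_axis)
  define psi where "psi x = beta x * exp (qq x)" for x
  have spsi: "smooth_on UNIV psi" unfolding psi_def[abs_def] beta_def by (rule smooth_bump_exp[OF sq])
  have supp: "psi x = 0" if "x ~: cball x0 R" for x
  proof -
   have "x ~: ball x0 R" using that by auto
   thus ?thesis using bump_zero[OF _ R(1)] by (simp add: psi_def beta_def)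
  qed
  have inT: "(zero_ext c psi, zero_ext c (chart_op a b q psi)) : T"
   by (rule test_function_in_T[OF c spsi compact_cball R(2) supp co])
  have ce: "exp (qq x) * cnj (exp (qq x)) = 1" for x
  proof -
   have "cnj (qq x) = - qq x" by (simp add: qq_def)
   moreover have "exp (qq x) * cnj (exp (qq x)) = exp (qq x + cnj (qq x))" by (simp only: exp_add exp_cnj)
   ultimately show ?thesis by simp
  qed
  have op: "chart_op a b q psi x * cnj (psi x) * of_real (dens c x) = F0 x + of_real t * F1 x - of_real (t^2) * F2 x" for x
  proof -
   define W where "W = dsum (%i j. a x $ i $ j *
     (pd i (pd j beta) x + of_real t * (\<i> * (pd j beta x * of_real (xi $ i) + pd i beta x * of_real (xi $ j)))
      - of_real (t^2) * (of_real (xi $ i * xi $ j) * beta x))) +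
     (SUM i:UNIV. b x $ i * (pd i beta x + of_real t * (\<i> * of_real (xi $ i) * beta x))) + q x * beta x"
   have "chart_op a b q psi x = exp (qq x) * W"
    unfolding W_def chart_op_def psi_def[abs_def] partial_derivs_mult_exp[OF sb sq] pq
    by (simp add: sum_distrib_left algebra_simps power2_eq_square)
   moreover have "cnj (psi x) = beta x * cnj (exp (qq x))" by (simp add: psi_def beta_def)
   ultimately have "chart_op a b q psi x * cnj (psi x) * of_real (dens c x) = (exp (qq x) * cnj (exp (qq x))) * (of_real (dens c x) * beta x * W)"
    by (simp only: ac_simps)
   also have "... = F0 x + of_real t * F1 x - of_real (t^2) * F2 x"
    unfolding ce W_def F0_def F1_def F2_def symbol_def beta_def
    by (simp add: distrib_left right_diff_distrib sum.distrib sum_subtractf sum_distrib_left power2_eq_square ac_simps)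
   finally show ?thesis .
  qed
  have "ip (zero_ext c (chart_op a b q psi)) (zero_ext c psi) = (LINT y|M. zero_ext c (%x. chart_op a b q psi x * cnj (psi x)) y)"
   unfolding L2_inner_def by (rule lint_cong) (auto simp: zero_ext_def)
  also have "... = (LBINT x. indicator (cdom c) x *\<^sub>R (dens c x *\<^sub>R (chart_op a b q psi x * cnj (psi x))))"
   unfolding M_eq
   by (intro integral_zero_ext[OF c] measurable_zero_ext[OF c] continuous_intros chart_op_continuous[OF c co spsi]
    continuous_on_subset[OF smooth_on_continuous[OF spsi]] subset_UNIV)
  also have "... = (LBINT x. indicator (cball x0 R) x *\<^sub>R F0 x + of_real t * (indicator (cball x0 R) x *\<^sub>R F1 x) - of_real (t^2) * (indicator (cball x0 R) x *\<^sub>R F2 x))"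
  proof (rule lint_cong[OF refl])
   fix x
   show "indicator (cdom c) x *\<^sub>R (dens c x *\<^sub>R (chart_op a b q psi x * cnj (psi x))) =
    indicator (cball x0 R) x *\<^sub>R F0 x + of_real t * (indicator (cball x0 R) x *\<^sub>R F1 x) - of_real (t^2) * (indicator (cball x0 R) x *\<^sub>R F2 x)"
   proof (cases "x : cball x0 R")
    case True
    hence "x : cdom c" using R(2) by blast
    thus ?thesis using True op[of x] by (simp add: scaleR_conv_of_real ac_simps)
   next
    case False thus ?thesis using supp[OF False] by simp
   qed
  qed
  also have "... = J F0 + of_real t * J F1 - of_real (t^2) * J F2"
  proof -
   have "(LBINT x. G0 x + c1 * G1 x - c2 * G2 x) = (LBINT x. G0 x) + c1 * (LBINT x. G1 x) - c2 * (LBINT x. G2 x)"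
    if "integrable lborel G2" "integrable lborel G1" "integrable lborel G0" for G0 G1 G2 :: "real^'n => complex" and c1 c2
    using that by simp
   from this[OF int] show ?thesis unfolding J_def .
  qed
  finally have eq: "ip (zero_ext c (chart_op a b q psi)) (zero_ext c psi) = J F0 + of_real t * J F1 - of_real (t^2) * J F2" .
  let ?z = "ip (zero_ext c (chart_op a b q psi)) (zero_ext c psi)"
  interpret L2: semi_hilbert "L2_space M" "%c f x. c * f x" "L2_inner M" by (rule semi_hilbert_L2)
  have "?z = ip (zero_ext c psi) (zero_ext c (chart_op a b q psi))" by (rule T_sym[OF inT inT])
  also have "... = cnj ?z" by (rule L2.ip_cnj[OF T_memD(2)[OF inT] T_memD(1)[OF inT]])
  finally have "Im ?z = 0" by (metis Reals_cnj_iff complex_is_Real_iff)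
  moreover have "0 <= Re ?z" using T_nonneg inT by (auto simp: nonneg_op_def)
  ultimately show ?thesis unfolding eq by simp
 qed
 have "Re (J F2) <= 0"
  by (rule quadratic_nonneg_coeff[of "Re (J F0)" "Re (J F1)"]) (use key in simp)
 moreover have "Im (J F2) <= 0"
  by (rule quadratic_nonneg_coeff[of "Im (J F0)" "Im (J F1)"]) (use key in simp)
 moreover have "- Im (J F2) <= 0"
  by (rule quadratic_nonneg_coeff[of "- Im (J F0)" "- Im (J F1)"]) (use key in "simp add: algebra_simps")
 ultimately show "Im I = 0" "Re I <= 0" unfolding I_def J_def F2_def by auto
qed

lemma symbol_negative:
 assumes c: "c : A" and co: "op_coeffs A L c a b q" and x: "x : cdom c"
 shows "Im (symbol a xi x) = 0" and "xi ~= 0 ==> Re (symbol a xi x) < 0"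
proof -
 have ca: "continuous_on (cdom c) a"
  using co smooth_on_continuous unfolding op_coeffs_def by blast
 have cs: "continuous_on (cdom c) (symbol a xi)" unfolding symbol_def[abs_def] by (intro continuous_intros ca)
 have int: "integrable lborel (%x. indicator (cball x0 R) x *\<^sub>R (of_real ((bump x0 R x)^2 * dens c x) * symbol a xi x))"
  if "cball x0 R <= cdom c" for x0 R
 proof (rule borel_integrable_compact[OF compact_cball])
  have "continuous_on (cball x0 R) (bump x0 R)" using Ck_on_bump[of 0 x0 R] by (auto intro: continuous_on_subset)
  thus "continuous_on (cball x0 R) (%x. of_real ((bump x0 R x)^2 * dens c x) * symbol a xi x)"
   by (intro continuous_intros continuous_on_subset[OF cs that] continuous_on_subset[OF dens_continuous[OF c] that])
 qed
 have lin: "(LBINT x. indicator (cball x0 R) x * ((bump x0 R x)^2 * dens c x * l (symbol a xi x))) =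
  l (LBINT x. indicator (cball x0 R) x *\<^sub>R (of_real ((bump x0 R x)^2 * dens c x) * symbol a xi x))"
  if "cball x0 R <= cdom c" "bounded_linear l" for x0 R and l :: "complex => real"
 proof -
  have "l (indicator (cball x0 R) x *\<^sub>R (of_real ((bump x0 R x)^2 * dens c x) * symbol a xi x))
   = indicator (cball x0 R) x * ((bump x0 R x)^2 * dens c x * l (symbol a xi x))" for x
  proof -
   have "l (r *\<^sub>R (of_real t * z)) = r * (t * l z)" for r t z
    using linear_cmul[OF bounded_linear.linear[OF that(2)], of "r * t" z] by (simp add: scaleR_conv_of_real mult.assoc)
   thus ?thesis by blast
  qed
  thus ?thesis using integral_bounded_linear[OF that(2) int[OF that(1)]] by simp
 qed
 have "Im (symbol a xi x) <= 0"
 proof (rule sign_from_bumps[OF c _ _ x])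
  show "continuous_on (cdom c) (%x. Im (symbol a xi x))" by (intro continuous_intros cs)
  fix x0 R assume R: "(R::real) > 0" "cball x0 R <= cdom c"
  show "(LBINT x. indicator (cball x0 R) x * ((bump x0 R x)^2 * dens c x * Im (symbol a xi x))) <= 0"
   using symbol_integral(1)[OF c co R] lin[OF R(2) bounded_linear_Im] by simp
 qed
 moreover have "- Im (symbol a xi x) <= 0"
 proof (rule sign_from_bumps[OF c _ _ x])
  show "continuous_on (cdom c) (%x. - Im (symbol a xi x))" by (intro continuous_intros cs)
  fix x0 R assume R: "(R::real) > 0" "cball x0 R <= cdom c"
  show "(LBINT x. indicator (cball x0 R) x * ((bump x0 R x)^2 * dens c x * (- Im (symbol a xi x)))) <= 0"
   using symbol_integral(1)[OF c co R] lin[OF R(2) bounded_linear_minus[OF bounded_linear_Im]] by simp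
 qed
 moreover have re: "Re (symbol a xi x) <= 0"
 proof (rule sign_from_bumps[OF c _ _ x])
  show "continuous_on (cdom c) (%x. Re (symbol a xi x))" by (intro continuous_intros cs)
  fix x0 R assume R: "(R::real) > 0" "cball x0 R <= cdom c"
  show "(LBINT x. indicator (cball x0 R) x * ((bump x0 R x)^2 * dens c x * Re (symbol a xi x))) <= 0"
   using symbol_integral(2)[OF c co R] lin[OF R(2) bounded_linear_Re] by simp
 qed
 ultimately show im: "Im (symbol a xi x) = 0" by linarith
 assume "xi ~= 0"
 hence "symbol a xi x ~= 0" using co x unfolding op_coeffs_def symbol_def by blast
 thus "Re (symbol a xi x) < 0" using im re by (auto simp: complex_eq_iff)
qed

end

section \<open>Gaussian integrals\<close>

lemma nn_integral_scale:
 fixes f :: "'e::euclidean_space => ennreal"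
 assumes "f : meas borel" "c > 0"
 shows "nint lborel (%x. f x) = ennreal (c ^ DIM('e)) * nint lborel (%x. f (t + c *\<^sub>R x))"
proof -
 have "nint lborel (%x. f x) = (\<integral>\<^sup>+x. f x \<partial>density (distr lborel borel (%x::'e. t + c *\<^sub>R x)) (%_. \<bar>c\<bar>^DIM('e)))"
  using lborel_affine[of c t] assms(2) by simp
 also have "... = ennreal (c ^ DIM('e)) * nint lborel (%x. f (t + c *\<^sub>R x))"
  using assms by (simp add: nn_integral_density nn_integral_distr nn_integral_cmult)
 finally show ?thesis .
qed

lemma integral_scale:
 fixes f :: "'e::euclidean_space => complex"
 assumes "f : meas borel" "c > 0"
 shows "(LBINT x. f x) = (c ^ DIM('e)) *\<^sub>R (LBINT x. f (t + c *\<^sub>R x))"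
proof -
 have "(LBINT x. f x) = (\<integral>x. f x \<partial>density (distr lborel borel (%x::'e. t + c *\<^sub>R x)) (%_. \<bar>c\<bar>^DIM('e)))"
  using lborel_affine[of c t] assms(2) by simp
 also have "... = (c ^ DIM('e)) *\<^sub>R (LBINT x. f (t + c *\<^sub>R x))"
  using assms by (subst integral_density) (simp_all add: integral_distr)
 finally show ?thesis .
qed

definition gauss_mass :: "'e::euclidean_space itself => real" where
 "gauss_mass _ = enn2real (nint lborel (%(x::'e). ennreal (exp (- (norm x)\<^sup>2))))"

lemma gauss_mass:
 "(\<integral>\<^sup>+(x::'e::euclidean_space). ennreal (exp (- (norm x)\<^sup>2)) \<partial>lborel) = ennreal (gauss_mass TYPE('e))"
 "gauss_mass TYPE('e) > 0"
proof -
 have 1: "nint lborel (%(x::real). ennreal (exp (- x\<^sup>2))) < \<infinity>"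
 proof -
  have "integrable lborel (%x. sqrt (2 * pi * (1 / sqrt 2)^2) * normal_density 0 (1 / sqrt 2) x)"
   by (intro integrable_mult_right integrable_normal_density) simp
  hence "integrable lborel (%x::real. exp (- x\<^sup>2))"
   by (simp add: normal_density_def power_divide)
  thus ?thesis by (simp add: integrable_iff_bounded)
 qed
 have "nint lborel (%(x::'e). ennreal (exp (- (norm x)\<^sup>2))) = nint lborel (%(x::'e). (\<Prod>b\<in>Basis. ennreal (exp (- (x \<bullet> b)\<^sup>2))))"
 proof (rule nn_integral_cong)
  fix x :: 'e
  have "(norm x)^2 = (SUM b:Basis. (x \<bullet> b)^2)"
   by (subst power2_norm_eq_inner, subst euclidean_inner) (simp add: power2_eq_square)
  hence "exp (- (norm x)\<^sup>2) = (\<Prod>b\<in>Basis. exp (- (x \<bullet> b)\<^sup>2))" by (simp add: exp_sum sum_negf[symmetric])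
  thus "ennreal (exp (- (norm x)\<^sup>2)) = (\<Prod>b\<in>Basis. ennreal (exp (- (x \<bullet> b)\<^sup>2)))" by (simp add: prod_ennreal)
 qed
 also have "... = (\<Prod>b\<in>(Basis::'e set). (nint lborel (%(x::real). ennreal (exp (- x\<^sup>2)))))"
  by (rule nn_integral_lborel_prod) auto
 also have "... < \<infinity>" using 1 by (cases "\<integral>\<^sup>+(x::real). ennreal (exp (- x\<^sup>2)) \<partial>lborel") (auto simp: ennreal_power)
 finally have fin: "nint lborel (%(x::'e). ennreal (exp (- (norm x)\<^sup>2))) < \<infinity>" .
 thus eq: "nint lborel (%(x::'e). ennreal (exp (- (norm x)\<^sup>2))) = ennreal (gauss_mass TYPE('e))"
  by (simp add: gauss_mass_def)
 have "(nint lborel (%(x::'e). ennreal (exp (- (norm x)\<^sup>2)))) ~= 0"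
 proof
  assume "nint lborel (%(x::'e). ennreal (exp (- (norm x)\<^sup>2))) = 0"
  hence "AE x::'e in lborel. ennreal (exp (- (norm x)\<^sup>2)) = 0" by (subst (asm) nn_integral_0_iff_AE) auto
  hence "AE x::'e in lborel. False" by (auto elim!: eventually_mono)
  thus False using emeasure_lborel_UNIV[where 'a = 'e] by (simp add: eventually_False ae_filter_eq_bot_iff)
 qed
 thus "gauss_mass TYPE('e) > 0" using eq by (metis ennreal_eq_0_iff not_le)
qed

lemma nn_integral_gauss:
 fixes y :: "'e::euclidean_space"
 assumes "gamma > 0"
 shows "nint lborel (%x. ennreal (exp (- gamma * (norm (x - y))^2))) = ennreal ((1 / sqrt gamma) ^ DIM('e) * gauss_mass TYPE('e))"
proof -
 have "nint lborel (%x. ennreal (exp (- gamma * (norm (x - y))^2))) =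
  ennreal ((1 / sqrt gamma) ^ DIM('e)) * nint lborel (%(x::'e). ennreal (exp (- gamma * (norm (y + (1 / sqrt gamma) *\<^sub>R x - y))^2)))"
  using assms by (intro nn_integral_scale) auto
 also have "nint lborel (%(x::'e). ennreal (exp (- gamma * (norm (y + (1 / sqrt gamma) *\<^sub>R x - y))^2))) = nint lborel (%(x::'e). ennreal (exp (- (norm x)\<^sup>2)))"
  using assms by (intro nn_integral_cong) (simp add: power_divide)
 finally show ?thesis using assms gauss_mass(2)[where 'e='e] by (simp add: gauss_mass ennreal_mult[symmetric])
qed

lemma integrable_gauss:
 assumes "gamma > 0" shows "integrable lborel (%x::'e::euclidean_space. exp (- gamma * (norm x)^2))"
 using nn_integral_gauss[OF assms, of "0::'e"] by (simp add: integrable_iff_bounded)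

lemma has_vector_derivative_iff_quotient:
 fixes f :: "real => 'b::real_normed_vector"
 shows "(f has_vd D) (at t0) \<longleftrightarrow> ((%t. (1 / (t - t0)) *\<^sub>R (f t - f t0)) ---> D) (at t0)"
proof -
 have eq: "norm ((f t - f t0 - (t - t0) *\<^sub>R D) /\<^sub>R norm (t - t0)) = norm ((1 / (t - t0)) *\<^sub>R (f t - f t0) - D)" if "t ~= t0" for t
 proof -
  have "(1 / (t - t0)) *\<^sub>R (f t - f t0) - D = (1 / (t - t0)) *\<^sub>R (f t - f t0 - (t - t0) *\<^sub>R D)"
   using that by (simp add: scaleR_diff_right)
  thus ?thesis by (simp add: divide_inverse)
 qed
 have "((%t. norm ((f t - f t0 - (t - t0) *\<^sub>R D) /\<^sub>R norm (t - t0))) ---> 0) (at t0) \<longleftrightarrow>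
  ((%t. norm ((1 / (t - t0)) *\<^sub>R (f t - f t0) - D)) ---> 0) (at t0)"
  by (intro tendsto_cong) (unfold eventually_at_filter, intro always_eventually allI impI, rule eq)
 hence "((%t. (f t - f t0 - (t - t0) *\<^sub>R D) /\<^sub>R norm (t - t0)) ---> 0) (at t0) \<longleftrightarrow>
  ((%t. (1 / (t - t0)) *\<^sub>R (f t - f t0)) ---> D) (at t0)"
  unfolding tendsto_norm_zero_iff LIM_zero_iff .
 thus ?thesis unfolding has_vector_derivative_def has_derivative_at_within
  by (simp only: bounded_linear_scaleR_left simp_thms)
qed

text \<open>Differentiation under the integral sign.\<close>

lemma has_vector_derivative_integral:
 fixes f :: "real => 'b => complex"
 assumes delta: "delta > 0"
  and der: "!!t x. abs (t - t0) < delta ==> ((%t. f t x) has_vd f' t x) (at t)"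
  and int: "!!t. abs (t - t0) < delta ==> integrable N (f t)"
  and meas: "f' t0 : meas N"
  and dom: "!!t x. abs (t - t0) < delta ==> cmod (f' t x) <= h x" and h: "integrable N h"
 shows "((%t. \<integral>x. f t x \<partial>N) has_vd (LINT x|N. f' t0 x)) (at t0)"
proof -
 have lip: "cmod (f t x - f t0 x) <= h x * abs (t - t0)" if "abs (t - t0) < delta" for t x
 proof -
  have "norm (f t x - f t0 x) <= h x * norm (t - t0)"
  proof (rule differentiable_bound[of "{t0 - delta<..<t0 + delta}" _ "%t s. s *\<^sub>R f' t x"])
   show "((%t. f t x) has_derivative (%s. s *\<^sub>R f' u x)) (at u within {t0 - delta<..<t0 + delta})" if "u : {t0 - delta<..<t0 + delta}" for u
    using der[of u x] that by (auto simp: has_vector_derivative_def intro: has_derivative_at_withinI)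
   show "onorm (%s. s *\<^sub>R f' u x) <= h x" if "u : {t0 - delta<..<t0 + delta}" for u
   proof (rule onorm_bound)
    have u: "abs (u - t0) < delta" using that by auto
    show "0 <= h x" by (rule order.trans[OF norm_ge_zero dom[OF u]])
    show "norm (s *\<^sub>R f' u x) <= h x * norm s" for s
     using mult_right_mono[OF dom[OF u, of x], of "norm s"] by (simp add: mult.commute)
   qed
  qed (use that delta in auto)
  thus ?thesis by simp
 qed
 have "((%t. (1 / (t - t0)) *\<^sub>R ((LINT x|N. f t x) - (LINT x|N. f t0 x))) ---> (LINT x|N. f' t0 x)) (at t0)"
  unfolding tendsto_at_iff_sequentially o_def
 proof (intro allI impI)
  fix X :: "nat => real" assume X0: "ALL i. X i : UNIV - {t0}" and lim: "X ----> t0"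
  from lim delta have "eventually (%i. abs (X i - t0) < delta) sequentially"
   by (auto dest: tendstoD simp: dist_real_def)
  then obtain m where m: "!!i. i >= m ==> abs (X i - t0) < delta" by (auto simp: eventually_sequentially)
  define Y where "Y i = X (i + m)" for i
  have Y: "abs (Y i - t0) < delta" "Y i ~= t0" for i using m X0 by (auto simp: Y_def)
  have limY: "Y ----> t0" using lim by (simp add: Y_def[abs_def] LIMSEQ_ignore_initial_segment)
  have t0: "abs (t0 - t0) < delta" using delta by simp
  have "(%i. \<integral>x. (1 / (Y i - t0)) *\<^sub>R (f (Y i) x - f t0 x) \<partial>N) ----> (LINT x|N. f' t0 x)"
  proof (rule integral_dominated_convergence[OF meas _ h])
   show "(%x. (1 / (Y i - t0)) *\<^sub>R (f (Y i) x - f t0 x)) : meas N" for i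
    using int[OF Y(1)] int[OF t0] by (intro borel_measurable_scaleR borel_measurable_diff) auto
   show "AE x in N. (%i. (1 / (Y i - t0)) *\<^sub>R (f (Y i) x - f t0 x)) ----> f' t0 x"
   proof (intro AE_I2)
    fix x
    have "((%t. (1 / (t - t0)) *\<^sub>R (f t x - f t0 x)) ---> f' t0 x) (at t0)"
     using der[OF t0, of x] by (simp only: has_vector_derivative_iff_quotient)
    thus "(%i. (1 / (Y i - t0)) *\<^sub>R (f (Y i) x - f t0 x)) ----> f' t0 x"
     using Y limY unfolding tendsto_at_iff_sequentially o_def by auto
   qed
   show "AE x in N. norm ((1 / (Y i - t0)) *\<^sub>R (f (Y i) x - f t0 x)) <= h x" for i
   proof (intro AE_I2)
    fix x
    have "norm ((1 / (Y i - t0)) *\<^sub>R (f (Y i) x - f t0 x)) = cmod (f (Y i) x - f t0 x) / abs (Y i - t0)" by simp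
    also have "... <= h x" using lip[OF Y(1), of i x] Y(2)[of i] by (simp add: pos_divide_le_eq)
    finally show "norm ((1 / (Y i - t0)) *\<^sub>R (f (Y i) x - f t0 x)) <= h x" .
   qed
  qed
  moreover have "(LINT x|N. (1 / (Y i - t0)) *\<^sub>R (f (Y i) x - f t0 x)) = (1 / (Y i - t0)) *\<^sub>R ((LINT x|N. f (Y i) x) - (LINT x|N. f t0 x))" for i
   using int[OF Y(1)] int[OF t0] by simp
  ultimately have "(%i. (1 / (Y i - t0)) *\<^sub>R ((LINT x|N. f (Y i) x) - (LINT x|N. f t0 x))) ----> (LINT x|N. f' t0 x)"
   by (simp only:)
  thus "(%i. (1 / (X i - t0)) *\<^sub>R ((LINT x|N. f (X i) x) - (LINT x|N. f t0 x))) ----> (LINT x|N. f' t0 x)"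
   unfolding Y_def by (rule LIMSEQ_offset)
 qed
 thus ?thesis by (simp only: has_vector_derivative_iff_quotient)
qed

definition wt :: "real => complex" where "wt t = 1 / (1 + \<i> * of_real t)"

lemma wt_Re: "Re (wt t) = 1 / (1 + t^2)"
 by (simp add: wt_def Re_divide power2_eq_square)

lemma wt_nz: "1 + \<i> * complex_of_real t ~= 0"
 by (auto simp: complex_eq_iff)

lemma wt_norm: "cmod (wt t) <= 1"
proof -
 have "1 <= cmod (1 + \<i> * of_real t)" using complex_Re_le_cmod[of "1 + \<i> * of_real t"] by simp
 moreover have "cmod (1 + \<i> * of_real t) ~= 0" using wt_nz by simp
 ultimately show ?thesis by (simp add: wt_def norm_divide field_simps)
qed

lemma wt_power_deriv: "((%t. wt t ^ n) has_vd of_nat n * wt t ^ (n - 1) * (- \<i> * (wt t)^2)) (at t)"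
proof -
 have "((%z. (1 / (1 + \<i> * z)) ^ n) has_field_derivative of_nat n * wt t ^ (n - 1) * (- \<i> * (wt t)^2)) (at (of_real t))"
  using wt_nz[of t] by (auto intro!: derivative_eq_intros simp: wt_def power2_eq_square)
 thus ?thesis unfolding wt_def by (rule has_vector_derivative_real_field)
qed

locale quadratic_form =
 fixes Q :: "'e::euclidean_space => real" and b B :: real
 assumes Q_cont: "continuous_on UNIV Q"
  and Q_scale: "!!c x. Q (c *\<^sub>R x) = c^2 * Q x"
  and b_pos: "b > 0" and Q_lower: "!!x. b * (norm x)^2 <= Q x" and Q_upper: "!!x. Q x <= B * (norm x)^2"
begin

lemma Q_meas [measurable]: "Q : meas borel"
 using Q_cont by (rule borel_measurable_continuous_onI)

lemma Q_nonneg: "0 <= Q x"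
 using b_pos Q_lower[of x] by (meson mult_nonneg_nonneg less_imp_le order.trans zero_le_power2)

lemma Q_exp_integrable:
 assumes "a > 0" shows "integrable lborel (%x. exp (- (a * Q x)))"
proof (rule Bochner_Integration.integrable_bound)
 show "integrable lborel (%x::'e. exp (- (a * b) * (norm x)^2))"
  using assms b_pos by (intro integrable_gauss) simp
 show "AE x in lborel. norm (exp (- (a * Q x))) <= norm (exp (- (a * b) * (norm x)^2))"
  using mult_left_mono[OF Q_lower, of a] assms by (intro AE_I2) (simp add: mult.assoc)
qed measurable

lemma Q_exp_bound:
 assumes "a > 0" shows "Q x * exp (- (a * Q x)) <= (2 / a) * exp (- (a / 2 * Q x))"
proof -
 have "a / 2 * Q x <= exp (a / 2 * Q x)" using exp_ge_add_one_self[of "a / 2 * Q x"] by linarith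
 hence "Q x <= (2 / a) * exp (a / 2 * Q x)" using assms by (simp add: field_simps)
 hence "Q x * exp (- (a * Q x)) <= (2 / a) * exp (a / 2 * Q x) * exp (- (a * Q x))" by (intro mult_right_mono) auto
 also have "... = (2 / a) * exp (- (a / 2 * Q x))" by (simp add: mult.assoc exp_add[symmetric])
 finally show ?thesis .
qed

definition gint :: "complex => complex" where
 "gint w = (LBINT x. exp (- (w * of_real (Q x))))"

lemma cexp_norm: "cmod (exp (- (w * of_real (Q x)))) = exp (- (Re w * Q x))"
 by simp

lemma gint_integrable:
 assumes "Re w > 0" shows "integrable lborel (%x. exp (- (w * of_real (Q x))))"
proof (rule Bochner_Integration.integrable_bound[OF Q_exp_integrable[OF assms]])
 show "AE x in lborel. norm (exp (- (w * of_real (Q x)))) <= norm (exp (- (Re w * Q x)))"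
  by simp
qed measurable

text \<open>The derivative of the integral under dilation, computed in two ways.\<close>

lemma gint_radial:
 assumes w: "Re w > 0"
 shows "w * (LBINT x. of_real (Q x) * exp (- (w * of_real (Q x)))) = of_nat DIM('e) / 2 * gint w"
proof -
 let ?f = "%r x. exp (- (of_real r * w * of_real (Q x)))"
 let ?f' = "%r x. - (w * of_real (Q x)) * exp (- (of_real r * w * of_real (Q x)))"
 define a where "a = Re w / 2"
 have a: "a > 0" using w by (simp add: a_def)
 have "((%r. \<integral>x. ?f r x \<partial>lborel) has_vd (LBINT x. ?f' 1 x)) (at 1)"
 proof (rule has_vector_derivative_integral[where delta = "1/2" and h = "%x. cmod w * ((2 / a) * exp (- (a / 2 * Q x)))"])
  fix t :: real assume t: "abs (t - 1) < 1 / 2"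
  hence t2: "t > 1/2" by linarith
  show "integrable lborel (?f t)" using gint_integrable[of "of_real t * w"] t2 w by simp
  fix x
  show "((%t. ?f t x) has_vd ?f' t x) (at t)"
   by (rule has_vector_derivative_real_field) (auto intro!: derivative_eq_intros)
  have "cmod (?f' t x) = cmod w * (Q x * exp (- (t * Re w * Q x)))"
   by (simp add: norm_mult abs_of_nonneg[OF Q_nonneg])
  also have "... <= cmod w * (Q x * exp (- (a * Q x)))"
  proof (intro mult_left_mono)
   have "a * Q x <= t * Re w * Q x" using t2 w Q_nonneg by (intro mult_right_mono) (auto simp: a_def)
   thus "exp (- (t * Re w * Q x)) <= exp (- (a * Q x))" by simp
  qed (auto simp: Q_nonneg)
  also have "... <= cmod w * ((2 / a) * exp (- (a / 2 * Q x)))" by (intro mult_left_mono Q_exp_bound a) auto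
  finally show "cmod (?f' t x) <= cmod w * ((2 / a) * exp (- (a / 2 * Q x)))" .
 next
  show "integrable lborel (%x. cmod w * ((2 / a) * exp (- (a / 2 * Q x))))"
   using a by (intro integrable_mult_right Q_exp_integrable) auto
 qed (auto)
 moreover have "((%r. \<integral>x. ?f r x \<partial>lborel) has_vd - (of_nat DIM('e) / 2 * gint w)) (at 1)"
 proof (rule has_vector_derivative_transform_within_open[where S = "{0<..}"])
  have "((%r. (1 / sqrt r) ^ DIM('e)) has_real_derivative - (real DIM('e) / 2)) (at 1)"
   by (auto intro!: derivative_eq_intros)
  from has_vector_derivative_scaleR[OF this has_vector_derivative_const[of "gint w"]]
  show "((%r. ((1 / sqrt r) ^ DIM('e)) *\<^sub>R gint w) has_vd - (of_nat DIM('e) / 2 * gint w)) (at 1)"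
   by (simp add: scaleR_conv_of_real)
  fix r :: real assume "r : {0<..}"
  hence r: "r > 0" by simp
  have "(LBINT x. ?f r x) = ((1 / sqrt r) ^ DIM('e)) *\<^sub>R (LBINT x. ?f r (0 + (1 / sqrt r) *\<^sub>R x))"
   using r by (intro integral_scale) auto
  also have "(%x. ?f r (0 + (1 / sqrt r) *\<^sub>R x)) = (%x. exp (- (w * of_real (Q x))))"
   using r by (simp add: Q_scale power_divide fun_eq_iff del: scaleR_scaleR)
  finally show "((1 / sqrt r) ^ DIM('e)) *\<^sub>R gint w = (LBINT x. ?f r x)" by (simp add: gint_def)
 qed auto
 ultimately have "(LBINT x. ?f' 1 x) = - (of_nat DIM('e) / 2 * gint w)" by (rule vector_derivative_unique_at)
 moreover have "(LBINT x. ?f' 1 x) = - (w * (LBINT x. of_real (Q x) * exp (- (w * of_real (Q x)))))"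
  by (simp add: mult.assoc)
 ultimately show ?thesis by simp
qed

lemma gint_deriv:
 "((%t. gint (wt t)) has_vd \<i> * wt t * (of_nat DIM('e) / 2) * gint (wt t)) (at t)"
proof -
 define a where "a = 1 / (1 + (abs t + 1)^2)"
 have a: "a > 0" by (simp add: a_def add_pos_nonneg)
 let ?f' = "%t x. \<i> * (wt t)^2 * (of_real (Q x) * exp (- (wt t * of_real (Q x))))"
 have "((%t. \<integral>x. exp (- (wt t * of_real (Q x))) \<partial>lborel) has_vd (LBINT x. ?f' t x)) (at t)"
 proof (rule has_vector_derivative_integral[where delta = 1 and h = "%x. (2 / a) * exp (- (a / 2 * Q x))"])
  fix s :: real assume s: "abs (s - t) < 1"
  have "s^2 <= (abs t + 1)^2" using s by (intro power2_le_iff_abs_le[THEN iffD2]) auto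
  hence aw: "a <= Re (wt s)" unfolding wt_Re a_def by (intro divide_left_mono) (auto simp: add_pos_nonneg)
  show "integrable lborel (%x. exp (- (wt s * of_real (Q x))))"
   using aw a by (intro gint_integrable) auto
  fix x
  show "((%t. exp (- (wt t * of_real (Q x)))) has_vd ?f' s x) (at s)"
  proof -
   have "((%z. exp (- (1 / (1 + \<i> * z) * of_real (Q x)))) has_field_derivative ?f' s x) (at (of_real s))"
    using wt_nz[of s] by (auto intro!: derivative_eq_intros simp: wt_def power2_eq_square)
   thus ?thesis unfolding wt_def by (rule has_vector_derivative_real_field)
  qed
  have "cmod (?f' s x) = (cmod (wt s))^2 * (Q x * exp (- (Re (wt s) * Q x)))"
   by (simp add: norm_mult norm_power abs_of_nonneg[OF Q_nonneg])
  also have "... <= 1 * (Q x * exp (- (a * Q x)))"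
   using wt_norm aw Q_nonneg by (intro mult_mono power_le_one) (auto intro: mult_right_mono)
  also have "... <= (2 / a) * exp (- (a / 2 * Q x))" using Q_exp_bound[OF a] by simp
  finally show "cmod (?f' s x) <= (2 / a) * exp (- (a / 2 * Q x))" .
 next
  show "integrable lborel (%x. (2 / a) * exp (- (a / 2 * Q x)))"
   using a by (intro integrable_mult_right Q_exp_integrable) auto
 qed auto
 moreover have "(LBINT x. ?f' t x) = \<i> * wt t * (of_nat DIM('e) / 2 * gint (wt t))"
 proof -
  have w: "Re (wt t) > 0" by (simp add: wt_Re add_pos_nonneg)
  have "(LBINT x. ?f' t x) = \<i> * wt t * (wt t * (LBINT x. of_real (Q x) * exp (- (wt t * of_real (Q x)))))"
   by (simp add: power2_eq_square mult.assoc)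
  thus ?thesis unfolding gint_radial[OF w] .
 qed
 ultimately have "((%t. \<integral>x. exp (- (wt t * of_real (Q x))) \<partial>lborel) has_vd \<i> * wt t * (of_nat DIM('e) / 2 * gint (wt t))) (at t)"
  by (simp only:)
 thus ?thesis unfolding gint_def by (simp only: mult.assoc)
qed

text \<open>By a differential equation, \<open>(gint w)^2 w^n\<close> does not depend on the time, so oscillation does not make the integral
 smaller than at the real time.\<close>

lemma gint_lower: "(1 / sqrt B) ^ DIM('e) * gauss_mass TYPE('e) <= cmod (gint (wt t))"
proof -
 let ?n = "DIM('e)"
 let ?P = "%t. (gint (wt t))^2 * (wt t) ^ ?n"
 have "(?P has_vd 0) (at t)" for t
 proof -
  let ?d = "\<i> * wt t * (of_nat ?n / 2) * gint (wt t)"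
  have n: "wt t ^ (?n - 1) * wt t = wt t ^ ?n" by (metis DIM_positive power_minus_mult)
  have d: "(?P has_vd (gint (wt t))^2 * (of_nat ?n * wt t ^ (?n - 1) * (- \<i> * (wt t)^2)) + (gint (wt t) * ?d + ?d * gint (wt t)) * wt t ^ ?n) (at t)"
   unfolding power2_eq_square[of "gint _"]
   by (intro has_vector_derivative_mult gint_deriv wt_power_deriv)
  have "(gint (wt t))^2 * (of_nat ?n * wt t ^ (?n - 1) * (- \<i> * (wt t)^2)) = - ((gint (wt t))^2 * of_nat ?n * \<i> * wt t * (wt t ^ (?n - 1) * wt t))"
   by (simp add: power2_eq_square)
  moreover have "(gint (wt t) * ?d + ?d * gint (wt t)) * wt t ^ ?n = (gint (wt t))^2 * of_nat ?n * \<i> * wt t * wt t ^ ?n"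
   by (simp add: power2_eq_square)
  ultimately have "(gint (wt t))^2 * (of_nat ?n * wt t ^ (?n - 1) * (- \<i> * (wt t)^2)) + (gint (wt t) * ?d + ?d * gint (wt t)) * wt t ^ ?n = 0"
   unfolding n by (simp only: add.left_inverse)
  with d show ?thesis by (simp only:)
 qed
 hence d0: "(?P has_vd 0) (at t within UNIV)" for t by (rule has_vector_derivative_at_within)
 obtain c where c: "!!t. t : UNIV ==> ?P t = c"
  using has_vector_derivative_zero_constant[OF convex_UNIV d0] by metis
 have w0: "wt 0 = 1" by (simp add: wt_def)
 have eq: "(gint (wt t))^2 * (wt t) ^ ?n = (gint 1)^2"
  using trans[OF c[of t] c[of 0, symmetric]] unfolding w0 by simp
 have "(cmod (gint 1))^2 = (cmod (gint (wt t)))^2 * (cmod (wt t)) ^ ?n"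
  by (simp only: norm_mult[symmetric] norm_power[symmetric] eq)
 also have "... <= (cmod (gint (wt t)))^2 * 1"
  using wt_norm by (intro mult_left_mono power_le_one) auto
 finally have 1: "cmod (gint 1) <= cmod (gint (wt t))" by (simp add: power_mono_iff)
 have Bpos: "B > 0"
 proof -
  obtain x :: 'e where x: "x : Basis" using nonempty_Basis by blast
  hence "b <= B" using Q_lower[of x] Q_upper[of x] by simp
  thus ?thesis using b_pos by simp
 qed
 have "gint 1 = of_real (LBINT x. exp (- Q x))"
 proof -
  have "exp (- (1 * complex_of_real (Q x))) = of_real (exp (- Q x))" for x by (simp add: exp_of_real[symmetric])
  thus ?thesis unfolding gint_def by (simp only: integral_complex_of_real)
 qed
 hence "cmod (gint 1) = (LBINT x. exp (- Q x))" by simp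
 also have "... >= (LBINT (x::'e). exp (- B * (norm x)^2))"
  using Q_upper Q_exp_integrable[of 1] Bpos by (intro integral_mono integrable_gauss) auto
 finally have 2: "(LBINT (x::'e). exp (- B * (norm x)^2)) <= cmod (gint 1)" .
 have "ennreal (LBINT (x::'e). exp (- B * (norm x)^2)) = ennreal ((1 / sqrt B) ^ DIM('e) * gauss_mass TYPE('e))"
 proof -
  have "nint lborel (%(x::'e). ennreal (exp (- B * (norm x)^2))) = ennreal (LBINT (x::'e). exp (- B * (norm x)^2))"
   by (rule nn_integral_eq_integral[OF integrable_gauss[OF Bpos]]) simp
  thus ?thesis using nn_integral_gauss[OF Bpos, of "0::'e"] by (simp only: diff_zero)
 qed
 hence "(LBINT (x::'e). exp (- B * (norm x)^2)) = (1 / sqrt B) ^ DIM('e) * gauss_mass TYPE('e)"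
  using Bpos gauss_mass(2)[where 'e='e] by (subst (asm) ennreal_inj) auto
 thus ?thesis using 1 2 by simp
qed

end

section \<open>Quadratic forms inverse to a positive definite matrix\<close>

lemma inner_matrix_vector_transpose: "(u::real^'n::finite) \<bullet> (G *v v) = (transpose G *v u) \<bullet> v"
 by (metis dot_lmul_matrix transpose_matrix_vector)

locale positive_matrix =
 fixes G :: "real^'n::finite^'n" and lo up :: real
 assumes sym: "transpose G = G" and lam: "lo > 0" and Lam: "up > 0"
  and lower: "!!v. lo * (norm v)^2 <= v \<bullet> (G *v v)" and upper: "!!v. norm (G *v v) <= up * norm v"
begin

definition Bi :: "real^'n^'n" where "Bi = matrix_inv G"

lemma G_invertible: "invertible G"
proof -
 have "G *v v ~= 0" if "v ~= 0" for v
 proof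
  assume "G *v v = 0"
  hence "lo * (norm v)^2 <= 0" using lower[of v] by simp
  thus False using lam that by (simp add: mult_le_0_iff)
 qed
 thus ?thesis using matrix_left_invertible_ker[of G] invertible_left_inverse[of G] by blast
qed

lemma Bi_inv: "G ** Bi = mat 1" "Bi ** G = mat 1"
 using someI_ex[OF G_invertible[unfolded invertible_def]] by (simp_all add: Bi_def matrix_inv_def)

lemma GB: "G *v (Bi *v z) = z" "Bi *v (G *v z) = z"
 by (simp_all add: matrix_vector_mul_assoc Bi_inv)

lemma Bi_sym: "transpose Bi = Bi"
proof -
 have "transpose Bi = transpose Bi ** (G ** Bi)" by (simp add: Bi_inv)
 also have "... = (transpose Bi ** transpose G) ** Bi" by (simp add: sym matrix_mul_assoc)
 also have "transpose Bi ** transpose G = mat 1" by (metis Bi_inv(1) matrix_transpose_mul transpose_mat)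
 finally show ?thesis by simp
qed

lemma Bi_norm: "norm (Bi *v z) <= norm z / lo"
proof -
 let ?w = "Bi *v z"
 have "lo * (norm ?w)^2 <= ?w \<bullet> z" using lower[of ?w] by (simp add: GB)
 also have "... <= norm ?w * norm z" by (rule norm_cauchy_schwarz)
 finally have "lo * norm ?w * norm ?w <= norm z * norm ?w" by (simp add: power2_eq_square algebra_simps)
 hence "lo * norm ?w <= norm z" by (cases "norm ?w = 0") (auto simp: mult_le_cancel_right)
 thus ?thesis using lam by (simp add: field_simps)
qed

lemma Bi_form: "z \<bullet> (Bi *v z) = (Bi *v z) \<bullet> (G *v (Bi *v z))"
 by (simp add: GB inner_commute)

lemma Bi_lower: "(lo / up^2) * (norm z)^2 <= z \<bullet> (Bi *v z)"
proof -
 let ?w = "Bi *v z"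
 have "norm z <= up * norm ?w" using upper[of ?w] by (simp add: GB)
 hence "(norm z)^2 <= (up * norm ?w)^2" by (intro power_mono) auto
 hence "(lo / up^2) * (norm z)^2 <= (lo / up^2) * (up * norm ?w)^2" using lam by (intro mult_left_mono) auto
 also have "... = lo * (norm ?w)^2" using Lam by (simp add: power_mult_distrib)
 finally show ?thesis using lower[of ?w] by (simp add: Bi_form)
qed

lemma Bi_upper: "z \<bullet> (Bi *v z) <= (1 / lo) * (norm z)^2"
proof -
 have "z \<bullet> (Bi *v z) <= norm z * norm (Bi *v z)" by (rule norm_cauchy_schwarz)
 also have "... <= norm z * (norm z / lo)" by (intro mult_left_mono Bi_norm) auto
 finally show ?thesis by (simp add: power2_eq_square)
qed

lemma Bi_entry: "abs (Bi $ i $ j) <= 1 / lo"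
proof -
 have "Bi $ i $ j = (Bi *v axis j 1) $ i" by (simp add: matrix_vector_mult_basis column_def)
 also have "abs (...) <= norm (Bi *v axis j 1)" by (rule component_le_norm_cart)
 also have "... <= 1 / lo" using Bi_norm[of "axis j 1"] by simp
 finally show ?thesis .
qed

lemma trace_GB: "dsum (%i j. G $ i $ j * Bi $ i $ j) = real CARD('n)"
proof -
 have "dsum (%i j. G $ i $ j * Bi $ i $ j) = (SUM i:UNIV. (G ** Bi) $ i $ i)"
 proof -
  have "Bi $ i $ j = Bi $ j $ i" for i j using Bi_sym by (metis transpose_def vec_lambda_beta)
  thus ?thesis by (simp add: matrix_matrix_mult_def)
 qed
 thus ?thesis by (simp add: Bi_inv mat_def)
qed

definition Qf :: "real^'n => real" where "Qf z = (z \<bullet> (Bi *v z)) / 4"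

sublocale quadratic_form Qf "lo / (4 * up^2)" "1 / (4 * lo)"
proof
 show "continuous_on UNIV Qf" unfolding Qf_def[abs_def]
  by (intro continuous_intros linear_continuous_on) (simp add: matrix_vector_mul_bounded_linear)
 show "Qf (c *\<^sub>R x) = c^2 * Qf x" for c x by (simp add: Qf_def matrix_vector_mult_scaleR power2_eq_square)
 show "0 < lo / (4 * up^2)" using lam Lam by simp
 show "lo / (4 * up^2) * (norm x)^2 <= Qf x" for x using Bi_lower[of x] by (simp add: Qf_def)
 show "Qf x <= 1 / (4 * lo) * (norm x)^2" for x using Bi_upper[of x] by (simp add: Qf_def)
qed

lemma Qf_deriv: "((%x. Qf (x - xi)) has_derivative (%v. (v \<bullet> (Bi *v (x - xi))) / 2)) (at x)"
proof -
 have "((%x. (x - xi) \<bullet> (Bi *v (x - xi)) / 4) has_derivative (%v. ((x - xi) \<bullet> (Bi *v v) + v \<bullet> (Bi *v (x - xi))) / 4)) (at x)"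
  by (auto intro!: derivative_eq_intros bounded_linear.has_derivative[OF matrix_vector_mul_bounded_linear])
 moreover have "(x - xi) \<bullet> (Bi *v v) = v \<bullet> (Bi *v (x - xi))" for v
  using inner_matrix_vector_transpose[of "x - xi" Bi v] by (simp add: Bi_sym inner_commute)
 ultimately show ?thesis by (simp add: Qf_def[abs_def])
qed

text \<open>The exponent of the Gaussian at complex time; \<open>kap\<close> is the reciprocal of the time.\<close>

definition qexp :: "complex => real^'n => real^'n => complex" where
 "qexp kap xi x = - (kap * of_real (Qf (x - xi)))"

lemma smooth_qexp: "smooth_on UNIV (qexp kap xi)"
 unfolding smooth_on_def
proof
 fix k
 have "Ck_on k UNIV (%x. (- kap / 4) * of_real ((x - xi) \<bullet> (Bi *v (x - xi))))"
  by (intro Ck_on_linear[OF open_UNIV bounded_linear_mult_right] Ck_on_linear[OF open_UNIV bounded_linear_of_real]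
    Ck_on_bilinear[OF open_UNIV bounded_bilinear_inner] Ck_on_diff_const open_UNIV
    Ck_on_linear[OF open_UNIV matrix_vector_mul_bounded_linear])
 moreover have "qexp kap xi = (%x. (- kap / 4) * of_real ((x - xi) \<bullet> (Bi *v (x - xi))))"
  by (simp add: fun_eq_iff qexp_def Qf_def)
 ultimately show "Ck_on k UNIV (qexp kap xi)" by simp
qed

lemma qexp_partial: "pd i (qexp kap xi) = (%x. - (kap / 2) * of_real ((Bi *v (x - xi)) $ i))"
proof
 fix x
 have "(qexp kap xi has_derivative (%v. - (kap * of_real ((v \<bullet> (Bi *v (x - xi))) / 2)))) (at x)"
  unfolding qexp_def[abs_def] by (intro has_derivative_minus has_derivative_mult_right has_derivative_of_real Qf_deriv)
 from partial_deriv_eqI[OF this, of i] show "pd i (qexp kap xi) x = - (kap / 2) * of_real ((Bi *v (x - xi)) $ i)"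
  by (simp add: inner_axis' mult.commute)
qed

lemma qexp_partial2: "pd i (pd j (qexp kap xi)) x = - (kap / 2) * of_real (Bi $ i $ j)"
proof -
 have l: "bounded_linear (%x. (Bi *v x) $ j)"
  by (intro bounded_linear_compose[OF bounded_linear_vec_nth] matrix_vector_mul_bounded_linear)
 have "((%x. (Bi *v (x - xi)) $ j) has_derivative (%v. (Bi *v v) $ j)) (at x)"
  by (rule bounded_linear.has_derivative[OF l]) (auto intro!: derivative_eq_intros)
 hence "((%x. - (kap / 2) * of_real ((Bi *v (x - xi)) $ j)) has_derivative (%v. - (kap / 2) * of_real ((Bi *v v) $ j))) (at x)"
  by (intro has_derivative_mult_right has_derivative_of_real)
 from partial_deriv_eqI[OF this, of i] have "pd i (pd j (qexp kap xi)) x = - (kap / 2) * of_real ((Bi *v axis i 1) $ j)"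
  by (simp only: qexp_partial)
 also have "(Bi *v axis i 1) $ j = Bi $ i $ j"
  using Bi_sym by (metis matrix_vector_mult_basis column_def transpose_def vec_lambda_beta)
 finally show ?thesis .
qed

text \<open>The Gaussian solves the heat equation with coefficients \<open>G\<close>.\<close>

lemma heat_identity:
 "dsum (%i j. of_real (G $ i $ j) * (pd i (pd j (qexp kap xi)) x
   + pd i (qexp kap xi) x * pd j (qexp kap xi) x))
  = - (kap / 2) * of_nat CARD('n) + kap^2 * of_real (Qf (x - xi))"
proof -
 let ?w = "Bi *v (x - xi)"
 have form: "dsum (%i j. G $ i $ j * (?w $ i * ?w $ j)) = 4 * Qf (x - xi)"
 proof -
  have "4 * Qf (x - xi) = ?w \<bullet> (G *v ?w)" by (simp add: Qf_def Bi_form)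
  also have "... = dsum (%i j. G $ i $ j * (?w $ i * ?w $ j))"
   by (simp add: inner_vec_def matrix_vector_mult_def sum_distrib_left ac_simps)
  finally show ?thesis by simp
 qed
 have "dsum (%i j. of_real (G $ i $ j) * (pd i (pd j (qexp kap xi)) x
   + pd i (qexp kap xi) x * pd j (qexp kap xi) x)) =
  - (kap / 2) * of_real (SUM i:UNIV. SUM j:UNIV. G $ i $ j * Bi $ i $ j)
   + (kap^2 / 4) * of_real (SUM i:UNIV. SUM j:UNIV. G $ i $ j * (?w $ i * ?w $ j))"
  unfolding qexp_partial2 unfolding qexp_partial
  by (simp add: distrib_left right_diff_distrib sum.distrib sum_subtractf sum_distrib_left sum_negf power2_eq_square ac_simps)
 also have "... = - (kap / 2) * of_nat CARD('n) + kap^2 * of_real (Qf (x - xi))"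
  unfolding form trace_GB by simp
 finally show ?thesis .
qed

end

lemma polynomial_gauss_bound:
 fixes beta y :: real
 assumes "beta > 0" "0 <= y"
 shows "(1 + 2 * y + y ^ 3) * exp (- beta * y^2) <= 2 + 3 / (2 * beta) + 1 / beta^2"
proof -
 have e: "1 + beta * y^2 + (beta * y^2)^2 / 2 <= exp (beta * y^2)"
  using exp_lower_Taylor_quadratic[of "beta * y^2"] assms by simp
 have "2 * y <= 1 + y^2" using zero_le_power2[of "y - 1"] by (simp add: power2_diff)
 moreover have "y ^ 3 <= (y^2 + y ^ 4) / 2"
  using mult_nonneg_nonneg[OF zero_le_power2[of y] zero_le_power2[of "y - 1"]] by (simp add: power2_eq_square power3_eq_cube power4_eq_xxxx algebra_simps)
 ultimately have "1 + 2 * y + y ^ 3 <= 2 + 3 / 2 * y^2 + y ^ 4 / 2" by simp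
 also have "... = 2 * 1 + (3 / (2 * beta)) * (beta * y^2) + (1 / beta^2) * ((beta * y^2)^2 / 2)"
  using assms by (simp add: field_simps power2_eq_square power4_eq_xxxx)
 also have "... <= 2 * exp (beta * y^2) + (3 / (2 * beta)) * exp (beta * y^2) + (1 / beta^2) * exp (beta * y^2)"
 proof -
  have nn: "0 <= beta * y^2" "0 <= (beta * y^2)^2" using assms by auto
  have "1 <= exp (beta * y^2)" "beta * y^2 <= exp (beta * y^2)" "(beta * y^2)^2 / 2 <= exp (beta * y^2)"
   using e nn by linarith+
  thus ?thesis using assms by (intro add_mono mult_left_mono) auto
 qed
 finally have "1 + 2 * y + y ^ 3 <= (2 + 3 / (2 * beta) + 1 / beta^2) * exp (beta * y^2)" by (simp add: algebra_simps)
 hence "(1 + 2 * y + y ^ 3) * exp (- beta * y^2) <= (2 + 3 / (2 * beta) + 1 / beta^2) * exp (beta * y^2) * exp (- beta * y^2)"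
  by (intro mult_right_mono) auto
 thus ?thesis by (simp add: mult.assoc exp_add[symmetric])
qed

section \<open>Gaussians in a coordinate ball\<close>

definition frozen :: "(real^'n => complex^'n^'n) => real^'n => real^'n^'n::finite" where
 "frozen a xi = (\<chi> i j. - (Re (a xi $ i $ j) + Re (a xi $ j $ i)) / 2)"

lemma partial_deriv_cmult:
 "smooth_on UNIV f ==> pd i (%x. k * f x) = (%x. k * pd i f x)"
 by (rule ext) (simp add: partial_deriv_mult smooth_on_differentiable)

lemma inverse_sqrt_power_deriv:
 assumes "r > 0" "n > 0"
 shows "((%r. (1 / sqrt r) ^ n) has_real_derivative - (real n / (2 * r)) * (1 / sqrt r) ^ n) (at r)"
proof -
 obtain k where n: "n = Suc k" using assms by (cases n) auto
 have "((%r. 1 / sqrt r) has_real_derivative - (1 / (2 * r * sqrt r))) (at r)"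
  using assms by (auto intro!: derivative_eq_intros simp: field_simps)
 from DERIV_power[OF this, of n] show ?thesis using assms unfolding n by (simp add: field_simps)
qed

text \<open>The terms that remain when the leading ones have cancelled. Here \<open>y\<close> is the distance in units of \<open>sqrt r\<close>, and every
 group loses at most one factor \<open>1 / sqrt r\<close>.\<close>

lemma bracket_bound:
 fixes A B Dij Q2 E :: "'n::finite => 'n => complex" and Di Q1 F :: "'n => complex"
 assumes c: "1 <= C" "1 <= l" "1 <= mu" "0 < r" "r <= 1" "0 <= y"
  and A: "!!i j. cmod (E i j) <= l * (sqrt r * y)" "!!i j. cmod (B i j) <= C" "!!i. cmod (F i) <= C" "cmod q <= C"
  and D: "cmod D <= C" "!!i. cmod (Di i) <= C" "!!i j. cmod (Dij i j) <= C"
  and Q: "!!i. cmod (Q1 i) <= mu * (y / sqrt r)" "!!i j. cmod (Q2 i j) <= mu / r"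
 shows "cmod (D * dsum (%i j. E i j * (Q2 i j + Q1 i * Q1 j))
  + dsum (%i j. B i j * (Dij i j + Di j * Q1 i + Di i * Q1 j))
  + (SUM i:UNIV. F i * (Di i + D * Q1 i)) + q * D)
  <= 3 * (real CARD('n))^2 * C^2 * l * mu^2 * (1 / sqrt r) * (1 + 2 * y + y ^ 3)"
proof -
 define N where "N = real CARD('n)"
 have N: "1 <= N" by (simp add: N_def Suc_leI)
 have N2: "1 <= N^2" "N <= N^2" using N by (auto simp: power2_eq_square mult_ge1_I)
 define s where "s = sqrt r"
 have s: "0 < s" "s <= 1" "r = s^2" using c by (auto simp: s_def)
 have s1: "1 <= 1 / s" using s by (simp add: field_simps)
 \<comment> \<open>a common bound of the constants in all groups, up to the number of terms\<close>
 define Z where "Z = C^2 * l * mu^2 * (1 / s)"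
 have C2: "C <= C^2" using c by (simp add: power2_eq_square)
 have m2: "mu <= mu^2" "1 <= mu^2" using c by (auto simp: power2_eq_square mult_ge1_I)
 have Z1: "C^2 <= Z"
 proof -
  have "C^2 * 1 * 1 * 1 <= Z" unfolding Z_def using c s1 m2 by (intro mult_mono) auto
  thus ?thesis by simp
 qed
 have Z2: "C^2 * (mu * (1 / s)) <= Z"
 proof -
  have "C^2 * 1 * mu * (1 / s) <= Z" unfolding Z_def using c s1 m2 s by (intro mult_mono) auto
  thus ?thesis by simp
 qed
 have Z3: "C * l * mu * (1 / s) <= Z" "C * l * mu^2 * (1 / s) <= Z"
  unfolding Z_def using c s m2 C2 by (intro mult_mono mult_nonneg_nonneg; simp)+
 have Z0: "0 <= Z" using Z1 c by (meson order.trans zero_le_power2)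
 note nb = sum_norm_bound[where S = "UNIV :: 'n set"]
 have nb2: "norm (SUM i:UNIV. SUM j:UNIV. f i j) <= N^2 * X" if "!!i j. norm (f i j) <= X" for f :: "'n => 'n => complex" and X
 proof -
  have "norm (SUM j:UNIV. f i j) <= N * X" for i unfolding N_def by (rule sum_norm_bound) (rule that)
  hence "norm (SUM i:UNIV. SUM j:UNIV. f i j) <= N * (N * X)" unfolding N_def by (rule sum_norm_bound)
  thus ?thesis by (simp add: power2_eq_square mult.assoc)
 qed
 have q1: "cmod (Q1 i) <= mu * (1 / s) * y" for i using Q(1)[of i] by (simp add: s_def)
 have t1: "cmod (D * dsum (%i j. E i j * (Q2 i j + Q1 i * Q1 j))) <= N^2 * (Z * (y + y ^ 3))"
 proof -
  have "norm (D * (E i j * (Q2 i j + Q1 i * Q1 j))) <= Z * (y + y ^ 3)" for i j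
  proof -
   have "norm (Q1 i * Q1 j) <= (mu * (1 / s) * y) * (mu * (1 / s) * y)"
    unfolding norm_mult by (intro mult_mono q1) (use c s in auto)
   hence "norm (Q2 i j + Q1 i * Q1 j) <= mu / r + (mu * (1 / s) * y) * (mu * (1 / s) * y)"
    by (intro order.trans[OF norm_triangle_ineq] add_mono Q)
   hence "norm (D * (E i j * (Q2 i j + Q1 i * Q1 j))) <= C * ((l * (sqrt r * y)) * (mu / r + (mu * (1 / s) * y) * (mu * (1 / s) * y)))"
    unfolding norm_mult using c D A by (intro mult_mono) auto
   also have "... = (C * l * mu * (1 / s)) * y + (C * l * mu^2 * (1 / s)) * y ^ 3"
    using s by (simp add: s_def[symmetric]) (simp add: field_simps power2_eq_square power3_eq_cube)
   also have "... <= Z * y + Z * y ^ 3" using Z3 c by (intro add_mono mult_right_mono) auto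
   finally show ?thesis by (simp add: algebra_simps)
  qed
  thus ?thesis unfolding sum_distrib_left by (rule nb2)
 qed
 have dq: "norm (e * Q1 i) <= C * (mu * (1 / s) * y)" if "norm e <= C" for e i
  unfolding norm_mult using c s by (intro mult_mono q1 that) auto
 have t2: "cmod (SUM i:UNIV. SUM j:UNIV. B i j * (Dij i j + Di j * Q1 i + Di i * Q1 j)) <= N^2 * (Z * (1 + 2 * y))"
 proof (rule nb2)
  fix i j
  have "norm (Dij i j + Di j * Q1 i + Di i * Q1 j) <= C + C * (mu * (1 / s) * y) + C * (mu * (1 / s) * y)"
   by (intro order.trans[OF norm_triangle_ineq] add_mono D dq)
  hence "norm (B i j * (Dij i j + Di j * Q1 i + Di i * Q1 j)) <= C * (C + C * (mu * (1 / s) * y) + C * (mu * (1 / s) * y))"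
   unfolding norm_mult using c A by (intro mult_mono) auto
  also have "... = C^2 + 2 * (C^2 * (mu * (1 / s)) * y)" by (simp add: algebra_simps power2_eq_square)
  also have "... <= Z + 2 * (Z * y)" using Z1 Z2 c by (intro add_mono mult_left_mono mult_right_mono) auto
  finally show "norm (B i j * (Dij i j + Di j * Q1 i + Di i * Q1 j)) <= Z * (1 + 2 * y)" by (simp add: algebra_simps)
 qed
 have t3: "cmod (SUM i:UNIV. F i * (Di i + D * Q1 i)) <= N^2 * (Z * (1 + y))"
 proof -
  have "norm (F i * (Di i + D * Q1 i)) <= Z * (1 + y)" for i
  proof -
   have "norm (Di i + D * Q1 i) <= C + C * (mu * (1 / s) * y)"
    by (intro order.trans[OF norm_triangle_ineq] add_mono D dq)
   hence "norm (F i * (Di i + D * Q1 i)) <= C * (C + C * (mu * (1 / s) * y))"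
    unfolding norm_mult using c A by (intro mult_mono) auto
   also have "... = C^2 + C^2 * (mu * (1 / s)) * y" by (simp add: algebra_simps power2_eq_square)
   also have "... <= Z + Z * y" using Z1 Z2 c by (intro add_mono mult_left_mono mult_right_mono) auto
   finally show ?thesis by (simp add: algebra_simps)
  qed
  hence "cmod (SUM i:UNIV. F i * (Di i + D * Q1 i)) <= N * (Z * (1 + y))" unfolding N_def by (rule sum_norm_bound)
  also have "... <= N^2 * (Z * (1 + y))" using N2 Z0 c by (intro mult_right_mono) auto
  finally show ?thesis .
 qed
 have t4: "cmod (q * D) <= N^2 * Z"
 proof -
  have "cmod (q * D) <= C * C" unfolding norm_mult using A D c by (intro mult_mono) auto
  also have "... <= 1 * Z" using Z1 by (simp add: power2_eq_square)
  also have "... <= N^2 * Z" using N2 Z0 by (intro mult_right_mono) auto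
  finally show ?thesis .
 qed
 have "cmod (D * dsum (%i j. E i j * (Q2 i j + Q1 i * Q1 j))
  + dsum (%i j. B i j * (Dij i j + Di j * Q1 i + Di i * Q1 j))
  + (SUM i:UNIV. F i * (Di i + D * Q1 i)) + q * D)
  <= N^2 * (Z * (y + y ^ 3)) + N^2 * (Z * (1 + 2 * y)) + N^2 * (Z * (1 + y)) + N^2 * Z"
  by (intro norm_add_rule_thm t1 t2 t3 t4)
 also have "... = N^2 * Z * (3 + 4 * y + y ^ 3)" by (simp add: algebra_simps)
 also have "... <= N^2 * Z * (3 * (1 + 2 * y + y ^ 3))" using c Z0 by (intro mult_left_mono) (auto simp: zero_le_power)
 finally show ?thesis by (simp add: N_def Z_def s_def algebra_simps)
qed

lemma (in positive_matrix) Bi_commute: "Bi $ i $ j = Bi $ j $ i"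
proof -
 have "Bi $ i $ j = transpose Bi $ i $ j" by (simp only: Bi_sym)
 thus ?thesis by (simp add: transpose_def)
qed

text \<open>The numbers \<open>lo\<close>, \<open>up\<close> bound the principal part, \<open>l\<close> is its Lipschitz constant, \<open>C\<close> bounds everything else, \<open>m\<close> bounds the
 bump function from below on the half ball, and \<open>d1\<close>, \<open>d2\<close> bound the density.\<close>

locale coordinate_ball = elliptic_operator A g L M T
 for A :: "('a::{second_countable_topology, t2_space}, 'n::finite) chart set" and g L M T +
 fixes c :: "('a, 'n) chart" and a b q and x0 :: "real^'n" and R lo up l C m d1 d2 :: real
 assumes c: "c : A" and co: "op_coeffs A L c a b q" and R: "R > 0" and cball: "cball x0 R <= cdom c"
  and lo: "0 < lo" "lo <= 1" and up: "0 < up" and l: "1 <= l" and C: "1 <= C" and m: "0 < m" and d1: "0 < d1"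
  and a_lower: "!!xi v. xi : cball x0 R ==> lo * (norm v)^2 <= v \<bullet> (frozen a xi *v v)"
  and a_upper: "!!xi v. xi : cball x0 R ==> norm (frozen a xi *v v) <= up * norm v"
  and a_lip: "!!xi eta i j. xi : cball x0 R ==> eta : cball x0 R ==> cmod (a eta $ i $ j - a xi $ i $ j) <= l * norm (eta - xi)"
  and coeff_bounds: "!!eta i j. eta : cball x0 R ==> cmod (a eta $ i $ j) <= C"
   "!!eta i. eta : cball x0 R ==> cmod (b eta $ i) <= C" "!!eta. eta : cball x0 R ==> cmod (q eta) <= C"
  and bump_bounds: "!!eta. eta : cball x0 R ==> bump x0 R eta <= C"
   "!!eta i. eta : cball x0 R ==> cmod (pd i (%x. complex_of_real (bump x0 R x)) eta) <= C"
   "!!eta i j. eta : cball x0 R ==> cmod (pd i (pd j (%x. complex_of_real (bump x0 R x))) eta) <= C"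
  and bump_lower: "!!xi. xi : ball x0 (R / 2) ==> m <= bump x0 R xi"
  and dens_bounds: "!!eta. eta : cball x0 R ==> d1 <= dens c eta" "!!eta. eta : cball x0 R ==> dens c eta <= d2"
begin

abbreviation D where "D \<equiv> (%x. complex_of_real (bump x0 R x))"
abbreviation qf where "qf xi \<equiv> positive_matrix.Qf (frozen a xi)"
abbreviation qe where "qe sg xi r \<equiv> positive_matrix.qexp (frozen a xi) (wt sg / of_real r) xi"

text \<open>The amplitude normalises the cut off Gaussian such that it concentrates at its centre with mass one.\<close>

definition amp where "amp sg xi = 1 / (quadratic_form.gint (qf xi) (wt sg) * of_real (bump x0 R xi * dens c xi))"

definition ampr where "ampr sg xi r = amp sg xi * of_real ((1 / sqrt r) ^ CARD('n))"

definition gau where "gau sg xi r eta = ampr sg xi r * D eta * exp (qe sg xi r eta)"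

definition dgau where
 "dgau sg xi r eta = gau sg xi r eta * (wt sg * of_real (qf xi (eta - xi)) / of_real (r^2) - of_real (real CARD('n) / (2 * r)))"

definition err where
 "err sg xi r eta = dgau sg xi r eta + (1 + \<i> * of_real sg) * chart_op a b q (gau sg xi r) eta"

lemma frozen_pm: "xi : cball x0 R ==> positive_matrix (frozen a xi) lo up"
 by unfold_locales (use lo up a_lower a_upper in "auto simp: frozen_def transpose_def vec_eq_iff")

lemma a_symmetrised:
 assumes x: "x : cdom c"
 shows "a x $ i $ j + a x $ j $ i = - 2 * of_real (frozen a x $ i $ j)"
proof -
 have s: "Im (symbol a xi x) = 0" for xi by (rule symbol_negative(1)[OF c co x])
 have d: "symbol a (axis k 1) x = a x $ k $ k" for k
 proof -
  have "a x $ i $ j * of_real ((axis k 1 :: real^'n) $ i * (axis k 1 :: real^'n) $ j) = (if j = k then if i = k then a x $ i $ j else 0 else 0)" for i j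
   by (simp add: axis_def)
  thus ?thesis by (simp add: symbol_def)
 qed
 have e: "symbol a (axis i 1 + axis j 1) x = a x $ i $ i + a x $ i $ j + a x $ j $ i + a x $ j $ j"
 proof -
  have "a x $ k $ k' * of_real ((axis i 1 + axis j 1 :: real^'n) $ k * (axis i 1 + axis j 1 :: real^'n) $ k') =
   (if k' = i then if k = i then a x $ k $ k' else 0 else 0) + (if k' = j then if k = i then a x $ k $ k' else 0 else 0)
   + (if k' = i then if k = j then a x $ k $ k' else 0 else 0) + (if k' = j then if k = j then a x $ k $ k' else 0 else 0)" for k k'
   by (simp add: axis_def)
  thus ?thesis by (simp add: symbol_def sum.distrib)
 qed
 have "Im (a x $ i $ j + a x $ j $ i) = 0" using s[of "axis i 1 + axis j 1"] s[of "axis i 1"] s[of "axis j 1"]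
  unfolding d e by simp
 thus ?thesis by (simp add: complex_eq_iff frozen_def)
qed

lemma gau_smooth:
 assumes xi: "xi : cball x0 R" shows "smooth_on UNIV (gau sg xi r)"
proof -
 interpret P: positive_matrix "frozen a xi" lo up by (rule frozen_pm[OF xi])
 have "smooth_on UNIV (%x. ampr sg xi r * (D x * exp (qe sg xi r x)))"
  by (intro smooth_on_mult smooth_bump_exp P.smooth_qexp open_UNIV) (simp add: smooth_on_def)
 thus ?thesis by (simp add: gau_def[abs_def] mult.assoc)
qed

lemma gau_zero: "eta ~: cball x0 R ==> gau sg xi r eta = 0"
 using bump_zero[of eta x0 R] R by (simp add: gau_def)

lemma gau_time_derivative:
 assumes xi: "xi : cball x0 R" and r: "r > 0"
 shows "((%r. gau sg xi r eta) has_vd dgau sg xi r eta) (at r)"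
proof -
 interpret P: positive_matrix "frozen a xi" lo up by (rule frozen_pm[OF xi])
 define w where "w = wt sg * of_real (qf xi (eta - xi))"
 have 1: "((%r. complex_of_real ((1 / sqrt r) ^ CARD('n))) has_vd of_real (- (real CARD('n) / (2 * r)) * (1 / sqrt r) ^ CARD('n))) (at r)"
  by (intro has_vector_derivative_of_real has_real_derivative_iff_has_vector_derivative[THEN iffD1] inverse_sqrt_power_deriv r) simp
 have 2: "((%r. exp (- (w / of_real r))) has_vd exp (- (w / of_real r)) * (w / of_real (r^2))) (at r)"
 proof -
  have "((%z. exp (- (w / z))) has_field_derivative exp (- (w / of_real r)) * (w / of_real (r^2))) (at (complex_of_real r))"
   using r by (auto intro!: derivative_eq_intros simp: field_simps power2_eq_square)
  from has_vector_derivative_real_field[OF this] show ?thesis .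
 qed
 have q: "qe sg xi r eta = - (w / of_real r)" for r by (simp add: P.qexp_def w_def)
 have "((%r. (amp sg xi * D eta) * (of_real ((1 / sqrt r) ^ CARD('n)) * exp (- (w / of_real r)))) has_vector_derivative
  (amp sg xi * D eta) * (of_real ((1 / sqrt r) ^ CARD('n)) * (exp (- (w / of_real r)) * (w / of_real (r^2)))
   + of_real (- (real CARD('n) / (2 * r)) * (1 / sqrt r) ^ CARD('n)) * exp (- (w / of_real r)))) (at r)"
  by (intro has_vector_derivative_mult_right has_vector_derivative_mult 1 2)
 thus ?thesis unfolding gau_def dgau_def ampr_def q w_def[symmetric] by (simp add: algebra_simps)
qed

lemma chart_op_gau:
 assumes xi: "xi : cball x0 R"
 shows "chart_op a b q (gau sg xi r) eta = ampr sg xi r * exp (qe sg xi r eta) *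
  (dsum (%i j. a eta $ i $ j * (pd i (pd j D) eta + pd j D eta * pd i (qe sg xi r) eta
    + pd i D eta * pd j (qe sg xi r) eta
    + D eta * (pd i (pd j (qe sg xi r)) eta + pd i (qe sg xi r) eta * pd j (qe sg xi r) eta)))
  + (SUM i:UNIV. b eta $ i * (pd i D eta + D eta * pd i (qe sg xi r) eta)) + q eta * D eta)"
proof -
 interpret P: positive_matrix "frozen a xi" lo up by (rule frozen_pm[OF xi])
 define f where "f x = D x * exp (qe sg xi r x)" for x
 have g: "gau sg xi r = (%x. ampr sg xi r * f x)" by (simp add: fun_eq_iff gau_def f_def)
 have s: "smooth_on UNIV f" unfolding f_def[abs_def] by (intro smooth_bump_exp P.smooth_qexp)
 have d: "pd i (gau sg xi r) eta = ampr sg xi r * pd i f eta"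
  "pd i (pd j (gau sg xi r)) eta = ampr sg xi r * pd i (pd j f) eta" for i j
  unfolding g by (simp_all add: partial_deriv_cmult s smooth_partial_deriv)
 show ?thesis unfolding chart_op_def d unfolding f_def[abs_def] partial_derivs_mult_exp[OF smooth_bump P.smooth_qexp]
  by (simp add: gau_def sum_distrib_left distrib_left mult.assoc mult.left_commute mult.commute)
qed

lemma err_formula:
 assumes xi: "xi : cball x0 R" and r: "r > 0"
 shows "err sg xi r eta = (1 + \<i> * of_real sg) * ampr sg xi r * exp (qe sg xi r eta) *
  (D eta * dsum (%i j. (a eta $ i $ j - a xi $ i $ j) * (pd i (pd j (qe sg xi r)) eta + pd i (qe sg xi r) eta * pd j (qe sg xi r) eta))
  + dsum (%i j. a eta $ i $ j * (pd i (pd j D) eta + pd j D eta * pd i (qe sg xi r) eta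
    + pd i D eta * pd j (qe sg xi r) eta))
  + (SUM i:UNIV. b eta $ i * (pd i D eta + D eta * pd i (qe sg xi r) eta)) + q eta * D eta)"
proof -
 interpret P: positive_matrix "frozen a xi" lo up by (rule frozen_pm[OF xi])
 let ?kap = "wt sg / of_real r"
 define S where "S i j = pd i (pd j (qe sg xi r)) eta + pd i (qe sg xi r) eta * pd j (qe sg xi r) eta" for i j
 have Ssym: "S i j = S j i" for i j unfolding S_def P.qexp_partial2
  by (subst P.Bi_commute) (rule arg_cong2[of _ _ _ _ "(+)", OF refl mult.commute])
 define w where "w = complex_of_real (qf xi (eta - xi))"
 define Sx where "Sx = dsum (%i j. a xi $ i $ j * S i j)"
 define Sy where "Sy = dsum (%i j. a eta $ i $ j * S i j)"
 define P where "P = dsum (%i j. a eta $ i $ j * (pd i (pd j D) eta + pd j D eta * pd i (qe sg xi r) eta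
    + pd i D eta * pd j (qe sg xi r) eta))"
 define B where "B = (SUM i:UNIV. b eta $ i * (pd i D eta + D eta * pd i (qe sg xi r) eta))"
 have sw: "Sx = dsum (%i j. a xi $ j $ i * S i j)"
  unfolding Sx_def by (subst sum.swap) (rule sum.cong[OF refl], rule sum.cong[OF refl], subst Ssym, rule refl)
 have "Sx + Sx = dsum (%i j. (a xi $ i $ j + a xi $ j $ i) * S i j)"
  by (subst (2) sw) (simp only: Sx_def distrib_right sum.distrib)
 moreover have "a xi $ i $ j + a xi $ j $ i = - 2 * of_real (frozen a xi $ i $ j)" for i j
  using a_symmetrised cball xi by blast
 moreover have "dsum (%i j. (- 2 * of_real (frozen a xi $ i $ j)) * S i j) = - 2 * (- (?kap / 2) * of_nat CARD('n) + ?kap^2 * w)"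
  unfolding w_def P.heat_identity[symmetric] S_def by (simp only: sum_distrib_left mult.assoc)
 ultimately have "Sx + Sx = - 2 * (- (?kap / 2) * of_nat CARD('n) + ?kap^2 * w)" by simp
 moreover have "x = k * (n / 2 - k * w)" if "x + x = - 2 * (- (k / 2) * n + k^2 * w)" for x k n :: complex
 proof -
  have "2 * x = 2 * (k * (n / 2 - k * w))" using that by (simp add: algebra_simps power2_eq_square)
  thus ?thesis by simp
 qed
 ultimately have aS: "Sx = ?kap * (of_nat CARD('n) / 2 - ?kap * w)" by blast
 have om: "(1 + \<i> * of_real sg) * ?kap = 1 / of_real r" using wt_nz[of sg] by (simp add: wt_def)
 have "(1 + \<i> * of_real sg) * Sx = (1 / of_real r) * (of_nat CARD('n) / 2 - ?kap * w)"
  unfolding aS om[symmetric] by (simp only: mult.assoc)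
 hence t: "wt sg * w / of_real (r^2) - of_real (real CARD('n) / (2 * r)) = - ((1 + \<i> * of_real sg) * Sx)"
  using r by (simp add: field_simps power2_eq_square)
 have y: "dsum (%i j. a eta $ i $ j * (pd i (pd j D) eta + pd j D eta * pd i (qe sg xi r) eta
    + pd i D eta * pd j (qe sg xi r) eta + D eta * S i j)) = P + D eta * Sy"
  unfolding P_def Sy_def by (simp only: distrib_left sum.distrib sum_distrib_left mult.left_commute)
 have x: "dsum (%i j. (a eta $ i $ j - a xi $ i $ j) * S i j) = Sy - Sx"
  unfolding Sx_def Sy_def by (simp only: left_diff_distrib sum_subtractf)
 show ?thesis
  unfolding err_def dgau_def chart_op_gau[OF xi] w_def[symmetric] t S_def[symmetric] x y P_def[symmetric] B_def[symmetric]
  by (simp add: gau_def algebra_simps)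
qed

definition ex where "ex = lo / (8 * up^2)"

definition amp_max where
 "amp_max = 1 / ((1 / sqrt (1 / (4 * lo))) ^ CARD('n) * gauss_mass TYPE(real^'n) * (m * d1))"

definition ker_const where
 "ker_const = amp_max * (3 * (real CARD('n))^2 * C^2 * l * (1 / lo)^2) * (2 + 3 / (2 * ex) + 1 / ex^2)"

definition ker where
 "ker sg xi r eta = ker_const * sqrt (1 + sg^2) ^ 5 * (1 / sqrt r) ^ CARD('n) * exp (- (ex / (r * (1 + sg^2))) * (norm (eta - xi))^2)"

lemma ex_pos: "ex > 0" using lo up by (simp add: ex_def)

lemma amp_max_pos: "amp_max > 0" using lo m d1 gauss_mass(2)[where 'e = "real^'n"] by (simp add: amp_max_def)

lemma half_ball: "xi : ball x0 (R / 2) ==> xi : cball x0 R" using R by auto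

lemma amp_bound:
 assumes xi: "xi : ball x0 (R / 2)" shows "cmod (amp sg xi) <= amp_max"
proof -
 interpret P: positive_matrix "frozen a xi" lo up by (rule frozen_pm[OF half_ball[OF xi]])
 have md: "m * d1 <= bump x0 R xi * dens c xi"
  using m d1 bump_lower[OF xi] dens_bounds(1)[OF half_ball[OF xi]] by (intro mult_mono) auto
 have md0: "0 < m * d1" using m d1 by simp
 define g0 where "g0 = (1 / sqrt (1 / (4 * lo))) ^ CARD('n) * gauss_mass TYPE(real^'n)"
 have g0: "0 < g0" "g0 <= cmod (P.gint (wt sg))"
  using P.gint_lower[of sg] lo gauss_mass(2)[where 'e = "real^'n"] by (auto simp: g0_def)
 have "0 < g0 * (m * d1)" using g0 md0 by simp
 moreover have "g0 * (m * d1) <= cmod (P.gint (wt sg)) * abs (bump x0 R xi * dens c xi)"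
  by (intro mult_mono g0 order.trans[OF md]) (use md0 in auto)
 ultimately have "1 / (cmod (P.gint (wt sg)) * abs (bump x0 R xi * dens c xi)) <= 1 / (g0 * (m * d1))" by (intro frac_le) auto
 thus ?thesis unfolding amp_max_def g0_def[symmetric] by (simp only: amp_def norm_divide norm_mult norm_one norm_of_real)
qed

lemma qe_bound:
 assumes xi: "xi : cball x0 R" and r: "r > 0"
 shows "cmod (exp (qe sg xi r eta)) <= exp (- (2 * ex / (r * (1 + sg^2))) * (norm (eta - xi))^2)"
proof -
 interpret P: positive_matrix "frozen a xi" lo up by (rule frozen_pm[OF xi])
 have p: "0 < r * (1 + sg^2)" using r by (simp add: add_pos_nonneg)
 have "2 * ex * (norm (eta - xi))^2 <= qf xi (eta - xi)" using P.Q_lower[of "eta - xi"] by (simp add: ex_def)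
 hence "2 * ex * (norm (eta - xi))^2 / (r * (1 + sg^2)) <= qf xi (eta - xi) / (r * (1 + sg^2))" using p by (intro divide_right_mono) auto
 thus ?thesis by (simp add: P.qexp_def wt_Re mult.commute)
qed

lemma ker_parts: "(1 + 2 * y + y ^ 3) * exp (- (2 * ex / (1 + sg^2)) * y^2) \<le>
  sqrt (1 + sg^2) ^ 4 * (2 + 3 / (2 * ex) + 1 / ex^2) * exp (- (ex / (1 + sg^2)) * y^2)" if y: "0 <= y"
proof -
 define w where "w = 1 + sg^2"
 have w1: "1 <= w" by (simp add: w_def)
 have w: "1 <= w" "w <= w^2" "1 <= w^2" using w1 self_le_power[OF w1, of 2] one_le_power[OF w1, of 2] by auto
 have "(1 + 2 * y + y ^ 3) * exp (- (2 * ex / w) * y^2) = (1 + 2 * y + y ^ 3) * exp (- (ex / w) * y^2) * exp (- (ex / w) * y^2)"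
  by (simp add: mult.assoc exp_add[symmetric] add_divide_distrib[symmetric])
 also have "... <= (2 + 3 / (2 * (ex / w)) + 1 / (ex / w)^2) * exp (- (ex / w) * y^2)"
  using ex_pos w y by (intro mult_right_mono polynomial_gauss_bound) auto
 also have "... <= (w^2 * (2 + 3 / (2 * ex) + 1 / ex^2)) * exp (- (ex / w) * y^2)"
 proof (intro mult_right_mono)
  have "2 + 3 / (2 * (ex / w)) + 1 / (ex / w)^2 = 2 * 1 + w * (3 / (2 * ex)) + w^2 * (1 / ex^2)"
   using w ex_pos by (simp add: field_simps power2_eq_square)
  also have "... <= 2 * w^2 + w^2 * (3 / (2 * ex)) + w^2 * (1 / ex^2)"
   using w ex_pos by (intro add_mono mult_right_mono) auto
  finally show "2 + 3 / (2 * (ex / w)) + 1 / (ex / w)^2 <= w^2 * (2 + 3 / (2 * ex) + 1 / ex^2)" by (simp add: algebra_simps)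
 qed simp
 also have "w^2 = sqrt (1 + sg^2) ^ 4" using w by (simp add: w_def power4_eq_xxxx power2_eq_square)
 finally show ?thesis by (simp add: w_def)
qed

lemma ker_const_pos: "ker_const > 0"
 using amp_max_pos ex_pos lo l C by (auto simp: ker_const_def intro!: mult_pos_pos add_pos_nonneg)

lemma gau_bound:
 assumes xi: "xi : ball x0 (R / 2)" and r: "r > 0" and eta: "eta : cball x0 R"
 shows "cmod (gau sg xi r eta) <= ker sg xi r eta"
proof -
 define y where "y = norm (eta - xi) / sqrt r"
 have y: "0 <= y" "y^2 = (norm (eta - xi))^2 / r" using r by (auto simp: y_def power_divide)
 have N: "1 <= (real CARD('n))^2" by (simp add: Suc_leI)
 have "C * 1 * 1 * 1 * 1 <= C^2 * 3 * (real CARD('n))^2 * l * (1 / lo)^2"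
  using C l lo N by (intro mult_mono) (auto simp: power2_eq_square field_simps mult_le_one)
 hence C': "C <= 3 * (real CARD('n))^2 * C^2 * l * (1 / lo)^2" by (simp add: algebra_simps)
 have "exp (- (2 * ex / (1 + sg^2)) * y^2) <= (1 + 2 * y + y ^ 3) * exp (- (2 * ex / (1 + sg^2)) * y^2)"
  using y by simp
 also note ker_parts[OF y(1)]
 finally have e: "exp (- (2 * ex / (1 + sg^2)) * y^2) <= sqrt (1 + sg^2) ^ 4 * (2 + 3 / (2 * ex) + 1 / ex^2) * exp (- (ex / (1 + sg^2)) * y^2)" .
 have t: "sqrt (1 + sg^2) ^ 4 <= sqrt (1 + sg^2) ^ 5" by (intro power_increasing) auto
 have "cmod (gau sg xi r eta) <= amp_max * (1 / sqrt r) ^ CARD('n) * C * exp (- (2 * ex / (1 + sg^2)) * y^2)"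
  unfolding gau_def ampr_def norm_mult
  using amp_bound[OF xi, of sg] qe_bound[OF half_ball[OF xi] r, of sg eta] bump_bounds(1)[OF eta] bump_nonneg[of x0 R eta] r C amp_max_pos
  by (intro mult_mono) (auto simp: y field_simps norm_power norm_divide)
 also have "... <= amp_max * (1 / sqrt r) ^ CARD('n) * (3 * (real CARD('n))^2 * C^2 * l * (1 / lo)^2)
   * (sqrt (1 + sg^2) ^ 5 * (2 + 3 / (2 * ex) + 1 / ex^2) * exp (- (ex / (1 + sg^2)) * y^2))"
  using amp_max_pos r C ex_pos C' l
  by (intro mult_mono order.trans[OF e] mult_right_mono t) auto
 also have "... = ker sg xi r eta" unfolding ker_def ker_const_def y by (simp add: mult_ac)
 finally show ?thesis .
qed

lemma err_bound:
 assumes xi: "xi : ball x0 (R / 2)" and r: "r > 0" "r <= 1" and eta: "eta : cball x0 R"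
 shows "cmod (err sg xi r eta) <= (1 / sqrt r) * ker sg xi r eta"
proof -
 note xi' = half_ball[OF xi]
 interpret P: positive_matrix "frozen a xi" lo up by (rule frozen_pm[OF xi'])
 define y where "y = norm (eta - xi) / sqrt r"
 have y: "0 <= y" "y^2 = (norm (eta - xi))^2 / r" "sqrt r * y = norm (eta - xi)" "y / sqrt r = norm (eta - xi) / r"
  using r by (auto simp: y_def power_divide)
 let ?B = "3 * (real CARD('n))^2 * C^2 * l * (1 / lo)^2"
 have "cmod (wt sg / of_real r) <= 1 / r" using wt_norm[of sg] r by (simp add: norm_divide divide_right_mono)
 hence w: "cmod (wt sg / of_real r) / 2 <= 1 / r" using norm_ge_zero[of "wt sg / of_real r"] by linarith
 have b: "cmod (D eta * dsum (%i j. (a eta $ i $ j - a xi $ i $ j) * (pd i (pd j (qe sg xi r)) eta + pd i (qe sg xi r) eta * pd j (qe sg xi r) eta))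
  + dsum (%i j. a eta $ i $ j * (pd i (pd j D) eta + pd j D eta * pd i (qe sg xi r) eta
    + pd i D eta * pd j (qe sg xi r) eta))
  + (SUM i:UNIV. b eta $ i * (pd i D eta + D eta * pd i (qe sg xi r) eta)) + q eta * D eta)
  <= ?B * (1 / sqrt r) * (1 + 2 * y + y ^ 3)"
 proof (rule bracket_bound)
  show "1 <= 1 / lo" using lo by simp
  show "cmod (a eta $ i $ j - a xi $ i $ j) <= l * (sqrt r * y)" for i j unfolding y(3) by (rule a_lip[OF xi' eta])
  show "cmod (D eta) <= C" using bump_bounds(1)[OF eta] bump_nonneg[of x0 R eta] by simp
  show "cmod (pd i (qe sg xi r) eta) <= 1 / lo * (y / sqrt r)" for i
  proof -
   have "abs ((P.Bi *v (eta - xi)) $ i) <= norm (eta - xi) / lo" using component_le_norm_cart P.Bi_norm by (rule order.trans)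
   hence "cmod (wt sg / of_real r) / 2 * abs ((P.Bi *v (eta - xi)) $ i) <= 1 / r * (norm (eta - xi) / lo)"
    by (intro mult_mono w) (use r lo in auto)
   thus ?thesis unfolding P.qexp_partial y(4) by (simp add: norm_mult norm_divide mult.commute)
  qed
  show "cmod (pd i (pd j (qe sg xi r)) eta) <= 1 / lo / r" for i j
  proof -
   have "cmod (wt sg / of_real r) / 2 * abs (P.Bi $ i $ j) <= 1 / r * (1 / lo)"
    by (intro mult_mono P.Bi_entry w) (use r lo in auto)
   thus ?thesis unfolding P.qexp_partial2 by (simp add: norm_mult norm_divide mult.commute)
  qed
 qed (use C l r y coeff_bounds[OF eta] bump_bounds[OF eta] in auto)
 have s5: "sqrt (1 + sg^2) ^ 5 = sqrt (1 + sg^2) * sqrt (1 + sg^2) ^ 4"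
  using power_Suc[of "sqrt (1 + sg^2)" 4] by simp
 have om: "cmod (1 + \<i> * of_real sg) = sqrt (1 + sg^2)" by (simp add: cmod_def)
 have "cmod (err sg xi r eta) <= sqrt (1 + sg^2) * (amp_max * (1 / sqrt r) ^ CARD('n)) * exp (- (2 * ex / (1 + sg^2)) * y^2) * (?B * (1 / sqrt r) * (1 + 2 * y + y ^ 3))"
  unfolding err_formula[OF xi' r(1)] ampr_def norm_mult
  using amp_bound[OF xi, of sg] qe_bound[OF xi' r(1), of sg eta] r C amp_max_pos
  by (intro mult_mono b[unfolded norm_mult]) (auto simp: y field_simps norm_power norm_divide om)
 also have "... = sqrt (1 + sg^2) * (amp_max * (1 / sqrt r) ^ CARD('n)) * (?B * (1 / sqrt r)) * ((1 + 2 * y + y ^ 3) * exp (- (2 * ex / (1 + sg^2)) * y^2))"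
  by (simp add: mult_ac)
 also have "... <= sqrt (1 + sg^2) * (amp_max * (1 / sqrt r) ^ CARD('n)) * (?B * (1 / sqrt r)) *
  (sqrt (1 + sg^2) ^ 4 * (2 + 3 / (2 * ex) + 1 / ex^2) * exp (- (ex / (1 + sg^2)) * y^2))"
  using amp_max_pos r C l by (intro mult_left_mono ker_parts y) auto
 also have "... = (1 / sqrt r) * ker sg xi r eta" unfolding ker_def s5 ker_const_def y by (simp add: mult_ac)
 finally show ?thesis .
qed

end

section \<open>The parametrix\<close>

context elliptic_operator
begin

definition hk_bound :: "real => (real => 'a => 'a => real) => bool" where
 "hk_bound G k = ((ALL r x y. 0 <= k r x y) \<and>
  (%(r, x, y). k r x y) : meas borel3 \<and>
  (ALL r:{0<..1}. ALL x. (nint M (%y. k r x y)) <= G & nint M (%y. k r y x) <= G \<and>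
    (ALL y. k r x y <= G * (1 / sqrt r) ^ CARD('n))))"

text \<open>An approximate heat kernel \<open>phi\<close> with pole \<open>x\<close> at the complex time \<open>r (1 - i s)\<close>, with \<open>psi = L phi\<close>. The error \<open>e\<close> in the heat
 equation is only of order \<open>1 / sqrt r\<close>, which is integrable in time.\<close>

definition parametrix_at :: "real => (real => 'a => 'a => real) => 'a =>
  (real => 'a => complex) => (real => 'a => complex) => (real => 'a => complex) => bool" where
 "parametrix_at s k x phi e psi \<longleftrightarrow>
  (ALL r>0. (phi r, psi r) : T & e r : meas borel \<and>
    (ALL y. ((%r. phi r y) has_vd (e r y - (1 - \<i> * of_real s) * psi r y)) (at r))) \<and>
  (ALL y. continuous_on {0<..} (%r. e r y)) \<and>
  (ALL r:{0<..1}. ALL y. cmod (phi r y) <= k r x y & cmod (e r y) <= (1 / sqrt r) * k r x y) \<and>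
  (ALL eps>0. EX B. ALL r:{eps..1}. ALL y. cmod (e r y - (1 - \<i> * of_real s) * psi r y) <= B) \<and>
  (ALL f X. smooth_fun A f --> (ALL j. 0 < X j) --> X ----> 0 --> (%j. ip f (phi (X j))) ----> f x)"

end

context coordinate_ball
begin

lemma gau_in_T:
 "xi : cball x0 R ==> (zero_ext c (gau sg xi r), zero_ext c (chart_op a b q (gau sg xi r))) : T"
 using test_function_in_T[OF c gau_smooth compact_cball cball gau_zero co] by blast

lemma dgau_zero: "eta ~: cball x0 R ==> dgau sg xi r eta = 0"
 by (simp add: dgau_def gau_zero)

lemma err_zero: "eta ~: cball x0 R ==> err sg xi r eta = 0"
 using chart_op_supp[OF compact_cball, of x0 R "gau sg xi r" eta a b q] gau_zero by (simp add: err_def dgau_zero)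

lemma err_continuous:
 assumes xi: "xi : cball x0 R" shows "continuous_on (cdom c) (err sg xi r)"
proof -
 interpret P: positive_matrix "frozen a xi" lo up by (rule frozen_pm[OF xi])
 have 1: "continuous_on (cdom c) (gau sg xi r)"
  by (rule continuous_on_subset[OF smooth_on_continuous[OF gau_smooth[OF xi]]]) simp
 have 2: "continuous_on (cdom c) (%eta. qf xi (eta - xi))"
  by (rule continuous_on_compose2[OF P.Q_cont]) (auto intro: continuous_intros)
 show ?thesis unfolding err_def[abs_def] dgau_def divide_inverse
  by (intro continuous_on_add continuous_on_mult continuous_on_diff continuous_on_const 1 continuous_on_of_real 2
    chart_op_continuous[OF c co gau_smooth[OF xi]])
qed

lemma err_continuous_time:
 assumes xi: "xi : cball x0 R" shows "continuous_on {0<..} (%r. err sg xi r eta)"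
proof -
 interpret P: positive_matrix "frozen a xi" lo up by (rule frozen_pm[OF xi])
 have q: "continuous_on {0<..} (%r. wt sg / complex_of_real r)" by (intro continuous_intros) auto
 have am: "continuous_on {0<..} (ampr sg xi)" unfolding ampr_def[abs_def] by (intro continuous_intros) auto
 have ee: "continuous_on {0<..} (%r. exp (qe sg xi r eta))" unfolding P.qexp_def by (intro continuous_intros) auto
 have g: "continuous_on {0<..} (%r. gau sg xi r eta)" unfolding gau_def by (intro continuous_intros am ee)
 have d: "continuous_on {0<..} (%r. dgau sg xi r eta)" unfolding dgau_def by (intro continuous_intros g) auto
 show ?thesis unfolding err_def chart_op_gau[OF xi] P.qexp_partial2 unfolding P.qexp_partial
  by (intro continuous_on_add continuous_on_mult continuous_on_sum continuous_on_const continuous_on_minus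
   continuous_on_divide[OF _ continuous_on_const] am ee d q) auto
qed

lemma dgau_bounded:
 assumes xi: "xi : ball x0 (R / 2)" and eps: "eps > 0"
 shows "EX B. ALL r:{eps..1}. ALL eta. cmod (dgau sg xi r eta) <= B"
proof -
 note xi' = half_ball[OF xi]
 interpret P: positive_matrix "frozen a xi" lo up by (rule frozen_pm[OF xi'])
 define B1 where "B1 = ker_const * sqrt (1 + sg^2) ^ 5 * (1 / sqrt eps) ^ CARD('n)"
 define B2 where "B2 = 1 / (4 * lo) * (2 * R)^2 / eps^2 + real CARD('n) / (2 * eps)"
 have B2: "0 <= B2" using lo eps by (simp add: B2_def)
 have B1: "0 <= B1" using ker_const_pos eps by (simp add: B1_def)
 have "cmod (dgau sg xi r eta) <= B1 * B2" if r: "r : {eps..1}" for r eta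
 proof (cases "eta : cball x0 R")
  case False thus ?thesis using B1 B2 by (simp add: dgau_zero)
 next
  case eta: True
  have r0: "r > 0" using r eps by auto
  have "ker sg xi r eta <= ker_const * sqrt (1 + sg^2) ^ 5 * (1 / sqrt eps) ^ CARD('n) * 1" unfolding ker_def
   using r r0 eps ker_const_pos ex_pos by (intro mult_mono power_mono frac_le) auto
  hence 1: "cmod (gau sg xi r eta) <= B1" using gau_bound[OF xi r0 eta, of sg] by (simp add: B1_def)
  have "dist eta x0 <= R" "dist x0 xi <= R" using eta xi' by (simp_all add: dist_commute)
  hence "norm (eta - xi) <= 2 * R" using dist_triangle[of eta xi x0] by (simp add: dist_norm)
  hence "qf xi (eta - xi) <= 1 / (4 * lo) * (2 * R)^2"
   using lo by (intro order.trans[OF P.Q_upper] mult_left_mono power_mono) auto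
  hence "cmod (wt sg * of_real (qf xi (eta - xi)) / of_real (r^2)) <= 1 * (1 / (4 * lo) * (2 * R)^2) / eps^2"
   unfolding norm_mult norm_divide norm_of_real using wt_norm[of sg] P.Q_nonneg[of "eta - xi"] r eps lo
   by (intro frac_le mult_mono) (auto intro!: power_mono)
  moreover have "cmod (of_real (real CARD('n) / (2 * r))) <= real CARD('n) / (2 * eps)"
   unfolding norm_of_real using r eps r0 by (auto intro!: divide_left_mono)
  ultimately have "cmod (wt sg * of_real (qf xi (eta - xi)) / of_real (r^2) - of_real (real CARD('n) / (2 * r))) <= B2"
   unfolding B2_def by (intro order.trans[OF norm_triangle_ineq4]) (simp only: mult_1_left add_mono)
  thus ?thesis unfolding dgau_def norm_mult by (intro mult_mono 1 B1) auto
 qed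
 thus ?thesis by blast
qed

lemma gau_concentrates:
 assumes xi: "xi : ball x0 (R / 2)" and f: "smooth_fun A f" and X: "!!j. 0 < X j" "X ----> 0"
 shows "(%j. ip f (zero_ext c (gau sg xi (X j)))) ----> f (chart_inv c xi)"
proof -
 note xi' = half_ball[OF xi]
 interpret P: positive_matrix "frozen a xi" lo up by (rule frozen_pm[OF xi'])
 let ?U = "cdom c"
 define F where "F = f o chart_inv c"
 define h0 where "h0 eta = of_real (dens c eta * bump x0 R eta) * F eta" for eta
 define h where "h eta = indicator ?U eta *\<^sub>R h0 eta" for eta
 define N where "N z = cnj (amp sg xi * exp (- (wt sg * of_real (qf xi z))))" for z
 have w: "Re (wt sg) > 0" by (simp add: wt_Re add_pos_nonneg)
 have oU: "open ?U" by (rule chartD(2)[OF c])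
 have xiU: "xi : ?U" using xi' cball by blast
 have Fc: "continuous_on ?U F" unfolding F_def using f c smooth_on_continuous unfolding smooth_fun_def by blast
 have bc: "continuous_on ?U (bump x0 R)"
  using Ck_on_bump[of 0 x0 R] by (auto intro: continuous_on_subset)
 have h0c: "continuous_on ?U h0" unfolding h0_def[abs_def] by (intro continuous_intros dens_continuous[OF c] bc Fc)
 have hm [measurable]: "h : meas borel" unfolding h_def[abs_def]
  by (rule borel_measurable_continuous_on_indicator[OF _ h0c]) (simp add: oU)
 have Nm [measurable]: "N : meas borel" unfolding N_def[abs_def] by measurable
 obtain H where H: "!!eta. cmod (h eta) <= H"
 proof -
  obtain H where H: "0 <= H" "!!y. y : cball x0 R ==> norm (h0 y) <= H"
   using compact_norm_bound[OF compact_cball continuous_on_subset[OF h0c cball]] by blast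
  have "cmod (h eta) <= H" for eta
  proof (cases "eta : cball x0 R")
   case True thus ?thesis using H by (simp add: h_def indicator_def)
  next
   case False
   hence "bump x0 R eta = 0" using bump_zero[of eta x0 R] R by auto
   thus ?thesis using H(1) by (simp add: h_def h0_def)
  qed
  thus ?thesis using that by blast
 qed
 have eq: "ip f (zero_ext c (gau sg xi r)) = (LBINT z. h (xi + sqrt r *\<^sub>R z) * N z)" if r: "r > 0" for r
 proof -
  define psi where "psi eta = F eta * cnj (gau sg xi r eta)" for eta
  have gc: "continuous_on ?U (gau sg xi r)"
   by (rule continuous_on_subset[OF smooth_on_continuous[OF gau_smooth[OF xi']]]) simp
  have "ip f (zero_ext c (gau sg xi r)) = (\<integral>y. zero_ext c psi y \<partial>riemannian_volume A g)"
   unfolding L2_inner_def M_eq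
   by (rule lint_cong[OF refl]) (simp add: zero_ext_def psi_def F_def chart_inv_left[OF c])
  also have "... = (LBINT eta. indicator ?U eta *\<^sub>R (dens c eta *\<^sub>R psi eta))"
   by (rule integral_zero_ext[OF c measurable_zero_ext[OF c]]) (auto simp: psi_def[abs_def] intro!: continuous_intros Fc gc)
  also have "... = (LBINT eta. h eta * cnj (ampr sg xi r * exp (qe sg xi r eta)))"
   by (rule lint_cong[OF refl]) (simp add: h_def h0_def psi_def gau_def scaleR_conv_of_real mult_ac)
  also have "... = (sqrt r ^ DIM(real^'n)) *\<^sub>R (LBINT z. h (xi + sqrt r *\<^sub>R z) * cnj (ampr sg xi r * exp (qe sg xi r (xi + sqrt r *\<^sub>R z))))"
  proof (rule integral_scale)
   have "continuous_on UNIV (%eta. cnj (ampr sg xi r * exp (qe sg xi r eta)))"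
    using smooth_on_continuous[OF P.smooth_qexp] by (intro continuous_intros)
   hence "(%eta. cnj (ampr sg xi r * exp (qe sg xi r eta))) : meas borel" by (rule borel_measurable_continuous_onI)
   thus "(%eta. h eta * cnj (ampr sg xi r * exp (qe sg xi r eta))) : meas borel" by (intro borel_measurable_times hm)
  qed (use r in simp)
  also have "... = (LBINT z. (sqrt r ^ CARD('n)) *\<^sub>R (h (xi + sqrt r *\<^sub>R z) * cnj (ampr sg xi r * exp (qe sg xi r (xi + sqrt r *\<^sub>R z)))))"
   by (simp only: integral_scaleR_right DIM_cart DIM_real mult_1_right)
  also have "... = (LBINT z. h (xi + sqrt r *\<^sub>R z) * N z)"
  proof (rule lint_cong[OF refl])
   fix z
   have 1: "qe sg xi r (xi + sqrt r *\<^sub>R z) = - (wt sg * of_real (qf xi z))" using r by (simp add: P.qexp_def P.Q_scale)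
   have 2: "cnj (ampr sg xi r) = of_real ((1 / sqrt r) ^ CARD('n)) * cnj (amp sg xi)" by (simp add: ampr_def)
   have 3: "sqrt r ^ CARD('n) * (1 / sqrt r) ^ CARD('n) = 1" using r by (simp add: power_mult_distrib[symmetric])
   have 4: "cnj (ampr sg xi r * exp (qe sg xi r (xi + sqrt r *\<^sub>R z))) = of_real ((1 / sqrt r) ^ CARD('n)) * N z"
    by (simp only: complex_cnj_mult 2 N_def 1 mult.assoc)
   have "x *\<^sub>R (y * (of_real u * v)) = of_real (x * u) * (y * v)" for x u and y v :: complex
    by (simp add: scaleR_conv_of_real)
   thus "(sqrt r ^ CARD('n)) *\<^sub>R (h (xi + sqrt r *\<^sub>R z) * cnj (ampr sg xi r * exp (qe sg xi r (xi + sqrt r *\<^sub>R z)))) = h (xi + sqrt r *\<^sub>R z) * N z"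
    unfolding 4 by (simp only: 3 of_real_1 mult_1_left)
  qed
  finally show ?thesis .
 qed
 have "(%j. (LBINT z. h (xi + sqrt (X j) *\<^sub>R z) * N z)) ----> (LBINT z. h xi * N z)"
 proof (rule integral_dominated_convergence[where w = "%z. H * (cmod (amp sg xi) * exp (- (Re (wt sg) * qf xi z)))"])
  show "integrable lborel (%z. H * (cmod (amp sg xi) * exp (- (Re (wt sg) * qf xi z))))"
   by (intro integrable_mult_right P.Q_exp_integrable w)
  have "isCont h xi"
  proof -
   have "isCont h0 xi" using h0c oU xiU continuous_on_eq_continuous_at by blast
   moreover have "\<forall>\<^sub>F eta in nhds xi. h eta = h0 eta" using eventually_nhds_in_open[OF oU xiU] by eventually_elim (simp add: h_def)
   ultimately show ?thesis using isCont_cong by blast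
  qed
  moreover have "(%j. xi + sqrt (X j) *\<^sub>R z) ----> xi" for z
   using tendsto_add[OF tendsto_const tendsto_scaleR[OF tendsto_real_sqrt[OF X(2)] tendsto_const], of xi z] by simp
  ultimately have "(%j. h (xi + sqrt (X j) *\<^sub>R z)) ----> h xi" for z by (rule isCont_tendsto_compose)
  thus "AE z in lborel. (%j. h (xi + sqrt (X j) *\<^sub>R z) * N z) ----> h xi * N z"
   by (intro AE_I2 tendsto_mult tendsto_const)
  fix j show "AE z in lborel. norm (h (xi + sqrt (X j) *\<^sub>R z) * N z) <= H * (cmod (amp sg xi) * exp (- (Re (wt sg) * qf xi z)))"
   unfolding norm_mult N_def complex_mod_cnj P.cexp_norm by (intro AE_I2 mult_right_mono H) simp
 qed measurable
 also have "(LBINT z. h xi * N z) = h xi * cnj (amp sg xi * P.gint (wt sg))"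
  by (simp add: N_def P.gint_def)
 also have "... = f (chart_inv c xi)"
 proof -
  have g0: "P.gint (wt sg) ~= 0"
  proof -
   have "0 < (1 / sqrt (1 / (4 * lo))) ^ CARD('n) * gauss_mass TYPE(real^'n)" using lo gauss_mass(2)[where 'e = "real^'n"] by simp
   thus ?thesis using P.gint_lower[of sg] by auto
  qed
  have b: "0 < bump x0 R xi" "0 < dens c xi" using bump_lower[OF xi] m dens_bounds(1)[OF xi'] d1 by linarith+
  have "amp sg xi * P.gint (wt sg) = 1 / of_real (bump x0 R xi * dens c xi)" using g0 by (simp add: amp_def)
  moreover have "h xi = of_real (bump x0 R xi * dens c xi) * f (chart_inv c xi)" using xiU by (simp add: h_def h0_def F_def mult.commute)
  ultimately show ?thesis using b by simp
 qed
 finally show ?thesis unfolding eq[OF X(1)] .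
qed

end

context coordinate_ball
begin

definition dom where "dom = fst c Int snd c -` cball x0 R"

definition kk where
 "kk sg r x y = (if r > 0 then indicator dom x * indicator dom y * ker sg (snd c x) r (snd c y) else 0)"

lemma dom_closed: "closed dom"
proof -
 have "dom = chart_inv c ` cball x0 R"
 proof (intro equalityI subsetI)
  fix y assume y: "y : dom"
  hence "y = chart_inv c (snd c y)" using chart_inv_left[OF c] by (simp add: dom_def)
  thus "y : chart_inv c ` cball x0 R" using y by (intro image_eqI) (auto simp: dom_def)
 qed (use cball chart_inv_right[OF c] chart_inv_mem[OF c] in "auto simp: dom_def")
 thus ?thesis using chart_compact_inv(2)[OF c compact_cball cball] by simp
qed

lemma ker_nonneg: "0 < r ==> 0 <= ker sg xi r eta"
 using ker_const_pos by (simp add: ker_def)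

lemma kk_nonneg: "0 <= kk sg r x y"
 by (auto simp: kk_def intro!: mult_nonneg_nonneg ker_nonneg)

lemma kk_sym: "kk sg r x y = kk sg r y x"
 by (simp add: kk_def ker_def norm_minus_commute mult_ac)

lemma kk_measurable: "(%(r, x, y). kk sg r x y) : meas borel3"
proof -
 define cc where "cc y = indicator (fst c) y *\<^sub>R snd c y" for y
 have [measurable]: "cc : meas borel" unfolding cc_def[abs_def]
  using chartD(1)[OF c] by (intro borel_measurable_continuous_on_indicator chart_continuous c) simp
 have [measurable]: "dom : sets borel" using dom_closed by simp
 have "kk sg r x y = (if 0 < r then indicator dom x * indicator dom y * ker sg (cc x) r (cc y) else 0)" for r x y
  by (simp add: kk_def cc_def dom_def indicator_def)
 thus ?thesis unfolding ker_def by simp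
qed

lemma kk_row:
 assumes r: "0 < r"
 shows "nint M (%y. kk sg r x y) <= ennreal (d2 * ker_const * sqrt (1 + sg^2) ^ 5 * (sqrt (1 + sg^2) / sqrt ex) ^ CARD('n) * gauss_mass TYPE(real^'n))"
proof (cases "x : dom")
 case False
 hence "kk sg r x y = 0" for y by (simp add: kk_def)
 thus ?thesis by simp
next
 case x: True
 define xi where "xi = snd c x"
 have "xi : cball x0 R" using x by (simp add: dom_def xi_def)
 hence d2: "0 <= d2" using dens_bounds[of xi] d1 by linarith
 define K where "K = d2 * (ker_const * sqrt (1 + sg^2) ^ 5 * (1 / sqrt r) ^ CARD('n))"
 have K: "0 <= K" using d2 ker_const_pos r by (simp add: K_def)
 define gamma where "gamma = ex / (r * (1 + sg^2))"
 have gamma: "gamma > 0" using ex_pos r by (simp add: gamma_def add_pos_nonneg)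
 have m: "(%y. ennreal (kk sg r x y)) : meas borel"
  using measurable_compose[OF measurable_Pair1'[of r borel "borel \<Otimes>\<^sub>M borel"] kk_measurable[of sg]]
   measurable_compose[OF measurable_Pair1'[of x borel borel]] by simp
 have "nint M (%y. kk sg r x y) = (\<integral>\<^sup>+y. ennreal (kk sg r x y) * indicator (fst c) y \<partial>riemannian_volume A g)"
  unfolding M_eq by (rule nn_integral_cong) (simp add: kk_def dom_def indicator_def)
 also have "... = nint lborel (%eta. ennreal (kk sg r x (chart_inv c eta)) * ennreal (dens c eta) * indicator (cdom c) eta)"
  by (rule nn_integral_chart[OF c m])
 also have "... <= nint lborel (%eta. ennreal K * ennreal (exp (- gamma * (norm (eta - xi))^2)))"
 proof (rule nn_integral_mono)
  fix eta :: "real^'n"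
  show "ennreal (kk sg r x (chart_inv c eta)) * ennreal (dens c eta) * indicator (cdom c) eta <= ennreal K * ennreal (exp (- gamma * (norm (eta - xi))^2))"
  proof (cases "eta : cdom c & eta : cball x0 R")
   case False
   have "eta : cdom c ==> chart_inv c eta ~: dom" using False chart_inv_right[OF c, of eta] by (simp add: dom_def)
   thus ?thesis by (cases "eta : cdom c") (simp_all add: kk_def)
  next
   case True
   have "ker sg xi r eta * dens c eta <= ker sg xi r eta * d2"
    using True dens_bounds(2)[of eta] by (intro mult_left_mono ker_nonneg r) auto
   also have "... = K * exp (- gamma * (norm (eta - xi))^2)" by (simp add: K_def gamma_def ker_def)
   finally have "ennreal (ker sg xi r eta * dens c eta) <= ennreal (K * exp (- gamma * (norm (eta - xi))^2))" by (rule ennreal_leI)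
   moreover have "chart_inv c eta : dom" "snd c (chart_inv c eta) = eta" using True chart_inv_right[OF c, of eta] chart_inv_mem[OF c, of eta] by (auto simp: dom_def)
   ultimately show ?thesis using True x r K dens_pos[OF c, of eta] ker_nonneg[OF r, of sg xi eta]
    by (simp add: kk_def xi_def ennreal_mult')
  qed
 qed
 also have "... = ennreal K * ennreal ((1 / sqrt gamma) ^ CARD('n) * gauss_mass TYPE(real^'n))"
  using nn_integral_gauss[OF gamma, of xi] by (subst nn_integral_cmult) auto
 also have "... = ennreal (K * ((1 / sqrt gamma) ^ CARD('n) * gauss_mass TYPE(real^'n)))" using K by (simp add: ennreal_mult')
 also have "K * ((1 / sqrt gamma) ^ CARD('n) * gauss_mass TYPE(real^'n)) =
  d2 * ker_const * sqrt (1 + sg^2) ^ 5 * ((1 / sqrt r) ^ CARD('n) * (1 / sqrt gamma) ^ CARD('n)) * gauss_mass TYPE(real^'n)"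
  by (simp add: K_def mult_ac)
 also have "(1 / sqrt r) ^ CARD('n) * (1 / sqrt gamma) ^ CARD('n) = (sqrt (1 + sg^2) / sqrt ex) ^ CARD('n)"
  using r ex_pos by (simp add: power_mult_distrib[symmetric] gamma_def real_sqrt_divide real_sqrt_mult)
 finally show ?thesis .
qed

definition kconst where
 "kconst = abs (d2 * ker_const * (1 / sqrt ex) ^ CARD('n) * gauss_mass TYPE(real^'n)) + ker_const"

lemma hk_bound_kk: "hk_bound (kconst * (1 + abs sg) ^ (CARD('n) + 5)) (kk sg)"
proof -
 define theta where "theta = sqrt (1 + sg^2)"
 define G where "G = kconst * (1 + abs sg) ^ (CARD('n) + 5)"
 have theta: "1 <= theta" "theta <= 1 + abs sg"
  by (auto simp: theta_def power2_sum intro!: real_le_lsqrt)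
 have p: "theta ^ (CARD('n) + 5) <= (1 + abs sg) ^ (CARD('n) + 5)" using theta by (intro power_mono) auto
 have k1: "d2 * ker_const * theta ^ 5 * (theta / sqrt ex) ^ CARD('n) * gauss_mass TYPE(real^'n) <= G"
 proof -
  have "d2 * ker_const * theta ^ 5 * (theta / sqrt ex) ^ CARD('n) * gauss_mass TYPE(real^'n) =
   (d2 * ker_const * (1 / sqrt ex) ^ CARD('n) * gauss_mass TYPE(real^'n)) * theta ^ (CARD('n) + 5)"
   by (simp add: power_add power_divide)
  also have "... <= kconst * (1 + abs sg) ^ (CARD('n) + 5)"
   using ker_const_pos theta by (intro mult_mono p) (auto simp: kconst_def)
  finally show ?thesis by (simp add: G_def)
 qed
 have k2: "kk sg r x y <= G * (1 / sqrt r) ^ CARD('n)" if r: "0 < r" for r x y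
 proof -
  have "theta ^ 5 <= theta ^ (CARD('n) + 5)" using theta by (intro power_increasing) auto
  note p5 = order.trans[OF this p]
  have "ker_const * theta ^ 5 <= G" unfolding G_def
   using ker_const_pos theta by (intro mult_mono p5) (auto simp: kconst_def)
  moreover have "0 <= ker_const * theta ^ 5" using ker_const_pos theta by simp
  ultimately have G0: "ker_const * theta ^ 5 <= G" "0 <= G" by linarith+
  hence 1: "ker_const * theta ^ 5 * (1 / sqrt r) ^ CARD('n) * exp (- (ex / (r * (1 + sg^2))) * (norm (snd c y - snd c x))^2) <= G * (1 / sqrt r) ^ CARD('n) * 1"
   using r ker_const_pos ex_pos theta by (intro mult_mono) (auto simp: divide_nonpos_nonneg)
  have "0 <= G * (1 / sqrt r) ^ CARD('n)" using G0 r by simp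
  thus ?thesis using 1 r G0(2) by (auto simp: kk_def ker_def theta_def indicator_def)
 qed
 have rows: "nint M (%y. kk sg r x y) <= G" if "0 < r" for r x
  using kk_row[OF that, of sg x] ennreal_leI[OF k1] unfolding theta_def by (rule order.trans)
 have "nint M (%y. kk sg r y x) = nint M (%y. kk sg r x y)" for r x by (simp add: kk_sym[of sg r _ x])
 thus ?thesis unfolding hk_bound_def G_def[symmetric] using kk_nonneg kk_measurable rows k2 by auto
qed

lemma parametrix_at_gau:
 assumes x: "x : fst c" "snd c x : ball x0 (R / 2)"
 defines "xi \<equiv> snd c x"
 shows "parametrix_at s (kk (- s)) x (%r. zero_ext c (gau (- s) xi r)) (%r. zero_ext c (err (- s) xi r))
  (%r. zero_ext c (chart_op a b q (gau (- s) xi r)))"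
proof -
 have xi: "xi : ball x0 (R / 2)" using x by (simp add: xi_def)
 note xi' = half_ball[OF xi]
 have xd: "x : dom" using x xi' by (simp add: dom_def xi_def)
 have d: "zero_ext c (err (- s) xi r) y - (1 - \<i> * of_real s) * zero_ext c (chart_op a b q (gau (- s) xi r)) y = zero_ext c (dgau (- s) xi r) y" for r y
  by (simp add: zero_ext_def err_def)
 have "((%r. zero_ext c (gau (- s) xi r) y) has_vd zero_ext c (dgau (- s) xi r) y) (at r)" if "r > 0" for r y
  using gau_time_derivative[OF xi' that, of "- s" "snd c y"] by (simp add: zero_ext_def)
 moreover have "zero_ext c (err (- s) xi r) : meas borel" for r
  by (rule measurable_zero_ext[OF c err_continuous[OF xi']])
 moreover have "continuous_on {0<..} (%r. zero_ext c (err (- s) xi r) y)" for y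
  using err_continuous_time[OF xi', of "- s" "snd c y"] by (cases "y : fst c") (simp_all add: zero_ext_def)
 moreover have "cmod (zero_ext c (gau (- s) xi r) y) <= kk (- s) r x y & cmod (zero_ext c (err (- s) xi r) y) <= (1 / sqrt r) * kk (- s) r x y"
  if "r : {0<..1}" for r y
 proof (cases "y : dom")
  case True thus ?thesis using gau_bound[OF xi, of r "snd c y" "- s"] err_bound[OF xi, of r "snd c y" "- s"] that xd
   by (auto simp: zero_ext_def dom_def kk_def xi_def)
 next
  case False thus ?thesis using gau_zero[of "snd c y"] err_zero[of "snd c y"] by (simp add: zero_ext_def dom_def kk_def)
 qed
 moreover have "EX B. ALL r:{eps..1}. ALL y. cmod (zero_ext c (dgau (- s) xi r) y) <= B" if eps: "eps > 0" for eps
 proof -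
  obtain B where B: "ALL r:{eps..1}. ALL eta. cmod (dgau (- s) xi r eta) <= B" using dgau_bounded[OF xi eps] by blast
  have "cmod (zero_ext c (dgau (- s) xi r) y) <= max B 0" if "r : {eps..1}" for r y
   using B that by (auto simp: zero_ext_def le_max_iff_disj)
  thus ?thesis by blast
 qed
 moreover have "chart_inv c xi = x" using chart_inv_left[OF c x(1)] by (simp add: xi_def)
 ultimately show ?thesis unfolding parametrix_at_def d using gau_in_T[OF xi'] gau_concentrates[OF xi] by auto
qed

end

lemma compact_norm_bound_finite:
 fixes f :: "'i::finite => 'b::topological_space => 'c::real_normed_vector"
 assumes "compact K" "!!i. continuous_on K (f i)" shows "EX B>=0. ALL i. ALL x:K. norm (f i x) <= B"
proof -
 have "EX B. ALL i. B i >= 0 & (ALL x:K. norm (f i x) <= B i)" by (rule choice) (use compact_norm_bound[OF assms(1,2)] in blast)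
 then obtain B where B: "!!i. B i >= 0" "!!i x. x : K ==> norm (f i x) <= B i" by blast
 have "B i <= sum B UNIV" for i using B(1) by (intro member_le_sum) auto
 hence "norm (f i x) <= sum B UNIV" if "x : K" for i x using B(2)[OF that, of i] order.trans by blast
 moreover have "0 <= sum B UNIV" using B(1) by (simp add: sum_nonneg)
 ultimately show ?thesis by blast
qed

lemma smooth_lipschitz:
 fixes f :: "real^'n::finite => 'c::real_normed_vector"
 assumes "smooth_on S f" "cball x0 R <= S"
 shows "EX B>=0. ALL x:cball x0 R. ALL y:cball x0 R. norm (f x - f y) <= B * norm (x - y)"
proof -
 have "continuous_on (cball x0 R) (%x. fd f (at x) v)" for v
  using smooth_on_continuous[OF smooth_on_derivative(2)[OF assms(1)]] assms(2) by (rule continuous_on_subset)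
 hence "EX B>=0. ALL i. ALL x:cball x0 R. norm (fd f (at x) (axis i 1)) <= B"
  by (intro compact_norm_bound_finite compact_cball)
 then obtain B where B: "B >= 0" "!!i x. x : cball x0 R ==> norm (fd f (at x) (axis i 1)) <= B" by blast
 have "norm (f x - f y) <= (real CARD('n) * B) * norm (x - y)" if x: "x : cball x0 R" and y: "y : cball x0 R" for x y
 proof (rule differentiable_bound[OF convex_cball _ _ x y])
  fix z assume z: "z : cball x0 R"
  have hd: "(f has_derivative fd f (at z)) (at z)" using smooth_on_derivative(1)[OF assms(1)] assms(2) z by blast
  show "(f has_derivative fd f (at z)) (at z within cball x0 R)" by (rule has_derivative_at_withinI[OF hd])
  show "onorm (fd f (at z)) <= real CARD('n) * B"
  proof (rule onorm_le)
   fix v :: "real^'n"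
   have "fd f (at z) v = fd f (at z) (SUM i:UNIV. (v $ i) *\<^sub>R axis i 1)"
    using basis_expansion[of v] by (simp add: scalar_mult_eq_scaleR)
   also have "... = (SUM i:UNIV. (v $ i) *\<^sub>R fd f (at z) (axis i 1))"
    using has_derivative_linear[OF hd] by (simp add: linear_sum linear_cmul)
   also have "norm ... <= (\<Sum>i\<in>(UNIV::'n set). norm v * B)"
    using B z component_le_norm_cart[of v] by (intro order.trans[OF norm_sum] sum_mono) (auto intro!: mult_mono)
   finally show "norm (fd f (at z) v) <= real CARD('n) * B * norm v" by (simp add: mult_ac)
  qed
 qed
 thus ?thesis using B(1) by (intro exI[of _ "real CARD('n) * B"]) auto
qed

context elliptic_operator
begin

lemma coordinate_ball_exists:
 assumes c: "c : A" and co: "op_coeffs A L c a b q" and R: "R > 0" and cb: "cball x0 R <= cdom c"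
 shows "EX lo up l C m d1 d2. coordinate_ball A g L M T c a b q x0 R lo up l C m d1 d2"
proof -
 let ?K = "cball x0 R"
 have sm: "smooth_on (cdom c) a" "smooth_on (cdom c) b" "smooth_on (cdom c) q"
  using co unfolding op_coeffs_def by blast+
 have con: "continuous_on ?K a" "continuous_on ?K b" "continuous_on ?K q"
  by (rule continuous_on_subset[OF smooth_on_continuous cb], fact sm)+
 have fc: "continuous_on (?K \<times> sphere (0::real^'n) 1) (%(xi, v). frozen a xi *v v)"
  unfolding frozen_def matrix_vector_mult_def case_prod_unfold
  by (intro continuous_intros continuous_on_compose2[OF con(1)]) auto
 have ks: "compact (?K \<times> sphere (0::real^'n) 1)" by (intro compact_Times compact_cball compact_sphere)
 obtain up0 where up0: "up0 >= 0" "!!xi v. xi : ?K ==> norm v = 1 ==> norm (frozen a xi *v v) <= up0"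
  using compact_norm_bound[OF ks fc] by auto
 have "axis undefined 1 : sphere (0::real^'n) 1" by simp
 hence ne: "?K \<times> sphere (0::real^'n) 1 ~= {}" using R by (metis centre_in_cball empty_iff less_imp_le mem_Sigma_iff)
 have "continuous_on (?K \<times> sphere (0::real^'n) 1) (%p. snd p \<bullet> (frozen a (fst p) *v snd p))"
  using fc by (intro continuous_intros) (simp add: case_prod_unfold)
 from continuous_attains_inf[OF ks ne this] obtain p where
  p: "p : ?K \<times> sphere 0 1" "!!p'. p' : ?K \<times> sphere 0 1 ==> snd p \<bullet> (frozen a (fst p) *v snd p) <= snd p' \<bullet> (frozen a (fst p') *v snd p')" by blast
 define lo0 where "lo0 = snd p \<bullet> (frozen a (fst p) *v snd p)"
 have lo0: "lo0 > 0"
 proof -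
  have U: "fst p : cdom c" and nz: "snd p ~= 0" using p(1) cb by auto
  have "Re (symbol a (snd p) (fst p)) = dsum (%i j. Re (a (fst p) $ i $ j) * (snd p $ i * snd p $ j))" by (simp add: symbol_def)
  moreover have "dsum (%i j. Re (a (fst p) $ i $ j) * (snd p $ i * snd p $ j)) = dsum (%i j. Re (a (fst p) $ j $ i) * (snd p $ i * snd p $ j))"
   by (subst sum.swap) (simp add: mult_ac)
  moreover have "lo0 = - (dsum (%i j. Re (a (fst p) $ i $ j) * (snd p $ i * snd p $ j)) + dsum (%i j. Re (a (fst p) $ j $ i) * (snd p $ i * snd p $ j))) / 2"
   by (simp add: lo0_def inner_vec_def matrix_vector_mult_def frozen_def sum_distrib_left sum.distrib[symmetric] sum_negf[symmetric] sum_divide_distrib algebra_simps add_divide_distrib)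
  ultimately have "lo0 = - Re (symbol a (snd p) (fst p))" by simp
  thus ?thesis using symbol_negative(2)[OF c co U nz] by simp
 qed
 have hom: "frozen a xi *v v = norm v *\<^sub>R (frozen a xi *v (v /\<^sub>R norm v))" for xi v
  by (cases "v = 0") (simp_all add: matrix_vector_mult_scaleR)
 have lower: "lo0 * (norm v)^2 <= v \<bullet> (frozen a xi *v v)" if xi: "xi : ?K" for xi v
 proof (cases "v = 0")
  case False
  let ?u = "v /\<^sub>R norm v"
  have "lo0 <= ?u \<bullet> (frozen a xi *v ?u)" using p(2)[of "(xi, ?u)"] xi False by (simp add: lo0_def)
  hence "lo0 * (norm v)^2 <= (?u \<bullet> (frozen a xi *v ?u)) * (norm v)^2" by (rule mult_right_mono) simp
  also have "... = v \<bullet> (frozen a xi *v v)" using False by (subst (2) hom) (simp add: power2_eq_square)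
  finally show ?thesis .
 qed simp
 have upper: "norm (frozen a xi *v v) <= (up0 + 1) * norm v" if xi: "xi : ?K" for xi v
 proof (cases "v = 0")
  case False
  have "norm (frozen a xi *v (v /\<^sub>R norm v)) <= up0 + 1" using up0(2)[OF xi, of "v /\<^sub>R norm v"] False by simp
  thus ?thesis by (subst hom) (simp add: mult.commute mult_left_mono)
 qed simp
 obtain l0 where l0: "l0 >= 0" "!!x y. x : ?K ==> y : ?K ==> norm (a x - a y) <= l0 * norm (x - y)"
  using smooth_lipschitz[OF sm(1) cb] by blast
 obtain Ca Cb Cq where C: "Ca >= 0" "!!x. x : ?K ==> norm (a x) <= Ca" "Cb >= 0" "!!x. x : ?K ==> norm (b x) <= Cb"
  "Cq >= 0" "!!x. x : ?K ==> norm (q x) <= Cq"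
  using con[THEN compact_norm_bound[OF compact_cball]] by metis
 let ?D = "%x. complex_of_real (bump x0 R x)"
 have bc: "continuous_on ?K ?D" "continuous_on ?K (pd i ?D)" "continuous_on ?K (%x. pd (fst ij) (pd (snd ij) ?D) x)" for i ij
  by (rule continuous_on_subset[OF smooth_on_continuous subset_UNIV], intro smooth_bump smooth_partial_deriv)+
 obtain D0 where D0: "D0 >= 0" "!!x. x : ?K ==> norm (?D x) <= D0" using compact_norm_bound[OF compact_cball bc(1)] by blast
 obtain D1 where D1: "D1 >= 0" "!!i x. x : ?K ==> norm (pd i ?D x) <= D1"
  using compact_norm_bound_finite[of ?K "%i. pd i ?D", OF compact_cball bc(2)] by blast
 obtain D2 where D2: "D2 >= 0" "!!ij x. x : ?K ==> norm (pd (fst ij) (pd (snd ij) ?D) x) <= D2"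
  using compact_norm_bound_finite[of ?K "%ij x. pd (fst ij) (pd (snd ij) ?D) x", OF compact_cball bc(3)] by blast
 have bR: "continuous_on UNIV (bump x0 R)" using Ck_on_bump[of 0 x0 R] by simp
 obtain xm where xm: "xm : cball x0 (R / 2)" "!!x. x : cball x0 (R / 2) ==> bump x0 R xm <= bump x0 R x"
  using continuous_attains_inf[OF compact_cball _ continuous_on_subset[OF bR subset_UNIV], of x0 "R / 2"] R by (metis cball_eq_empty less_divide_eq_numeral1(1) linorder_not_less mult_zero_left order_less_imp_le)
 have bm: "bump x0 R xm > 0" using xm(1) R by (intro bump_pos) auto
 have dc: "continuous_on ?K (dens c)" by (rule continuous_on_subset[OF dens_continuous[OF c] cb])
 have K0: "?K ~= {}" using R by simp
 obtain y1 where y1: "y1 : ?K" "!!x. x : ?K ==> dens c y1 <= dens c x" using continuous_attains_inf[OF compact_cball K0 dc] by blast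
 obtain y2 where y2: "y2 : ?K" "!!x. x : ?K ==> dens c x <= dens c y2" using continuous_attains_sup[OF compact_cball K0 dc] by blast
 define C where "C = 1 + Ca + Cb + Cq + D0 + D1 + D2"
 have "coordinate_ball A g L M T c a b q x0 R (min 1 lo0) (up0 + 1) (1 + l0) C (bump x0 R xm) (dens c y1) (dens c y2)"
 proof unfold_locales
  show "min 1 lo0 * (norm v)^2 <= v \<bullet> (frozen a xi *v v)" if "xi : ?K" for xi v
   using lower[OF that, of v] mult_right_mono[of "min 1 lo0" lo0 "(norm v)^2"] by simp
  show "cmod (a eta $ i $ j - a xi $ i $ j) <= (1 + l0) * norm (eta - xi)" if "xi : ?K" "eta : ?K" for xi eta i j
  proof -
   have "cmod ((a eta - a xi) $ i $ j) <= norm (a eta - a xi)" by (rule order.trans[OF nth_le nth_le])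
   also have "... <= l0 * norm (eta - xi)" using l0(2) that by blast
   also have "... <= (1 + l0) * norm (eta - xi)" by (intro mult_right_mono) auto
   finally show ?thesis by simp
  qed
  show "cmod (a eta $ i $ j) <= C" if "eta : ?K" for eta i j
   using order.trans[OF nth_le[of "a eta $ i" j] order.trans[OF nth_le[of "a eta" i] C(2)[OF that]]] C D0 D1 D2 by (simp add: C_def)
  show "cmod (b eta $ i) <= C" if "eta : ?K" for eta i
   using order.trans[OF nth_le[of "b eta" i] C(4)[OF that]] C D0 D1 D2 by (simp add: C_def)
  show "cmod (q eta) <= C" if "eta : ?K" for eta using C(6)[OF that] C D0 D1 D2 by (simp add: C_def)
  show "bump x0 R eta <= C" if "eta : ?K" for eta using D0(2)[OF that] C D0 D1 D2 by (simp add: C_def)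
  show "cmod (pd i ?D eta) <= C" if "eta : ?K" for eta i using D1(2)[OF that, of i] C D0 D1 D2 by (simp add: C_def)
  show "cmod (pd i (pd j ?D) eta) <= C" if "eta : ?K" for eta i j using D2(2)[OF that, of "(i, j)"] C D0 D1 D2 by (simp add: C_def)
  show "bump x0 R xm <= bump x0 R xi" if "xi : ball x0 (R / 2)" for xi using xm(2) that by simp
  show "0 < dens c y1" using y1(1) cb by (intro dens_pos c) blast
 qed (use c co R cb lo0 up0 upper l0 C D0 D1 D2 bm y1 y2 in "auto simp: C_def")
 thus ?thesis by blast
qed

lemma hk_bound_sum:
 assumes "finite I" "!!i. i : I ==> hk_bound (G i) (k i)"
 shows "hk_bound (SUM i:I. G i) (%r x y. SUM i:I. k i r x y)"
 using assms
proof (induction I rule: finite_induct)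
 case empty thus ?case by (simp add: hk_bound_def)
next
 case (insert i I)
 have 1: "hk_bound (G i) (k i)" and 2: "hk_bound (SUM i:I. G i) (%r x y. SUM i:I. k i r x y)" using insert by auto
 have add: "hk_bound (a + b) (%r x y. k r x y + l r x y)" if k: "hk_bound a k" and l: "hk_bound b l" for a b k l
 proof -
  have nn: "0 <= k r x y" "0 <= l r x y" for r x y using k l by (auto simp: hk_bound_def)
  have m: "(%(r, x, y). k r x y) : meas borel3" "(%(r, x, y). l r x y) : meas borel3"
   using k l by (auto simp: hk_bound_def)
  have m1 [measurable]: "(%y. k r x y) : meas borel" "(%y. l r x y) : meas borel"
   "(%y. k r y x) : meas borel" "(%y. l r y x) : meas borel" for r x
   using measurable_compose[OF _ m(1), of "%y. (r, x, y)" borel] measurable_compose[OF _ m(2), of "%y. (r, x, y)" borel]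
    measurable_compose[OF _ m(1), of "%y. (r, y, x)" borel] measurable_compose[OF _ m(2), of "%y. (r, y, x)" borel] by simp_all
  have kb: "k r x y <= a * (1 / sqrt r) ^ CARD('n)" "l r x y <= b * (1 / sqrt r) ^ CARD('n)" if "r : {0<..1}" for r x y
   using k l that by (auto simp: hk_bound_def)
  hence "k r x y + l r x y <= (a + b) * (1 / sqrt r) ^ CARD('n)" if "r : {0<..1}" for r x y
   using that by (metis add_mono distrib_right)
  moreover have ab: "0 <= a" "0 <= b"
   using order.trans[OF nn(1) kb(1)[of 1]] order.trans[OF nn(2) kb(2)[of 1]] by auto
  moreover have "nint M (%y. k r x y + l r x y) <= ennreal (a + b)" "nint M (%y. k r y x + l r y x) <= ennreal (a + b)" if "r : {0<..1}" for r x
   using k l that ab nn by (auto simp: hk_bound_def ennreal_plus nn_integral_add intro!: add_mono simp del: ennreal_plus[symmetric])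
  moreover have "(%(r, x, y). k r x y + l r x y) : meas borel3"
   using borel_measurable_add[OF m] by (simp add: case_prod_unfold)
  ultimately show ?thesis using nn by (auto simp: hk_bound_def)
 qed
 show ?case using add[OF 1 2] insert by simp
qed

text \<open>At every point use the Gaussian of one of finitely many coordinate balls whose halves cover the manifold.\<close>

theorem heat_parametrix:
 "EX Gam>=1. EX alpha::nat. ALL s. EX k. hk_bound (Gam * (1 + abs s) ^ alpha) k & (ALL x. EX phi e psi. parametrix_at s k x phi e psi)"
proof -
 from ball_cover obtain I where I: "finite I" "\<forall>(c, x, R)\<in>I. c : A & R > 0 & cball x R <= cdom c"
   "ALL y. \<exists>(c, x, R)\<in>I. y : fst c & snd c y : ball x (R/2)" by blast
 define N where "N = CARD('n) + 5"
 define Q where "Q = (%(i :: ('a, 'n) chart \<times> (real^'n) \<times> real) Gam k. (ALL s. hk_bound (Gam * (1 + abs s) ^ N) (k s) \<and>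
  (ALL x. x : fst (fst i) & snd (fst i) x : ball (fst (snd i)) (snd (snd i) / 2) --> (EX phi e psi. parametrix_at s (k s) x phi e psi))))"
 have loc: "EX Gam k. Q i Gam k" if i: "i : I" for i
 proof -
  obtain c x0 R where ii: "i = (c, x0, R)" by (cases i)
  have c: "c : A" "R > 0" "cball x0 R <= cdom c" using I(2) i ii by auto
  obtain a b q where co: "op_coeffs A L c a b q" by (rule second_order_elliptic_coeffs[OF elliptic c(1)])
  obtain lo up l C m d1 d2 where "coordinate_ball A g L M T c a b q x0 R lo up l C m d1 d2"
   using coordinate_ball_exists[OF c(1) co c(2,3)] by blast
  then interpret B: coordinate_ball A g L M T c a b q x0 R lo up l C m d1 d2 .
  show ?thesis unfolding Q_def ii N_def fst_conv snd_conv using B.hk_bound_kk[of "- _"] B.parametrix_at_gau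
   by (intro exI[of _ B.kconst] exI[of _ "%s. B.kk (- s)"]) (simp, blast)
 qed
 obtain Gam where "ALL i:I. EX k. Q i (Gam i) k" using bchoice[of I "%i Gam. EX k. Q i Gam k"] loc by blast
 then obtain k where "ALL i:I. Q i (Gam i) (k i)" using bchoice[of I "%i k. Q i (Gam i) k"] by blast
 hence k: "!!i s. i : I ==> hk_bound (Gam i * (1 + abs s) ^ N) (k i s)"
  "!!i s x. i : I ==> x : fst (fst i) ==> snd (fst i) x : ball (fst (snd i)) (snd (snd i) / 2) ==> EX phi e psi. parametrix_at s (k i s) x phi e psi" unfolding Q_def by blast+
 define kk where "kk s r x y = (SUM i:I. k i s r x y)" for s r x y
 have nn: "0 <= k i s r x y" if "i : I" for i s r x y using k(1)[OF that] by (auto simp: hk_bound_def)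
 have b: "hk_bound (sum Gam I * (1 + abs s) ^ N) (kk s)" for s
  using hk_bound_sum[OF I(1) k(1)] unfolding kk_def[abs_def] sum_distrib_right .
 have mono: "hk_bound b l" if "hk_bound a l" "a <= b" for a b l
 proof -
  have "l r x y <= b * (1 / sqrt r) ^ CARD('n)" if r: "r : {0<..1}" for r x y
  proof -
   have "a * (1 / sqrt r) ^ CARD('n) <= b * (1 / sqrt r) ^ CARD('n)" using `a <= b` r by (intro mult_right_mono) auto
   thus ?thesis using `hk_bound a l` r unfolding hk_bound_def by (meson order.trans)
  qed
  thus ?thesis using that ennreal_leI[OF that(2)] unfolding hk_bound_def by (meson order.trans)
 qed
 have "EX phi e psi. parametrix_at s (kk s) x phi e psi" for s x
 proof -
  obtain i where i: "i : I" "x : fst (fst i)" "snd (fst i) x : ball (fst (snd i)) (snd (snd i) / 2)"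
   using I(3) by (fastforce simp: case_prod_unfold)
  obtain phi e psi where P: "parametrix_at s (k i s) x phi e psi" using k(2)[OF i] by blast
  have le: "k i s r x y <= kk s r x y" for r y unfolding kk_def using I(1) i(1) nn by (intro member_le_sum) auto
  have "cmod (phi r y) <= kk s r x y & cmod (e r y) <= (1 / sqrt r) * kk s r x y" if "r : {0<..1}" for r y
  proof -
   have "(1 / sqrt r) * k i s r x y <= (1 / sqrt r) * kk s r x y" using le that by (intro mult_left_mono) auto
   moreover have "cmod (phi r y) <= k i s r x y & cmod (e r y) <= (1 / sqrt r) * k i s r x y" using P that unfolding parametrix_at_def by blast
   ultimately show ?thesis using le[of r y] by linarith
  qed
  hence "parametrix_at s (kk s) x phi e psi" using P unfolding parametrix_at_def by blast
  thus ?thesis by blast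
 qed
 moreover have "hk_bound ((abs (sum Gam I) + 1) * (1 + abs s) ^ N) (kk s)" for s
  by (rule mono[OF b]) (simp add: mult_right_mono)
 ultimately have "ALL s. EX k. hk_bound ((abs (sum Gam I) + 1) * (1 + abs s) ^ N) k & (ALL x. EX phi e psi. parametrix_at s k x phi e psi)"
  by blast
 thus ?thesis by (intro exI[of _ "abs (sum Gam I) + 1"] conjI exI[of _ N]) auto
qed

end

section \<open>Duhamel's formula\<close>

text \<open>A heat multiplier with complex time \<open>z\<close>, and the result of applying a multiplier to a finite sum
 of eigenfunctions. A family of eigenfunctions is indexed by its eigenvalues.\<close>

definition heat :: "complex => real => complex" where "heat z l = exp (- (of_real l * z))"

definition comb :: "(real => complex) => real set => (real => 'a => complex) => 'a => complex" where
 "comb h Sp u x = (SUM l:Sp. h l * u l x)"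

definition ctime :: "real => complex" where "ctime s = 1 + \<i> * of_real s"

abbreviation flow where "flow s r == comb (heat (of_real r * ctime s))"

abbreviation total where "total == comb (%l. 1)"

lemma heat_norm: "0 <= l ==> 0 <= r ==> cmod (heat (of_real r * ctime s) l) <= 1"
 by (simp add: heat_def ctime_def)

lemma norm_integral_le_nn:
 fixes g :: "'b => complex" shows "ennreal (cmod (LINT x|N. g x)) <= nint N (%x. ennreal (cmod (g x)))"
 by (cases "integrable N g") (simp_all add: integral_norm_bound_ennreal not_integrable_integral_eq)

lemma inner_le_nn:
 assumes "!!y. cmod (phi y) <= kap y"
 shows "ennreal (cmod (L2_inner M u phi)) <= nint M (%y. ennreal (kap y) * ennreal (cmod (u y)))"
proof -
 have "ennreal (cmod (L2_inner M u phi)) <= nint M (%y. ennreal (cmod (u y * cnj (phi y))))"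
  unfolding L2_inner_def by (rule norm_integral_le_nn)
 also have "... <= nint M (%y. ennreal (kap y) * ennreal (cmod (u y)))"
 proof (rule nn_integral_mono)
  fix y
  have "0 <= kap y" using assms[of y] norm_ge_zero order.trans by blast
  moreover have "cmod (u y * cnj (phi y)) <= kap y * cmod (u y)"
   unfolding norm_mult complex_mod_cnj by (subst mult.commute) (intro mult_right_mono assms norm_ge_zero)
  ultimately show "ennreal (cmod (u y * cnj (phi y))) <= ennreal (kap y) * ennreal (cmod (u y))"
   by (simp add: enn_mult)
 qed
 finally show ?thesis .
qed

context elliptic_operator
begin

definition family :: "real set => (real => 'a => complex) => bool" where
 "family Sp u = (finite Sp & (ALL l:Sp. 0 <= l & (u l, %x. of_real l * u l x) : T))"

lemma familyD:
 assumes "family Sp u"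
 shows "finite Sp" "l : Sp ==> 0 <= l" "l : Sp ==> (u l, %x. of_real l * u l x) : T" "l : Sp ==> u l : L2_space M"
  "l : Sp ==> u l : meas borel"
 using assms T_memD(1) L2_space_measurable[of "u l" M] measurable_cong_sets[OF sets_M refl] by (auto simp: family_def)

lemma comb_measurable: "family Sp u ==> comb h Sp u : meas borel"
 unfolding comb_def[abs_def] by (intro borel_measurable_sum borel_measurable_times borel_measurable_const familyD(5))

lemma L2_imp_integrable: "u : L2_space M ==> integrable M u"
 using L2_mult_integrable[OF _ bounded_measurable_L2[OF finite_measure_axioms borel_measurable_const, of 1 1]] by simp

lemma inner_comb:
 assumes f: "family Sp u" and v: "v : L2_space M"
 shows "ip (comb h Sp u) v = (SUM l:Sp. h l * ip (u l) v)"
proof -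
 have "ip (comb h Sp u) v = (LINT y|M. (SUM l:Sp. h l * (u l y * cnj (v y))))"
  by (simp add: L2_inner_def comb_def sum_distrib_right mult.assoc)
 also have "... = (SUM l:Sp. \<integral>y. h l * (u l y * cnj (v y)) \<partial>M)"
  using L2_mult_integrable[OF familyD(4)[OF f] v] by (intro Bochner_Integration.integral_sum integrable_mult_right)
 also have "... = (SUM l:Sp. h l * ip (u l) v)" by (simp add: L2_inner_def)
 finally show ?thesis .
qed

definition duhamel :: "real => (real => 'a => 'a => real) => real set => (real => 'a => complex) => real => 'a => ennreal" where
 "duhamel s k Sp u R x = nint lborel (%r. indicator {0<..<R} r *
   (nint M (%y. ennreal (1 / sqrt r * k r x y) * ennreal (cmod (flow s (R - r) Sp u y)))))"

end

locale heat_parametrix_at = elliptic_operator A g L M T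
 for A :: "('a::{second_countable_topology, t2_space}, 'n::finite) chart set" and g L M T +
 fixes s G :: real and k x phi e psi
 assumes hb: "hk_bound G k" and par: "parametrix_at s k x phi e psi"
begin

lemma k_nonneg: "0 <= k r x y" using hb by (simp add: hk_bound_def)

lemma k_bound: "r : {0<..1} ==> k r x y <= G * (1 / sqrt r) ^ CARD('n)" using hb by (auto simp: hk_bound_def)

lemma G_nonneg: "0 <= G" using order.trans[OF k_nonneg k_bound[of 1]] by simp

lemma phi_T: "r > 0 ==> (phi r, psi r) : T"
 and e_meas: "r > 0 ==> e r : meas borel"
 and phi_deriv: "r > 0 ==> ((%r. phi r y) has_vd (e r y - cnj (ctime s) * psi r y)) (at r)"
 and e_cont: "continuous_on {0<..} (%r. e r y)"
 and phi_le: "r : {0<..1} ==> cmod (phi r y) <= k r x y"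
 and e_le: "r : {0<..1} ==> cmod (e r y) <= 1 / sqrt r * k r x y"
 and deriv_le: "eps > 0 ==> EX B. ALL r:{eps..1}. ALL y. cmod (e r y - cnj (ctime s) * psi r y) <= B"
 and concentrates: "smooth_fun A f ==> (!!j. 0 < X j) ==> X ----> 0 ==> (%j. ip f (phi (X j))) ----> f x"
 using par by (auto simp: parametrix_at_def ctime_def)

lemma e_bound:
 assumes r: "r : {eps..1}" and eps: "eps > 0" shows "cmod (e r y) <= (1 / sqrt eps) * (G * (1 / sqrt eps) ^ CARD('n))"
proof -
 have r': "r : {0<..1}" using assms by auto
 have i: "1 / sqrt r <= 1 / sqrt eps" using assms by (intro frac_le) auto
 have "cmod (e r y) <= (1 / sqrt r) * (G * (1 / sqrt r) ^ CARD('n))"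
  using r' by (intro order.trans[OF e_le] mult_left_mono k_bound) auto
 also have "... <= (1 / sqrt eps) * (G * (1 / sqrt eps) ^ CARD('n))"
  using r' eps G_nonneg by (intro mult_mono power_mono i mult_nonneg_nonneg) auto
 finally show ?thesis .
qed

lemma e_L2: assumes "r : {0<..1}" shows "e r : L2_space M"
 using e_bound[of r r] e_meas[of r] assms by (intro bounded_measurable_L2[OF finite_measure_axioms]) (auto cong: measurable_cong_sets)

lemma inner_derivative:
 assumes u: "(u, %x. of_real l * u x) : T" and r: "0 < r" "r < 1"
 shows "((%r. ip u (phi r)) has_vector_derivative
  (ip u (e r) - of_real l * ctime s * ip u (phi r))) (at r)"
proof -
 have uL: "u : L2_space M" by (rule T_memD(1)[OF u])
 have um: "u : meas M" by (rule L2_space_measurable[OF uL])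
 obtain B where B: "!!t y. t : {r/2..1} ==> cmod (e t y - cnj (ctime s) * psi t y) <= B"
 proof -
  have "EX B. ALL t:{r/2..1}. ALL y. cmod (e t y - cnj (ctime s) * psi t y) <= B" by (rule deriv_le) (use r in simp)
  thus ?thesis using that by blast
 qed
 define delta where "delta = min (r / 2) ((1 - r) / 2)"
 have t: "0 < t" "t : {r/2..1}" if "abs (t - r) < delta" for t using that r by (auto simp: delta_def abs_if split: if_splits)
 have psiL: "psi r : L2_space M" using T_memD(2)[OF phi_T[OF r(1)]] .
 have eL: "e r : L2_space M" using e_L2[of r] r by simp
 have "((%r. \<integral>y. u y * cnj (phi r y) \<partial>M) has_vd (LINT y|M. u y * cnj (e r y - cnj (ctime s) * psi r y))) (at r)"
 proof (rule has_vector_derivative_integral[where delta = delta and h = "%y. cmod (u y) * B"])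
  show "delta > 0" using r by (simp add: delta_def)
  fix t y assume t': "abs (t - r) < delta"
  show "((%t. u y * cnj (phi t y)) has_vd u y * cnj (e t y - cnj (ctime s) * psi t y)) (at t)"
   by (intro has_vector_derivative_mult_right has_vector_derivative_cnj phi_deriv t(1)[OF t'])
  show "integrable M (%y. u y * cnj (phi t y))" by (rule L2_mult_integrable[OF uL T_memD(1)[OF phi_T[OF t(1)[OF t']]]])
  show "cmod (u y * cnj (e t y - cnj (ctime s) * psi t y)) <= cmod (u y) * B"
   unfolding norm_mult complex_mod_cnj by (intro mult_left_mono B t(2)[OF t']) simp
 next
  show "(%y. u y * cnj (e r y - cnj (ctime s) * psi r y)) : meas M"
   using L2_space_measurable[OF psiL] L2_space_measurable[OF eL] um by measurable
  show "integrable M (%y. cmod (u y) * B)" using L2_imp_integrable[OF uL] by simp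
 qed
 moreover have "(LINT y|M. u y * cnj (e r y - cnj (ctime s) * psi r y)) = ip u (e r) - of_real l * ctime s * ip u (phi r)"
 proof -
  have "u y * cnj (e r y - cnj (ctime s) * psi r y) = u y * cnj (e r y) - ctime s * (u y * cnj (psi r y))" for y
   by (simp add: algebra_simps)
  hence "(LINT y|M. u y * cnj (e r y - cnj (ctime s) * psi r y)) = ip u (e r) - ctime s * ip u (psi r)"
   using L2_mult_integrable[OF uL psiL] L2_mult_integrable[OF uL eL] by (simp add: L2_inner_def)
  moreover have "ip u (psi r) = ip (%x. of_real l * u x) (phi r)" using T_sym[OF phi_T[OF r(1)] u] by simp
  moreover have "ip (%x. of_real l * u x) (phi r) = of_real l * ip u (phi r)"
   by (simp add: L2_inner_def mult.assoc)
  ultimately show ?thesis by (simp add: mult_ac)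
 qed
 ultimately show ?thesis by (simp add: L2_inner_def)
qed

lemma inner_e_continuous:
 assumes u: "u : L2_space M" and eps: "eps > 0"
 shows "continuous_on {eps..1} (%r. ip u (e r))"
 unfolding continuous_on_sequentially comp_def
proof (intro allI ballI impI, elim conjE)
 fix X r assume r: "r : {eps..1}" and X: "ALL n. X n : {eps..1}" "X ----> r"
 have um: "u : meas M" by (rule L2_space_measurable[OF u])
 have em: "e t : meas M" if "t : {eps..1}" for t using e_meas[of t] that eps by (auto cong: measurable_cong_sets)
 show "(%n. ip u (e (X n))) ----> ip u (e r)" unfolding L2_inner_def
 proof (rule integral_dominated_convergence[where w = "%y. cmod (u y) * ((1 / sqrt eps) * (G * (1 / sqrt eps) ^ CARD('n)))"])
  show "integrable M (%y. cmod (u y) * ((1 / sqrt eps) * (G * (1 / sqrt eps) ^ CARD('n))))"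
   using L2_imp_integrable[OF u] by (intro integrable_mult_left integrable_norm)
  have "(%n. e (X n) y) ----> e r y" for y
   using continuous_on_tendsto_compose[OF e_cont[of y] X(2)] r X(1) eps by (auto simp: less_le_trans)
  thus "AE y in M. (%n. u y * cnj (e (X n) y)) ----> u y * cnj (e r y)" by (intro AE_I2 tendsto_intros)
  fix n :: nat
  have Xn: "X n : {eps..1}" using X(1) by blast
  show "AE y in M. cmod (u y * cnj (e (X n) y)) <= cmod (u y) * ((1 / sqrt eps) * (G * (1 / sqrt eps) ^ CARD('n)))"
   unfolding norm_mult complex_mod_cnj by (intro AE_I2 mult_left_mono e_bound eps Xn) auto
  show "(%y. u y * cnj (e (X n) y)) : meas M" using um em[OF Xn] by measurable
 next
  show "(%y. u y * cnj (e r y)) : meas M" using um em[OF r] by measurable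
 qed
qed

text \<open>Along the flow the derivative of \<open>r \<mapsto> \<langle>S(R - r) f, phi r\<rangle>\<close> is \<open>\<langle>S(R - r) f, e r\<rangle>\<close>, since the two terms with the operator cancel.\<close>

lemma duhamel_pointwise:
 assumes f: "family Sp u" and R: "0 < eps" "eps < R" "R < 1"
 shows "ennreal (cmod (SUM l:Sp. heat (of_real (R - eps) * ctime s) l * ip (u l) (phi eps)))
  <= nint M (%y. ennreal (k R x y) * ennreal (cmod (total Sp u y))) + duhamel s k Sp u R x"
proof -
 define h where "h r l = heat (of_real (R - r) * ctime s) l" for r l
 define b where "b r = (SUM l:Sp. h r l * ip (u l) (phi r))" for r
 define D where "D r = (SUM l:Sp. h r l * ip (u l) (e r))" for r
 have db: "(b has_vd D r) (at r within S)" if r: "r : {eps..R}" for r S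
 proof -
  have hd: "((%r. h r l) has_vd (of_real l * ctime s) * h r l) (at r)" for l
  proof -
   have "((%z. exp (- (of_real l * ((of_real R - z) * ctime s)))) has_field_derivative (of_real l * ctime s) * h r l) (at (complex_of_real r))"
    by (auto intro!: derivative_eq_intros simp: h_def heat_def)
   from has_vector_derivative_real_field[OF this] show ?thesis by (simp add: h_def heat_def)
  qed
  have "(b has_vd (SUM l:Sp. h r l * (ip (u l) (e r) - of_real l * ctime s * ip (u l) (phi r)) + ((of_real l * ctime s) * h r l) * ip (u l) (phi r))) (at r)"
   unfolding b_def[abs_def] using r R by (intro has_vector_derivative_sum has_vector_derivative_mult hd inner_derivative familyD(3)[OF f]) auto
  moreover have "(SUM l:Sp. h r l * (ip (u l) (e r) - of_real l * ctime s * ip (u l) (phi r)) + ((of_real l * ctime s) * h r l) * ip (u l) (phi r)) = D r"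
   unfolding D_def by (rule sum.cong[OF refl]) (simp add: algebra_simps)
  ultimately show ?thesis by (simp add: has_vector_derivative_at_within)
 qed
 have Dc: "continuous_on {eps..R} D" unfolding D_def[abs_def] h_def heat_def
  using R by (intro continuous_intros continuous_on_subset[OF inner_e_continuous[OF familyD(4)[OF f] R(1)]]) auto
 have FTC: "has_bochner_integral lborel (%r. indicator {eps..R} r *\<^sub>R D r) (b R - b eps)"
  using R db Dc by (intro has_bochner_integral_FTC_Icc) auto
 have "b eps = b R - (LBINT r. indicator {eps..R} r *\<^sub>R D r)" using FTC by (simp add: has_bochner_integral_integral_eq)
 hence "cmod (b eps) <= cmod (b R) + cmod (LBINT r. indicator {eps..R} r *\<^sub>R D r)" by (metis norm_triangle_ineq4)
 hence "ennreal (cmod (b eps)) <= ennreal (cmod (b R)) + ennreal (cmod (LBINT r. indicator {eps..R} r *\<^sub>R D r))"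
  by (simp add: ennreal_plus[symmetric] ennreal_leI del: ennreal_plus)
 moreover have "ennreal (cmod (b R)) <= nint M (%y. ennreal (k R x y) * ennreal (cmod (total Sp u y)))"
 proof -
  have "b R = ip (total Sp u) (phi R)"
   using inner_comb[OF f T_memD(1)[OF phi_T[of R]]] R by (simp add: b_def h_def heat_def)
  thus ?thesis using R by (simp only:) (intro inner_le_nn phi_le; simp)
 qed
 moreover have "ennreal (cmod (LBINT r. indicator {eps..R} r *\<^sub>R D r)) <= duhamel s k Sp u R x"
 proof -
  have "ennreal (cmod (LBINT r. indicator {eps..R} r *\<^sub>R D r)) <= nint lborel (%r. ennreal (cmod (indicator {eps..R} r *\<^sub>R D r)))"
   by (rule norm_integral_le_nn)
  also have "... <= duhamel s k Sp u R x" unfolding duhamel_def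
  proof (rule nn_integral_mono_AE)
   have "AE r in lborel. r ~= R" by (rule AE_lborel_singleton)
   thus "AE r in lborel. ennreal (cmod (indicator {eps..R} r *\<^sub>R D r)) <= indicator {0<..<R} r *
   (nint M (%y. ennreal (1 / sqrt r * k r x y) * ennreal (cmod (flow s (R - r) Sp u y))))"
   proof eventually_elim
    case (elim r)
    show ?case
    proof (cases "r : {eps..R}")
     case True
     hence r: "r : {0<..1}" "r : {0<..<R}" using R elim by auto
     have "D r = ip (flow s (R - r) Sp u) (e r)"
      using inner_comb[OF f e_L2[OF r(1)]] by (simp add: D_def h_def)
     hence "ennreal (cmod (D r)) <= nint M (%y. ennreal (1 / sqrt r * k r x y) * ennreal (cmod (flow s (R - r) Sp u y)))"
      by (simp only:) (rule inner_le_nn[OF e_le[OF r(1)]])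
     thus ?thesis using True r by simp
    qed simp
   qed
  qed
  finally show ?thesis .
 qed
 ultimately show ?thesis unfolding b_def h_def by (meson add_mono order.trans)
qed

text \<open>The parametrix reproduces smooth functions in the limit of time zero, so each eigenfunction is replaced by a smooth
 approximation \<open>w\<close> with error at most \<open>d\<close>.\<close>

lemma duhamel_limit:
 assumes f: "family Sp u" and R: "0 < R" "R < 1" and X: "!!i. 0 < X i" "!!i. X i < R" "X ----> 0"
  and ap: "!!delta. delta > 0 ==> EX w d. (ALL l:Sp. smooth_fun A (w l) & (ALL y. cmod (u l y - w l y) <= d y)) & d x < delta
   & liminf (%i. \<integral>\<^sup>+y. ennreal (k (X i) x y) * ennreal (d y) \<partial>M) < ennreal delta"
 shows "ennreal (cmod (flow s R Sp u x))
  <= nint M (%y. ennreal (k R x y) * ennreal (cmod (total Sp u y))) + duhamel s k Sp u R x" (is "_ <= ?V")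
proof (rule ennreal_le_epsilon)
 fix eta :: real assume eta: "0 < eta"
 define delta where "delta = eta / (3 * real (card Sp) + 1)"
 have delta: "0 < delta" using eta by (simp add: delta_def add_nonneg_pos)
 obtain w d where w: "!!l. l : Sp ==> smooth_fun A (w l)" "!!l y. l : Sp ==> cmod (u l y - w l y) <= d y" "d x < delta"
  "liminf (%i. \<integral>\<^sup>+y. ennreal (k (X i) x y) * ennreal (d y) \<partial>M) < ennreal delta"
  using ap[OF delta] by blast
 have 1: "\<exists>\<^sub>F i in sequentially. (nint M (%y. ennreal (k (X i) x y) * ennreal (d y))) < ennreal delta"
 proof (rule ccontr)
  assume "\<not> ?thesis"
  hence "\<forall>\<^sub>F i in sequentially. ennreal delta <= nint M (%y. ennreal (k (X i) x y) * ennreal (d y))"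
   by (simp add: not_frequently not_less)
  from Liminf_bounded[OF this] show False using w(4) by simp
 qed
 have 2: "\<forall>\<^sub>F i in sequentially. ALL l:Sp. cmod (ip (w l) (phi (X i)) - w l x) < delta"
 proof (rule eventually_ball_finite[OF familyD(1)[OF f]], rule ballI)
  fix l assume "l : Sp"
  from tendstoD[OF concentrates[OF w(1)[OF this] X(1,3)] delta]
  show "\<forall>\<^sub>F i in sequentially. cmod (ip (w l) (phi (X i)) - w l x) < delta" by (simp add: dist_norm)
 qed
 define b where "b i = (SUM l:Sp. heat (of_real (R - X i) * ctime s) l * u l x)" for i
 have "b ----> (SUM l:Sp. heat (of_real (R - 0) * ctime s) l * u l x)"
  unfolding b_def[abs_def] heat_def by (intro tendsto_intros X)
 hence "b ----> flow s R Sp u x" by (simp add: comb_def)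
 from tendstoD[OF this delta] have 3: "\<forall>\<^sub>F i in sequentially. cmod (b i - flow s R Sp u x) < delta"
  by (simp add: dist_norm)
 obtain i where i: "nint M (%y. ennreal (k (X i) x y) * ennreal (d y)) < ennreal delta"
   "!!l. l : Sp ==> cmod (ip (w l) (phi (X i)) - w l x) < delta"
   "cmod (b i - flow s R Sp u x) < delta"
  using frequently_ex[OF frequently_eventually_frequently[OF 1 eventually_conj[OF 2 3]]] by blast
 have r: "X i : {0<..1}" using X(1,2)[of i] R by auto
 define q where "q l = ip (u l) (phi (X i))" for l
 have q: "cmod (q l - u l x) <= 3 * delta" if l: "l : Sp" for l
 proof -
  have phiL: "phi (X i) : L2_space M" by (rule T_memD(1)[OF phi_T[OF X(1)]])
  note wc = smooth_fun_continuous[OF w(1)[OF l]]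
  obtain B where "!!y. cmod (w l y) <= B" using compact_norm_bound[OF compact_space wc] by blast
  moreover have "w l : meas M" using borel_measurable_continuous_onI[OF wc] by (simp cong: measurable_cong_sets)
  ultimately have wL: "w l : L2_space M" by (intro bounded_measurable_L2[OF finite_measure_axioms])
  have "ennreal (cmod (ip (%y. u l y - w l y) (phi (X i)))) <= nint M (%y. ennreal (k (X i) x y) * ennreal (cmod (u l y - w l y)))"
   by (rule inner_le_nn[OF phi_le[OF r]])
  also have "... <= nint M (%y. ennreal (k (X i) x y) * ennreal (d y))"
   by (intro nn_integral_mono mult_left_mono ennreal_leI w(2) l) simp
  also have "... < ennreal delta" by (rule i(1))
  finally have "cmod (ip (%y. u l y - w l y) (phi (X i))) < delta" using delta by (simp add: ennreal_less_iff)
  moreover have "ip (%y. u l y - w l y) (phi (X i)) = q l - ip (w l) (phi (X i))"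
   using L2_mult_integrable[OF familyD(4)[OF f l] phiL] L2_mult_integrable[OF wL phiL]
   by (simp add: L2_inner_def q_def left_diff_distrib)
  moreover have "cmod (u l x - w l x) < delta" using w(2)[OF l, of x] w(3) by linarith
  moreover have "q l - u l x = (q l - ip (w l) (phi (X i))) + (ip (w l) (phi (X i)) - w l x) - (u l x - w l x)" by simp
  ultimately show ?thesis using i(2)[OF l]
   by (smt (verit) norm_triangle_ineq norm_triangle_ineq4)
 qed
 define c where "c = (SUM l:Sp. heat (of_real (R - X i) * ctime s) l * q l)"
 have "cmod (c - b i) = cmod (SUM l:Sp. heat (of_real (R - X i) * ctime s) l * (q l - u l x))"
  by (simp add: c_def b_def sum_subtractf[symmetric] right_diff_distrib)
 also have "... <= (SUM l:Sp. 1 * (3 * delta))"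
 proof (intro order.trans[OF norm_sum] sum_mono)
  fix l assume l: "l : Sp"
  show "cmod (heat (of_real (R - X i) * ctime s) l * (q l - u l x)) <= 1 * (3 * delta)"
   unfolding norm_mult using X(2)[of i] by (intro mult_mono heat_norm q[OF l] familyD(2)[OF f l]) auto
 qed
 finally have "cmod (c - b i) <= real (card Sp) * (3 * delta)" by simp
 hence "cmod (flow s R Sp u x) <= cmod c + (real (card Sp) * (3 * delta) + delta)"
  using i(3) by (smt (verit) norm_minus_commute norm_triangle_sub)
 also have "real (card Sp) * (3 * delta) + delta = eta"
 proof -
  have "delta * (3 * real (card Sp) + 1) = eta" by (simp add: delta_def add_nonneg_eq_0_iff)
  thus ?thesis by (simp add: algebra_simps)
 qed
 finally have "ennreal (cmod (flow s R Sp u x)) <= ennreal (cmod c) + ennreal eta"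
  using eta by (simp add: ennreal_plus[symmetric] ennreal_leI del: ennreal_plus)
 also have "ennreal (cmod c) <= ?V" unfolding c_def q_def by (rule duhamel_pointwise[OF f X(1,2) R(2)])
 finally show "ennreal (cmod (flow s R Sp u x)) <= ?V + ennreal eta" by (simp add: add_right_mono)
qed

end

context elliptic_operator
begin

lemma kernel_measurable:
 assumes "hk_bound G k"
 shows "(%(r, x, y). k r x y) : meas borel3"
  and "(%(x, y). k r x y) : meas borel2"
proof -
 show 1: "(%(r, x, y). k r x y) : meas borel3"
  using assms by (simp add: hk_bound_def)
 have "(%p. (r, p)) : measurable borel2 borel3" by (intro measurable_Pair1') simp
 from measurable_compose[OF this 1] show "(%(x, y). k r x y) : meas borel2" by simp
qed

lemma column_bound:
 assumes m: "(%(x, y). kap x y) : meas borel2" and d: "d : meas borel"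
  and col: "!!y. (nint M (%x. ennreal (kap x y))) <= ennreal G"
 shows "nint M (%x. nint M (%y. ennreal (kap x y) * d y)) <= ennreal G * nint M (%y. d y)"
proof -
 interpret MM: pair_sigma_finite M M by unfold_locales
 have [measurable]: "(%(x, y). kap x y) : meas (M \<Otimes>\<^sub>M M)" "d : meas M"
  using m d by (auto cong: measurable_cong_sets sets_pair_measure_cong)
 have "nint M (%x. nint M (%y. ennreal (kap x y) * d y)) = nint M (%y. nint M (%x. ennreal (kap x y) * d y))"
  by (rule MM.Fubini'[symmetric]) measurable
 also have "... = nint M (%y. (nint M (%x. ennreal (kap x y))) * d y)" by (intro nn_integral_cong nn_integral_multc) measurable
 also have "... <= nint M (%y. ennreal G * d y)" by (intro nn_integral_mono mult_right_mono col) simp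
 also have "... = ennreal G * nint M (%y. d y)" by (rule nn_integral_cmult) measurable
 finally show ?thesis .
qed

lemma smooth_approx:
 assumes u: "(u, v) : T" and tau: "tau > 0"
 shows "EX f. smooth_fun A f & nint M (%x. ennreal (cmod (u x - f x))) <= ennreal tau"
proof -
 define mu where "mu = measure M UNIV"
 define eta where "eta = tau / (2 * (mu + 1))"
 have mu: "0 <= mu" by (simp add: mu_def)
 have eta: "eta > 0" using tau mu by (simp add: eta_def)
 have "ennreal (sqrt (eta * tau / 2)) > 0" using eta tau by simp
 then obtain f where f: "smooth_fun A f" "Lp_norm M 2 (%x. u x - f x) < ennreal (sqrt (eta * tau / 2))"
  using u unfolding T_eq L2_realization_def by blast
 let ?I = "\<integral>\<^sup>+x. ennreal ((cmod (u x - f x))^2) \<partial>M"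
 have I: "?I <= ennreal (eta * tau / 2)"
 proof -
  have fin: "?I ~= \<infinity>" and "sqrt (enn2real ?I) < sqrt (eta * tau / 2)"
   using f(2) by (auto simp: Lp_norm_2 Let_def ennreal_less_iff split: if_splits)
  hence "enn2real ?I <= eta * tau / 2" by simp
  thus ?thesis using fin by (metis enn2real_le infinity_ennreal_def enn2real_nonneg order.trans top.not_eq_extremum)
 qed
 have fm: "(%x. u x - f x) : meas M"
  using L2_space_measurable[OF T_memD(1)[OF u]] borel_measurable_continuous_onI[OF smooth_fun_continuous[OF f(1)]]
  by (auto cong: measurable_cong_sets)
 have "nint M (%x. ennreal (cmod (u x - f x))) <= nint M (%x. ennreal eta + ennreal (1 / eta) * ennreal ((cmod (u x - f x))^2))"
 proof (rule nn_integral_mono)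
  fix x
  let ?a = "cmod (u x - f x)"
  have "0 <= (?a - eta)^2 + ?a * eta" using eta by simp
  hence "?a * eta <= eta * eta + ?a^2" by (simp add: power2_eq_square algebra_simps)
  hence "?a <= eta + 1 / eta * ?a^2" using eta by (simp add: field_simps)
  thus "ennreal ?a <= ennreal eta + ennreal (1 / eta) * ennreal (?a^2)"
   using eta by (simp add: enn_mult ennreal_plus[symmetric] ennreal_leI del: ennreal_plus)
 qed
 also have "... = ennreal eta * emeasure M UNIV + ennreal (1 / eta) * ?I"
  using fm by (subst nn_integral_add) (auto simp: nn_integral_cmult)
 also have "... <= ennreal eta * ennreal mu + ennreal (1 / eta) * ennreal (eta * tau / 2)"
  by (intro add_mono mult_left_mono I) (auto simp: mu_def emeasure_eq_measure)
 also have "... = ennreal (eta * mu + tau / 2)"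
  using eta mu tau by (simp add: enn_mult ennreal_plus[symmetric] del: ennreal_plus)
 also have "... <= ennreal tau"
 proof (rule ennreal_leI)
  have "eta * (mu + 1) = tau / 2" using mu by (simp add: eta_def field_simps)
  thus "eta * mu + tau / 2 <= tau" using eta by (simp add: algebra_simps)
 qed
 finally show ?thesis using f(1) by blast
qed

text \<open>Eigenfunctions are limits of smooth functions in the mean. Fatou's lemma, applied to a sequence of errors and to their
 images under the dominating kernel, provides good approximations at almost every point.\<close>

lemma duhamel_AE:
 assumes hb: "hk_bound G k" and par: "!!x. EX phi e psi. parametrix_at s k x phi e psi"
  and f: "family Sp u" and R: "0 < R" "R < 1"
 shows "AE x in M. ennreal (cmod (flow s R Sp u x))
  <= nint M (%y. ennreal (k R x y) * ennreal (cmod (total Sp u y))) + duhamel s k Sp u R x"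
proof -
 define X where "X i = R / real (i + 2)" for i
 have X: "!!i. 0 < X i" "!!i. X i < R" using R by (auto simp: X_def field_simps intro: add_pos_nonneg)
 have X0: "X ----> 0" unfolding X_def[abs_def] using LIMSEQ_ignore_initial_segment[OF lim_const_over_n[of R], of 2] by simp
 have "EX w. ALL l:Sp. smooth_fun A (w l) & nint M (%x. ennreal (cmod (u l x - w l x))) <= ennreal ((1/2) ^ n)" for n
  by (rule bchoice, rule ballI, rule smooth_approx[OF familyD(3)[OF f]]) auto
 then obtain w where w: "!!n l. l : Sp ==> smooth_fun A (w n l)"
  "!!n l. l : Sp ==> (nint M (%x. ennreal (cmod (u l x - w n l x)))) <= ennreal ((1/2) ^ n)" by metis
 define d where "d n y = (SUM l:Sp. cmod (u l y - w n l y))" for n y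
 have d0: "0 <= d n y" for n y by (simp add: d_def sum_nonneg)
 have wm: "(%y. cmod (u l y - w n l y)) : meas borel" if "l : Sp" for n l
  using familyD(5)[OF f that] borel_measurable_continuous_onI[OF smooth_fun_continuous[OF w(1)[OF that]]] by measurable
 hence dm [measurable]: "d n : meas borel" for n unfolding d_def[abs_def] by (intro borel_measurable_sum)
 have dI: "nint M (%y. ennreal (d n y)) <= ennreal (real (card Sp) * (1/2) ^ n)" for n
 proof -
  have "nint M (%y. ennreal (d n y)) = nint M (%y. (SUM l:Sp. ennreal (cmod (u l y - w n l y))))" by (simp add: d_def)
  also have "... = (SUM l:Sp. \<integral>\<^sup>+y. ennreal (cmod (u l y - w n l y)) \<partial>M)"
   using wm by (intro nn_integral_sum) (auto cong: measurable_cong_sets)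
  also have "... <= (SUM l:Sp. ennreal ((1/2) ^ n))" by (intro sum_mono w(2))
  also have "... = ennreal (real (card Sp) * (1/2) ^ n)" by (simp add: ennreal_mult ennreal_of_nat_eq_real_of_nat)
  finally show ?thesis .
 qed
 define h where "h n x = liminf (%i. \<integral>\<^sup>+y. ennreal (k (X i) x y) * ennreal (d n y) \<partial>M)" for n x
 have km: "(%(x, y). ennreal (k r x y) * ennreal (d n y)) : meas (M \<Otimes>\<^sub>M M)" for r n
 proof -
  have [measurable]: "(%(x, y). k r x y) : meas (M \<Otimes>\<^sub>M M)" "d n : meas M"
   using kernel_measurable(2)[OF hb] dm by (auto cong: measurable_cong_sets sets_pair_measure_cong)
  show ?thesis by measurable
 qed
 have im [measurable]: "(%x. \<integral>\<^sup>+y. ennreal (k (X i) x y) * ennreal (d n y) \<partial>M) : meas M" for i n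
  using borel_measurable_nn_integral[of "%x y. ennreal (k (X i) x y) * ennreal (d n y)" M] km by blast
 have hm [measurable]: "h n : meas M" for n unfolding h_def[abs_def] by measurable
 have G: "0 <= G" using hb unfolding hk_bound_def by (metis greaterThanAtMost_iff order.trans power_one div_by_1 real_sqrt_one mult.right_neutral zero_less_one order_refl)
 have hI: "nint M (%x. h n x) <= ennreal (G * (real (card Sp) * (1/2) ^ n))" for n
 proof -
  have "nint M (%x. h n x) <= liminf (%i. \<integral>\<^sup>+x. \<integral>\<^sup>+y. ennreal (k (X i) x y) * ennreal (d n y) \<partial>M \<partial>M)"
   unfolding h_def by (intro nn_integral_liminf im)
  also have "... <= liminf (%i::nat. ennreal (G * (real (card Sp) * (1/2) ^ n)))"
  proof (intro Liminf_mono always_eventually allI)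
   fix i
   have "X i : {0<..1}" using X(1,2)[of i] R by auto
   hence "nint M (%x. nint M (%y. ennreal (k (X i) x y) * ennreal (d n y))) <= ennreal G * nint M (%y. ennreal (d n y))"
    using hb by (intro column_bound kernel_measurable(2)[OF hb]) (auto simp: hk_bound_def)
   also have "... <= ennreal G * ennreal (real (card Sp) * (1/2) ^ n)" by (intro mult_left_mono dI) simp
   finally show "nint M (%x. nint M (%y. ennreal (k (X i) x y) * ennreal (d n y))) <= ennreal (G * (real (card Sp) * (1/2) ^ n))"
    using G by (simp add: ennreal_mult')
  qed
  also have "... = ennreal (G * (real (card Sp) * (1/2) ^ n))" by (rule Liminf_const) simp
  finally show ?thesis .
 qed
 \<comment> \<open>a null function, so at almost every point some approximation is good in both respects\<close>
 define z where "z x = (INF n. h n x + ennreal (d n x))" for x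
 have zm: "z : meas M" unfolding z_def[abs_def] by measurable
 have "nint M (%x. z x) <= ennreal ((G + 1) * real (card Sp) * (1/2) ^ n)" for n
 proof -
  have "nint M (%x. z x) <= nint M (%x. h n x + ennreal (d n x))" unfolding z_def by (intro nn_integral_mono INF_lower) simp
  also have "... = nint M (%x. h n x) + nint M (%x. ennreal (d n x))" by (intro nn_integral_add) measurable
  also have "... <= ennreal (G * (real (card Sp) * (1/2) ^ n)) + ennreal (real (card Sp) * (1/2) ^ n)" by (intro add_mono hI dI)
  also have "... = ennreal ((G + 1) * real (card Sp) * (1/2) ^ n)"
   using G by (simp add: ennreal_plus[symmetric] algebra_simps del: ennreal_plus)
  finally show ?thesis .
 qed
 moreover have "(%n. ennreal ((G + 1) * real (card Sp) * (1/2) ^ n)) ----> ennreal 0"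
  by (rule tendsto_ennrealI) (auto intro!: tendsto_mult_right_zero LIMSEQ_power_zero)
 ultimately have "nint M (%x. z x) <= ennreal 0" by (intro LIMSEQ_le_const) auto
 hence "AE x in M. z x = 0" using nn_integral_0_iff_AE[OF zm] by simp
 thus ?thesis
 proof eventually_elim
  case (elim x)
  obtain phi e psi where "parametrix_at s k x phi e psi" using par by blast
  then interpret H: heat_parametrix_at A g L M T s G k x phi e psi by unfold_locales (rule hb)
  show ?case
  proof (rule H.duhamel_limit[OF f R X X0])
   fix delta :: real assume delta: "delta > 0"
   have "z x < ennreal delta" using elim delta by simp
   then obtain n where n: "h n x + ennreal (d n x) < ennreal delta" unfolding z_def by (auto simp: INF_less_iff)
   have "h n x < ennreal delta" using n by (rule le_less_trans[rotated]) simp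
   moreover have "ennreal (d n x) < ennreal delta" using n by (rule le_less_trans[rotated]) simp
   hence "d n x < delta" using d0 delta by (simp add: ennreal_less_iff)
   moreover have "cmod (u l y - w n l y) <= d n y" if "l : Sp" for l y
    unfolding d_def by (rule member_le_sum[OF that]) (auto simp: familyD(1)[OF f])
   ultimately show "EX w d. (ALL l:Sp. smooth_fun A (w l) & (ALL y. cmod (u l y - w l y) <= d y)) & d x < delta
   & liminf (%i. \<integral>\<^sup>+y. ennreal (k (X i) x y) * ennreal (d y) \<partial>M) < ennreal delta"
    using w(1) unfolding h_def by blast
  qed
 qed
qed

end

section \<open>Bounds in Lebesgue spaces\<close>

lemma young_tangent:
 fixes a y p :: real
 assumes "1 <= p" "0 < a" "0 <= y"
 shows "p * a powr (p - 1) * y <= y powr p + (p - 1) * a powr p"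
proof (cases "p = 1")
 case False
 hence p: "p > 1" using assms by simp
 define q where "q = p / (p - 1)"
 have q: "q > 1" "1 / p + 1 / q = 1" "(p - 1) * q = p" using p by (auto simp: q_def field_simps)
 have "y * a powr (p - 1) <= y powr p / p + (a powr (p - 1)) powr q / q"
  by (rule Youngs_inequality[OF p q(1,2)]) (use assms in auto)
 also have "(a powr (p - 1)) powr q = a powr p" by (simp add: powr_powr q)
 finally have "p * (y * a powr (p - 1)) <= p * (y powr p / p + a powr p / q)" using p by simp
 also have "... = y powr p + (p - 1) * a powr p" using p by (simp add: q_def field_simps)
 finally show ?thesis by (simp add: mult_ac)
qed (use assms in simp)

text \<open>Integrate the tangent line inequality for \<open>y^p\<close> at \<open>h / A\<close>.\<close>

lemma jensen_nn:
 fixes f :: "'b => real" and p h A :: real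
 assumes p: "1 <= p" and kap [measurable]: "kap : meas N" and f [measurable]: "f : meas N"
  and nn: "!!y. 0 <= f y" "0 <= h" "0 < A"
  and A: "nint N (%y. kap y) <= ennreal A" and h: "ennreal h <= nint N (%y. kap y * ennreal (f y))"
 shows "ennreal (h powr p) <= ennreal (A powr (p - 1)) * nint N (%y. kap y * ennreal (f y powr p))"
proof (cases "h = 0 | (nint N (%y. kap y * ennreal (f y powr p))) = \<infinity>")
 case True thus ?thesis using nn p by (auto simp: ennreal_mult_top)
next
 case False
 then obtain x where x: "nint N (%y. kap y * ennreal (f y powr p)) = ennreal x" "0 <= x"
  by (metis ennreal_cases infinity_ennreal_def)
 define a where "a = h / A"
 have a: "0 < a" using False nn by (auto simp: a_def)
 define c where "c = 1 / (p * a powr (p - 1))"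
 define d where "d = (1 - 1 / p) * a"
 have cd: "0 <= c" "0 <= d" using p a by (auto simp: c_def d_def)
 have t: "f y <= c * f y powr p + d" for y
 proof -
  have "f y = c * (p * a powr (p - 1) * f y)" using p a by (simp add: c_def)
  also have "... <= c * (f y powr p + (p - 1) * a powr p)" using cd by (intro mult_left_mono young_tangent p a nn)
  also have "c * ((p - 1) * a powr p) = d"
   using p a powr_add[of a "p - 1" 1] by (simp add: c_def d_def field_simps)
  hence "c * (f y powr p + (p - 1) * a powr p) = c * f y powr p + d" by (simp add: distrib_left)
  finally show ?thesis .
 qed
 have "ennreal h <= nint N (%y. kap y * ennreal (f y))" by (rule h)
 also have "... <= nint N (%y. ennreal c * (kap y * ennreal (f y powr p)) + ennreal d * kap y)"
 proof (rule nn_integral_mono)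
  fix y
  have "ennreal (f y) <= ennreal c * ennreal (f y powr p) + ennreal d"
   using t[of y] cd by (simp add: enn_mult ennreal_plus[symmetric] ennreal_leI del: ennreal_plus)
  hence "kap y * ennreal (f y) <= kap y * (ennreal c * ennreal (f y powr p) + ennreal d)" by (intro mult_left_mono) auto
  also have "... = ennreal c * (kap y * ennreal (f y powr p)) + ennreal d * kap y" by (simp add: distrib_left mult_ac)
  finally show "kap y * ennreal (f y) <= ennreal c * (kap y * ennreal (f y powr p)) + ennreal d * kap y" .
 qed
 also have "... = ennreal c * ennreal x + ennreal d * nint N (%y. kap y)"
  by (simp add: nn_integral_add nn_integral_cmult x)
 also have "... <= ennreal c * ennreal x + ennreal d * ennreal A" by (intro add_left_mono mult_left_mono A) simp
 also have "... = ennreal (c * x + d * A)" using cd x nn by (simp add: enn_mult ennreal_plus[symmetric] del: ennreal_plus)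
 finally have "h <= c * x + d * A" using cd x nn by (subst (asm) ennreal_le_iff) auto
 also have "d * A = (1 - 1 / p) * h" using nn by (simp add: d_def a_def)
 finally have "h / p <= x / (p * a powr (p - 1))" by (simp add: c_def algebra_simps)
 hence "h * a powr (p - 1) <= x" using p a by (simp add: field_simps)
 hence "A powr (p - 1) * (h * a powr (p - 1)) <= A powr (p - 1) * x" by (intro mult_left_mono) auto
 also have "A powr (p - 1) * (h * a powr (p - 1)) = h * (A * a) powr (p - 1)" using nn a by (simp add: powr_mult)
 also have "A * a = h" using nn by (simp add: a_def)
 also have "h * h powr (p - 1) = h powr p" using nn False powr_add[of h 1 "p - 1"] by simp
 finally show ?thesis using x by (simp add: enn_mult ennreal_leI)
qed

text \<open>Schur's test.\<close>

lemma schur_nn: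
 fixes f :: "'a => 'b => real" and h :: "'a => real"
 assumes sf: "sigma_finite_measure M" "sigma_finite_measure N"
  and p: "1 <= p" and kap [measurable]: "(%(x, y). kap x y) : meas (M \<Otimes>\<^sub>M N)"
  and f [measurable]: "(%(x, y). f x y) : meas (M \<Otimes>\<^sub>M N)"
  and nn: "!!x y. 0 <= f x y" "!!x. 0 <= h x" "0 < A"
  and A: "!!x. x : space M ==> (nint N (%y. kap x y)) <= ennreal A" and h: "AE x in M. ennreal (h x) <= nint N (%y. kap x y * ennreal (f x y))"
 shows "nint M (%x. ennreal (h x powr p)) <= ennreal (A powr (p - 1)) * nint N (%y. nint M (%x. kap x y * ennreal (f x y powr p)))"
proof -
 interpret MN: pair_sigma_finite M N using sf by (simp add: pair_sigma_finite_def)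
 have "nint M (%x. ennreal (h x powr p)) <= nint M (%x. ennreal (A powr (p - 1)) * nint N (%y. kap x y * ennreal (f x y powr p)))"
 proof (rule nn_integral_mono_AE)
  show "AE x in M. ennreal (h x powr p) <= ennreal (A powr (p - 1)) * nint N (%y. kap x y * ennreal (f x y powr p))"
   using h AE_space
  proof eventually_elim
   case (elim x)
   have [measurable]: "kap x : meas N" "f x : meas N"
    using measurable_compose[OF measurable_Pair1'[OF elim(2)] kap] measurable_compose[OF measurable_Pair1'[OF elim(2)] f] by simp_all
   show ?case by (rule jensen_nn[OF p _ _ nn A[OF elim(2)] elim(1)]) measurable
  qed
 qed
 also have "... = ennreal (A powr (p - 1)) * nint M (%x. nint N (%y. kap x y * ennreal (f x y powr p)))"
  by (rule nn_integral_cmult) measurable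
 also have "nint M (%x. nint N (%y. kap x y * ennreal (f x y powr p))) = nint N (%y. nint M (%x. kap x y * ennreal (f x y powr p)))"
  by (rule MN.Fubini'[symmetric]) measurable
 finally show ?thesis .
qed

lemma inverse_sqrt_integral:
 assumes "0 <= R" shows "nint lborel (%r. indicator {0<..<R} r * ennreal (1 / sqrt r)) = ennreal (2 * sqrt R)"
proof -
 have "((%r. 1 / sqrt r) has_integral (2 * sqrt R - 2 * sqrt 0)) {0..R}"
 proof (rule fundamental_theorem_of_calculus_interior)
  fix x :: real assume "x : {0<..<R}"
  thus "((%r. 2 * sqrt r) has_vd 1 / sqrt x) (at x)"
   unfolding has_real_derivative_iff_has_vector_derivative[symmetric]
   by (auto intro!: derivative_eq_intros simp: field_simps)
 qed (use assms in "auto intro!: continuous_intros")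
 hence "nint lborel (%r. ennreal (1 / sqrt r) * indicator {0..R} r) = ennreal (2 * sqrt R)"
  by (intro nn_integral_has_integral_lebesgue') auto
 moreover have "nint lborel (%r. indicator {0<..<R} r * ennreal (1 / sqrt r)) = nint lborel (%r. ennreal (1 / sqrt r) * indicator {0..R} r)"
 proof (rule nn_integral_cong_AE)
  have "AE r in lborel. r ~= 0" "AE r in lborel. r ~= R" by (rule AE_lborel_singleton)+
  thus "AE r in lborel. indicator {0<..<R} r * ennreal (1 / sqrt r) = ennreal (1 / sqrt r) * indicator {0..R} r"
   by eventually_elim (auto simp: indicator_def)
 qed
 ultimately show ?thesis by simp
qed

context elliptic_operator
begin

definition Ipow :: "real => ('a => complex) => ennreal" where
 "Ipow p f = nint M (%x. ennreal (cmod (f x) powr p))"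

definition dominated :: "real => ('a => complex) => ('a => complex) => bool" where
 "dominated K f F = ((ALL p>=1. Ipow p F <= ennreal (K powr p) * Ipow p f))"

lemma comb_heat_measurable:
 assumes f: "family Sp u"
 shows "(%(r, y). comb (heat (of_real (R - r) * z)) Sp u y) : meas borel2"
 unfolding comb_def case_prod_unfold heat_def
 by (intro borel_measurable_sum borel_measurable_times measurable_compose[OF measurable_snd familyD(5)[OF f]]) measurable

lemma family_scale:
 assumes "family Sp u" shows "family Sp (%l x. h l * u l x)"
proof -
 interpret L2: semi_hilbert "L2_space M" "%c f x. c * f x" "L2_inner M" by (rule semi_hilbert_L2)
 have sa: "L2.sa T" using T_sa by (simp add: self_adjoint_op_iff)
 have "(%x. h l * u l x, %x. of_real l * (h l * u l x)) : T" if "l : Sp" for l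
  using L2.sa_sc[OF sa familyD(3)[OF assms that], of "h l"] by (simp add: mult.left_commute)
 thus ?thesis using assms by (simp add: family_def)
qed

lemma comb_scale: "comb h Sp (%l x. h' l * u l x) = comb (%l. h l * h' l) Sp u"
 by (simp add: comb_def fun_eq_iff mult.assoc)

lemma mass_finite: "emeasure M UNIV = ennreal (measure M UNIV)" by (simp add: emeasure_eq_measure)

end

section \<open>The Levi series\<close>

text \<open>Up to the time \<open>rho\<close>, one more convolution with the error kernel divides the mass by four, so the series of iterated
 kernels converges; its sum dominates the heat flow.\<close>

locale short_kernel = elliptic_operator A g L M T
 for A :: "('a::{second_countable_topology, t2_space}, 'n::finite) chart set" and g L M T +
 fixes G :: real and k
 assumes hb: "hk_bound G k" and G: "1 <= G"
begin

definition N where "N = (lborel :: real measure) \<Otimes>\<^sub>M M"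

definition e where "e R x q = ennreal (indicator {0<..<R} (fst q) / sqrt (fst q)) * ennreal (k (fst q) x (snd q))" for R :: real

primrec iter :: "nat => real => 'a => 'a => ennreal" where
 "iter 0 R x y = ennreal (k R x y)"
| "iter (Suc j) R x y = nint N (%q. e R x q * iter j (R - fst q) (snd q) y)"

definition levi where "levi R x y = (\<Sum>j. iter j R x y)"

definition rho where "rho = 1 / (64 * G^2 * 2 ^ CARD('n))"

lemma rho: "0 < rho" "rho < 1" "R <= rho ==> 2 * sqrt R * G * sqrt 2 ^ CARD('n) <= 1 / 4" "R <= rho ==> 0 <= R ==> 2 * sqrt R * G <= 1 / 4"
proof -
 have "1 <= G^2 * 2 ^ CARD('n)" using G by (simp add: mult_ge1_I one_le_power)
 thus "0 < rho" "rho < 1" using G by (auto simp: rho_def field_simps)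
 have s: "2 * sqrt R * G * sqrt 2 ^ CARD('n) <= 1 / 4" if "R <= rho" for R
 proof -
  have "sqrt R <= 1 / (8 * G * sqrt 2 ^ CARD('n))"
   using real_sqrt_le_mono[OF that] G by (simp add: rho_def real_sqrt_divide real_sqrt_mult real_sqrt_power)
  hence "sqrt R * (8 * G * sqrt 2 ^ CARD('n)) <= 1 / (8 * G * sqrt 2 ^ CARD('n)) * (8 * G * sqrt 2 ^ CARD('n))" using G by (intro mult_right_mono) auto
  thus ?thesis using G by (simp add: mult_ac)
 qed
 thus "R <= rho ==> 2 * sqrt R * G * sqrt 2 ^ CARD('n) <= 1 / 4" .
 show "2 * sqrt R * G <= 1 / 4" if "R <= rho" "0 <= R"
 proof -
  have "2 * sqrt R * G * 1 <= 2 * sqrt R * G * sqrt 2 ^ CARD('n)" using that G by (intro mult_left_mono one_le_power) auto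
  thus ?thesis using s[OF that(1)] by simp
 qed
qed

lemma k_nonneg: "0 <= k r x y"
 and row: "r : {0<..1} ==> (nint M (%y. ennreal (k r x y))) <= ennreal G"
 and col: "r : {0<..1} ==> (nint M (%x. ennreal (k r x y))) <= ennreal G"
 and k_sup: "r : {0<..1} ==> k r x y <= G * (1 / sqrt r) ^ CARD('n)"
 using hb by (auto simp: hk_bound_def)

lemma k_comp [measurable (raw)]:
 assumes [measurable]: "a : meas P" "b : measurable P borel" "c : measurable P borel"
 shows "(%p. k (a p) (b p) (c p)) : meas P"
proof -
 have "(%p. (a p, b p, c p)) : measurable P borel3" by measurable
 from measurable_compose[OF this kernel_measurable(1)[OF hb]] show ?thesis by simp
qed

lemma N_proj [measurable]: "fst : meas N" "snd : measurable N borel"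
 unfolding N_def by measurable

sublocale N: sigma_finite_measure N
proof -
 interpret pair_sigma_finite "lborel :: real measure" M by unfold_locales
 show "sigma_finite_measure N" unfolding N_def by (rule sigma_finite_measure_axioms)
qed

sublocale NM: pair_sigma_finite N M by unfold_locales

lemma e_comp [measurable (raw)]:
 assumes [measurable]: "a : meas P" "b : measurable P borel" "c : measurable P N"
 shows "(%p. e (a p) (b p) (c p)) : meas P"
 unfolding e_def indicator_def greaterThanLessThan_iff by measurable

lemma iter_comp [measurable (raw)]:
 assumes [measurable]: "a : meas P" "b : measurable P borel" "c : measurable P borel"
 shows "(%p. iter j (a p) (b p) (c p)) : meas P"
proof -
 have "(%p. iter j (fst p) (fst (snd p)) (snd (snd p))) : meas borel3" for j
 proof (induction j)
  case 0 show ?case unfolding iter.simps by measurable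
 next
  case (Suc j)
  have [measurable]: "(%p. iter j (f p) (h p) (w p)) : meas P"
   if [measurable]: "f : meas P" "h : measurable P borel" "w : measurable P borel" for f h w and P :: "((real \<times> 'a \<times> 'a) \<times> real \<times> 'a) measure"
  proof -
   have "(%p. (f p, h p, w p)) : measurable P borel3" by measurable
   from measurable_compose[OF this Suc] show ?thesis by simp
  qed
  show ?case unfolding iter.simps by measurable
 qed
 note m = this[of j]
 have "(%p. (a p, b p, c p)) : measurable P borel3" by measurable
 from measurable_compose[OF this m] show ?thesis by simp
qed

lemma levi_comp [measurable (raw)]:
 assumes [measurable]: "a : meas P" "b : measurable P borel" "c : measurable P borel"
 shows "(%p. levi (a p) (b p) (c p)) : meas P"
 unfolding levi_def by measurable

lemma N_fst: "h : meas N ==> (nint N (%q. h q)) = nint lborel (%r. nint M (%z. h (r, z)))"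
 unfolding N_def by (rule nn_integral_fst[symmetric])

text \<open>Integration in time of the singularity \<open>1 / sqrt r\<close> over a short interval.\<close>

lemma time_integral:
 assumes R: "R : {0<..rho}" and h: "!!r. r : {0<..<R} ==> h r <= ennreal G * C"
 shows "nint lborel (%r. ennreal (indicator {0<..<R} r / sqrt r) * h r) <= ennreal (1 / 4) * C"
proof -
 have "nint lborel (%r. ennreal (indicator {0<..<R} r / sqrt r) * h r) <= nint lborel (%r. (ennreal G * C) * (indicator {0<..<R} r * ennreal (1 / sqrt r)))"
  using h by (intro nn_integral_mono) (auto simp: indicator_def mult.commute intro!: mult_right_mono)
 also have "... = (ennreal G * C) * ennreal (2 * sqrt R)" using R by (subst nn_integral_cmult) (auto simp: inverse_sqrt_integral)
 also have "... = ennreal (2 * sqrt R * G) * C" using R G by (simp add: ennreal_mult mult_ac)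
 also have "... <= ennreal (1 / 4) * C" using R rho(4)[of R] by (intro mult_right_mono ennreal_leI) auto
 finally show ?thesis .
qed

lemma e_row:
 assumes R: "R : {0<..rho}" and W [measurable]: "(%q. W (R - fst q) (snd q)) : meas N"
  and C: "!!r z. r : {0<..<R} ==> W r z <= C"
 shows "nint N (%q. e R x q * W (R - fst q) (snd q)) <= ennreal (1 / 4) * C"
proof -
 have "nint N (%q. e R x q * W (R - fst q) (snd q)) <= nint N (%q. e R x q * C)"
 proof (rule nn_integral_mono)
  fix q :: "real \<times> 'a"
  show "e R x q * W (R - fst q) (snd q) <= e R x q * C"
   using C[of "R - fst q" "snd q"] by (cases "fst q : {0<..<R}") (auto simp: e_def intro!: mult_left_mono)
 qed
 also have "... = nint lborel (%r. ennreal (indicator {0<..<R} r / sqrt r) * (nint M (%z. ennreal (k r x z)) * C))"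
  by (subst N_fst, measurable) (simp add: e_def nn_integral_cmult nn_integral_multc mult.assoc)
 also have "... <= ennreal (1 / 4) * C" using R rho(2) by (intro time_integral mult_right_mono row) auto
 finally show ?thesis .
qed

lemma e_column:
 assumes R: "R : {0<..rho}" and W [measurable]: "(%q. W (R - fst q) (snd q)) : meas N"
  and C: "!!r. r : {0<..<R} ==> (nint M (%z. W r z)) <= C"
 shows "nint M (%x. nint N (%q. e R x q * W (R - fst q) (snd q))) <= ennreal (1 / 4) * C"
proof -
 have [measurable]: "(%q. W (R - fst (fst q)) (snd (fst q))) : meas (N \<Otimes>\<^sub>M M)"
  using measurable_compose[OF measurable_fst W] by simp
 have "nint M (%x. nint N (%q. e R x q * W (R - fst q) (snd q))) = nint N (%q. nint M (%x. e R x q * W (R - fst q) (snd q)))"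
  by (rule NM.Fubini') (simp add: case_prod_unfold)
 also have "... = nint N (%q. ennreal (indicator {0<..<R} (fst q) / sqrt (fst q)) * nint M (%x. ennreal (k (fst q) x (snd q))) * W (R - fst q) (snd q))"
  by (simp add: e_def nn_integral_cmult nn_integral_multc mult.assoc)
 also have "... <= nint N (%q. ennreal (indicator {0<..<R} (fst q) / sqrt (fst q)) * ennreal G * W (R - fst q) (snd q))"
 proof (rule nn_integral_mono)
  fix q :: "real \<times> 'a"
  show "ennreal (indicator {0<..<R} (fst q) / sqrt (fst q)) * nint M (%x. ennreal (k (fst q) x (snd q))) * W (R - fst q) (snd q)
   <= ennreal (indicator {0<..<R} (fst q) / sqrt (fst q)) * ennreal G * W (R - fst q) (snd q)"
   using R rho(2) by (cases "fst q : {0<..<R}") (auto intro!: mult_right_mono mult_left_mono col)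
 qed
 also have "... = nint lborel (%r. nint M (%z. ennreal (indicator {0<..<R} r / sqrt r) * ennreal G * W (R - r) z))"
 proof (subst N_fst)
  have "(%q. ennreal (indicator {0<..<R} (fst q) / sqrt (fst q))) : meas N"
   unfolding indicator_def greaterThanLessThan_iff by measurable
  thus "(%q. ennreal (indicator {0<..<R} (fst q) / sqrt (fst q)) * ennreal G * W (R - fst q) (snd q)) : meas N"
   by (intro borel_measurable_times_ennreal W) auto
 qed simp
 also have "... = nint lborel (%r. ennreal (indicator {0<..<R} r / sqrt r) * (ennreal G * nint M (%z. W (R - r) z)))"
 proof (rule nn_integral_cong)
  fix r :: real
  have "(%z. W (R - r) z) : meas M" using measurable_compose[OF measurable_Pair1'[of r lborel M] W[unfolded N_def]] by simp
  thus "nint M (%z. ennreal (indicator {0<..<R} r / sqrt r) * ennreal G * W (R - r) z) = ennreal (indicator {0<..<R} r / sqrt r) * (ennreal G * nint M (%z. W (R - r) z))"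
   by (simp add: nn_integral_cmult mult.assoc)
 qed
 also have "... <= ennreal (1 / 4) * C" using R by (intro time_integral mult_left_mono C) auto
 finally show ?thesis .
qed

lemma quarter: "ennreal (1 / 4) * ennreal (G / 4 ^ j) = ennreal (G / 4 ^ Suc j)"
 using G by (simp add: enn_mult)

lemma iter_row: "R : {0<..rho} ==> (nint M (%y. iter j R x y)) <= ennreal (G / 4 ^ j)"
proof (induction j arbitrary: R x)
 case 0 thus ?case using row[of R x] rho(2) by simp
next
 case (Suc j)
 have "nint M (%y. iter (Suc j) R x y) = nint N (%q. nint M (%y. e R x q * iter j (R - fst q) (snd q) y))"
  unfolding iter.simps by (rule NM.Fubini') measurable
 also have "... = nint N (%q. e R x q * nint M (%y. iter j (R - fst q) (snd q) y))" by (simp add: nn_integral_cmult)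
 also have "... <= ennreal (1 / 4) * ennreal (G / 4 ^ j)" using Suc by (intro e_row) auto
 finally show ?case by (simp only: quarter)
qed

lemma iter_column: "R : {0<..rho} ==> (nint M (%x. iter j R x y)) <= ennreal (G / 4 ^ j)"
proof (induction j arbitrary: R)
 case 0 thus ?case using col[of R y] rho(2) by simp
next
 case (Suc j)
 have "nint M (%x. iter (Suc j) R x y) <= ennreal (1 / 4) * ennreal (G / 4 ^ j)"
  unfolding iter.simps using Suc by (intro e_column) auto
 thus ?case by (simp only: quarter)
qed

lemma half_time:
 assumes "0 < R" "R / 2 <= t" shows "(1 / sqrt t) ^ CARD('n) <= sqrt 2 ^ CARD('n) * (1 / sqrt R) ^ CARD('n)"
proof -
 have "1 / sqrt t <= 1 / sqrt (R / 2)" using assms by (intro frac_le) auto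
 thus ?thesis unfolding power_mult_distrib[symmetric] using assms by (intro power_mono) (auto simp: real_sqrt_divide)
qed

text \<open>One of the two kernels in the convolution is evaluated at a time of at least \<open>R / 2\<close> and bounded by its supremum, the other one is integrated.\<close>

lemma iter_sup: "R : {0<..rho} ==> iter j R x y <= ennreal (G * (1 / sqrt R) ^ CARD('n) / 2 ^ j)"
proof (induction j arbitrary: R x)
 case 0 thus ?case using k_sup[of R x y] rho(2) by (auto intro: ennreal_leI)
next
 case (Suc j)
 let ?n = "CARD('n)"
 define Z where "Z = G * (sqrt 2 ^ ?n * (1 / sqrt R) ^ ?n) / 2 ^ j"
 have R: "0 < R" "R <= rho" using Suc by auto
 have Z: "0 <= Z" using G R by (simp add: Z_def)
 have "nint M (%z. ennreal (k r x z) * iter j (R - r) z y) <= ennreal G * ennreal Z" if r: "r : {0<..<R}" for r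
 proof (cases "r < R / 2")
  case True
  have "iter j (R - r) z y <= ennreal Z" for z
  proof -
   have "iter j (R - r) z y <= ennreal (G * (1 / sqrt (R - r)) ^ ?n / 2 ^ j)" using r R by (intro Suc.IH) auto
   also have "... <= ennreal Z" unfolding Z_def using True R G by (intro ennreal_leI divide_right_mono mult_left_mono half_time) auto
   finally show ?thesis .
  qed
  hence "nint M (%z. ennreal (k r x z) * iter j (R - r) z y) <= nint M (%z. ennreal (k r x z) * ennreal Z)" by (intro nn_integral_mono mult_left_mono) auto
  also have "... = nint M (%z. ennreal (k r x z)) * ennreal Z" by (rule nn_integral_multc) measurable
  also have "... <= ennreal G * ennreal Z" using r R rho(2) by (intro mult_right_mono row) auto
  finally show ?thesis .
 next
  case False
  define Z' where "Z' = G * (sqrt 2 ^ ?n * (1 / sqrt R) ^ ?n)"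
  have Z': "0 <= Z'" using G R by (simp add: Z'_def)
  have "k r x z <= Z'" for z
  proof -
   have "k r x z <= G * (1 / sqrt r) ^ ?n" using r R rho(2) by (intro k_sup) auto
   also have "... <= Z'" unfolding Z'_def using False R G by (intro mult_left_mono half_time) auto
   finally show ?thesis .
  qed
  hence "nint M (%z. ennreal (k r x z) * iter j (R - r) z y) <= nint M (%z. ennreal Z' * iter j (R - r) z y)" by (intro nn_integral_mono mult_right_mono ennreal_leI) auto
  also have "... = ennreal Z' * nint M (%z. iter j (R - r) z y)" by (rule nn_integral_cmult) measurable
  also have "... <= ennreal Z' * ennreal (G / 4 ^ j)" using r R by (intro mult_left_mono iter_column) auto
  also have "... = ennreal (G * (Z' / 4 ^ j))" using Z' G by (simp add: enn_mult mult_ac)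
  also have "... <= ennreal (G * Z)" using Z' G by (auto simp: Z_def Z'_def[symmetric] intro!: ennreal_leI mult_left_mono frac_le power_mono)
  finally show ?thesis using G by (simp add: ennreal_mult')
 qed
 hence t: "!!r. r : {0<..<R} ==> (nint M (%z. ennreal (k r x z) * iter j (R - r) z y)) <= ennreal G * ennreal Z" .
 have "iter (Suc j) R x y = nint lborel (%r. ennreal (indicator {0<..<R} r / sqrt r) * nint M (%z. ennreal (k r x z) * iter j (R - r) z y))"
  unfolding iter.simps by (subst N_fst, measurable) (simp add: e_def nn_integral_cmult mult.assoc)
 also have "... <= nint lborel (%r. ennreal (G * Z) * (indicator {0<..<R} r * ennreal (1 / sqrt r)))"
  using t G by (intro nn_integral_mono) (auto simp: indicator_def ennreal_mult' mult.commute intro!: mult_left_mono)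
 also have "... = ennreal (G * Z * (2 * sqrt R))" using R Z G by (subst nn_integral_cmult) (auto simp: inverse_sqrt_integral enn_mult)
 also have "... <= ennreal (G * (1 / sqrt R) ^ ?n / 2 ^ Suc j)"
 proof (rule ennreal_leI)
  have "(2 * sqrt R * G * sqrt 2 ^ ?n) * (G * (1 / sqrt R) ^ ?n / 2 ^ j) <= 1 / 2 * (G * (1 / sqrt R) ^ ?n / 2 ^ j)"
   using R G rho(3)[OF R(2)] by (intro mult_right_mono) auto
  thus "G * Z * (2 * sqrt R) <= G * (1 / sqrt R) ^ ?n / 2 ^ Suc j" by (simp add: Z_def mult_ac)
 qed
 finally show ?case .
qed

lemma geometric_le: "0 <= c ==> 2 <= b ==> (\<Sum>j. ennreal (c / b ^ j)) <= ennreal (2 * c)"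
proof -
 assume c: "0 <= c" and b: "(2::real) <= b"
 have "(\<Sum>j. ennreal (c / b ^ j)) <= (\<Sum>j. ennreal (c * (1 / 2) ^ j))"
  using b c by (intro suminf_le) (auto intro!: ennreal_leI divide_left_mono power_mono simp: power_divide)
 also have "... = ennreal (\<Sum>j. c * (1 / 2) ^ j)" using c by (intro suminf_ennreal2 summable_mult summable_geometric) auto
 also have "(\<Sum>j. c * (1 / 2) ^ j) = 2 * c" by (subst suminf_mult) (auto simp: suminf_geometric)
 finally show ?thesis .
qed

lemma levi_bounds:
 assumes R: "R : {0<..rho}"
 shows "nint M (%y. levi R x y) <= ennreal (2 * G)" "nint M (%x. levi R x y) <= ennreal (2 * G)"
  "levi R x y <= ennreal (2 * (G * (1 / sqrt R) ^ CARD('n)))"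
proof -
 have "nint M (%y. levi R x y) <= (\<Sum>j. ennreal (G / 4 ^ j))" "nint M (%x. levi R x y) <= (\<Sum>j. ennreal (G / 4 ^ j))"
  "levi R x y <= (\<Sum>j. ennreal (G * (1 / sqrt R) ^ CARD('n) / 2 ^ j))"
  unfolding levi_def using R iter_row iter_column iter_sup
  by (auto simp: nn_integral_suminf intro!: suminf_le)
 moreover have "(\<Sum>j. ennreal (G / 4 ^ j)) <= ennreal (2 * G)" "(\<Sum>j. ennreal (G * (1 / sqrt R) ^ CARD('n) / 2 ^ j)) <= ennreal (2 * (G * (1 / sqrt R) ^ CARD('n)))"
  using G R by (auto intro!: geometric_le)
 ultimately show "nint M (%y. levi R x y) <= ennreal (2 * G)" "nint M (%x. levi R x y) <= ennreal (2 * G)"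
  "levi R x y <= ennreal (2 * (G * (1 / sqrt R) ^ CARD('n)))" by (blast intro: order.trans)+
qed

lemma levi_equation: "levi R x y = ennreal (k R x y) + nint N (%q. e R x q * levi (R - fst q) (snd q) y)"
proof -
 have "levi R x y = (\<Sum>j. iter (Suc j) R x y) + iter 0 R x y"
  unfolding levi_def using suminf_offset[of "%j. iter j R x y" 1] by (simp add: add.commute)
 also have "(\<Sum>j. iter (Suc j) R x y) = nint N (%q. e R x q * levi (R - fst q) (snd q) y)"
  unfolding levi_def by (simp add: nn_integral_suminf[symmetric] ennreal_suminf_cmult)
 finally show ?thesis by (simp add: add.commute)
qed

text \<open>The excess of the solution over the Levi series satisfies the homogeneous inequality and vanishes because its
 mass is at most a quarter of itself.\<close>

lemma levi_dominates:
 assumes par: "!!x. EX phi e psi. parametrix_at s k x phi e psi" and f: "family Sp u" and R: "R : {0<..rho}"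
 shows "AE x in M. ennreal (cmod (flow s R Sp u x)) <= nint M (%y. levi R x y * ennreal (cmod (total Sp u y)))"
proof -
 define a where "a r x = ennreal (cmod (flow s r Sp u x))" for r x
 define f0 where "f0 y = ennreal (cmod (total Sp u y))" for y
 have f0m [measurable]: "f0 : meas borel" unfolding f0_def[abs_def] using comb_measurable[OF f] by measurable
 have am: "(%p. a (t p) (x p)) : meas P" if [measurable]: "t : meas P" "x : measurable P borel" for t x and P :: "'c measure"
 proof -
  have "(%p. (- t p, x p)) : measurable P borel2" by measurable
  from measurable_compose[OF this comb_heat_measurable[OF f, of 0 "ctime s"]] show ?thesis unfolding a_def by simp
 qed
 define Q where "Q r x = nint M (%y. levi r x y * f0 y)" for r x
 have Qm: "(%p. Q (t p) (x p)) : meas P" if [measurable]: "t : meas P" "x : measurable P borel" for t x and P :: "'c measure"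
  unfolding Q_def by measurable
 \<comment> \<open>the excess over the Levi series, truncated at zero\<close>
 define b where "b r x = a r x - Q r x" for r x
 have bm: "(%p. b (t p) (x p)) : meas P" if [measurable]: "t : meas P" "x : measurable P borel" for t x and P :: "'c measure"
  unfolding b_def using am[OF that] Qm[OF that] by measurable
 have bq [measurable]: "(%q. b (r - fst q) (snd q)) : meas N" "(%q. Q (r - fst q) (snd q)) : meas N" "(%q. a (r - fst q) (snd q)) : meas N" for r
  by (intro bm Qm am; measurable)+
 have sub: "AE x in M. b r x <= nint N (%q. e r x q * b (r - fst q) (snd q))" if r: "r : {0<..rho}" for r
 proof -
  have r1: "0 < r" "r < 1" using r rho by auto
  show ?thesis using duhamel_AE[OF hb par f r1]
  proof eventually_elim
   case (elim x)
   have "duhamel s k Sp u r x = nint N (%q. e r x q * a (r - fst q) (snd q))"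
   proof (subst N_fst)
    show "duhamel s k Sp u r x = nint lborel (%t. nint M (%z. e r x (t, z) * a (r - fst (t, z)) (snd (t, z))))"
     unfolding duhamel_def a_def[symmetric]
     by (rule nn_integral_cong) (auto simp: e_def indicator_def k_nonneg enn_mult)
   qed measurable
   also have "... <= nint N (%q. e r x q * Q (r - fst q) (snd q) + e r x q * b (r - fst q) (snd q))"
    unfolding b_def distrib_left[symmetric] using ennreal_minus_le_iff[of _ _ "_ - _"] by (intro nn_integral_mono mult_left_mono) auto
   also have "... = nint N (%q. e r x q * Q (r - fst q) (snd q)) + nint N (%q. e r x q * b (r - fst q) (snd q))"
    by (rule nn_integral_add) measurable
   finally have 1: "a r x <= nint M (%y. ennreal (k r x y) * f0 y) + (nint N (%q. e r x q * Q (r - fst q) (snd q)) + nint N (%q. e r x q * b (r - fst q) (snd q)))"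
    using elim unfolding a_def f0_def by (meson add_left_mono order.trans)
   have "nint N (%q. e r x q * Q (r - fst q) (snd q)) = nint N (%q. nint M (%y. e r x q * levi (r - fst q) (snd q) y * f0 y))"
    by (simp add: Q_def nn_integral_cmult mult.assoc)
   also have "... = nint M (%y. nint N (%q. e r x q * levi (r - fst q) (snd q) y * f0 y))" by (rule NM.Fubini'[symmetric]) measurable
   also have "... = nint M (%y. (nint N (%q. e r x q * levi (r - fst q) (snd q) y)) * f0 y)" by (simp add: nn_integral_multc)
   finally have "nint M (%y. ennreal (k r x y) * f0 y) + nint N (%q. e r x q * Q (r - fst q) (snd q)) =
    (nint M (%y. (ennreal (k r x y) + nint N (%q. e r x q * levi (r - fst q) (snd q) y)) * f0 y))"
    by (simp add: distrib_right nn_integral_add)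
   also have "... = Q r x" unfolding Q_def levi_equation[symmetric] ..
   finally have "a r x <= Q r x + nint N (%q. e r x q * b (r - fst q) (snd q))" using 1 by (simp add: add.assoc[symmetric])
   moreover have "a r x ~= top" by (simp add: a_def)
   ultimately show ?case unfolding b_def by (simp add: ennreal_minus_le_iff)
  qed
 qed
 define beta where "beta = (SUP r\<in>{0<..rho}. \<integral>\<^sup>+x. b r x \<partial>M)"
 have "beta <= ennreal (1 / 4) * beta"
  unfolding beta_def[of]
 proof (rule SUP_least)
  fix r assume r: "r : {0<..rho}"
  have "nint M (%x. b r x) <= nint M (%x. nint N (%q. e r x q * b (r - fst q) (snd q)))" by (rule nn_integral_mono_AE[OF sub[OF r]])
  also have "... <= ennreal (1 / 4) * beta" using r unfolding beta_def by (intro e_column bq SUP_upper) auto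
  finally show "nint M (%x. b r x) <= ennreal (1 / 4) * (SUP r\<in>{0<..rho}. \<integral>\<^sup>+x. b r x \<partial>M)" by (simp add: beta_def)
 qed
 moreover have "beta < \<infinity>"
 proof -
  have "beta <= (SUM l:Sp. \<integral>\<^sup>+x. ennreal (cmod (u l x)) \<partial>M)" unfolding beta_def
  proof (rule SUP_least)
   fix r assume r: "r : {0<..rho}"
   have "b r x <= (SUM l:Sp. ennreal (cmod (u l x)))" for x
   proof -
    have "cmod (heat (of_real r * ctime s) l * u l x) <= 1 * cmod (u l x)" if "l : Sp" for l
     unfolding norm_mult using r by (intro mult_right_mono heat_norm familyD(2)[OF f that]) auto
    hence "cmod (flow s r Sp u x) <= (SUM l:Sp. 1 * cmod (u l x))" unfolding comb_def by (intro order.trans[OF norm_sum] sum_mono)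
    hence "a r x <= ennreal (SUM l:Sp. cmod (u l x))" unfolding a_def by (intro ennreal_leI) simp
    thus ?thesis unfolding b_def by (simp add: order.trans[OF diff_le_self_ennreal])
   qed
   hence "nint M (%x. b r x) <= nint M (%x. (SUM l:Sp. ennreal (cmod (u l x))))" by (intro nn_integral_mono)
   also have "... = (SUM l:Sp. \<integral>\<^sup>+x. ennreal (cmod (u l x)) \<partial>M)"
    using L2_space_measurable[OF familyD(4)[OF f]] by (intro nn_integral_sum) simp
   finally show "nint M (%x. b r x) <= (SUM l:Sp. \<integral>\<^sup>+x. ennreal (cmod (u l x)) \<partial>M)" .
  qed
  also have "... < \<infinity>"
  proof -
   have "nint M (%x. ennreal (cmod (u l x))) < \<infinity>" if "l : Sp" for l
    using L2_imp_integrable[OF familyD(4)[OF f that]] by (simp add: integrable_iff_bounded)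
   thus ?thesis by (simp add: less_top[symmetric] ennreal_sum_eq_top familyD(1)[OF f])
  qed
  finally show ?thesis .
 qed
 ultimately have "beta = 0"
 proof (cases beta)
  case (real t)
  hence "t <= 1 / 4 * t" using `beta <= ennreal (1 / 4) * beta` by (simp add: enn_mult ennreal_le_iff)
  thus ?thesis using real by simp
 qed simp
 hence "nint M (%x. b R x) = 0" using R SUP_upper[of R "{0<..rho}" "%r. \<integral>\<^sup>+x. b r x \<partial>M"] by (simp add: beta_def)
 moreover have "b R : meas M" using bm[of "%_. R" M "%x. x"] by simp
 ultimately have "AE x in M. b R x = 0" by (simp add: nn_integral_0_iff_AE)
 thus ?thesis
 proof eventually_elim
  case (elim x)
  hence "a R x <= Q R x" unfolding b_def using elim by (simp add: ennreal_minus_eq_0)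
  thus ?case by (simp add: a_def Q_def f0_def)
 qed
qed

text \<open>Schur's test for the Levi kernel.\<close>

lemma short_time_bound:
 assumes par: "!!x. EX phi e psi. parametrix_at s k x phi e psi" and f: "family Sp u" and R: "R : {0<..rho}"
 shows "dominated (2 * G) (total Sp u) (flow s R Sp u)"
 unfolding dominated_def
proof (intro allI impI)
 fix p :: real assume p: "1 <= p"
 have fm [measurable]: "total Sp u : meas borel" by (rule comb_measurable[OF f])
 have sM: "sigma_finite_measure M" by unfold_locales
 have "Ipow p (flow s R Sp u) <= ennreal ((2 * G) powr (p - 1)) *
  (nint M (%y. nint M (%x. levi R x y * ennreal (cmod (total Sp u y) powr p))))"
  unfolding Ipow_def using G levi_bounds[OF R] by (intro schur_nn[OF sM sM p _ _ _ _ _ _ levi_dominates[OF par f R]]) auto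
 also have "... = ennreal ((2 * G) powr (p - 1)) * nint M (%y. (nint M (%x. levi R x y)) * ennreal (cmod (total Sp u y) powr p))"
  by (simp add: nn_integral_multc)
 also have "... <= ennreal ((2 * G) powr (p - 1)) * nint M (%y. ennreal (2 * G) * ennreal (cmod (total Sp u y) powr p))"
  by (intro mult_left_mono nn_integral_mono mult_right_mono levi_bounds[OF R]) auto
 also have "... = ennreal ((2 * G) powr (p - 1)) * (ennreal (2 * G) * Ipow p (total Sp u))"
  unfolding Ipow_def by (subst nn_integral_cmult) measurable
 also have "... = ennreal ((2 * G) powr p) * Ipow p (total Sp u)"
  using G powr_add[of "2 * G" "p - 1" 1] by (simp add: mult.assoc[symmetric] enn_mult)
 finally show "Ipow p (flow s R Sp u) <= ennreal ((2 * G) powr p) * Ipow p (total Sp u)" .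
qed

end

section \<open>Heat bounds for all times\<close>

context elliptic_operator
begin

definition mass :: "('a => complex) => real" where "mass f = (LINT y|M. cmod (f y))"

lemma comb_L2: "family Sp u ==> comb h Sp u : L2_space M"
proof -
 assume f: "family Sp u"
 have "(%x. SUM l:F. h l * u l x) : L2_space M" if "F <= Sp" "finite F" for F using that(2,1)
 proof (induction F rule: finite_induct)
  case empty thus ?case by (simp add: L2_space_iff)
 next
  case (insert l F)
  thus ?case using L2_space_add[OF L2_space_scale[OF familyD(4)[OF f, of l], of "h l"]] by simp
 qed
 thus ?thesis using familyD(1)[OF f] by (simp add: comb_def[abs_def])
qed

lemma mass_nn: "family Sp u ==> (nint M (%y. ennreal (cmod (comb h Sp u y)))) = ennreal (mass (comb h Sp u))"
 unfolding mass_def using L2_imp_integrable[OF comb_L2] by (intro nn_integral_eq_integral) auto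

lemma mass_nonneg: "0 <= mass f" by (simp add: mass_def)

lemma eigenfunctions_orthogonal:
 assumes f: "family Sp u" and l: "l : Sp" "m : Sp" "l ~= m" shows "ip (u l) (u m) = 0"
proof -
 have "ip (%x. of_real l * u l x) (u m) = ip (u l) (%x. of_real m * u m x)"
  by (rule T_sym[OF familyD(3)[OF f l(2)] familyD(3)[OF f l(1)]])
 moreover have "ip (%x. of_real l * u l x) (u m) = of_real l * ip (u l) (u m)"
  by (simp add: L2_inner_def mult.assoc)
 moreover have "ip (u l) (%x. of_real m * u m x) = of_real m * ip (u l) (u m)"
  by (simp add: L2_inner_def mult.left_commute)
 ultimately have "of_real (l - m) * ip (u l) (u m) = 0" by (simp add: algebra_simps)
 thus ?thesis using l(3) by (simp del: of_real_diff)
qed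

lemma parseval:
 assumes f: "family Sp u"
 shows "(LINT x|M. (cmod (comb h Sp u x))^2) = (SUM l:Sp. (cmod (h l))^2 * (LINT x|M. (cmod (u l x))^2))"
proof -
 have c: "ip v w = cnj (ip w v)" for v w
  unfolding L2_inner_def by (subst Bochner_Integration.integral_cnj[symmetric]) (simp add: mult.commute)
 have 1: "ip (u l) (comb h Sp u) = cnj (h l) * ip (u l) (u l)" if l: "l : Sp" for l
 proof -
  have "ip (comb h Sp u) (u l) = (SUM m:Sp. h m * ip (u m) (u l))" by (rule inner_comb[OF f familyD(4)[OF f l]])
  also have "... = (SUM m:Sp. if m = l then h l * ip (u l) (u l) else 0)"
   using eigenfunctions_orthogonal[OF f _ l] by (intro sum.cong) auto
  also have "... = h l * ip (u l) (u l)" using l familyD(1)[OF f] by simp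
  finally show ?thesis using c[of "u l" "comb h Sp u"] c[of "u l" "u l"] by simp
 qed
 have "complex_of_real (LINT x|M. (cmod (comb h Sp u x))^2) = (SUM l:Sp. h l * ip (u l) (comb h Sp u))"
  unfolding L2_inner_self[symmetric] by (rule inner_comb[OF f comb_L2[OF f]])
 also have "... = (SUM l:Sp. of_real ((cmod (h l))^2 * (LINT x|M. (cmod (u l x))^2)))"
 proof (rule sum.cong[OF refl])
  fix l assume "l : Sp"
  have "h l * (cnj (h l) * ip (u l) (u l)) = of_real ((cmod (h l))^2) * ip (u l) (u l)"
   by (simp only: mult.assoc[symmetric] complex_norm_square)
  thus "h l * ip (u l) (comb h Sp u) = of_real ((cmod (h l))^2 * (LINT x|M. (cmod (u l x))^2))"
   unfolding 1[OF `l : Sp`] by (simp add: L2_inner_self)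
 qed
 finally show ?thesis unfolding of_real_sum[symmetric] of_real_eq_iff .
qed

lemma L2_contraction:
 assumes f: "family Sp u" and h: "!!l. l : Sp ==> cmod (h l) <= 1"
 shows "(LINT x|M. (cmod (comb h Sp u x))^2) <= (LINT x|M. (cmod (total Sp u x))^2)"
 unfolding parseval[OF f] using h by (intro sum_mono mult_right_mono) (auto intro: power_le_one)

lemma jensen_mass:
 assumes f: "family Sp u" and p: "1 <= p"
 shows "ennreal (mass (comb h Sp u) powr p) <= ennreal ((measure M UNIV + 1) powr (p - 1)) * Ipow p (comb h Sp u)"
proof -
 have m: "(%y. cmod (comb h Sp u y)) : meas M" using comb_measurable[OF f] by (simp cong: measurable_cong_sets)
 have "ennreal (mass (comb h Sp u) powr p) <= ennreal ((measure M UNIV + 1) powr (p - 1)) * nint M (%y. 1 * ennreal (cmod (comb h Sp u y) powr p))"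
  using mass_nonneg mass_nn[OF f, of h]
  by (intro jensen_nn[OF p _ m]) (auto simp: mass_finite add_nonneg_pos intro!: ennreal_leI)
 thus ?thesis by (simp add: Ipow_def)
qed

text \<open>Large times are split off from two short real times; only the contraction in "L2" is used in between.\<close>

lemma long_time_bound:
 assumes uc: "!!Sp u r. family Sp u ==> r : {0<..rho} ==> AE x in M.
   cmod (flow 0 r Sp u x) <= C * mass (total Sp u) * (1 / sqrt r) ^ CARD('n)"
  and C: "0 <= C" and f: "family Sp u" and t: "t : {0<..rho}" and r: "2 * t <= r"
 shows "dominated ((measure M UNIV + 1)^2 * (C * (1 / sqrt t) ^ CARD('n))^2) (total Sp u) (flow s r Sp u)"
 unfolding dominated_def
proof (intro allI impI)
 fix p :: real assume p: "1 <= p"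
 define A where "A = measure M UNIV + 1"
 have A: "1 <= A" by (simp add: A_def)
 define D where "D = C * (1 / sqrt t) ^ CARD('n)"
 have D: "0 <= D" using C t by (simp add: D_def)
 define h where "h = heat (of_real t * ctime 0)"
 define m where "m = heat (of_real r * ctime s - 2 * (of_real t * ctime 0))"
 have hmh: "heat (of_real r * ctime s) l = h l * (m l * h l)" for l
  unfolding h_def m_def heat_def exp_add[symmetric] by (simp add: algebra_simps)
 have m1: "cmod (m l) <= 1" if "l : Sp" for l
  using r familyD(2)[OF f that] by (simp add: m_def heat_def ctime_def)
 define u1 where "u1 l x = h l * u l x" for l x
 define u2 where "u2 l x = m l * u1 l x" for l x
 have f1: "family Sp u1" unfolding u1_def by (rule family_scale[OF f])
 have f2: "family Sp u2" unfolding u2_def by (rule family_scale[OF f1])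
 have c1: "total Sp u1 = comb h Sp u" unfolding u1_def comb_scale by simp
 have c2: "total Sp u2 = comb m Sp u1" unfolding u2_def comb_scale by simp
 have c3: "comb h Sp u2 = flow s r Sp u" unfolding u2_def u1_def comb_scale using hmh by (simp add: comb_def fun_eq_iff mult.assoc)
 define N where "N = mass (total Sp u)"
 have N: "0 <= N" by (simp add: N_def mass_nonneg)
 have sup1: "AE x in M. cmod (comb h Sp u x) <= D * N"
  using uc[OF f t] by (simp add: h_def D_def N_def mult_ac)
 have sq: "Ipow 2 (comb h' Sp v) = ennreal (LINT x|M. (cmod (comb h' Sp v x))^2)" if "family Sp v" for h' v
 proof -
  have "nint M (%x. ennreal ((cmod (comb h' Sp v x))^2)) = ennreal (LINT x|M. (cmod (comb h' Sp v x))^2)"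
   using comb_L2[OF that] by (intro nn_integral_eq_integral) (auto simp: L2_space_iff)
  moreover have "cmod z powr 2 = (cmod z)^2" for z by (simp add: powr_numeral)
  ultimately show ?thesis by (simp add: Ipow_def)
 qed
 have "ennreal ((mass (comb m Sp u1)) powr 2) <= ennreal (A powr (2 - 1)) * Ipow 2 (comb m Sp u1)"
  unfolding A_def by (rule jensen_mass[OF f1]) simp
 also have "... <= ennreal A * Ipow 2 (comb h Sp u)"
  using L2_contraction[OF f1 m1] A unfolding sq[OF f1] sq[OF f] c1 by (simp add: mult_left_mono ennreal_leI)
 also have "... <= ennreal A * nint M (%x. ennreal ((D * N)^2))" unfolding Ipow_def
  using sup1 by (intro mult_left_mono nn_integral_mono_AE) (auto elim!: eventually_mono intro!: ennreal_leI power_mono simp: powr_numeral)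
 also have "... <= ennreal A * (ennreal ((D * N)^2) * ennreal A)"
  by (intro mult_left_mono) (auto simp: mass_finite A_def intro!: mult_left_mono ennreal_leI)
 also have "... = ennreal ((A * (D * N))^2)" using A by (simp add: enn_mult power2_eq_square mult_ac)
 finally have "(mass (comb m Sp u1))^2 <= (A * (D * N))^2" using mass_nonneg by (simp add: powr_numeral)
 hence mass2: "mass (comb m Sp u1) <= A * (D * N)" using A D N by (simp add: power2_le_iff_abs_le mass_nonneg)
 have sup2: "AE x in M. cmod (flow s r Sp u x) <= A * D^2 * N"
  using uc[OF f2 t, unfolded h_def[symmetric] c2 c3]
 proof eventually_elim
  case (elim x)
  have "C * mass (comb m Sp u1) * (1 / sqrt t) ^ CARD('n) = D * mass (comb m Sp u1)" by (simp add: D_def)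
  also have "... <= D * (A * (D * N))" by (intro mult_left_mono mass2 D)
  finally show ?case using elim by (simp add: power2_eq_square mult_ac)
 qed
 have "Ipow p (flow s r Sp u) <= nint M (%x. ennreal ((A * D^2 * N) powr p))" unfolding Ipow_def
  using sup2 p by (intro nn_integral_mono_AE) (auto elim!: eventually_mono intro!: ennreal_leI powr_mono2)
 also have "... <= ennreal ((A * D^2 * N) powr p) * ennreal A" by (auto simp: mass_finite A_def intro!: mult_left_mono ennreal_leI)
 also have "... = ennreal (A * (A * D^2) powr p) * ennreal (N powr p)"
  using A D N by (simp add: powr_mult enn_mult mult_ac)
 also have "... <= ennreal (A * (A * D^2) powr p) * (ennreal (A powr (p - 1)) * Ipow p (total Sp u))"
  unfolding N_def A_def by (intro mult_left_mono jensen_mass[OF f p]) simp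
 also have "... = ennreal ((A^2 * D^2) powr p) * Ipow p (total Sp u)"
 proof -
  have "A powr p = A * A powr (p - 1)" using A powr_add[of A 1 "p - 1"] by simp
  hence "A * (A * D^2) powr p * A powr (p - 1) = (A^2 * D^2) powr p" using A by (simp add: powr_mult power2_eq_square mult_ac)
  thus ?thesis using A by (simp add: mult.assoc[symmetric] enn_mult)
 qed
 finally show "Ipow p (flow s r Sp u) <= ennreal (((measure M UNIV + 1)^2 * (C * (1 / sqrt t) ^ CARD('n))^2) powr p) * Ipow p (total Sp u)"
  by (simp add: A_def D_def)
qed

lemma dominated_mono: "dominated K f F ==> 0 <= K ==> K <= K' ==> dominated K' f F"
 unfolding dominated_def by (meson ennreal_leI mult_right_mono order.trans powr_mono2 zero_le order.strict_implies_order less_le_trans zero_less_one)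

end

lemma (in short_kernel) ultracontractive:
 assumes par: "!!x. EX phi e psi. parametrix_at s k x phi e psi" and f: "family Sp u" and R: "R : {0<..rho}"
 shows "AE x in M. cmod (flow s R Sp u x) <= 2 * G * mass (total Sp u) * (1 / sqrt R) ^ CARD('n)"
 using levi_dominates[OF par f R]
proof eventually_elim
 case (elim x)
 have "nint M (%y. levi R x y * ennreal (cmod (total Sp u y))) <= nint M (%y. ennreal (2 * (G * (1 / sqrt R) ^ CARD('n))) * ennreal (cmod (total Sp u y)))"
  by (intro nn_integral_mono mult_right_mono levi_bounds(3)[OF R]) auto
 also have "... = ennreal (2 * (G * (1 / sqrt R) ^ CARD('n))) * ennreal (mass (total Sp u))"
  unfolding mass_nn[OF f, symmetric] using comb_measurable[OF f] by (intro nn_integral_cmult) (simp cong: measurable_cong_sets)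
 also have "... = ennreal (2 * G * mass (total Sp u) * (1 / sqrt R) ^ CARD('n))"
  using G R mass_nonneg by (simp add: enn_mult mult_ac)
 finally have "ennreal (cmod (flow s R Sp u x)) <= ennreal (2 * G * mass (total Sp u) * (1 / sqrt R) ^ CARD('n))"
  using elim by (rule order.trans[rotated])
 thus ?case using G R mass_nonneg by (subst (asm) ennreal_le_iff) auto
qed

text \<open>The admissible short times and hence all constants depend polynomially on \<open>s\<close>.\<close>

theorem (in elliptic_operator) heat_bound:
 "EX K>0. EX N::nat. ALL s r Sp u. 0 < r --> family Sp u -->
  dominated (K * (1 + abs s) ^ N) (total Sp u) (flow s r Sp u)"
proof -
 obtain Gam alpha where G1: "Gam >= 1" and ex: "!!s. EX k. hk_bound (Gam * (1 + abs s) ^ alpha) k & (ALL x. EX phi e psi. parametrix_at s k x phi e psi)"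
  using heat_parametrix by blast
 obtain k where k: "hk_bound Gam k" "!!x. EX phi e psi. parametrix_at 0 k x phi e psi"
  using ex[of 0] by auto
 interpret S0: short_kernel A g L M T Gam k by unfold_locales (use k G1 in auto)
 define rho where "rho = S0.rho"
 have rho: "0 < rho" using S0.rho(1) by (simp add: rho_def)
 define K1 where "K1 = (measure M UNIV + 1)^2 * (2 * Gam * (sqrt 2 / sqrt rho) ^ CARD('n))^2"
 have K1: "0 <= K1" by (simp add: K1_def)
 define N where "N = alpha * CARD('n) * 2 + alpha"
 have "dominated ((2 * Gam + K1) * (1 + abs s) ^ N) (total Sp u) (flow s r Sp u)"
  if r: "0 < r" and f: "family Sp u" for s r Sp u
 proof -
  define S where "S = 1 + abs s"
  have S: "1 <= S" by (simp add: S_def)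
  define G where "G = Gam * S ^ alpha"
  have G: "1 <= G" using G1 S by (simp add: G_def mult_ge1_I one_le_power)
  obtain k' where k': "hk_bound G k'" "!!x. EX phi e psi. parametrix_at s k' x phi e psi"
   using ex[of s] by (auto simp: G_def S_def)
  interpret Ss: short_kernel A g L M T G k' by unfold_locales (use k' G in auto)
  have Ssrho: "Ss.rho = rho / (S ^ alpha)^2"
   unfolding rho_def Ss.rho_def S0.rho_def by (simp add: G_def power_mult_distrib mult_ac)
  show ?thesis
  proof (cases "r <= Ss.rho")
   case True
   have "S ^ alpha <= S ^ N" using S by (intro power_increasing) (auto simp: N_def)
   hence "2 * G <= (2 * Gam + K1) * S ^ N" unfolding G_def mult.assoc[symmetric] using G1 K1 S by (intro mult_mono) auto
   thus ?thesis using dominated_mono[OF Ss.short_time_bound[OF k'(2) f, of r]] r G True by (auto simp: S_def)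
  next
   case False
   define t where "t = Ss.rho / 2"
   have S2: "1 <= (S ^ alpha)^2" using S by (simp add: one_le_power)
   have t: "t : {0<..S0.rho}"
   proof -
    have "rho / (S ^ alpha)^2 <= rho / 1" using rho S2 by (intro frac_le) auto
    thus ?thesis using Ss.rho(1) Ssrho rho by (auto simp: t_def rho_def)
   qed
   have rt: "2 * t <= r" using False by (simp add: t_def)
   have "dominated ((measure M UNIV + 1)^2 * (2 * Gam * (1 / sqrt t) ^ CARD('n))^2) (total Sp u) (flow s r Sp u)"
    by (rule long_time_bound[OF S0.ultracontractive[OF k(2)] _ f t rt]) (use G1 in auto)
   moreover have "(measure M UNIV + 1)^2 * (2 * Gam * (1 / sqrt t) ^ CARD('n))^2 <= (2 * Gam + K1) * S ^ N"
   proof -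
    have "1 / sqrt t = (sqrt 2 / sqrt rho) * S ^ alpha" using S by (simp add: t_def Ssrho real_sqrt_divide real_sqrt_mult)
    hence "(measure M UNIV + 1)^2 * (2 * Gam * (1 / sqrt t) ^ CARD('n))^2 = K1 * S ^ (alpha * CARD('n) * 2)"
     by (simp only: K1_def power_mult_distrib power_mult[symmetric] mult_ac)
    also have "... <= (2 * Gam + K1) * S ^ N" using G1 K1 S by (intro mult_mono power_increasing) (auto simp: N_def)
    finally show ?thesis .
   qed
   ultimately show ?thesis using dominated_mono by (auto simp: S_def)
  qed
 qed
 thus ?thesis using G1 K1 by (intro exI[of _ "2 * Gam + K1"] conjI exI[of _ N]) auto
qed

section \<open>A Fourier integral\<close>

definition cinv :: "nat => real => complex" where "cinv M s = inverse (ctime s) ^ M"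

abbreviation "wave s y == exp (\<i> * of_real (s * y))"

abbreviation "cjinv s == inverse (1 - \<i> * of_real s)"

definition gam :: "nat => real => complex" where "gam M y = (LBINT s. exp (\<i> * of_real (s * y)) * cinv M s)"

definition gam' :: "nat => real => complex" where
 "gam' M y = (LBINT s. exp (\<i> * of_real (s * y)) * (cinv M s * inverse (1 - \<i> * of_real s)))"

lemma ctime_facts: "ctime s ~= 0" "1 <= cmod (ctime s)" "abs s <= cmod (ctime s)" "(cmod (ctime s))^2 = 1 + s^2" "1 - \<i> * of_real s = cnj (ctime s)"
 using complex_Re_le_cmod[of "ctime s"] abs_Im_le_cmod[of "ctime s"] unfolding cmod_power2 by (auto simp: ctime_def complex_eq_iff)

lemma cinv_norm: "cmod (cinv M s) <= 1" "2 <= M ==> cmod (cinv M s) <= 1 / (1 + s^2)"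
proof -
 have i: "cmod (cinv M s) = (1 / cmod (ctime s)) ^ M" by (simp only: cinv_def norm_power inverse_eq_divide norm_divide norm_one)
 have le: "0 <= 1 / cmod (ctime s)" "1 / cmod (ctime s) <= 1" using ctime_facts(2)[of s] by (auto simp: divide_simps)
 show "cmod (cinv M s) <= 1" unfolding i by (rule power_le_one[OF le])
 show "cmod (cinv M s) <= 1 / (1 + s^2)" if "2 <= M"
  using power_decreasing[OF that le] unfolding i by (simp add: power_divide ctime_facts(4))
qed

lemma cinv_Suc: "cinv M s = ctime s * cinv (Suc M) s"
 using ctime_facts(1)[of s] by (simp add: cinv_def)

lemma cinv_measurable [measurable]: "cinv M : meas borel" unfolding cinv_def[abs_def] ctime_def by measurable

lemma cauchy_weight: "integrable lborel (%s::real. 1 / (1 + s^2))" "(LBINT s. 1 / (1 + s^2)) = pi"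
proof -
 have nz: "1 + s^2 ~= 0" for s :: real by (simp add: add_nonneg_eq_0_iff)
 have "DERIV arctan x :> 1 / (1 + x^2)" "isCont (%s. 1 / (1 + s^2)) x" "0 <= 1 / (1 + x^2)" for x :: real
  using nz DERIV_arctan[of x] by (auto simp: inverse_eq_divide intro!: continuous_intros)
 moreover have "((arctan o real_of_ereal) ---> - (pi / 2)) (at_right (-\<infinity>))" "((arctan o real_of_ereal) ---> pi / 2) (at_left \<infinity>)"
  by (simp_all add: ereal_tendsto_simps1 tendsto_arctan_at_top tendsto_arctan_at_bot)
 ultimately have "set_integrable lborel (einterval (-\<infinity>) \<infinity>) (%s::real. 1 / (1 + s^2))" "(LBINT s=-\<infinity>..\<infinity>. 1 / (1 + s^2)) = pi / 2 - (- (pi / 2))"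
  by (intro interval_integral_FTC_nonneg[where F = arctan]; auto)+
 thus "integrable lborel (%s::real. 1 / (1 + s^2))" "(LBINT s. 1 / (1 + s^2)) = pi"
  by (simp_all add: set_integrable_def interval_lebesgue_integral_def set_lebesgue_integral_def)
qed

lemma cinv_cjinv_norm: "1 <= M ==> cmod (cinv M s * cjinv s) <= 1 / (1 + s^2)"
proof -
 assume "1 <= M"
 then obtain K where "M = Suc K" by (cases M) auto
 hence "cmod (cinv M s * cjinv s) = cmod (cinv K s) * cmod (cinv 2 s)"
  unfolding ctime_facts(5) by (simp add: cinv_def norm_mult norm_inverse norm_power power2_eq_square)
 also have "... <= 1 * (1 / (1 + s^2))" by (intro mult_mono cinv_norm) auto
 finally show ?thesis by simp
qed

lemma weighted_integrable:
 assumes "w : meas borel" "!!s. cmod (w s) <= B / (1 + s^2)"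
 shows "integrable lborel (%s. wave s y * w s)"
proof (rule Bochner_Integration.integrable_bound[where f = "%s. B * (1 / (1 + s^2))"])
 show "integrable lborel (%s::real. B * (1 / (1 + s^2)))" by (intro integrable_mult_right cauchy_weight)
 have "cmod (w s) <= abs B / (1 + s^2)" for s by (rule order.trans[OF assms(2)]) (simp add: divide_right_mono)
 thus "AE s in lborel. norm (wave s y * w s) <= norm (B * (1 / (1 + s^2)))" by (auto simp: norm_mult add_nonneg_eq_0_iff)
qed (use assms in measurable)

lemma weighted_deriv:
 assumes w: "w : meas borel" and b: "!!s. cmod (w s) <= B / (1 + s^2)" "!!s. cmod (\<i> * of_real s * w s) <= B / (1 + s^2)"
 shows "((%y. \<integral>s. wave s y * w s \<partial>lborel) has_vd (LBINT s. wave s y * (\<i> * of_real s * w s))) (at y)"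
proof (rule has_vector_derivative_integral[where delta = 1 and h = "%s. B * (1 / (1 + s^2))"])
 show "((%y. wave s y * w s) has_vd exp (\<i> * of_real (s * t)) * (\<i> * of_real s * w s)) (at t)" for t s
 proof -
  have "((%z. exp (\<i> * (of_real s * z)) * w s) has_field_derivative exp (\<i> * of_real (s * t)) * (\<i> * of_real s * w s)) (at (complex_of_real t))"
   by (auto intro!: derivative_eq_intros)
  from has_vector_derivative_real_field[OF this] show ?thesis by simp
 qed
 show "integrable lborel (%s. exp (\<i> * of_real (s * t)) * w s)" for t by (rule weighted_integrable[OF w b(1)])
 show "integrable lborel (%s::real. B * (1 / (1 + s^2)))" by (intro integrable_mult_right cauchy_weight)
qed (use w b(2) in "auto simp: norm_mult")

lemma gam_integrable: "2 <= M ==> integrable lborel (%s. wave s y * cinv M s)"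
 using cinv_norm(2)[of M] by (intro weighted_integrable[where B = 1]) auto

lemma gam_parts:
 assumes M: "1 <= M" "2 <= M | y = 0"
 shows "of_real y * gam M y = of_nat M * gam (Suc M) y"
proof -
 define c where "c s = wave s y * cinv M s" for s
 define d where "d s = \<i> * (wave s y * (of_real y * cinv M s - of_nat M * cinv (Suc M) s))" for s
 have der: "(c has_vd d s) (at s)" for s
 proof -
  obtain K where K: "M = Suc K" using M by (cases M) auto
  have nz: "1 + \<i> * complex_of_real s ~= 0" using ctime_facts(1)[of s] by (simp add: ctime_def)
  have e: "((%z. exp (\<i> * (z * of_real y))) has_field_derivative exp (\<i> * (of_real s * of_real y)) * (\<i> * of_real y)) (at (complex_of_real s))"
   by (auto intro!: derivative_eq_intros)
  have v: "((%z. inverse (1 + \<i> * z)) has_field_derivative - (\<i> * (inverse (1 + \<i> * of_real s))^2)) (at (complex_of_real s))"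
   using nz by (auto intro!: derivative_eq_intros simp: power2_eq_square)
  have "((%z. exp (\<i> * (z * of_real y)) * inverse (1 + \<i> * z) ^ M) has_field_derivative d s) (at (complex_of_real s))"
   using DERIV_mult[OF e DERIV_power[OF v, of M]] by (simp add: d_def K cinv_def ctime_def algebra_simps power2_eq_square)
  from has_vector_derivative_real_field[OF this] show ?thesis by (simp add: c_def[abs_def] cinv_def ctime_def)
 qed
 have dc: "continuous_on UNIV d" unfolding d_def[abs_def] cinv_def ctime_def
  using ctime_facts(1) by (intro continuous_intros) (auto simp: ctime_def)
 have i1: "integrable lborel (%s. wave s y * (of_real y * cinv M s))"
  using M(2) gam_integrable[of M y] by (auto simp: mult.left_commute[of _ "of_real y"])
 have i2: "integrable lborel (%s. wave s y * (of_nat M * cinv (Suc M) s))"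
  using M(1) gam_integrable[of "Suc M" y] by (simp add: mult.left_commute[of _ "of_nat M"])
 have di: "integrable lborel d" unfolding d_def[abs_def] right_diff_distrib using i1 i2 by simp
 have lim: "(c ---> 0) at_infinity"
 proof (rule Lim_null_comparison[OF _ tendsto_norm_zero[OF tendsto_inverse_0]])
  show "\<forall>\<^sub>F s in at_infinity. cmod (c s) <= norm (inverse s)" unfolding eventually_at_infinity
  proof (intro exI[of _ 1] allI impI)
   fix s :: real assume s: "1 <= norm s"
   obtain K where K: "M = Suc K" using M by (cases M) auto
   have "cmod (c s) = cmod (inverse (ctime s)) * cmod (cinv K s)" by (simp add: c_def cinv_def K norm_mult)
   also have "... <= cmod (inverse (ctime s)) * 1" by (intro mult_left_mono cinv_norm) auto
   also have "... <= norm (inverse s)" using s ctime_facts(3)[of s] by (auto simp: norm_inverse intro!: le_imp_inverse_le)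
   finally show "cmod (c s) <= norm (inverse s)" .
  qed
 qed
 have "(LBINT s=-\<infinity>..\<infinity>. d s) = 0 - 0"
 proof (rule interval_integral_FTC_integrable[where F = c])
  show "((c o real_of_ereal) ---> 0) (at_right (-\<infinity>))" "((c o real_of_ereal) ---> 0) (at_left \<infinity>)"
   using lim tendsto_mono[OF at_top_le_at_infinity] tendsto_mono[OF at_bot_le_at_infinity] by (auto simp: ereal_tendsto_simps1)
 qed (use der dc di in "auto simp: continuous_on_eq_continuous_at set_integrable_def")
 hence "(LBINT s. d s) = 0" by (simp add: interval_lebesgue_integral_def set_lebesgue_integral_def)
 moreover have "(LBINT s. d s) = \<i> * (of_real y * gam M y - of_nat M * gam (Suc M) y)"
  unfolding d_def right_diff_distrib[of "exp _"] using i1 i2 by (simp add: gam_def mult.left_commute[of _ "of_real y"] mult.left_commute[of _ "of_nat M"])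
 ultimately show ?thesis by simp
qed

lemma gam_deriv:
 assumes "3 <= M"
 shows "(gam M has_vd (gam (M - 1) y - gam M y)) (at y)" "(gam' M has_vd (gam' M y - gam M y)) (at y)"
proof -
 have M: "2 <= M - 1" "2 <= M" "Suc (M - 1) = M" using assms by auto
 have ds: "\<i> * of_real s * cinv M s = cinv (M - 1) s - cinv M s" for s
  using cinv_Suc[of "M - 1" s] unfolding M(3) by (simp add: ctime_def algebra_simps)
 have ds': "\<i> * of_real s * (cinv M s * cjinv s) = cinv M s * cjinv s - cinv M s" for s
  using ctime_facts(1)[of s] unfolding ctime_facts(5)[of s] by (simp add: ctime_def field_simps)
 have t: "2 / (1 + s^2) = 1 / (1 + s^2) + 1 / (1 + s^2)" "0 <= 1 / (1 + s^2)" for s :: real by auto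
 have b: "cmod (cinv M s) <= 2 / (1 + s^2)" "cmod (cinv (M - 1) s - cinv M s) <= 2 / (1 + s^2)" for s
  using cinv_norm(2)[OF M(1), of s] cinv_norm(2)[OF M(2), of s] norm_triangle_ineq4[of "cinv (M - 1) s" "cinv M s"] t[of s] by linarith+
 note b' = cinv_cjinv_norm[of M, OF order.trans[OF _ M(2)], simplified]
 have b'': "cmod (cinv M s * cjinv s - cinv M s) <= 2 / (1 + s^2)" for s
  using b'[of s] cinv_norm(2)[OF M(2), of s] norm_triangle_ineq4[of "cinv M s * cjinv s" "cinv M s"] t[of s] by linarith
 have "(gam M has_vd (LBINT s. wave s y * (\<i> * of_real s * cinv M s))) (at y)"
  unfolding gam_def[abs_def] using b by (intro weighted_deriv[where B = 2]) (auto simp: ds)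
 thus "(gam M has_vd (gam (M - 1) y - gam M y)) (at y)"
  unfolding ds right_diff_distrib using gam_integrable[OF M(1)] gam_integrable[OF M(2)] by (simp add: gam_def)
 have m: "(%s. cinv M s * cjinv s) : meas borel" by measurable
 have b2: "cmod (cinv M s * cjinv s) <= 2 / (1 + s^2)" for s
  by (rule order.trans[OF b']) (simp add: divide_right_mono)
 have "(gam' M has_vd (LBINT s. wave s y * (\<i> * of_real s * (cinv M s * cjinv s)))) (at y)"
  unfolding gam'_def[abs_def] by (rule weighted_deriv[OF m b2]) (simp only: ds' b'')
 thus "(gam' M has_vd (gam' M y - gam M y)) (at y)"
  unfolding ds' right_diff_distrib[of "exp _"] using gam_integrable[OF M(2)] weighted_integrable[OF m b'] by (simp add: gam'_def gam_def)
qed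

lemma gam'_zero: "gam' (Suc M) 0 = of_real (pi / 2 ^ M)"
proof (induction M)
 case 0
 have "exp (\<i> * of_real (s * 0)) * (cinv (Suc 0) s * cjinv s) = of_real (1 / (1 + s^2))" for s
 proof -
  have "ctime s * (1 - \<i> * of_real s) = of_real (1 + s^2)" by (simp add: ctime_def algebra_simps power2_eq_square)
  thus ?thesis by (simp add: cinv_def inverse_mult_distrib[symmetric] inverse_eq_divide del: of_real_add inverse_mult_distrib)
 qed
 hence "gam' (Suc 0) 0 = (LBINT s. of_real (1 / (1 + s^2)))" unfolding gam'_def by (simp only:)
 also have "... = of_real (LBINT s. 1 / (1 + s^2))" by (rule integral_complex_of_real)
 finally show ?case unfolding cauchy_weight(2) by simp
next
 case (Suc M)
 have e: "cinv (Suc (Suc M)) s * cjinv s = (cinv (Suc (Suc M)) s + cinv (Suc M) s * cjinv s) / 2" for s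
  using ctime_facts(1)[of s] ctime_facts(1)[of "-s"] unfolding cinv_Suc[of "Suc M"] by (simp add: ctime_def field_simps)
 have m: "(%s. cinv (Suc M) s * cjinv s) : meas borel" by measurable
 note b = cinv_cjinv_norm[of "Suc M", simplified]
 have "gam' (Suc (Suc M)) 0 = (gam (Suc (Suc M)) 0 + gam' (Suc M) 0) / 2"
  unfolding gam'_def[of "Suc (Suc M)"] e using gam_integrable[of "Suc (Suc M)" 0] weighted_integrable[OF m b, of 0] by (simp add: gam_def gam'_def)
 moreover have "gam (Suc (Suc M)) 0 = 0" using gam_parts[of "Suc M" 0] by (simp add: of_nat_Suc[symmetric] del: of_nat_Suc)
 ultimately show ?case using Suc by simp
qed

text \<open>Integration by parts and differentiation give \<open>y f' = (M - 1 - y) f\<close>, so the integral is a multiple of the Gamma density.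
 The multiple is not zero, since otherwise \<open>gam'\<close> would solve \<open>f' = f\<close> on the half line; being bounded, it would vanish at \<open>0\<close>.\<close>

lemma gamma_density:
 assumes M: "3 <= M"
 shows "EX c. c ~= 0 & (ALL y>=0. of_real (exp y) * gam M y = c * of_real (y ^ (M - 1)))"
proof -
 obtain j where j: "M - 1 = Suc (Suc j)" using M by (intro that[of "M - 3"]) simp
 have rec: "of_real y * gam (M - 1) y = of_nat (M - 1) * gam M y" for y
 proof -
  have "1 <= M - 1" "2 <= M - 1 | y = 0" using M by auto
  from gam_parts[OF this] show ?thesis using M by simp
 qed
 define c where "c = of_real (exp 1) * gam M 1"
 have E: "of_real (exp y) * gam M y = c * of_real (y ^ (M - 1))" if y: "0 <= y" for y
 proof (cases "y = 0")
  case True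
  have "gam M 0 = 0" using rec[of 0] M by simp
  thus ?thesis using True M by simp
 next
  case False
  have d: "((%y. of_real (exp y / y ^ (M - 1)) * gam M y) has_vd 0) (at y within {0<..})" if y: "y : {0<..}" for y
  proof -
   have "((%y. exp y / y ^ (M - 1)) has_real_derivative (exp y / y ^ (M - 1)) * (1 - real (M - 1) / y)) (at y)"
    unfolding j by (rule DERIV_cong[OF DERIV_divide[OF DERIV_exp DERIV_pow]]) (use y in "auto simp: field_simps")
   hence 1: "((%y. of_real (exp y / y ^ (M - 1))) has_vd complex_of_real ((exp y / y ^ (M - 1)) * (1 - real (M - 1) / y))) (at y)"
    by (intro has_vector_derivative_of_real) (simp add: has_real_derivative_iff_has_vector_derivative)
   have "gam (M - 1) y = of_real (real (M - 1) / y) * gam M y" using rec[of y] y by (simp add: field_simps)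
   hence 2: "(gam M has_vd (of_real (real (M - 1) / y) * gam M y - gam M y)) (at y)" using gam_deriv(1)[OF M, of y] by simp
   have "((%y. of_real (exp y / y ^ (M - 1)) * gam M y) has_vector_derivative
    of_real (exp y / y ^ (M - 1)) * (of_real (real (M - 1) / y) * gam M y - gam M y) + of_real ((exp y / y ^ (M - 1)) * (1 - real (M - 1) / y)) * gam M y) (at y)"
    by (rule has_vector_derivative_mult[OF 1 2])
   moreover have "of_real e * (of_real a * G - G) + of_real (e * (1 - a)) * G = 0" for e a and G :: complex by (simp add: algebra_simps)
   ultimately show ?thesis by (simp only: has_vector_derivative_at_within)
  qed
  obtain k where k: "!!y. y : {0<..} ==> of_real (exp y / y ^ (M - 1)) * gam M y = k"
   by (rule has_vector_derivative_zero_constant[OF convex_real_interval(3) d]) blast+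
  have "k = c" using k[of 1] by (simp add: c_def)
  thus ?thesis using k[of y] False y by (simp add: field_simps)
 qed
 have "c ~= 0"
 proof
  assume "c = 0"
  hence z: "gam M y = 0" if "0 <= y" for y using E[OF that] by simp
  have d: "((%y. of_real (exp (- y)) * gam' M y) has_vd 0) (at y within {0..})" if "y : {0..}" for y
  proof -
   have "((%y. exp (- y)) has_real_derivative - exp (- y)) (at y)" by (auto intro!: derivative_eq_intros)
   hence 1: "((%y. of_real (exp (- y))) has_vd complex_of_real (- exp (- y))) (at y)"
    by (intro has_vector_derivative_of_real) (simp add: has_real_derivative_iff_has_vector_derivative)
   have "((%y. of_real (exp (- y)) * gam' M y) has_vd of_real (exp (- y)) * (gam' M y - gam M y) + of_real (- exp (- y)) * gam' M y) (at y)"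
    by (rule has_vector_derivative_mult[OF 1 gam_deriv(2)[OF M]])
   thus ?thesis using z that by (intro has_vector_derivative_at_within[of _ _ _ "{0..}"]) simp
  qed
  obtain k where k: "!!y. y : {0..} ==> of_real (exp (- y)) * gam' M y = k"
   by (rule has_vector_derivative_zero_constant[OF convex_real_interval(1) d]) blast+
  have b: "cmod (gam' M y) <= pi" for y
  proof -
   have m: "cmod (wave s y * (cinv M s * cjinv s)) <= 1 / (1 + s^2)" for s using cinv_cjinv_norm[of M s] M by (simp add: norm_mult)
   have "ennreal (cmod (gam' M y)) <= nint lborel (%s. ennreal (1 / (1 + s^2)))" unfolding gam'_def
    by (rule order.trans[OF norm_integral_le_nn nn_integral_mono]) (use m in "auto intro: ennreal_leI")
   also have "... = ennreal pi" using nn_integral_eq_integral[OF cauchy_weight(1)] by (simp add: cauchy_weight(2))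
   finally show ?thesis by simp
  qed
  have "norm k <= exp (- y) * pi" if "0 <= y" for y
   unfolding k[of y, symmetric, simplified, OF that] norm_mult using b by (intro mult_mono) auto
  moreover have "((%y. exp (- y) * pi) ---> 0 * pi) at_top"
   by (intro tendsto_intros filterlim_compose[OF exp_at_bot filterlim_uminus_at_bot_at_top])
  ultimately have "norm k <= 0 * pi" by (intro tendsto_le[OF _ _ tendsto_const]) (auto intro: eventually_at_top_linorderI[of 0])
  hence "gam' M 0 = 0" using k[of 0] by simp
  moreover have "gam' M 0 = of_real (pi / 2 ^ (M - 1))" using gam'_zero[of "M - 1"] M by simp
  ultimately show False by simp
 qed
 thus ?thesis using E by blast
qed

section \<open>Multipliers\<close>

context elliptic_operator begin

text \<open>Only values on the unit interval matter: \<open>t\<close> is the reciprocal of a bound for the eigenvalues.\<close>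

definition multiplier :: "real => (real => complex) => bool" where
 "multiplier C psi = (0 < C & (ALL t Sp u. 0 < t --> family Sp u --> (ALL l:Sp. t * l <= 1) --> dominated C (total Sp u) (comb (%l. psi (t * l)) Sp u)))"

lemma multiplierD: "multiplier C psi ==> 0 < t ==> family Sp u ==> (!!l. l : Sp ==> t * l <= 1) ==> 1 <= p ==>
  Ipow p (comb (%l. psi (t * l)) Sp u) <= ennreal (C powr p) * Ipow p (total Sp u)"
 by (auto simp: multiplier_def dominated_def)

lemma multiplier_one: "multiplier 1 (%x. 1)" by (simp add: multiplier_def dominated_def)

lemma multiplier_mult:
 assumes "multiplier C psi" "multiplier D phi" shows "multiplier (C * D) (%x. psi x * phi x)"
 unfolding multiplier_def dominated_def
proof (intro conjI allI impI)
 show "0 < C * D" using assms by (simp add: multiplier_def)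
 fix t Sp u p assume t: "0 < t" "family Sp u" "ALL l:Sp. t * l <= 1" and p: "1 <= (p::real)"
 have "Ipow p (comb (%l. psi (t * l)) Sp (%l x. phi (t * l) * u l x)) <= ennreal (C powr p) * Ipow p (total Sp (%l x. phi (t * l) * u l x))"
  using t by (intro multiplierD[OF assms(1) t(1) family_scale[OF t(2)] _ p]) auto
 also have "... <= ennreal (C powr p) * (ennreal (D powr p) * Ipow p (total Sp u))"
  unfolding comb_scale mult_1_left using t by (intro mult_left_mono multiplierD[OF assms(2) t(1,2) _ p]) auto
 finally show "Ipow p (comb (%l. psi (t * l) * phi (t * l)) Sp u) <= ennreal ((C * D) powr p) * Ipow p (total Sp u)"
  using assms by (simp add: comb_scale multiplier_def powr_mult ennreal_mult' mult.assoc)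
qed

lemma multiplier_power: "multiplier C psi ==> multiplier (C ^ n) (%x. psi x ^ n)"
 by (induction n) (auto simp: multiplier_one intro: multiplier_mult)

text \<open>Schur's test with the kernel \<open>|w s| b s\<close>.\<close>

lemma multiplier_superposition:
 assumes N: "sigma_finite_measure N" and w [measurable]: "w : meas N" and b [measurable]: "b : meas N"
  and mm [measurable]: "!!x. (%s. m s x) : meas N"
  and b0: "!!s. 0 < b s" and m: "!!s. w s ~= 0 ==> multiplier (b s) (m s)"
  and B: "0 < B" "nint N (%s. ennreal (cmod (w s) * b s)) <= ennreal B"
  and i: "!!x. 0 <= x ==> x <= 1 ==> integrable N (%s. w s * m s x)"
  and psi: "!!x. 0 <= x ==> x <= 1 ==> psi x = (LINT s|N. w s * m s x)"
 shows "multiplier B psi"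
 unfolding multiplier_def dominated_def
proof (intro conjI allI impI B)
 fix t Sp u p assume t: "0 < t" and f: "family Sp u" and l: "ALL l:Sp. t * l <= 1" and p: "1 <= (p::real)"
 define c where "c s = comb (%l. m s (t * l)) Sp u" for s
 let ?I = "Ipow p (total Sp u)"
 have u [measurable]: "u l : meas M" if "l : Sp" for l using familyD(5)[OF f that] by simp
 have cm: "(%(x, s). c s x) : meas (M \<Otimes>\<^sub>M N)" unfolding c_def comb_def case_prod_unfold
  by (intro borel_measurable_sum borel_measurable_times measurable_compose[OF measurable_snd mm] measurable_compose[OF measurable_fst u])
 have cx: "c s : meas M" for s using comb_measurable[OF f] unfolding c_def by simp
 have eq: "comb (%l. psi (t * l)) Sp u x = (LINT s|N. w s * c s x)" for x
 proof -
  have r: "0 <= t * l" "t * l <= 1" if "l : Sp" for l using t l that familyD(2)[OF f that] by auto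
  have "comb (%l. psi (t * l)) Sp u x = (SUM l:Sp. \<integral>s. w s * m s (t * l) * u l x \<partial>N)"
   unfolding comb_def using r by (intro sum.cong) (auto simp: psi)
  also have "... = (LINT s|N. (SUM l:Sp. w s * m s (t * l) * u l x))"
   using i r by (intro Bochner_Integration.integral_sum[symmetric] integrable_mult_left) auto
  finally show ?thesis by (simp add: c_def comb_def sum_distrib_left mult.assoc)
 qed
 have "Ipow p (comb (%l. psi (t * l)) Sp u) <= ennreal (B powr (p - 1)) * nint N (%s. nint M (%x. ennreal (cmod (w s) * b s) * ennreal ((cmod (c s x) / b s) powr p)))"
  unfolding Ipow_def
 proof (rule schur_nn[OF sigma_finite_measure_axioms N p])
  show "AE x in M. ennreal (cmod (comb (%l. psi (t * l)) Sp u x)) <= nint N (%s. ennreal (cmod (w s) * b s) * ennreal (cmod (c s x) / b s))"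
  proof (intro AE_I2)
   fix x
   have "ennreal (cmod (w s) * b s) * ennreal (cmod (c s x) / b s) = ennreal (cmod (w s * c s x))" for s
    using b0[of s] by (simp add: enn_mult norm_mult)
   thus "ennreal (cmod (comb (%l. psi (t * l)) Sp u x)) <= nint N (%s. ennreal (cmod (w s) * b s) * ennreal (cmod (c s x) / b s))"
    unfolding eq by (simp only: norm_integral_le_nn)
  qed
  show "(%(x, s). cmod (c s x) / b s) : meas (M \<Otimes>\<^sub>M N)"
   using cm by (simp add: case_prod_unfold)
 qed (use b0 B in "auto simp: less_imp_le")
 also have "... <= ennreal (B powr (p - 1)) * nint N (%s. ennreal (cmod (w s) * b s) * ?I)"
 proof (intro mult_left_mono nn_integral_mono)
  fix s
  have "nint M (%x. ennreal ((cmod (c s x) / b s) powr p)) <= ?I" if "w s ~= 0"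
  proof -
   have "nint M (%x. ennreal ((cmod (c s x) / b s) powr p)) = nint M (%x. ennreal (b s powr - p) * ennreal (cmod (c s x) powr p))"
    using b0[of s] by (simp add: enn_mult powr_mult powr_minus divide_inverse inverse_powr mult.commute)
   also have "... = ennreal (b s powr - p) * Ipow p (c s)" unfolding Ipow_def using cx by (subst nn_integral_cmult) auto
   also have "... <= ennreal (b s powr - p) * (ennreal (b s powr p) * ?I)"
    unfolding c_def using l by (intro mult_left_mono multiplierD[OF m[OF that] t f _ p]) auto
   also have "... = ?I" using b0[of s] by (simp add: mult.assoc[symmetric] enn_mult powr_minus)
   finally show ?thesis .
  qed
  moreover have "(%x. ennreal ((cmod (c s x) / b s) powr p)) : meas M" using cx by measurable
  ultimately show "nint M (%x. ennreal (cmod (w s) * b s) * ennreal ((cmod (c s x) / b s) powr p)) <= ennreal (cmod (w s) * b s) * ?I"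
   by (cases "w s = 0") (simp_all add: nn_integral_cmult mult_left_mono)
 qed auto
 also have "... = ennreal (B powr (p - 1)) * (nint N (%s. ennreal (cmod (w s) * b s)) * ?I)" by (subst nn_integral_multc) auto
 also have "... <= ennreal (B powr (p - 1)) * (ennreal B * ?I)" using B by (intro mult_left_mono mult_right_mono) auto
 also have "... = ennreal (B powr p) * ?I"
  using B powr_add[of B "p - 1" 1] by (simp add: mult.assoc[symmetric] enn_mult)
 finally show "Ipow p (comb (%l. psi (t * l)) Sp u) <= ennreal (B powr p) * ?I" .
qed

definition is_mult :: "(real => complex) => bool" where "is_mult psi = ((EX C. multiplier C psi))"

lemma is_mult_lincomb:
 assumes "is_mult psi" "is_mult phi" shows "is_mult (%x. a * psi x + c * phi x)"
proof -
 obtain C D where m: "multiplier C psi" "multiplier D phi" using assms by (auto simp: is_mult_def)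
 hence p: "0 < C" "0 < D" by (auto simp: multiplier_def)
 have "multiplier (cmod a * C + cmod c * D + 1) (%x. a * psi x + c * phi x)"
 proof (rule multiplier_superposition[where N = "count_space (UNIV :: bool set)" and w = "%s. if s then a else c"
   and b = "%s. if s then C else D" and m = "%s. if s then psi else phi"])
  show "sigma_finite_measure (count_space (UNIV :: bool set))" by (rule sigma_finite_measure_count_space_countable) simp
  show "nint (count_space UNIV) (%s. ennreal (cmod (if s then a else c) * (if s then C else D))) <= ennreal (cmod a * C + cmod c * D + 1)"
   using p by (simp add: nn_integral_count_space_finite UNIV_bool ennreal_plus[symmetric] add.commute del: ennreal_plus)
  show "0 < cmod a * C + cmod c * D + 1" using p by (simp add: add_nonneg_pos)
 qed (use m p in "auto simp: lebesgue_integral_count_space_finite integrable_count_space UNIV_bool")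
 thus ?thesis unfolding is_mult_def by blast
qed

lemma is_mult_mono:
 "is_mult (%x. 1)" "is_mult psi ==> is_mult (%x. psi x ^ n)"
 using multiplier_one multiplier_power unfolding is_mult_def by blast+

lemma heat_multiplier:
 "EX K>0. EX N::nat. ALL s. ALL tau>0. multiplier (K * (1 + abs s) ^ N) (heat (of_real tau * ctime s))"
proof -
 obtain K and N :: nat where K: "0 < K"
  and h: "!!s r Sp u. 0 < r ==> family Sp u ==> dominated (K * (1 + abs s) ^ N) (total Sp u) (flow s r Sp u)"
  using heat_bound by blast
 have "multiplier (K * (1 + abs s) ^ N) (heat (of_real tau * ctime s))" if "0 < tau" for s tau
  unfolding multiplier_def
 proof (intro conjI allI impI)
  show "0 < K * (1 + abs s) ^ N" using K by simp
  fix t :: real and Sp u assume t: "0 < t" "family Sp u"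
  have "heat (of_real tau * ctime s) (t * l) = heat (of_real (t * tau) * ctime s) l" for l by (simp add: heat_def mult_ac)
  thus "dominated (K * (1 + abs s) ^ N) (total Sp u) (comb (%l. heat (of_real tau * ctime s) (t * l)) Sp u)"
   using h[of "t * tau" Sp u s] t that by simp
 qed
 thus ?thesis using K by blast
qed

text \<open>The Gamma density at \<open>b - x\<close> is a superposition of the complex exponentials \<open>heat (1 + i s)\<close>; the decay of its Fourier
 transform compensates the polynomial growth of their bounds.\<close>

lemma is_mult_power:
 "EX n>0. ALL b>=1. is_mult (%x. of_real ((b - x) ^ n))"
proof -
 obtain K and N :: nat where K: "0 < K" and h: "!!s tau. 0 < tau ==> multiplier (K * (1 + abs s) ^ N) (heat (of_real tau * ctime s))"
  using heat_multiplier by blast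
 \<comment> \<open>\<open>N\<close> powers compensate the growth of the bounds, the others make the integral converge\<close>
 define M' where "M' = N + 3"
 obtain c where c: "c ~= 0" "!!y. 0 <= y ==> of_real (exp y) * gam M' y = c * of_real (y ^ (M' - 1))"
  using gamma_density[of M'] by (auto simp: M'_def)
 have "is_mult (%x. of_real ((b - x) ^ (M' - 1)))" if b: "1 <= b" for b
 proof -
  define w where "w s = inverse c * (exp (of_real b * ctime s) * cinv M' s)" for s
  define D where "D = cmod (inverse c) * exp b * K * 2 ^ N"
  have D: "0 < D" using c K by (simp add: D_def)
  have wb: "cmod (w s) * (K * (1 + abs s) ^ N) <= D * (1 / (1 + s^2))" for s
  proof -
   have "cmod (cinv M' s) = cmod (cinv N s) * cmod (cinv 3 s)" by (simp add: cinv_def M'_def power_add norm_mult)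
   moreover have "cmod (cinv N s) * (1 + abs s) ^ N <= 2 ^ N"
   proof -
    have "cmod (cinv N s) * (1 + abs s) ^ N = ((1 + abs s) / cmod (ctime s)) ^ N"
     by (simp add: cinv_def norm_power norm_inverse power_mult_distrib power_inverse divide_inverse mult.commute)
    also have "... <= 2 ^ N" using ctime_facts(2,3)[of s] by (intro power_mono) (auto simp: divide_simps)
    finally show ?thesis .
   qed
   ultimately have "cmod (cinv M' s) * (1 + abs s) ^ N <= 2 ^ N * (1 / (1 + s^2))"
    using mult_mono[of "cmod (cinv N s) * (1 + abs s) ^ N" "2 ^ N" "cmod (cinv 3 s)" "1 / (1 + s^2)"] cinv_norm(2)[of 3 s] by (simp add: mult_ac)
   hence "cmod (inverse c) * exp b * K * (cmod (cinv M' s) * (1 + abs s) ^ N) <= cmod (inverse c) * exp b * K * (2 ^ N * (1 / (1 + s^2)))"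
    using K by (intro mult_left_mono) auto
   moreover have "cmod (w s) = cmod (inverse c) * exp b * cmod (cinv M' s)" by (simp add: w_def norm_mult ctime_def)
   ultimately show ?thesis unfolding D_def by (simp only: mult_ac)
  qed
  have e: "w s * heat (ctime s) x = inverse c * of_real (exp (b - x)) * (exp (\<i> * of_real (s * (b - x))) * cinv M' s)" for s x
  proof -
   have "exp (of_real b * ctime s) * heat (ctime s) x = of_real (exp (b - x)) * exp (\<i> * of_real (s * (b - x)))"
    unfolding heat_def exp_of_real[symmetric] mult_exp_exp by (rule arg_cong[where f = exp]) (simp add: ctime_def algebra_simps)
   thus ?thesis by (simp add: w_def mult_ac)
  qed
  have "multiplier (D * pi) (%x. of_real ((b - x) ^ (M' - 1)))"
  proof (rule multiplier_superposition[where N = lborel and w = w and b = "%s. K * (1 + abs s) ^ N" and m = "%s. heat (ctime s)"])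
   show "w : meas lborel" unfolding w_def[abs_def] ctime_def by measurable
   show "(%s. heat (ctime s) x) : meas lborel" for x unfolding heat_def ctime_def by measurable
   have "nint lborel (%s. ennreal (cmod (w s) * (K * (1 + abs s) ^ N))) <= nint lborel (%s. ennreal (D * (1 / (1 + s^2))))"
    using wb by (intro nn_integral_mono ennreal_leI)
   also have "... = ennreal (D * pi)"
    using nn_integral_eq_integral[OF integrable_mult_right[OF cauchy_weight(1), of D]] D by (simp add: cauchy_weight(2) del: times_divide_eq_right)
   finally show "nint lborel (%s. ennreal (cmod (w s) * (K * (1 + abs s) ^ N))) <= ennreal (D * pi)" .
   fix x :: real assume x: "0 <= x" "x <= 1"
   show "integrable lborel (%s. w s * heat (ctime s) x)" unfolding e by (intro integrable_mult_right gam_integrable) (simp add: M'_def)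
   have "(LBINT s. w s * heat (ctime s) x) = inverse c * of_real (exp (b - x)) * gam M' (b - x)" unfolding e gam_def by (rule integral_mult_right_zero)
   thus "of_real ((b - x) ^ (M' - 1)) = (LBINT s. w s * heat (ctime s) x)" using c(2)[of "b - x"] c(1) x b by (simp add: mult.assoc)
  qed (use K D h[of 1] in "auto intro!: sigma_finite_lborel mult_pos_pos")
  thus ?thesis unfolding is_mult_def by blast
 qed
 thus ?thesis by (intro exI[of _ "M' - 1"]) (simp add: M'_def)
qed

end

lemma poly_difference:
 fixes p :: "'b::comm_ring_1 poly"
 assumes "degree p <= Suc n"
 shows "degree (pcompose p [:1, 1:] - p) <= n & coeff (pcompose p [:1, 1:] - p) n = of_nat (Suc n) * coeff p (Suc n)"
 using assms
proof (induction n arbitrary: p)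
 case 0
 obtain a b where p: "p = [:a, b:]" using 0 degree1_coeffs by (metis One_nat_def degree_0_id le_Suc_eq le_zero_eq pCons_0_0)
 show ?case by (simp add: p pcompose_pCons)
next
 case (Suc n)
 obtain a p' where p: "p = pCons a p'" by (cases p)
 define q where "q = pcompose p' [:1, 1:] - p'"
 have d: "degree p' <= Suc n" using Suc.prems by (auto simp: p split: if_splits)
 have q: "degree q <= n" "coeff q n = of_nat (Suc n) * coeff p' (Suc n)" using Suc.IH[OF d] by (auto simp: q_def)
 have e: "pcompose p [:1, 1:] - p = q + pCons 0 q + p'"
  by (simp add: p q_def pcompose_pCons algebra_simps poly_eq_iff coeff_pCons split: nat.split)
 have "degree (q + pCons 0 q + p') <= Suc n"
  using q(1) d by (intro degree_add_le) (auto intro: order.trans[OF degree_pCons_le])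
 moreover have "coeff q (Suc n) = 0" using q(1) by (intro coeff_eq_0) simp
 ultimately show ?case unfolding e using q(2) by (simp add: p algebra_simps)
qed

context elliptic_operator begin

text \<open>Differences in \<open>b\<close> lower the degree of the multiplier \<open>(b - x)^n\<close> until it is linear.\<close>

lemma is_mult_id: "is_mult (%x. of_real x)"
proof -
 have *: "is_mult (%x. of_real x)" if "degree p <= Suc n" "coeff p (Suc n) ~= 0" "!!b. 1 <= b ==> is_mult (%x. of_real (poly p (b - x)))" for n and p :: "real poly"
  using that
 proof (induction n arbitrary: p)
  case 0
  obtain a c where p: "p = [:a, c:]" using 0(1) degree1_coeffs by (metis One_nat_def degree_0_id le_Suc_eq le_zero_eq pCons_0_0)
  have "is_mult (%x. - of_real (1 / c) * of_real (poly p (1 - x)) + of_real ((a + c) / c) * 1)"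
   by (intro is_mult_lincomb 0 is_mult_mono) auto
  moreover have "c ~= 0" using 0(2) by (simp add: p)
  hence "- of_real (1 / c) * of_real (poly p (1 - x)) + of_real ((a + c) / c) * 1 = complex_of_real x" for x
   unfolding of_real_minus[symmetric] of_real_mult[symmetric] of_real_add[symmetric] mult_1_right of_real_eq_iff by (simp add: p field_simps)
  ultimately show ?case by (simp only:)
 next
  case (Suc n)
  let ?q = "pcompose p [:1, 1:] - p"
  have "is_mult (%x. of_real (poly ?q (b - x)))" if "1 <= b" for b
  proof -
   have "is_mult (%x. 1 * of_real (poly p (b + 1 - x)) + (- 1) * of_real (poly p (b - x)))" using that by (intro is_mult_lincomb Suc.prems(3)) auto
   moreover have "1 * of_real (poly p (b + 1 - x)) + (- 1) * of_real (poly p (b - x)) = complex_of_real (poly ?q (b - x))" for x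
    by (simp add: poly_pcompose algebra_simps)
   ultimately show ?thesis by (simp only:)
  qed
  moreover have "degree ?q <= Suc n" "coeff ?q (Suc n) ~= 0" using poly_difference[OF Suc.prems(1)] Suc.prems(2) by auto
  ultimately show ?case using Suc.IH by blast
 qed
 obtain n where n: "0 < n" "!!b. 1 <= b ==> is_mult (%x. of_real ((b - x) ^ n))" using is_mult_power by blast
 show ?thesis by (rule *[of "monom 1 n" "n - 1"]) (use n in "auto simp: poly_monom degree_monom_eq")
qed

end

section \<open>The square root as a multiplier\<close>

definition root_weight :: "real => real" where "root_weight tau = (if 0 < tau then 1 / (tau * sqrt tau) else 0)"

definition root_bound :: "real => real" where "root_bound tau = (if 0 < tau & tau < 1 then tau else 1)"

lemma root_measurable [measurable]: "root_weight : meas borel" "root_bound : meas borel"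
 unfolding root_weight_def[abs_def] root_bound_def[abs_def] by measurable

lemma root_bound_integral: "nint lborel (%tau. ennreal (root_weight tau * root_bound tau)) <= ennreal 4"
proof -
 have "nint lborel (%tau. ennreal (root_weight tau * root_bound tau))
  <= nint lborel (%tau. indicator {0<..<1} tau * ennreal (1 / sqrt tau) + ennreal (1 / (tau * sqrt tau)) * indicator {1..} tau)"
  by (intro nn_integral_mono) (auto simp: root_weight_def root_bound_def indicator_def)
 also have "... = nint lborel (%tau. indicator {0<..<1} tau * ennreal (1 / sqrt tau)) + nint lborel (%tau. ennreal (1 / (tau * sqrt tau)) * indicator {1..} tau)"
  by (rule nn_integral_add) measurable
 also have "nint lborel (%tau. ennreal (1 / (tau * sqrt tau)) * indicator {1..} tau) = ennreal (0 - (- 2 / sqrt 1))"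
 proof (rule nn_integral_FTC_atLeast)
  show "DERIV (%tau. - 2 / sqrt tau) x :> 1 / (x * sqrt x)" if "1 <= x" for x
   using that by (auto intro!: derivative_eq_intros simp: field_simps)
  show "((%tau. - 2 / sqrt tau) ---> 0) at_top"
   by (intro tendsto_divide_0[OF tendsto_const] filterlim_at_top_imp_at_infinity sqrt_at_top)
 qed auto
 finally show ?thesis using inverse_sqrt_integral[of 1] by (simp add: ennreal_plus[symmetric] del: ennreal_plus)
qed

lemma root_integrable:
 assumes "0 <= x" "x <= 1" shows "integrable lborel (%tau. root_weight tau * (1 - exp (- (tau * x))))"
proof (rule integrableI_bounded)
 have "norm (root_weight tau * (1 - exp (- (tau * x)))) <= root_weight tau * root_bound tau" for tau
 proof (cases "0 < tau")
  case True
  have "1 - exp (- (tau * x)) <= tau * x" using exp_ge_add_one_self[of "- (tau * x)"] by simp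
  moreover have "tau * x <= tau" using assms True by (simp add: mult_left_le)
  ultimately have "1 - exp (- (tau * x)) <= root_bound tau" by (simp add: root_bound_def)
  thus ?thesis using True assms by (simp add: root_weight_def abs_mult divide_right_mono)
 qed (simp add: root_weight_def)
 hence "nint lborel (%tau. ennreal (norm (root_weight tau * (1 - exp (- (tau * x)))))) <= nint lborel (%tau. ennreal (root_weight tau * root_bound tau))"
  by (intro nn_integral_mono ennreal_leI)
 also have "... < \<infinity>" by (rule le_less_trans[OF root_bound_integral]) simp
 finally show "nint lborel (%tau. ennreal (norm (root_weight tau * (1 - exp (- (tau * x)))))) < \<infinity>" .
qed measurable

text \<open>Substitute \<open>tau x\<close>.\<close>

lemma sqrt_subordination:
 "EX c>0. ALL x. 0 <= x --> x <= 1 --> (LBINT tau. root_weight tau * (1 - exp (- (tau * x)))) = c * sqrt x"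
proof -
 define J where "J x = (LBINT tau. root_weight tau * (1 - exp (- (tau * x))))" for x
 have s: "J x = J 1 * sqrt x" if x: "0 <= x" "x <= 1" for x
 proof (cases "x = 0")
  case False
  hence x0: "0 < x" using x by simp
  have e: "root_weight (0 + 1 / x * tau) * (1 - exp (- ((0 + 1 / x * tau) * x))) = x * sqrt x * (root_weight tau * (1 - exp (- (tau * 1))))" for tau
   using x0 by (auto simp: root_weight_def real_sqrt_divide zero_less_divide_iff zero_less_mult_iff)
  have "J x = abs (1 / x) *\<^sub>R (LBINT tau. root_weight (0 + 1 / x * tau) * (1 - exp (- ((0 + 1 / x * tau) * x))))"
   unfolding J_def using x0 by (intro lborel_integral_real_affine) simp
  thus ?thesis unfolding e J_def using x0 by simp
 qed (simp add: J_def)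
 have "J 1 ~= 0"
 proof
  assume "J 1 = 0"
  hence "AE tau in lborel. root_weight tau * (1 - exp (- (tau * 1))) = 0"
   unfolding J_def using root_integrable[of 1] by (subst (asm) integral_nonneg_eq_0_iff_AE) (auto simp: root_weight_def)
  hence "AE tau in lborel. tau ~: {0<..<1::real}" by eventually_elim (auto simp: root_weight_def)
  hence "emeasure lborel {x::real. ~ x ~: {0<..<1}} = 0" by (subst (asm) AE_iff_measurable[OF _ refl]) auto
  moreover have "{x::real. ~ x ~: {0<..<1}} = {0<..<1}" by auto
  ultimately show False by (simp only: emeasure_lborel_Ioo) simp
 qed
 moreover have "0 <= J 1" unfolding J_def by (intro integral_nonneg_AE) (auto simp: root_weight_def)
 ultimately show ?thesis using s unfolding J_def by (intro exI[of _ "J 1"]) (auto simp: J_def)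
qed

context elliptic_operator begin

text \<open>For small \<open>tau\<close> the multiplier \<open>1 - exp (- tau x)\<close> has size \<open>tau\<close>, being the integral of \<open>x exp (- s x)\<close> over \<open>0 < s < tau\<close>;
 for large \<open>tau\<close> it is bounded. This makes the representation of the square root absolutely convergent.\<close>

lemma is_mult_sqrt: "is_mult (%x. of_real (sqrt x))"
proof -
 obtain K and N :: nat where K: "0 < K" and "!!s tau. 0 < tau ==> multiplier (K * (1 + abs s) ^ N) (heat (of_real tau * ctime s))"
  using heat_multiplier by blast
 from this(2)[of _ 0] have h: "multiplier K (heat (of_real tau))" if "0 < tau" for tau using that by (simp add: ctime_def)
 obtain C where C: "multiplier C (%x. of_real x)" using is_mult_id by (auto simp: is_mult_def)
 hence C0: "0 < C" by (simp add: multiplier_def)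
 have small: "multiplier (tau * (C * K)) (%x. of_real (1 - exp (- (tau * x))))" if t: "0 < tau" for tau
 proof (rule multiplier_superposition[where N = lborel and w = "indicator {0<..tau}" and b = "%s. C * K" and m = "%sg x. of_real x * heat (of_real sg) x"])
  show "(%sg. of_real x * heat (of_real sg) x) : meas lborel" for x unfolding heat_def by measurable
  show "multiplier (C * K) (%x. of_real x * heat (of_real sg) x)" if "indicator {0<..tau} sg ~= (0::complex)" for sg
   using that by (intro multiplier_mult C h) (auto simp: indicator_def split: if_splits)
  have "nint lborel (%s. ennreal (cmod (indicator {0<..tau} s) * (C * K))) = nint lborel (%s. ennreal (C * K) * indicator {0<..tau} s)"
   by (intro nn_integral_cong) (auto simp: indicator_def)
  also have "... = ennreal (C * K) * ennreal tau" using t by (subst nn_integral_cmult_indicator) auto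
  also have "... <= ennreal (tau * (C * K))" using C0 K t by (simp add: ennreal_mult[symmetric] mult_ac)
  finally show "nint lborel (%s. ennreal (cmod (indicator {0<..tau} s) * (C * K))) <= ennreal (tau * (C * K))" .
  fix x :: real assume x: "0 <= x"
  have r: "indicator {0<..tau} sg * (of_real x * heat (of_real sg) x) = complex_of_real (indicator {0<..tau} sg * (x * exp (- (sg * x))))" for sg
   by (simp add: heat_def indicator_def exp_of_real[symmetric] mult.commute)
  have "has_bochner_integral lborel (%sg. (x * exp (- (sg * x))) * indicator {0..tau} sg) (- exp (- (tau * x)) - - exp (- (0 * x)))"
   using t by (intro has_bochner_integral_FTC_Icc_nonneg) (auto intro!: derivative_eq_intros continuous_intros simp: x)
  hence "has_bochner_integral lborel (%sg. indicator {0<..tau} sg * (x * exp (- (sg * x)))) (1 - exp (- (tau * x)))"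
  proof (subst (asm) has_bochner_integral_cong_AE)
   show "AE sg in lborel. x * exp (- (sg * x)) * indicator {0..tau} sg = indicator {0<..tau} sg * (x * exp (- (sg * x)))"
    using AE_lborel_singleton[of "0::real"] by eventually_elim (auto simp: indicator_def)
  qed auto
  hence i: "integrable lborel (%sg. indicator {0<..tau} sg * (x * exp (- (sg * x))))" "(LBINT sg. indicator {0<..tau} sg * (x * exp (- (sg * x)))) = 1 - exp (- (tau * x))"
   by (auto simp: has_bochner_integral_iff)
  show "integrable lborel (%sg. indicator {0<..tau} sg * (of_real x * heat (of_real sg) x))" unfolding r by (rule integrable_of_real[OF i(1)])
  show "of_real (1 - exp (- (tau * x))) = (LBINT sg. indicator {0<..tau} sg * (of_real x * heat (of_real sg) x))"
   unfolding r integral_complex_of_real i(2) ..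
 qed (use C0 K t in "auto intro: sigma_finite_lborel")
 have large: "multiplier (2 + 2 * K) (%x. of_real (1 - exp (- (tau * x))))" if t: "0 < tau" for tau
 proof (rule multiplier_superposition[where N = "count_space (UNIV :: bool set)" and w = "%s. if s then 1 else - 1"
   and b = "%s. if s then 1 else K" and m = "%s. if s then %x. 1 else heat (of_real tau)"])
  show "sigma_finite_measure (count_space (UNIV :: bool set))" by (rule sigma_finite_measure_count_space_countable) simp
  show "nint (count_space UNIV) (%s. ennreal (cmod (if s then 1 else - 1) * (if s then 1 else K))) <= ennreal (2 + 2 * K)"
   using K by (simp add: nn_integral_count_space_finite UNIV_bool ennreal_plus[symmetric] del: ennreal_plus)
 qed (use K multiplier_one h[OF t] in "auto simp: lebesgue_integral_count_space_finite integrable_count_space UNIV_bool heat_def exp_of_real[symmetric] mult.commute")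
 define D where "D = C * K + (2 + 2 * K)"
 have D: "0 < D" using C0 K by (simp add: D_def add_pos_pos)
 have mono: "multiplier b' psi" if "multiplier b psi" "b <= b'" for b b' psi     using that dominated_mono[of b _ _ b'] unfolding multiplier_def by (meson less_imp_le less_le_trans)
 obtain c where c: "0 < c" "!!x. 0 <= x ==> x <= 1 ==> (LBINT tau. root_weight tau * (1 - exp (- (tau * x)))) = c * sqrt x"
  using sqrt_subordination by blast
 have r: "complex_of_real (root_weight tau / c) * of_real (1 - exp (- (tau * x))) = of_real (inverse c * (root_weight tau * (1 - exp (- (tau * x)))))" for tau x
  by (simp only: of_real_mult[symmetric] divide_inverse mult_ac)
 have "multiplier (4 * D / c) (%x. of_real (sqrt x))"
 proof (rule multiplier_superposition[where N = lborel and w = "%tau. of_real (root_weight tau / c)" and b = "%tau. D * root_bound tau" and m = "%tau x. of_real (1 - exp (- (tau * x)))"])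
  show "multiplier (D * root_bound tau) (%x. of_real (1 - exp (- (tau * x))))" if "complex_of_real (root_weight tau / c) ~= 0" for tau
  proof (cases "tau < 1")
   case True
   have "0 < tau" using that by (simp add: root_weight_def split: if_splits)
   thus ?thesis using True K C0 by (intro mono[OF small]) (auto simp: root_bound_def D_def algebra_simps)
  next
   case False
   thus ?thesis using K C0 by (intro mono[OF large]) (auto simp: root_bound_def D_def)
  qed
  have "nint lborel (%tau. ennreal (cmod (of_real (root_weight tau / c)) * (D * root_bound tau))) = nint lborel (%tau. ennreal (D / c) * ennreal (root_weight tau * root_bound tau))"
   using D c(1) by (intro nn_integral_cong) (simp del: of_real_divide add: norm_of_real enn_mult root_weight_def root_bound_def)
  also have "... <= ennreal (D / c) * ennreal 4" using root_bound_integral by (subst nn_integral_cmult) (auto intro: mult_left_mono)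
  also have "... = ennreal (4 * D / c)" using D c(1) ennreal_mult[of "D / c" 4] by (simp del: ennreal_numeral add: mult.commute)
  finally show "nint lborel (%tau. ennreal (cmod (of_real (root_weight tau / c)) * (D * root_bound tau))) <= ennreal (4 * D / c)" .
  show "0 < D * root_bound tau" for tau using D by (simp add: root_bound_def)
  fix x :: real assume x: "0 <= x" "x <= 1"
  show "integrable lborel (%tau. complex_of_real (root_weight tau / c) * of_real (1 - exp (- (tau * x))))"
   unfolding r by (intro integrable_of_real integrable_mult_right root_integrable x)
  show "of_real (sqrt x) = (LBINT tau. complex_of_real (root_weight tau / c) * of_real (1 - exp (- (tau * x))))"
   unfolding r integral_complex_of_real integral_mult_right_zero c(2)[OF x] using c(1) by simp
 qed (use D c(1) in "auto intro: sigma_finite_lborel")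
 thus ?thesis unfolding is_mult_def by blast
qed

end

section \<open>The Bernstein inequality\<close>

context elliptic_operator begin

text \<open>For \<open>p = \<infinity>\<close> let the exponent tend to infinity: \<open>K\<close> does not depend on it, and the volume is finite.\<close>

lemma dominated_Lp_norm:
 assumes d: "dominated K f F" and K: "0 < K" and f: "f : meas M" and F: "F : meas M" and p: "1 <= p"
 shows "Lp_norm M p F <= ennreal K * Lp_norm M p f"
proof (cases "p = \<infinity>")
 case False
 define q where "q = enn2real p"
 have q: "1 <= q" using False p by (cases p) (auto simp: q_def)
 have i: "Ipow q F <= ennreal (K powr q) * Ipow q f" using d q by (simp add: dominated_def)
 have L: "Lp_norm M p h = (if Ipow q h = \<infinity> then \<infinity> else ennreal (enn2real (Ipow q h) powr (1 / q)))" for h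
  using False by (simp add: Lp_norm_def Ipow_def q_def Let_def)
 show ?thesis
 proof (cases "Ipow q f")
  case top thus ?thesis using K by (simp add: L ennreal_mult_top)
 next
  case (real a)
  hence le: "Ipow q F <= ennreal (K powr q * a)" using i by (simp add: ennreal_mult')
  hence "enn2real (Ipow q F) <= K powr q * a" using real by (intro enn2real_leI) auto
  hence "enn2real (Ipow q F) powr (1 / q) <= (K powr q * a) powr (1 / q)" using q by (intro powr_mono2) auto
  also have "... = K * a powr (1 / q)" using q K real by (simp add: powr_mult powr_powr)
  finally have "ennreal (enn2real (Ipow q F) powr (1 / q)) <= ennreal K * ennreal (a powr (1 / q))"
   using K by (simp add: enn_mult ennreal_leI)
  moreover have "Ipow q F ~= \<infinity>" using le by (auto simp: top_unique)
  ultimately show ?thesis using real by (simp add: L)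
 qed
next
 case True
 have L: "Lp_norm M p h = esssup M (%x. ennreal (cmod (h x)))" for h using True by (simp add: Lp_norm_def)
 show ?thesis
 proof (cases "Lp_norm M p f")
  case top thus ?thesis using K by (simp add: ennreal_mult_top)
 next
  case (real a)
  have fa: "AE x in M. cmod (f x) <= a" using esssup_AE[of "%x. ennreal (cmod (f x))" M] real by (auto simp: L[symmetric])
  have b: "AE x in M. cmod (F x) <= c" if c: "K * a < c" for c
  proof -
   have c0: "0 < c" using c K real by (meson le_less_trans less_imp_le mult_nonneg_nonneg)
   let ?E = "{x : space M. c < cmod (F x)}"
   have E: "?E : sets M" using F by measurable
   have "measure M ?E <= (K * a / c) ^ n * measure M UNIV" if n: "1 <= n" for n
   proof -
    have "ennreal (c powr real n) * emeasure M ?E = nint M (%x. ennreal (c powr real n) * indicator ?E x)" using E by (simp add: nn_integral_cmult_indicator)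
    also have "... <= Ipow (real n) F" unfolding Ipow_def using c0 by (intro nn_integral_mono) (auto simp: indicator_def intro!: ennreal_leI powr_mono2)
    also have "... <= ennreal (K powr real n) * Ipow (real n) f" using d n by (simp add: dominated_def)
    also have "Ipow (real n) f <= nint M (%x. ennreal (a powr real n))" unfolding Ipow_def
     by (intro nn_integral_mono_AE eventually_mono[OF fa]) (auto intro!: ennreal_leI powr_mono2)
    also have "... = ennreal (a powr real n) * ennreal (measure M UNIV)" by (simp add: emeasure_eq_measure)
    finally have "ennreal (c powr real n * measure M ?E) <= ennreal (K powr real n * (a powr real n * measure M UNIV))"
     by (simp add: ennreal_mult' emeasure_eq_measure mult_left_mono)
    hence "c powr real n * measure M ?E <= K powr real n * (a powr real n * measure M UNIV)" by (subst (asm) ennreal_le_iff) auto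
    moreover have "K powr real n = K ^ n" "c powr real n = c ^ n" "a powr real n = a ^ n" using K c0 real n by (auto simp: powr_realpow powr_realpow')
    ultimately show ?thesis using c0 by (simp add: power_divide power_mult_distrib field_simps)
   qed
   moreover have "(%n. (K * a / c) ^ n * measure M UNIV) ----> 0 * measure M UNIV"
    using c c0 K real by (intro tendsto_intros LIMSEQ_realpow_zero) auto
   ultimately have "measure M ?E <= 0 * measure M UNIV" by (intro LIMSEQ_le_const) auto
   hence "emeasure M ?E = 0" by (simp add: emeasure_eq_measure measure_le_0_iff)
   thus ?thesis using E by (intro AE_I[of _ _ ?E]) auto
  qed
  have "AE x in M. ALL n::nat. cmod (F x) <= K * a + 1 / real (Suc n)" unfolding AE_all_countable by (intro allI b) simp
  hence "AE x in M. ennreal (cmod (F x)) <= ennreal (K * a)"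
  proof eventually_elim
   case (elim x)
   have "(%n. K * a + 1 / real (Suc n)) ----> K * a + 0" by (intro tendsto_add tendsto_const LIMSEQ_inverse_real_of_nat[unfolded inverse_eq_divide])
   hence "cmod (F x) <= K * a + 0" using elim by (intro LIMSEQ_le_const) auto
   thus ?case by (simp add: ennreal_leI)
  qed
  thus ?thesis using real K F unfolding L[of F] by (simp add: ennreal_mult esssup_I)
 qed
qed

text \<open>With \<open>t = 1 / \<omega>^2\<close>, the half power acts on a band limited function as \<open>\<omega>^m (sqrt (t l))^m\<close> on the eigenvalue \<open>l\<close> of \<open>T\<close>,
 and \<open>(sqrt x)^m\<close> is a multiplier.\<close>

theorem bernstein:
 "EX C>0. ALL p om f. 1 <= p --> 0 < om --> f : bandlimited M (sqrt_op M T) om -->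
  f : Domain (half_power M T m) & (ALL h. (f, h) : half_power M T m --> Lp_norm M p h <= ennreal (C * om ^ m) * Lp_norm M p f)"
proof -
 obtain C where C: "multiplier C (%x. of_real (sqrt x) ^ m)" using is_mult_mono(2)[OF is_mult_sqrt] by (auto simp: is_mult_def)
 hence C0: "0 < C" by (simp add: multiplier_def)
 note S = sqrt_op[OF T_sa T_nonneg]
 have "f : Domain (half_power M T m) & (ALL h. (f, h) : half_power M T m --> Lp_norm M p h <= ennreal (C * om ^ m) * Lp_norm M p f)"
  if p: "1 <= p" and w: "0 < om" and f: "f : bandlimited M (sqrt_op M T) om" for p om f
 proof -
  obtain U z where U: "finite U" "U <= (\<Union>l\<in>{..om}. eigenfunctions M (sqrt_op M T) l)" and fU: "f = (%x. SUM u:U. z u * u x)"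
   using f by (auto simp: bandlimited_def)
  from U(2) have "ALL u:U. EX l. l <= om & u : eigenfunctions M (sqrt_op M T) l" by auto
  then obtain e where e: "!!u. u : U ==> e u <= om" "!!u. u : U ==> u : eigenfunctions M (sqrt_op M T) (e u)" by metis
  have e0: "0 <= e u" if "u : U" for u by (rule eigenvalue_nonneg[OF S(1,2) e(2)[OF that]])
  have eS: "(u, %x. of_real (e u) * u x) : sqrt_op M T" if "u : U" for u using e(2)[OF that] by (simp add: eigenfunctions_def)
  define F where "F k x = (SUM u:U. z u * (of_real (e u ^ k) * u x))" for k x
  have F0: "F 0 = f" by (simp add: F_def fU fun_eq_iff)
  have F: "(f, F m) : half_power M T m" "!!h. (f, h) : half_power M T m ==> h : L2_space M & (AE x in M. h x = F m x)"
   using relpow_eigen_sum[where z = z and e = e and k = m, OF S(1) U(1) eS] unfolding half_power_def F_def[symmetric] F0[symmetric] by auto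
  define Sp where "Sp = (%u. (e u)^2) ` U"
  define v where "v l x = (\<Sum>u\<in>{u\<in>U. (e u)^2 = l}. z u * u x)" for l x
  have eT: "(u, %x. of_real ((e u)^2) * u x) : T" if "u : U" for u
  proof -
   have "(%x. of_real (e u) * u x, %x. of_real (e u) * (of_real (e u) * u x)) : sqrt_op M T"
    using self_adjoint_sum[OF S(1), of "{u}" "%u. u" "%u x. of_real (e u) * u x" "%u. of_real (e u)"] eS[OF that] by simp
   hence "(u, %x. of_real (e u) * (of_real (e u) * u x)) : sqrt_op M T O sqrt_op M T" using eS[OF that] by blast
   thus ?thesis by (simp add: S(3) power2_eq_square mult.assoc)
  qed
  have fam: "family Sp v" unfolding family_def
  proof (intro conjI ballI)
   show "finite Sp" using U(1) by (simp add: Sp_def)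
   fix l assume "l : Sp"
   thus "0 <= l" by (auto simp: Sp_def)
   have "((%x. \<Sum>u\<in>{u\<in>U. (e u)^2 = l}. z u * u x), (%x. \<Sum>u\<in>{u\<in>U. (e u)^2 = l}. z u * (of_real l * u x))) : T"
    using U(1) eT by (intro self_adjoint_sum[OF T_sa]) auto
   moreover have "(%x. \<Sum>u\<in>{u\<in>U. (e u)^2 = l}. z u * (of_real l * u x)) = (%x. of_real l * v l x)" by (simp add: v_def sum_distrib_left mult_ac)
   ultimately show "(v l, %x. of_real l * v l x) : T" by (simp add: v_def[abs_def])
  qed
  have grp: "comb h Sp v x = (SUM u:U. h ((e u)^2) * (z u * u x))" for h x
   unfolding comb_def v_def Sp_def sum.image_gen[OF U(1), of _ "%u. (e u)^2"] by (intro sum.cong) (auto simp: sum_distrib_left)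
  have t: "0 < 1 / om^2" "ALL l:Sp. 1 / om^2 * l <= 1" using w e(1) e0 by (auto simp: Sp_def intro!: power_mono)
  define F' where "F' = comb (%l. of_real (sqrt (1 / om^2 * l)) ^ m) Sp v"
  have f1: "total Sp v = f" by (simp add: grp fU fun_eq_iff)
  have dF: "dominated C f F'" using C t fam unfolding multiplier_def F'_def f1[symmetric] by blast
  have FF: "F m x = of_real (om ^ m) * F' x" for x
  proof -
   have "of_real (om ^ m) * of_real (sqrt (1 / om^2 * (e u)^2)) ^ m = complex_of_real (e u ^ m)" if "u : U" for u
    using w e0[OF that] by (simp add: real_sqrt_mult real_sqrt_divide power_divide)
   thus ?thesis unfolding F'_def F_def grp sum_distrib_left by (intro sum.cong) (auto simp: mult.assoc[symmetric] mult.commute[of "z _"])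
  qed
  have "Lp_norm M p h <= ennreal (C * om ^ m) * Lp_norm M p f" if "(f, h) : half_power M T m" for h
  proof (rule dominated_Lp_norm[OF _ _ _ _ p])
   have h: "h : L2_space M" "AE x in M. h x = F m x" using F(2)[OF that] by auto
   show "0 < C * om ^ m" using C0 w by simp
   show "h : meas M" by (rule L2_space_measurable[OF h(1)])
   show "f : meas M" using comb_measurable[OF fam, of "%l. 1"] unfolding f1 by simp
   have F'm: "F' : meas M" using comb_measurable[OF fam] unfolding F'_def by simp
   show "dominated (C * om ^ m) f h" unfolding dominated_def
   proof (intro allI impI)
    fix q :: real assume q: "1 <= q"
    have "Ipow q h = nint M (%x. ennreal ((om ^ m) powr q) * ennreal (cmod (F' x) powr q))" unfolding Ipow_def
     using w by (intro nn_integral_cong_AE eventually_mono[OF h(2)]) (simp add: FF norm_mult norm_power powr_mult ennreal_mult')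
    also have "... = ennreal ((om ^ m) powr q) * Ipow q F'" unfolding Ipow_def using F'm by (intro nn_integral_cmult) simp
    also have "... <= ennreal ((om ^ m) powr q) * (ennreal (C powr q) * Ipow q f)" using dF q by (intro mult_left_mono) (auto simp: dominated_def)
    also have "... = ennreal ((C * om ^ m) powr q) * Ipow q f" using w C0 by (simp add: powr_mult ennreal_mult' mult_ac)
    finally show "Ipow q h <= ennreal ((C * om ^ m) powr q) * Ipow q f" .
   qed
  qed
  thus ?thesis using F(1) by blast
 qed
 thus ?thesis using C0 by blast
qed

end

theorem lemma9p2:
  fixes A :: "('a::{second_countable_topology, t2_space}, 'n::finite) chart set"
    and g :: "('a, 'n) chart \<Rightarrow> real^'n \<Rightarrow> real^'n^'n"
    and L :: "('a \<Rightarrow> complex) \<Rightarrow> ('a \<Rightarrow> complex)"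
    and M :: "'a measure" and T :: "'a L2_op"
    and m :: nat and p :: ennreal
  assumes "compact_riemannian_manifold A g"
    and "connected (UNIV :: 'a set)"
    and "M = riemannian_volume A g"
    and "second_order_elliptic A L"
    and "T = L2_realization M A L"
    and "self_adjoint_op M T"
    and "nonneg_op M T"
    and "simple_eigenvalue M (sqrt_op M T) 0"
    and "1 \<le> p"
  shows "\<exists>C::real. C > 0 \<and> (\<forall>\<omega>>1. \<forall>f\<in>bandlimited M (sqrt_op M T) \<omega>.
           f \<in> Domain (half_power M T m) \<and>
           (\<forall>h. (f, h) \<in> half_power M T m \<longrightarrow>
              Lp_norm M p h \<le> ennreal (C * \<omega> ^ m) * Lp_norm M p f))"
proof -
  interpret elliptic_operator A g L M T
    using assms(1-7) by unfold_locales (simp_all add: compact_riemannian_manifold_def)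
  obtain C where "C > 0" and C: "\<And>\<omega> f. 0 < \<omega> \<Longrightarrow> f \<in> bandlimited M (sqrt_op M T) \<omega> \<Longrightarrow> f \<in> Domain (half_power M T m) \<and>
      (\<forall>h. (f, h) \<in> half_power M T m \<longrightarrow> Lp_norm M p h \<le> ennreal (C * \<omega> ^ m) * Lp_norm M p f)"
    using bernstein[of m] assms(9) by blast
  have "0 < \<omega>" if "1 < \<omega>" for \<omega> :: real using that by simp
  thus ?thesis using \<open>C > 0\<close> C by blast
qed

end
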